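(* Let $\{\zeta(t),t\ge0\}$ be the time-changed stationary chi-square process $\zeta(t)=\sum_{i=1}^mX_i^2(\Theta_it)$ defined in the context, where the covariance functions $r_i$ of the $X_i$ satisfy $$r_i(t)=1-C_i|t|^\alpha+o(|t|^\alpha),\quad t\to0,\qquad r_i(t)<1\ \ \text{for all } t>0,\qquad 1\le i\le m,$$ with $\alpha\in(0,2]$ and positive constants $C_i$. Let $$L_t(v)=\int_0^t\mathbf{1}(\zeta(s)>v)\,ds,\quad t>0,$$ be the sojourn time of $\zeta$ above level $v$ in the interval $[0,t]$. Then, for all sufficiently small $t>0$, $$\lim_{v\to\infty}\int_x^\infty\frac{\mathbb{P}\{v^{1/\alpha}L_t(v)>y\}}{v^{1/\alpha}\,\mathbb{E}\{L_t(v)\}}\,dy=B(x)$$ holds at all continuity points $x>0$ of $$B(x)=\mathbb{P}\left\{\int_0^\infty\mathbf{1}(\widetilde Z(s)>0)\,ds>x\right\},$$ where the process $\widetilde Z$ is defined in the context.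
   Context: Let $m\ge2$ be a fixed integer. $\{X_i(t),t\ge0\}$, $1\le i\le m$, are independent centered stationary Gaussian processes with covariance functions $r_i(\cdot)$. The random vector $\boldsymbol{\Theta}=(\Theta_1,\ldots,\Theta_m)$ has non-negative and bounded components and is independent of the processes $X_i$, $1\le i\le m$. The time-changed stationary chi-square process is $\zeta(t)=\sum_{i=1}^mX_i^2(\Theta_it)$, $t\ge0$. $\mathbf{1}(\cdot)$ is the indicator function. Let $\{Z_i(t),t\ge0\}$, $1\le i\le m$, be independent copies of a fractional Brownian motion $\{Z(t),t\ge0\}$ with Hurst index $\alpha/2\in(0,1]$, normalized so that $Z$ is a centered Gaussian process with $\mathrm{Cov}(Z(s),Z(t))=t^\alpha+s^\alpha-|t-s|^\alpha$, $s,t\ge0$. Let $(O_1,\ldots,O_m)$ be uniformly distributed on the unit sphere of $\mathbb{R}^m$ and let $E$ be a unit exponential random variable, with $Z_1,\ldots,Z_m$, $(O_1,\ldots,O_m)$, $\boldsymbol{\Theta}$ and $E$ mutually independent. Define $$\widetilde Z(t)=\sum_{i=1}^mZ_i(C_i^{1/\alpha}\Theta_it)\,O_i-\sum_{i=1}^mC_iO_i^2\Theta_i^\alpha t^\alpha+E,\qquad t\ge0.$$ *)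

theory Defs
  imports "HOL-Probability.Probability" "HOL-Library.Landau_Symbols"
begin

text \<open>
  Processes are functions \<open>X t \<omega>\<close> of a real time argument that are only ever evaluated at, and
  only constrained for, times \<open>t \<ge> 0\<close>.  The dimension \<open>m\<close> is the cardinality of a finite index
  type \<open>'m\<close>, and random vectors in \<open>\<real>\<^sup>m\<close> are \<open>real ^ 'm\<close>-valued.
\<close>

text \<open>Joint measurability makes sojourn times random variables; no path continuity is imposed.\<close>

definition measurable_process :: "'w measure \<Rightarrow> (real \<Rightarrow> 'w \<Rightarrow> real) \<Rightarrow> bool" where
  "measurable_process M X \<longleftrightarrow>
     (\<lambda>(t, \<omega>). X t \<omega>) \<in> borel_measurable (restrict_space borel {0..} \<Otimes>\<^sub>M M)"

text \<open>The scale \<open>\<sigma>\<close> may vanish, so that point masses count as normal laws.\<close>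

definition normal_rv :: "'w measure \<Rightarrow> ('w \<Rightarrow> real) \<Rightarrow> bool" where
  "normal_rv M Y \<longleftrightarrow> Y \<in> borel_measurable M \<and>
     (\<exists>\<mu> \<sigma>. distr M borel Y = distr std_normal_distribution borel (\<lambda>z. \<mu> + \<sigma> * z))"

definition gaussian_process :: "'w measure \<Rightarrow> (real \<Rightarrow> 'w \<Rightarrow> real) \<Rightarrow> bool" where
  "gaussian_process M X \<longleftrightarrow>
     (\<forall>J c. finite J \<and> J \<subseteq> {0..} \<longrightarrow> normal_rv M (\<lambda>\<omega>. \<Sum>t\<in>J. c t * X t \<omega>))"

definition centered_process :: "'w measure \<Rightarrow> (real \<Rightarrow> 'w \<Rightarrow> real) \<Rightarrow> bool" where
  "centered_process M X \<longleftrightarrow> (\<forall>t\<ge>0. prob_space.expectation M (X t) = 0)"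

definition stationary_process :: "'w measure \<Rightarrow> (real \<Rightarrow> 'w \<Rightarrow> real) \<Rightarrow> bool" where
  "stationary_process M X \<longleftrightarrow>
     (\<forall>h J. 0 \<le> h \<and> finite J \<and> J \<subseteq> {0..} \<longrightarrow>
        distr M (\<Pi>\<^sub>M t\<in>J. borel) (\<lambda>\<omega>. \<lambda>t\<in>J. X (t + h) \<omega>) =
        distr M (\<Pi>\<^sub>M t\<in>J. borel) (\<lambda>\<omega>. \<lambda>t\<in>J. X t \<omega>))"

definition covariance :: "'w measure \<Rightarrow> ('w \<Rightarrow> real) \<Rightarrow> ('w \<Rightarrow> real) \<Rightarrow> real" where
  "covariance M Y Z = prob_space.expectation M
     (\<lambda>\<omega>. (Y \<omega> - prob_space.expectation M Y) * (Z \<omega> - prob_space.expectation M Z))"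

definition stationary_gaussian_process ::
    "'w measure \<Rightarrow> (real \<Rightarrow> real) \<Rightarrow> (real \<Rightarrow> 'w \<Rightarrow> real) \<Rightarrow> bool" where
  "stationary_gaussian_process M r X \<longleftrightarrow>
     measurable_process M X \<and> gaussian_process M X \<and> centered_process M X \<and>
     stationary_process M X \<and>
     (\<forall>s\<ge>0. \<forall>t\<ge>0. covariance M (X s) (X t) = r (t - s))"

text \<open>Fractional Brownian motion with Hurst index \<open>\<alpha>/2\<close>, normalized by \<open>Var (Z 1) = 2\<close>.\<close>

definition fractional_brownian_motion ::
    "'w measure \<Rightarrow> real \<Rightarrow> (real \<Rightarrow> 'w \<Rightarrow> real) \<Rightarrow> bool" where
  "fractional_brownian_motion M \<alpha> Z \<longleftrightarrow>
     measurable_process M Z \<and> gaussian_process M Z \<and> centered_process M Z \<and>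
     (\<forall>s\<ge>0. \<forall>t\<ge>0. covariance M (Z s) (Z t) =
        t powr \<alpha> + s powr \<alpha> - \<bar>t - s\<bar> powr \<alpha>)"

text \<open>
  Normalized surface measure on the unit sphere, obtained as the radial projection of the
  uniform distribution on the unit ball.
\<close>

definition uniform_sphere :: "(real ^ 'm) measure" where
  "uniform_sphere = distr (uniform_measure lborel (ball 0 1)) borel (\<lambda>x. x /\<^sub>R norm x)"

definition sigma_rv :: "'w measure \<Rightarrow> 'b measure \<Rightarrow> ('w \<Rightarrow> 'b) \<Rightarrow> 'w set set" where
  "sigma_rv M N Y = sets (vimage_algebra (space M) Y N)"

definition sigma_process :: "'w measure \<Rightarrow> 'i set \<Rightarrow> ('i \<Rightarrow> 'w \<Rightarrow> real) \<Rightarrow> 'w set set" where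
  "sigma_process M I X = sigma_rv M (\<Pi>\<^sub>M i\<in>I. borel) (\<lambda>\<omega>. \<lambda>i\<in>I. X i \<omega>)"

text \<open>
  Mutual independence of \<open>Z\<^sub>1, \<dots>, Z\<^sub>m, U, \<theta>, E\<close>, which take values in different spaces, is
  expressed through the generated \<open>\<sigma>\<close>-algebras, indexed by the following type.
\<close>

datatype 'm ingredient = Fbm 'm | Direction | Clock | Exponential

primrec sigma_ingredient ::
    "'w measure \<Rightarrow> ('m \<Rightarrow> real \<Rightarrow> 'w \<Rightarrow> real) \<Rightarrow> ('w \<Rightarrow> real ^ 'm) \<Rightarrow> ('w \<Rightarrow> real ^ 'm) \<Rightarrow>
     ('w \<Rightarrow> real) \<Rightarrow> 'm ingredient \<Rightarrow> 'w set set" where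
  "sigma_ingredient M Z U \<theta> E (Fbm i) = sigma_process M {0..} (Z i)"
| "sigma_ingredient M Z U \<theta> E Direction = sigma_rv M borel U"
| "sigma_ingredient M Z U \<theta> E Clock = sigma_rv M borel \<theta>"
| "sigma_ingredient M Z U \<theta> E Exponential = sigma_rv M borel E"

definition time_changed_chi_square ::
    "('m::finite \<Rightarrow> real \<Rightarrow> 'w \<Rightarrow> real) \<Rightarrow> ('w \<Rightarrow> real ^ 'm) \<Rightarrow> real \<Rightarrow> 'w \<Rightarrow> real" where
  "time_changed_chi_square X \<theta> t \<omega> = (\<Sum>i\<in>UNIV. (X i (\<theta> \<omega> $ i * t) \<omega>)\<^sup>2)"

definition sojourn_time :: "(real \<Rightarrow> 'w \<Rightarrow> real) \<Rightarrow> real \<Rightarrow> real \<Rightarrow> 'w \<Rightarrow> real" where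
  "sojourn_time \<zeta> t v \<omega> = (LINT s:{0..t}|lborel. indicator {v<..} (\<zeta> s \<omega>))"

definition limit_process ::
    "real \<Rightarrow> ('m::finite \<Rightarrow> real) \<Rightarrow> ('m \<Rightarrow> real \<Rightarrow> 'w \<Rightarrow> real) \<Rightarrow> ('w \<Rightarrow> real ^ 'm) \<Rightarrow>
     ('w \<Rightarrow> real ^ 'm) \<Rightarrow> ('w \<Rightarrow> real) \<Rightarrow> real \<Rightarrow> 'w \<Rightarrow> real" where
  "limit_process \<alpha> C Z U \<theta> E t \<omega> =
     (\<Sum>i\<in>UNIV. Z i (C i powr (1 / \<alpha>) * (\<theta> \<omega> $ i) * t) \<omega> * (U \<omega> $ i))
     - (\<Sum>i\<in>UNIV. C i * (U \<omega> $ i)\<^sup>2 * (\<theta> \<omega> $ i) powr \<alpha> * t powr \<alpha>) + E \<omega>"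

text \<open>
  The total sojourn time is an \<open>ennreal\<close>: it can be infinite, e.g. on the event \<open>\<theta> = 0\<close>.
\<close>

definition sojourn_tail :: "'w measure \<Rightarrow> (real \<Rightarrow> 'w \<Rightarrow> real) \<Rightarrow> real \<Rightarrow> real" where
  "sojourn_tail M Y x = prob_space.prob M
     {\<omega> \<in> space M. (\<integral>\<^sup>+ s\<in>{0..}. indicator {0<..} (Y s \<omega>) \<partial>lborel) > ennreal x}"

text \<open>
  The filter \<open>nhds 0\<close>, unlike \<open>at 0\<close>, includes \<open>t = 0\<close>, where the expansion reads \<open>r 0 = 1\<close>
  (unit variance).
\<close>

definition local_expansion :: "real \<Rightarrow> real \<Rightarrow> (real \<Rightarrow> real) \<Rightarrow> bool" where
  "local_expansion \<alpha> c r \<longleftrightarrow>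
     (\<lambda>t. r t - (1 - c * \<bar>t\<bar> powr \<alpha>)) \<in> o[nhds 0](\<lambda>t. \<bar>t\<bar> powr \<alpha>)"

end

theory Submission
  imports Defs
begin

text \<open>
  Write \<open>u = v powr (1/\<alpha>)\<close> and let \<open>A(s)\<close> indicate \<open>\<zeta>(s) > v\<close>. The numerator is the mean of
  \<open>(u L - x)\<^sup>+\<close>, and pathwise \<open>(u L - x)\<^sup>+\<close> is \<open>u\<close> times the integral over \<open>s\<close> of \<open>A(s)\<close> times
  the indicator that \<open>u\<close> times the sojourn remaining after \<open>s\<close> exceeds \<open>x\<close>. By stationarity it
  is enough to find, for a frozen clock, the conditional law of the remaining sojourn given an
  exceedance at \<open>s\<close>. Given the exceedance, the Gaussian vector has an asymptotically uniform
  direction and a radius whose square is about \<open>v + 2 z\<close> with \<open>z\<close> exponential; given direction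
  and radius, the finite-dimensional laws of \<open>|X(s + w/u)|\<^sup>2 - v\<close> converge, by characteristic
  functions, to those of twice the limit process. Sojourns over bounded windows then converge by
  moments, and the sojourn outside the window is negligible by Gaussian moment bounds, which
  need \<open>t\<close> small.
\<close>

section \<open>Gaussian families\<close>

text \<open>The processes are only jointly measurable, so neither a functional limit theorem nor a
  bound on suprema is at hand. Paths therefore enter through time integrals alone: moments of an
  occupation time are integrals of finite-dimensional probabilities, and a moment bound at each
  single time replaces a maximal inequality. For the same reason the clock, which is independent
  merely of the coordinates, is frozen only inside integrals over time, with mean-square continuity
  standing in for path continuity.

  The marginal law of the chi-square process is the same for every clock and every time. Hence the
  mean sojourn is exactly \<open>t\<close> times a tail probability, and the ratio becomes an
  average of conditional expectations given an exceedance. Tail indicators are replaced by Lipschitz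
  ramps until the very end, the only place where continuity of \<open>B\<close> at \<open>x\<close>
  enters. Smallness of \<open>t\<close>, together with the bound on the clock, keeps all
  correlations in the range where they are nonnegative and at most
  \<open>1 - C i / 2 * \<bar>u\<bar> powr \<alpha>\<close>; the drift coming from this bound pushes
  the process back below the level.\<close>

definition gaussian_family ::
    "'w measure \<Rightarrow> (real \<Rightarrow> real \<Rightarrow> real) \<Rightarrow> (real \<Rightarrow> 'w \<Rightarrow> real) \<Rightarrow> bool" where
  "gaussian_family M K X \<longleftrightarrow> (\<forall>t\<ge>0. X t \<in> borel_measurable M) \<and>
     (\<forall>J c. finite J \<and> J \<subseteq> {0..} \<longrightarrow>
        (LINT \<omega>|M. iexp (\<Sum>t\<in>J. c t * X t \<omega>)) =
          of_real (exp (- (\<Sum>s\<in>J. \<Sum>t\<in>J. c s * c t * K s t) / 2)))"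

lemma gaussian_familyD_measurable:
  "gaussian_family M K X \<Longrightarrow> 0 \<le> t \<Longrightarrow> X t \<in> borel_measurable M"
  by (auto simp: gaussian_family_def)

text \<open>The times \<open>w j\<close> may coincide, which a sum over a set of times cannot
  express; coefficients at equal times are added up. This covers time changes that are not
  injective, in particular a clock component equal to 0.\<close>

lemma gaussian_family_char:
  fixes I :: "'j set"
  assumes X: "gaussian_family M K X" and I: "finite I" and w: "\<And>j. j \<in> I \<Longrightarrow> 0 \<le> w j"
  shows "(LINT \<omega>|M. iexp (\<Sum>j\<in>I. b j * X (w j) \<omega>)) =
    of_real (exp (- (\<Sum>j\<in>I. \<Sum>k\<in>I. b j * b k * K (w j) (w k)) / 2))"
proof -
  define c where "c t = (\<Sum>j | j \<in> I \<and> w j = t. b j)" for t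
  have g: "(\<Sum>t\<in>w ` I. c t * f t) = (\<Sum>j\<in>I. b j * f (w j))" for f :: "real \<Rightarrow> real"
  proof -
    have "(\<Sum>j\<in>I. b j * f (w j)) = (\<Sum>t\<in>w ` I. \<Sum>j | j \<in> I \<and> w j = t. b j * f (w j))"
      by (rule sum.image_gen[OF I])
    also have "\<dots> = (\<Sum>t\<in>w ` I. c t * f t)"
      unfolding c_def sum_distrib_right by (intro sum.cong) auto
    finally show ?thesis ..
  qed
  have "(\<Sum>s\<in>w ` I. \<Sum>t\<in>w ` I. c s * c t * K s t) = (\<Sum>s\<in>w ` I. c s * (\<Sum>t\<in>w ` I. c t * K s t))"
    by (simp add: sum_distrib_left mult.assoc)
  also have "\<dots> = (\<Sum>j\<in>I. b j * (\<Sum>k\<in>I. b k * K (w j) (w k)))"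
    unfolding g ..
  also have "\<dots> = (\<Sum>j\<in>I. \<Sum>k\<in>I. b j * b k * K (w j) (w k))"
    by (simp add: sum_distrib_left mult.assoc)
  finally have q: "(\<Sum>s\<in>w ` I. \<Sum>t\<in>w ` I. c s * c t * K s t)
    = (\<Sum>j\<in>I. \<Sum>k\<in>I. b j * b k * K (w j) (w k))" .
  have "finite (w ` I)" "w ` I \<subseteq> {0..}" using I w by auto
  then have "(LINT \<omega>|M. iexp (\<Sum>t\<in>w ` I. c t * X t \<omega>)) =
          of_real (exp (- (\<Sum>s\<in>w ` I. \<Sum>t\<in>w ` I. c s * c t * K s t) / 2))"
    using X unfolding gaussian_family_def by blast
  then show ?thesis unfolding q g .
qed

lemma gaussian_family_time_change:
  assumes X: "gaussian_family M K X" and h: "\<And>t. 0 \<le> t \<Longrightarrow> 0 \<le> h t"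
  shows "gaussian_family M (\<lambda>s t. K (h s) (h t)) (\<lambda>t. X (h t))"
  unfolding gaussian_family_def
proof (intro conjI allI impI)
  show "X (h t) \<in> borel_measurable M" if "0 \<le> t" for t
    using X h[OF that] by (rule gaussian_familyD_measurable)
  fix J :: "real set" and c assume "finite J \<and> J \<subseteq> {0..}"
  then show "(LINT \<omega>|M. iexp (\<Sum>t\<in>J. c t * X (h t) \<omega>)) =
      of_real (exp (- (\<Sum>s\<in>J. \<Sum>t\<in>J. c s * c t * K (h s) (h t)) / 2))"
    using h by (intro gaussian_family_char[OF X]) auto
qed

text \<open>All three claims are transported from the standard normal law along the equality of
  distributions. Mean zero forces \<open>\<mu> = 0\<close>; then only
  \<open>\<sigma>\<^sup>2\<close> matters, so the sign of \<open>\<sigma>\<close> and the degenerate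
  case \<open>\<sigma> = 0\<close> need no separate treatment.\<close>

lemma normal_rv_integrals:
  assumes "normal_rv M Y"
  shows "integrable M Y" "integrable M (\<lambda>\<omega>. (Y \<omega>)\<^sup>2)"
    and "integral\<^sup>L M Y = 0 \<Longrightarrow>
      (LINT \<omega>|M. iexp (Y \<omega>)) = of_real (exp (- (LINT \<omega>|M. (Y \<omega>)\<^sup>2) / 2))"
proof -
  let ?N = std_normal_distribution
  interpret N: real_distribution ?N by (rule real_dist_normal_dist)
  from assms obtain \<mu> \<sigma> where [measurable]: "Y \<in> borel_measurable M"
    and d: "distr M borel Y = distr ?N borel (\<lambda>z. \<mu> + \<sigma> * z)"
    unfolding normal_rv_def by auto
  have int: "integrable ?N (\<lambda>z. z)" "integrable ?N (\<lambda>z. z\<^sup>2)"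
    using integrable_std_normal_distribution_moment[of 1]
      integrable_std_normal_distribution_moment[of 2] by simp_all
  have mom: "(LINT z|?N. z) = 0" "(LINT z|?N. z\<^sup>2) = 1"
    using integral_std_normal_distribution_moment_odd[of 1] std_normal_distribution_even_moments(1)[of 1]
    by simp_all
  have i: "integrable M (\<lambda>\<omega>. f (Y \<omega>)) \<longleftrightarrow> integrable ?N (\<lambda>z. f (\<mu> + \<sigma> * z))"
    if [measurable]: "f \<in> borel_measurable borel" for f :: "real \<Rightarrow> real"
    using integrable_distr_eq[of Y M borel f] integrable_distr_eq[of "\<lambda>z. \<mu> + \<sigma> * z" ?N borel f]
    by (simp add: d)
  have e: "(LINT \<omega>|M. f (Y \<omega>)) = (LINT z|?N. f (\<mu> + \<sigma> * z))"
    if [measurable]: "f \<in> borel_measurable borel" for f :: "real \<Rightarrow> 'b::{banach,second_countable_topology}"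
    using integral_distr[of Y M borel f] integral_distr[of "\<lambda>z. \<mu> + \<sigma> * z" ?N borel f]
    by (simp add: d)
  have sq: "(\<mu> + \<sigma> * z)\<^sup>2 = \<mu>\<^sup>2 + (2 * \<mu> * \<sigma>) * z + \<sigma>\<^sup>2 * z\<^sup>2" for z
    by (simp add: power2_eq_square algebra_simps)
  show "integrable M Y" unfolding i[of "\<lambda>x. x", simplified] using int by simp
  show "integrable M (\<lambda>\<omega>. (Y \<omega>)\<^sup>2)" unfolding i[of "\<lambda>x. x\<^sup>2", simplified] sq using int by simp
  have "integral\<^sup>L M Y = \<mu>"
    unfolding e[of "\<lambda>x. x", simplified] using int mom N.prob_space by simp
  moreover assume "integral\<^sup>L M Y = 0"
  ultimately have \<mu>: "\<mu> = 0" by simp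
  have "(LINT \<omega>|M. (Y \<omega>)\<^sup>2) = \<sigma>\<^sup>2"
    unfolding e[of "\<lambda>x. x\<^sup>2", simplified] \<mu> using int mom by (simp add: power_mult_distrib)
  moreover have "(LINT \<omega>|M. iexp (Y \<omega>)) = char ?N \<sigma>"
    by (subst e[of iexp]) (simp_all add: \<mu> char_def)
  ultimately show "(LINT \<omega>|M. iexp (Y \<omega>)) = of_real (exp (- (LINT \<omega>|M. (Y \<omega>)\<^sup>2) / 2))"
    by (simp add: char_std_normal_distribution)
qed

text \<open>A finite linear combination is centered normal, so its characteristic function at 1 is
  fixed by its second moment, which expands into the quadratic form of \<open>K\<close>. The cross
  moments exist because \<open>\<bar>a * b\<bar> \<le> a\<^sup>2 + b\<^sup>2\<close>.\<close>

lemma gaussian_process_family: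
  assumes M: "prob_space M" and X: "gaussian_process M X" and c: "centered_process M X"
    and K: "\<And>s t. 0 \<le> s \<Longrightarrow> 0 \<le> t \<Longrightarrow> covariance M (X s) (X t) = K s t"
  shows "gaussian_family M K X"
  unfolding gaussian_family_def
proof (intro conjI allI impI)
  interpret prob_space M by fact
  have n: "normal_rv M (X t)" if "0 \<le> t" for t
    using X[unfolded gaussian_process_def, rule_format, of "{t}" "\<lambda>_. 1"] that by simp
  then show "X t \<in> borel_measurable M" if "0 \<le> t" for t
    using that by (auto simp: normal_rv_def)
  have int: "integrable M (X t)" "integrable M (\<lambda>\<omega>. (X t \<omega>)\<^sup>2)" and z: "expectation (X t) = 0"
    if "0 \<le> t" for t
    using normal_rv_integrals[OF n[OF that]] c that by (auto simp: centered_process_def)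
  have int2: "integrable M (\<lambda>\<omega>. X s \<omega> * X t \<omega>)" if s: "0 \<le> s" and t: "0 \<le> t" for s t
  proof (rule Bochner_Integration.integrable_bound)
    show "integrable M (\<lambda>\<omega>. (X s \<omega>)\<^sup>2 + (X t \<omega>)\<^sup>2)" using int s t by auto
    show "(\<lambda>\<omega>. X s \<omega> * X t \<omega>) \<in> borel_measurable M" using n[OF s] n[OF t] by (intro borel_measurable_times) (simp_all add: normal_rv_def)
    have "\<bar>a * b\<bar> \<le> a\<^sup>2 + b\<^sup>2" for a b :: real
    proof -
      have "\<bar>a * b\<bar> \<le> 2 * \<bar>a\<bar> * \<bar>b\<bar>" by (simp add: abs_mult)
      also have "\<dots> \<le> a\<^sup>2 + b\<^sup>2" using sum_squares_bound[of "\<bar>a\<bar>" "\<bar>b\<bar>"] by simp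
      finally show ?thesis .
    qed
    then show "AE \<omega> in M. norm (X s \<omega> * X t \<omega>) \<le> norm ((X s \<omega>)\<^sup>2 + (X t \<omega>)\<^sup>2)"
      by auto
  qed
  have cov: "expectation (\<lambda>\<omega>. X s \<omega> * X t \<omega>) = K s t" if "0 \<le> s" "0 \<le> t" for s t
    using K[OF that] z that by (simp add: covariance_def)
  fix J :: "real set" and c assume "finite J \<and> J \<subseteq> {0..}"
  then have J: "finite J" "J \<subseteq> {0..}" by auto
  have N: "normal_rv M (\<lambda>\<omega>. \<Sum>t\<in>J. c t * X t \<omega>)"
    using X J by (auto simp: gaussian_process_def)
  have "expectation (\<lambda>\<omega>. \<Sum>t\<in>J. c t * X t \<omega>) = (\<Sum>t\<in>J. c t * expectation (X t))"
    using J int by (subst Bochner_Integration.integral_sum) (auto simp: subset_iff)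
  also have "\<dots> = 0" using z J by (auto intro!: sum.neutral)
  finally have "expectation (\<lambda>\<omega>. \<Sum>t\<in>J. c t * X t \<omega>) = 0" .
  note 1 = normal_rv_integrals(3)[OF N this]
  have "expectation (\<lambda>\<omega>. (\<Sum>t\<in>J. c t * X t \<omega>)\<^sup>2)
      = expectation (\<lambda>\<omega>. \<Sum>s\<in>J. \<Sum>t\<in>J. c s * c t * (X s \<omega> * X t \<omega>))"
    by (simp add: power2_eq_square sum_product mult.assoc mult.left_commute)
  also have "\<dots> = (\<Sum>s\<in>J. \<Sum>t\<in>J. c s * c t * expectation (\<lambda>\<omega>. X s \<omega> * X t \<omega>))"
    using J int2 by (simp add: subset_iff)
  also have "\<dots> = (\<Sum>s\<in>J. \<Sum>t\<in>J. c s * c t * K s t)"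
    using J cov by (intro sum.cong) (auto simp: subset_iff)
  finally have "expectation (\<lambda>\<omega>. (\<Sum>t\<in>J. c t * X t \<omega>)\<^sup>2) = (\<Sum>s\<in>J. \<Sum>t\<in>J. c s * c t * K s t)" .
  with 1 show "expectation (\<lambda>\<omega>. iexp (\<Sum>t\<in>J. c t * X t \<omega>)) =
      of_real (exp (- (\<Sum>s\<in>J. \<Sum>t\<in>J. c s * c t * K s t) / 2))"
    by simp
qed

text \<open>The variance \<open>V\<close> is given only through the characteristic function, so that
  any expression produced by a transform computation can be plugged in. Its sign is a consequence: a
  characteristic function is bounded by 1.\<close>

locale centered_normal = prob_space +
  fixes W :: "'a \<Rightarrow> real" and V :: real
  assumes W [measurable]: "W \<in> borel_measurable M"
    and char: "\<And>a. (LINT \<omega>|M. iexp (a * W \<omega>)) = of_real (exp (- (a\<^sup>2 * V) / 2))"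
begin

lemma V_nonneg: "0 \<le> V"
proof -
  have "norm (LINT \<omega>|M. iexp (1 * W \<omega>)) \<le> expectation (\<lambda>\<omega>. 1)"
    by (rule integral_norm_bound[THEN order_trans]) (simp add: prob_space)
  then show ?thesis unfolding char by (simp add: prob_space)
qed

lemma distr_eq: "distr M borel W = distr std_normal_distribution borel (\<lambda>z. sqrt V * z)"
proof (rule Levy_uniqueness)
  interpret N: real_distribution std_normal_distribution by (rule real_dist_normal_dist)
  show "real_distribution (distr M borel W)" by (rule real_distribution_distr) simp
  show "real_distribution (distr std_normal_distribution borel (\<lambda>z. sqrt V * z))"
    by (rule N.real_distribution_distr) simp
  show "Characteristic_Functions.char (distr M borel W) =
      Characteristic_Functions.char (distr std_normal_distribution borel (\<lambda>z. sqrt V * z))"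
  proof
    fix a
    have "Characteristic_Functions.char (distr M borel W) a = of_real (exp (- (a\<^sup>2 * V) / 2))"
      using char[of a] by (simp add: char_def integral_distr)
    also have "\<dots> = Characteristic_Functions.char std_normal_distribution (a * sqrt V)"
      using V_nonneg by (simp add: char_std_normal_distribution power_mult_distrib)
    also have "\<dots> = Characteristic_Functions.char (distr std_normal_distribution borel (\<lambda>z. sqrt V * z)) a"
      by (simp add: char_def integral_distr mult_ac)
    finally show "Characteristic_Functions.char (distr M borel W) a =
      Characteristic_Functions.char (distr std_normal_distribution borel (\<lambda>z. sqrt V * z)) a" .
  qed
qed

lemma even_moment:
  "integrable M (\<lambda>\<omega>. W \<omega> ^ (2 * k))"
  "expectation (\<lambda>\<omega>. W \<omega> ^ (2 * k)) = fact (2 * k) / (2 ^ k * fact k) * V ^ k"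
proof -
  let ?N = std_normal_distribution
  have s: "sqrt V ^ (2 * k) = V ^ k" using V_nonneg by (simp add: power_mult)
  have i: "integrable ?N (\<lambda>z. (sqrt V * z) ^ (2 * k))"
    using integrable_std_normal_distribution_moment[of "2 * k"] by (simp add: power_mult_distrib)
  then show "integrable M (\<lambda>\<omega>. W \<omega> ^ (2 * k))"
    using integrable_distr_eq[of W M borel "\<lambda>x. x ^ (2 * k)"]
      integrable_distr_eq[of "\<lambda>z. sqrt V * z" ?N borel "\<lambda>x. x ^ (2 * k)"]
    by (simp add: distr_eq)
  have "expectation (\<lambda>\<omega>. W \<omega> ^ (2 * k)) = (LINT z|?N. (sqrt V * z) ^ (2 * k))"
    using integral_distr[of W M borel "\<lambda>x. x ^ (2 * k)"]
      integral_distr[of "\<lambda>z. sqrt V * z" ?N borel "\<lambda>x. x ^ (2 * k)"]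
    by (simp add: distr_eq)
  then show "expectation (\<lambda>\<omega>. W \<omega> ^ (2 * k)) = fact (2 * k) / (2 ^ k * fact k) * V ^ k"
    using std_normal_distribution_even_moments(1)[of k] by (simp add: power_mult_distrib s)
qed

lemma second_moment: "integrable M (\<lambda>\<omega>. (W \<omega>)\<^sup>2)" "expectation (\<lambda>\<omega>. (W \<omega>)\<^sup>2) = V"
  using even_moment[of 1] by (simp_all add: numeral_2_eq_2)

text \<open>Markov's inequality for \<open>W ^ (2 * k)\<close>. The order \<open>k\<close> stays
  free because the decay that is needed later depends on \<open>\<alpha>\<close>.\<close>

lemma tail_bound:
  assumes "0 < a"
  shows "prob {\<omega> \<in> space M. a \<le> \<bar>W \<omega>\<bar>} \<le> fact (2 * k) / (2 ^ k * fact k) * (V / a\<^sup>2) ^ k"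
proof -
  have "prob {\<omega> \<in> space M. a \<le> \<bar>W \<omega>\<bar>} \<le> prob {\<omega> \<in> space M. a ^ (2 * k) \<le> W \<omega> ^ (2 * k)}"
  proof (rule finite_measure_mono)
    show "{\<omega> \<in> space M. a \<le> \<bar>W \<omega>\<bar>} \<subseteq> {\<omega> \<in> space M. a ^ (2 * k) \<le> W \<omega> ^ (2 * k)}"
    proof safe
      fix \<omega> assume "a \<le> \<bar>W \<omega>\<bar>"
      then have "a ^ (2 * k) \<le> \<bar>W \<omega>\<bar> ^ (2 * k)" using assms by (intro power_mono) auto
      then show "a ^ (2 * k) \<le> W \<omega> ^ (2 * k)" by (simp add: power_even_abs)
    qed
  qed simp
  also have "\<dots> \<le> expectation (\<lambda>\<omega>. W \<omega> ^ (2 * k)) / a ^ (2 * k)"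
    using assms even_moment(1)
    by (intro integral_Markov_inequality_measure[where A="{}"]) (auto simp: zero_le_even_power)
  also have "\<dots> = fact (2 * k) / (2 ^ k * fact k) * (V / a\<^sup>2) ^ k"
    unfolding even_moment(2) by (simp add: power_divide power_mult)
  finally show ?thesis .
qed

lemma no_atom:
  assumes "0 < V"
  shows "prob {\<omega> \<in> space M. W \<omega> = a} = 0"
proof -
  let ?N = std_normal_distribution
  have "prob {\<omega> \<in> space M. W \<omega> = a} = measure (distr M borel W) {a}"
    by (subst measure_distr) (auto intro!: arg_cong[where f=prob])
  also have "\<dots> = measure ?N {a / sqrt V}"
    unfolding distr_eq
    using assms by (subst measure_distr) (auto intro!: arg_cong[where f="measure ?N"] simp: field_simps)
  also have "\<dots> = 0"
  proof -
    have "emeasure ?N {a / sqrt V} = 0"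
      by (subst emeasure_density) (auto intro!: nn_integral_null_set)
    then show ?thesis by (simp add: measure_def)
  qed
  finally show ?thesis .
qed

end

text \<open>The index set \<open>bool\<close> with weights \<open>a\<close> and \<open>- a\<close>
  handles \<open>s = t\<close> together with the general case.\<close>

lemma (in prob_space) gaussian_family_increment:
  assumes X: "gaussian_family M K X" and st: "0 \<le> s" "0 \<le> t" and sym: "K s t = K t s"
  shows "centered_normal M (\<lambda>\<omega>. X t \<omega> - X s \<omega>) (K t t + K s s - 2 * K s t)"
proof
  show "(\<lambda>\<omega>. X t \<omega> - X s \<omega>) \<in> borel_measurable M"
    using gaussian_familyD_measurable[OF X] st by auto
  fix a :: real
  let ?w = "\<lambda>j::bool. if j then t else s" and ?b = "\<lambda>j::bool. if j then a else - a"
  show "(LINT \<omega>|M. iexp (a * (X t \<omega> - X s \<omega>)))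
    = of_real (exp (- (a\<^sup>2 * (K t t + K s s - 2 * K s t)) / 2))"
    using gaussian_family_char[OF X, of "UNIV :: bool set" ?w ?b] st
    by (simp add: UNIV_bool sym algebra_simps power2_eq_square)
qed

section \<open>Characteristic functions under a bounded weight\<close>

context prob_space begin

text \<open>
  A small signed weight \<open>g\<close> becomes a probability density after adding \<open>1\<close> and normalizing, so
  the theorems of Levy apply to weighted laws.
\<close>

definition tilted_law :: "('a \<Rightarrow> real) \<Rightarrow> ('a \<Rightarrow> real) \<Rightarrow> real measure" where
  "tilted_law g X = distr (density M (\<lambda>\<omega>. ennreal ((1 + g \<omega>) / (1 + expectation g)))) borel X"

context
  fixes g X :: "'a \<Rightarrow> real"
  assumes g [measurable]: "g \<in> borel_measurable M" and X [measurable]: "X \<in> borel_measurable M"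
    and g_le: "\<And>\<omega>. \<bar>g \<omega>\<bar> \<le> 1/2"
begin

lemma tilt_integrable: "integrable M g"
  by (rule integrable_const_bound[where B="1/2"]) (use g_le in auto)

lemma tilt_mass: "1/2 \<le> 1 + expectation g"
proof -
  have "- (1/2) \<le> expectation g"
    using integral_mono[OF integrable_const tilt_integrable, of "-(1/2)"] abs_le_D2[OF g_le]
    by (simp add: prob_space minus_le_iff)
  then show ?thesis by simp
qed

lemma tilt_density_nonneg: "0 \<le> (1 + g \<omega>) / (1 + expectation g)"
  using tilt_mass g_le[of \<omega>] by (intro divide_nonneg_nonneg) (auto simp: abs_le_iff)

lemma integral_tilted_law:
  fixes f :: "real \<Rightarrow> 'b::{banach, second_countable_topology}"
  assumes [measurable]: "f \<in> borel_measurable borel" and f: "\<And>x. norm (f x) \<le> 1"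
  shows "(LINT x|tilted_law g X. f x) =
    (expectation (\<lambda>\<omega>. f (X \<omega>)) + expectation (\<lambda>\<omega>. g \<omega> *\<^sub>R f (X \<omega>))) /\<^sub>R (1 + expectation g)"
proof -
  have 1: "integrable M (\<lambda>\<omega>. f (X \<omega>))"
    by (rule integrable_const_bound[where B=1]) (use f in auto)
  have 2: "integrable M (\<lambda>\<omega>. g \<omega> *\<^sub>R f (X \<omega>))"
  proof (rule integrable_const_bound[where B=1])
    have "norm (g \<omega> *\<^sub>R f (X \<omega>)) \<le> 1" for \<omega>
      using mult_mono[of "\<bar>g \<omega>\<bar>" 1 "norm (f (X \<omega>))" 1] g_le[of \<omega>] f[of "X \<omega>"] by auto
    then show "AE \<omega> in M. norm (g \<omega> *\<^sub>R f (X \<omega>)) \<le> 1" by auto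
  qed auto
  have "(LINT x|tilted_law g X. f x)
      = expectation (\<lambda>\<omega>. ((1 + g \<omega>) / (1 + expectation g)) *\<^sub>R f (X \<omega>))"
    unfolding tilted_law_def using tilt_density_nonneg
    by (subst integral_distr) (auto simp: integral_density)
  also have "\<dots> = expectation (\<lambda>\<omega>. (f (X \<omega>) + g \<omega> *\<^sub>R f (X \<omega>)) /\<^sub>R (1 + expectation g))"
    by (intro Bochner_Integration.integral_cong refl)
      (simp add: divide_inverse algebra_simps)
  also have "\<dots> = (expectation (\<lambda>\<omega>. f (X \<omega>)) + expectation (\<lambda>\<omega>. g \<omega> *\<^sub>R f (X \<omega>)))
      /\<^sub>R (1 + expectation g)"
    using 1 2 by simp
  finally show ?thesis .
qed

lemma real_distribution_tilted_law: "real_distribution (tilted_law g X)"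
proof -
  have "prob_space (density M (\<lambda>\<omega>. ennreal ((1 + g \<omega>) / (1 + expectation g))))"
  proof (rule prob_spaceI)
    have "(\<integral>\<^sup>+ \<omega>. ennreal ((1 + g \<omega>) / (1 + expectation g)) \<partial>M)
        = ennreal (expectation (\<lambda>\<omega>. (1 + g \<omega>) / (1 + expectation g)))"
      using tilt_density_nonneg tilt_integrable by (intro nn_integral_eq_integral) auto
    also have "expectation (\<lambda>\<omega>. (1 + g \<omega>) / (1 + expectation g)) = 1"
      using tilt_mass tilt_integrable by (simp add: prob_space)
    finally show "emeasure (density M (\<lambda>\<omega>. ennreal ((1 + g \<omega>) / (1 + expectation g))))
        (space (density M (\<lambda>\<omega>. ennreal ((1 + g \<omega>) / (1 + expectation g))))) = 1"
      by (simp add: emeasure_density cong: nn_integral_cong_simp)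
  qed
  then interpret T: prob_space "density M (\<lambda>\<omega>. ennreal ((1 + g \<omega>) / (1 + expectation g)))" .
  show ?thesis
    unfolding tilted_law_def by (rule T.real_distribution_distr) simp
qed

lemma char_tilted_law:
  "char (tilted_law g X) t =
    (expectation (\<lambda>\<omega>. iexp (t * X \<omega>)) + expectation (\<lambda>\<omega>. g \<omega> *\<^sub>R iexp (t * X \<omega>)))
      /\<^sub>R (1 + expectation g)"
  unfolding char_def by (rule integral_tilted_law) auto

lemma measure_tilted_law:
  assumes [measurable]: "A \<in> sets borel"
  shows "measure (tilted_law g X) A =
    (expectation (\<lambda>\<omega>. indicator A (X \<omega>)) + expectation (\<lambda>\<omega>. g \<omega> * indicator A (X \<omega>)))
      / (1 + expectation g)"
proof -
  interpret T: real_distribution "tilted_law g X" by (rule real_distribution_tilted_law)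
  have "measure (tilted_law g X) A = (LINT x|tilted_law g X. indicator A x :: real)"
    by simp
  also have "\<dots> = (expectation (\<lambda>\<omega>. indicator A (X \<omega>))
      + expectation (\<lambda>\<omega>. g \<omega> *\<^sub>R indicator A (X \<omega>))) /\<^sub>R (1 + expectation g)"
    by (rule integral_tilted_law) (auto simp: indicator_def)
  finally show ?thesis by (simp add: divide_inverse mult.commute)
qed

end

lemma integrable_iexp_mult:
  fixes X :: "'a \<Rightarrow> real" and G :: "'a \<Rightarrow> complex"
  assumes [measurable]: "X \<in> borel_measurable M" "G \<in> borel_measurable M"
    and G: "\<And>\<omega>. norm (G \<omega>) \<le> 1"
  shows "integrable M (\<lambda>\<omega>. iexp (X \<omega>) * G \<omega>)"
  by (rule integrable_const_bound[where B=1]) (use G in \<open>auto simp: norm_mult\<close>)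

lemma expectation_iexp_cnj:
  fixes X :: "'a \<Rightarrow> real" and G :: "'a \<Rightarrow> complex"
  shows "expectation (\<lambda>\<omega>. iexp (t * X \<omega>) * cnj (G \<omega>)) =
    cnj (expectation (\<lambda>\<omega>. iexp (- t * X \<omega>) * G \<omega>))"
proof -
  have "cnj (expectation (\<lambda>\<omega>. iexp (- t * X \<omega>) * G \<omega>))
      = expectation (\<lambda>\<omega>. cnj (iexp (- t * X \<omega>) * G \<omega>))"
    by (rule Bochner_Integration.integral_cnj[symmetric])
  also have "\<dots> = expectation (\<lambda>\<omega>. iexp (t * X \<omega>) * cnj (G \<omega>))"
    by (simp add: exp_cnj)
  finally show ?thesis ..
qed

text \<open>The theorems of Levy need real weights, whereas the inductions below produce complex
  ones. The real part is \<open>(G + cnj G) / 2\<close>, and the transform weighted by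
  \<open>cnj G\<close> at \<open>t\<close> is the conjugate of the one weighted by \<open>G\<close>
  at \<open>- t\<close>, so knowing the transform for all \<open>t\<close> is enough.\<close>

lemma expectation_iexp_Re:
  fixes X :: "'a \<Rightarrow> real" and G :: "'a \<Rightarrow> complex"
  assumes [measurable]: "X \<in> borel_measurable M" "G \<in> borel_measurable M"
    and G: "\<And>\<omega>. norm (G \<omega>) \<le> 1"
  shows "expectation (\<lambda>\<omega>. (Re (G \<omega>) / 2) *\<^sub>R iexp (t * X \<omega>)) =
    (expectation (\<lambda>\<omega>. iexp (t * X \<omega>) * G \<omega>)
      + cnj (expectation (\<lambda>\<omega>. iexp (- t * X \<omega>) * G \<omega>))) / 4"
proof -
  have *: "of_real (Re z) = (z + cnj z) / 2" for z
    by (simp add: complex_eq_iff)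
  have "(expectation (\<lambda>\<omega>. iexp (t * X \<omega>) * G \<omega>)
      + expectation (\<lambda>\<omega>. iexp (t * X \<omega>) * cnj (G \<omega>))) / 4
    = expectation (\<lambda>\<omega>. (iexp (t * X \<omega>) * G \<omega> + iexp (t * X \<omega>) * cnj (G \<omega>)) / 4)"
    using integrable_iexp_mult[of "\<lambda>\<omega>. t * X \<omega>" G]
      integrable_iexp_mult[OF _ borel_measurable_continuous_on[OF continuous_on_cnj[OF continuous_on_id] assms(2)],
        of "\<lambda>\<omega>. t * X \<omega>"] G
    by (subst integral_divide_zero, subst Bochner_Integration.integral_add) auto
  also have "\<dots> = expectation (\<lambda>\<omega>. (Re (G \<omega>) / 2) *\<^sub>R iexp (t * X \<omega>))"
    by (intro Bochner_Integration.integral_cong refl) (simp add: scaleR_conv_of_real * field_simps)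
  finally show ?thesis unfolding expectation_iexp_cnj ..
qed

text \<open>The laws tilted by \<open>Re G / 2\<close> and by 0 have the same mass, by the transform
  at 0, and the same characteristic function, hence agree. The difference of their masses on
  \<open>A\<close> is the asserted expectation up to a factor. Halving brings the weight into the
  range where a tilt is a density.\<close>

lemma char_weight_unique_Re:
  fixes X :: "'a \<Rightarrow> real" and G :: "'a \<Rightarrow> complex"
  assumes [measurable]: "X \<in> borel_measurable M" "G \<in> borel_measurable M" "A \<in> sets borel"
    and G: "\<And>\<omega>. norm (G \<omega>) \<le> 1"
    and 0: "\<And>t. expectation (\<lambda>\<omega>. iexp (t * X \<omega>) * G \<omega>) = 0"
  shows "expectation (\<lambda>\<omega>. indicator A (X \<omega>) * Re (G \<omega>)) = 0"
proof -
  let ?g = "\<lambda>\<omega>. Re (G \<omega>) / 2" and ?h = "\<lambda>_. 0 :: real"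
  have g: "\<bar>?g \<omega>\<bar> \<le> 1/2" for \<omega>
    using abs_Re_le_cmod[of "G \<omega>"] G[of \<omega>] by simp
  have c: "expectation (\<lambda>\<omega>. ?g \<omega> *\<^sub>R iexp (t * X \<omega>)) = 0" for t
    unfolding expectation_iexp_Re[OF assms(1,2) G] 0 by simp
  have "complex_of_real (expectation ?g) = 0"
    using c[of 0] by (simp flip: integral_complex_of_real add: scaleR_conv_of_real del: integral_divide_zero)
  then have m: "expectation ?g = 0" by simp
  have gm: "?g \<in> borel_measurable M" by simp
  have "char (tilted_law ?g X) t = char (tilted_law ?h X) t" for t
    unfolding char_tilted_law[OF gm assms(1) g] c m by (subst char_tilted_law) auto
  then have "tilted_law ?g X = tilted_law ?h X"
    by (intro Levy_uniqueness real_distribution_tilted_law ext g) auto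
  then have "measure (tilted_law ?g X) A = measure (tilted_law ?h X) A" by simp
  then have "expectation (\<lambda>\<omega>. ?g \<omega> * indicator A (X \<omega>)) = 0"
    by (simp add: measure_tilted_law[OF _ _ g] measure_tilted_law[of ?h] m del: integral_divide_zero)
  then show ?thesis by (simp add: mult.commute)
qed

lemma integrable_indicator_mult:
  fixes X :: "'a \<Rightarrow> 'b::topological_space" and G :: "'a \<Rightarrow> complex"
  assumes [measurable]: "X \<in> borel_measurable M" "G \<in> borel_measurable M" "A \<in> sets borel"
    and G: "\<And>\<omega>. norm (G \<omega>) \<le> 1"
  shows "integrable M (\<lambda>\<omega>. indicator A (X \<omega>) * G \<omega>)"
  by (rule integrable_const_bound[where B=1]) (use G in \<open>auto simp: norm_mult indicator_def\<close>)

lemma expectation_indicator_mult_complex: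
  fixes X :: "'a \<Rightarrow> 'b::topological_space" and G :: "'a \<Rightarrow> complex"
  assumes [measurable]: "X \<in> borel_measurable M" "G \<in> borel_measurable M" "A \<in> sets borel"
    and G: "\<And>\<omega>. norm (G \<omega>) \<le> 1"
  shows "expectation (\<lambda>\<omega>. indicator A (X \<omega>) * G \<omega>) =
    of_real (expectation (\<lambda>\<omega>. indicator A (X \<omega>) * Re (G \<omega>))) +
    \<i> * of_real (expectation (\<lambda>\<omega>. indicator A (X \<omega>) * Re (- \<i> * G \<omega>)))"
proof -
  note int = integrable_indicator_mult[OF assms]
  have "Re (expectation (\<lambda>\<omega>. indicator A (X \<omega>) * G \<omega>))
      = expectation (\<lambda>\<omega>. indicator A (X \<omega>) * Re (G \<omega>))"
    unfolding integral_Re[OF int, symmetric]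
    by (intro Bochner_Integration.integral_cong) (auto simp: indicator_def)
  moreover have "Im (expectation (\<lambda>\<omega>. indicator A (X \<omega>) * G \<omega>))
      = expectation (\<lambda>\<omega>. indicator A (X \<omega>) * Re (- \<i> * G \<omega>))"
    unfolding integral_Im[OF int, symmetric]
    by (intro Bochner_Integration.integral_cong) (auto simp: indicator_def)
  ultimately show ?thesis by (simp add: complex_eq_iff)
qed

lemma char_weight_unique:
  fixes X :: "'a \<Rightarrow> real" and G :: "'a \<Rightarrow> complex"
  assumes [measurable]: "X \<in> borel_measurable M" "G \<in> borel_measurable M" "A \<in> sets borel"
    and G: "\<And>\<omega>. norm (G \<omega>) \<le> 1"
    and 0: "\<And>t. expectation (\<lambda>\<omega>. iexp (t * X \<omega>) * G \<omega>) = 0"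
  shows "expectation (\<lambda>\<omega>. indicator A (X \<omega>) * G \<omega>) = 0"
proof -
  have "expectation (\<lambda>\<omega>. iexp (t * X \<omega>) * (- \<i> * G \<omega>)) = 0" for t
  proof -
    have "expectation (\<lambda>\<omega>. iexp (t * X \<omega>) * (- \<i> * G \<omega>))
        = expectation (\<lambda>\<omega>. - \<i> * (iexp (t * X \<omega>) * G \<omega>))"
      by (simp add: mult_ac)
    also have "\<dots> = 0" by (simp only: integral_mult_right_zero 0 mult_zero_right)
    finally show ?thesis .
  qed
  then have "expectation (\<lambda>\<omega>. indicator A (X \<omega>) * Re (- \<i> * G \<omega>)) = 0"
    by (intro char_weight_unique_Re) (auto simp: norm_mult G)
  moreover have "expectation (\<lambda>\<omega>. indicator A (X \<omega>) * Re (G \<omega>)) = 0"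
    by (intro char_weight_unique_Re assms)
  ultimately show ?thesis
    unfolding expectation_indicator_mult_complex[OF assms(1-4)] by simp
qed

text \<open>One exponential factor at a time is exchanged for an indicator while all remaining
  factors are moved into the weight. One-dimensional uniqueness thereby does the work of a
  multivariate theorem; this is why \<open>G\<close> is complex and arbitrary in the
  induction.\<close>

lemma char_weight_unique_finite:
  fixes Y :: "'j \<Rightarrow> 'a \<Rightarrow> real" and G :: "'a \<Rightarrow> complex"
  assumes "finite J" and "\<And>j. j \<in> J \<Longrightarrow> Y j \<in> borel_measurable M" "G \<in> borel_measurable M"
    and "\<And>j. j \<in> J \<Longrightarrow> A j \<in> sets borel"
    and "\<And>\<omega>. norm (G \<omega>) \<le> 1"
    and "\<And>b. expectation (\<lambda>\<omega>. iexp (\<Sum>j\<in>J. b j * Y j \<omega>) * G \<omega>) = 0"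
  shows "expectation (\<lambda>\<omega>. (\<Prod>j\<in>J. indicator (A j) (Y j \<omega>)) * G \<omega>) = 0"
  using assms
proof (induction J arbitrary: G rule: finite_induct)
  case empty
  from empty(5)[of "\<lambda>_. 0"] show ?case by simp
next
  case (insert k J)
  have [measurable]: "Y k \<in> borel_measurable M" "\<And>j. j \<in> J \<Longrightarrow> Y j \<in> borel_measurable M"
    "G \<in> borel_measurable M" "A k \<in> sets borel" "\<And>j. j \<in> J \<Longrightarrow> A j \<in> sets borel"
    using insert.prems by auto
  have "expectation (\<lambda>\<omega>. (\<Prod>j\<in>J. indicator (A j) (Y j \<omega>)) * (iexp (t * Y k \<omega>) * G \<omega>)) = 0" for t
  proof (rule insert.IH)
    fix b
    have "(\<Sum>j\<in>insert k J. (b(k := t)) j * Y j \<omega>) = t * Y k \<omega> + (\<Sum>j\<in>J. b j * Y j \<omega>)" for \<omega>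
      using insert.hyps by (auto intro!: sum.cong)
    then have "iexp (\<Sum>j\<in>insert k J. (b(k := t)) j * Y j \<omega>)
        = iexp (\<Sum>j\<in>J. b j * Y j \<omega>) * iexp (t * Y k \<omega>)" for \<omega>
      by (simp add: algebra_simps exp_add)
    then show "expectation (\<lambda>\<omega>. iexp (\<Sum>j\<in>J. b j * Y j \<omega>) * (iexp (t * Y k \<omega>) * G \<omega>)) = 0"
      using insert.prems(5)[of "b(k := t)"] by (simp add: mult.assoc)
  qed (use insert.prems in \<open>auto simp: norm_mult\<close>)
  then have *: "expectation (\<lambda>\<omega>. iexp (t * Y k \<omega>) * ((\<Prod>j\<in>J. indicator (A j) (Y j \<omega>)) * G \<omega>)) = 0" for t
    by (simp add: mult_ac)
  have le: "norm ((\<Prod>j\<in>J. indicator (A j) (Y j \<omega>)) * G \<omega>) \<le> 1" for \<omega>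
    using insert.prems(4)[of \<omega>]
    by (auto simp: norm_mult prod_norm[symmetric] indicator_def intro!: mult_le_one prod_le_1)
  have "expectation (\<lambda>\<omega>. indicator (A k) (Y k \<omega>) * ((\<Prod>j\<in>J. indicator (A j) (Y j \<omega>)) * G \<omega>)) = 0"
    by (rule char_weight_unique) (use * le in auto)
  then show ?case using insert.hyps by (simp add: mult.assoc)
qed

text \<open>The continuity theorem applies to the tilt by \<open>Re (G n) / 2\<close> and to the
  zero tilt; 0 is a continuity point of both limits because \<open>X'\<close> has no atom there. The
  difference of the two masses on \<open>{..0}\<close> isolates the weighted expectation.\<close>

lemma levy_weight_Re:
  fixes X :: "nat \<Rightarrow> 'a \<Rightarrow> real" and X' :: "'a \<Rightarrow> real" and G :: "nat \<Rightarrow> 'a \<Rightarrow> complex"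
  assumes [measurable]: "\<And>n. X n \<in> borel_measurable M" "X' \<in> borel_measurable M"
      "\<And>n. G n \<in> borel_measurable M" "G' \<in> borel_measurable M"
    and G: "\<And>n \<omega>. norm (G n \<omega>) \<le> 1" and G': "\<And>\<omega>. norm (G' \<omega>) \<le> 1"
    and no_atom: "prob {\<omega> \<in> space M. X' \<omega> = 0} = 0"
    and lim1: "\<And>t. (\<lambda>n. expectation (\<lambda>\<omega>. iexp (t * X n \<omega>))) \<longlonglongrightarrow> expectation (\<lambda>\<omega>. iexp (t * X' \<omega>))"
    and lim: "\<And>t. (\<lambda>n. expectation (\<lambda>\<omega>. iexp (t * X n \<omega>) * G n \<omega>))
      \<longlonglongrightarrow> expectation (\<lambda>\<omega>. iexp (t * X' \<omega>) * G' \<omega>)"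
  shows "(\<lambda>n. expectation (\<lambda>\<omega>. indicator {0<..} (X n \<omega>) * Re (G n \<omega>)))
    \<longlonglongrightarrow> expectation (\<lambda>\<omega>. indicator {0<..} (X' \<omega>) * Re (G' \<omega>))"
proof -
  let ?h = "\<lambda>_. 0 :: real"
  define g where "g n \<omega> = Re (G n \<omega>) / 2" for n \<omega>
  define g' where "g' \<omega> = Re (G' \<omega>) / 2" for \<omega>
  have [measurable]: "\<And>n. g n \<in> borel_measurable M" "g' \<in> borel_measurable M"
    unfolding g_def g'_def by auto
  have g: "\<bar>g n \<omega>\<bar> \<le> 1/2" for n \<omega>
    using abs_Re_le_cmod[of "G n \<omega>"] G[of n \<omega>] by (simp add: g_def)
  have g': "\<bar>g' \<omega>\<bar> \<le> 1/2" for \<omega>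
    using abs_Re_le_cmod[of "G' \<omega>"] G'[of \<omega>] by (simp add: g'_def)
  have c: "(\<lambda>n. expectation (\<lambda>\<omega>. g n \<omega> *\<^sub>R iexp (t * X n \<omega>)))
      \<longlonglongrightarrow> expectation (\<lambda>\<omega>. g' \<omega> *\<^sub>R iexp (t * X' \<omega>))" for t
    unfolding g_def g'_def expectation_iexp_Re[OF assms(1,3) G] expectation_iexp_Re[OF assms(2,4) G']
    by (intro tendsto_intros lim) simp
  \<comment> \<open>The transform at \<open>t = 0\<close> gives convergence of the total masses by
    which the tilted laws are normalized.\<close>
  have m: "(\<lambda>n. expectation (g n)) \<longlonglongrightarrow> expectation g'"
  proof -
    have "(\<lambda>n. complex_of_real (expectation (g n))) \<longlonglongrightarrow> complex_of_real (expectation g')"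
      using c[of 0] by (simp flip: integral_complex_of_real add: scaleR_conv_of_real)
    then show ?thesis by (simp only: tendsto_of_real_iff)
  qed
  have conv: "(\<lambda>n. measure (tilted_law (f n) (X n)) {..0}) \<longlonglongrightarrow> measure (tilted_law f' X') {..0}"
    if f[measurable]: "\<And>n. f n \<in> borel_measurable M" and f'[measurable]: "f' \<in> borel_measurable M"
      and f_le: "\<And>n \<omega>. \<bar>f n \<omega>\<bar> \<le> 1/2" "\<And>\<omega>. \<bar>f' \<omega>\<bar> \<le> 1/2"
      and f_c: "\<And>t. (\<lambda>n. expectation (\<lambda>\<omega>. f n \<omega> *\<^sub>R iexp (t * X n \<omega>)))
        \<longlonglongrightarrow> expectation (\<lambda>\<omega>. f' \<omega> *\<^sub>R iexp (t * X' \<omega>))"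
      and f_m: "(\<lambda>n. expectation (f n)) \<longlonglongrightarrow> expectation f'" for f f'
  proof -
    interpret T: real_distribution "tilted_law f' X'"
      by (rule real_distribution_tilted_law) (use f_le in auto)
    have nz: "1 + expectation f' \<noteq> 0" using tilt_mass[of f' X'] f_le by auto
    have "weak_conv_m (\<lambda>n. tilted_law (f n) (X n)) (tilted_law f' X')"
    proof (rule levy_continuity)
      show "(\<lambda>n. char (tilted_law (f n) (X n)) t) \<longlonglongrightarrow> char (tilted_law f' X') t" for t
        unfolding char_tilted_law[OF f assms(1) f_le(1)] char_tilted_law[OF f' assms(2) f_le(2)]
        by (intro tendsto_intros lim1 f_c f_m nz)
    qed (auto intro!: real_distribution_tilted_law f_le simp del: less_divide_eq_numeral1 le_divide_eq_numeral1)
    moreover have "isCont (cdf (tilted_law f' X')) 0"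
    proof -
      have "AE \<omega> in M. X' \<omega> \<noteq> 0"
        using no_atom by (subst AE_iff_measurable[OF _ refl]) (auto simp: emeasure_eq_measure)
      then have z: "AE \<omega> in M. indicator {0} (X' \<omega>) = (0::real)" by auto
      have "expectation (\<lambda>\<omega>. indicator {0} (X' \<omega>)) = (0::real)"
        using integral_cong_AE[of _ M "\<lambda>_. 0 :: real", OF _ _ z] by simp
      moreover have "AE \<omega> in M. f' \<omega> * indicator {0} (X' \<omega>) = 0"
        using z by eventually_elim simp
      then have "expectation (\<lambda>\<omega>. f' \<omega> * indicator {0} (X' \<omega>)) = 0"
        using integral_cong_AE[of "\<lambda>\<omega>. f' \<omega> * indicator {0} (X' \<omega>)" M "\<lambda>_. 0 :: real"] by simp
      ultimately have "measure (tilted_law f' X') {0} = 0"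
        by (subst measure_tilted_law) (use f_le in auto)
      then show ?thesis by (simp add: T.isCont_cdf)
    qed
    ultimately show ?thesis by (auto simp: weak_conv_m_def weak_conv_def cdf_def)
  qed
  have 1: "(\<lambda>n. measure (tilted_law ?h (X n)) {..0}) \<longlonglongrightarrow> measure (tilted_law ?h X') {..0}"
    by (rule conv) auto
  have 2: "(\<lambda>n. measure (tilted_law (g n) (X n)) {..0}) \<longlonglongrightarrow> measure (tilted_law g' X') {..0}"
    by (rule conv[OF _ _ g g' c m]) auto
  \<comment> \<open>Undoing the normalization, the mass of \<open>{..0}\<close> under the tilt by
    \<open>f\<close> is the plain probability plus the expectation of \<open>f\<close> on that
    event; the zero tilt removes the plain probability.\<close>
  have split: "expectation (\<lambda>\<omega>. indicator {0<..} (Y \<omega>) * f \<omega>) = expectation f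
      - (measure (tilted_law f Y) {..0} * (1 + expectation f) - measure (tilted_law ?h Y) {..0})"
    if [measurable]: "f \<in> borel_measurable M" "Y \<in> borel_measurable M"
      and f_le: "\<And>\<omega>. \<bar>f \<omega>\<bar> \<le> 1/2" for f Y :: "'a \<Rightarrow> real"
  proof -
    have nz: "1 + expectation f \<noteq> 0" using tilt_mass[of f Y] f_le by auto
    have i: "integrable M f" by (rule tilt_integrable[of f Y]) (use f_le in auto)
    have i': "integrable M (\<lambda>\<omega>. f \<omega> * indicator {..0} (Y \<omega>))"
      by (rule integrable_const_bound[where B=1])
        (use f_le order_trans[OF f_le] in \<open>auto simp: indicator_def\<close>)
    have "expectation (\<lambda>\<omega>. indicator {0<..} (Y \<omega>) * f \<omega>)
        = expectation (\<lambda>\<omega>. f \<omega> - f \<omega> * indicator {..0} (Y \<omega>))"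
      by (intro Bochner_Integration.integral_cong) (auto simp: indicator_def)
    also have "\<dots> = expectation f - expectation (\<lambda>\<omega>. f \<omega> * indicator {..0} (Y \<omega>))"
      using i i' by simp
    finally show ?thesis
      using nz by (simp add: measure_tilted_law[OF that] measure_tilted_law[of ?h])
  qed
  have "(\<lambda>n. expectation (\<lambda>\<omega>. indicator {0<..} (X n \<omega>) * g n \<omega>))
    \<longlonglongrightarrow> expectation (\<lambda>\<omega>. indicator {0<..} (X' \<omega>) * g' \<omega>)"
    unfolding split[OF _ _ g, OF \<open>\<And>n. g n \<in> borel_measurable M\<close> assms(1)]
      split[OF _ _ g', OF \<open>g' \<in> borel_measurable M\<close> assms(2)]
    by (intro tendsto_intros 1 2 m)
  then have "(\<lambda>n. 2 * expectation (\<lambda>\<omega>. indicator {0<..} (X n \<omega>) * g n \<omega>))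
    \<longlonglongrightarrow> 2 * expectation (\<lambda>\<omega>. indicator {0<..} (X' \<omega>) * g' \<omega>)"
    by (intro tendsto_intros)
  then show ?thesis by (simp add: g_def g'_def)
qed

lemma levy_weight:
  fixes X :: "nat \<Rightarrow> 'a \<Rightarrow> real" and X' :: "'a \<Rightarrow> real" and G :: "nat \<Rightarrow> 'a \<Rightarrow> complex"
  assumes [measurable]: "\<And>n. X n \<in> borel_measurable M" "X' \<in> borel_measurable M"
      "\<And>n. G n \<in> borel_measurable M" "G' \<in> borel_measurable M"
    and G: "\<And>n \<omega>. norm (G n \<omega>) \<le> 1" and G': "\<And>\<omega>. norm (G' \<omega>) \<le> 1"
    and no_atom: "prob {\<omega> \<in> space M. X' \<omega> = 0} = 0"
    and lim1: "\<And>t. (\<lambda>n. expectation (\<lambda>\<omega>. iexp (t * X n \<omega>))) \<longlonglongrightarrow> expectation (\<lambda>\<omega>. iexp (t * X' \<omega>))"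
    and lim: "\<And>t. (\<lambda>n. expectation (\<lambda>\<omega>. iexp (t * X n \<omega>) * G n \<omega>))
      \<longlonglongrightarrow> expectation (\<lambda>\<omega>. iexp (t * X' \<omega>) * G' \<omega>)"
  shows "(\<lambda>n. expectation (\<lambda>\<omega>. indicator {0<..} (X n \<omega>) * G n \<omega>))
    \<longlonglongrightarrow> expectation (\<lambda>\<omega>. indicator {0<..} (X' \<omega>) * G' \<omega>)"
proof -
  have *: "expectation (\<lambda>\<omega>. iexp (Y \<omega>) * (- \<i> * H \<omega>)) = - \<i> * expectation (\<lambda>\<omega>. iexp (Y \<omega>) * H \<omega>)"
    for Y and H :: "'a \<Rightarrow> complex"
    by (simp only: integral_mult_right_zero[symmetric] mult_ac)
  have **: "(\<lambda>n. expectation (\<lambda>\<omega>. iexp (t * X n \<omega>) * (- \<i> * G n \<omega>)))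
      \<longlonglongrightarrow> expectation (\<lambda>\<omega>. iexp (t * X' \<omega>) * (- \<i> * G' \<omega>))" for t
    unfolding * by (intro tendsto_intros lim)
  have 1: "(\<lambda>n. expectation (\<lambda>\<omega>. indicator {0<..} (X n \<omega>) * Re (G n \<omega>)))
      \<longlonglongrightarrow> expectation (\<lambda>\<omega>. indicator {0<..} (X' \<omega>) * Re (G' \<omega>))"
    by (rule levy_weight_Re) (use assms in auto)
  have 2: "(\<lambda>n. expectation (\<lambda>\<omega>. indicator {0<..} (X n \<omega>) * Re (- \<i> * G n \<omega>)))
      \<longlonglongrightarrow> expectation (\<lambda>\<omega>. indicator {0<..} (X' \<omega>) * Re (- \<i> * G' \<omega>))"
  proof (rule levy_weight_Re[OF _ _ _ _ _ _ no_atom lim1 **])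
  qed (use G G' in \<open>auto simp: norm_mult\<close>)
  have e: "expectation (\<lambda>\<omega>. indicator {0<..} (X n \<omega>) * G n \<omega>) =
    of_real (expectation (\<lambda>\<omega>. indicator {0<..} (X n \<omega>) * Re (G n \<omega>))) +
    \<i> * of_real (expectation (\<lambda>\<omega>. indicator {0<..} (X n \<omega>) * Re (- \<i> * G n \<omega>)))" for n
    by (rule expectation_indicator_mult_complex) (auto simp: G)
  have e': "expectation (\<lambda>\<omega>. indicator {0<..} (X' \<omega>) * G' \<omega>) =
    of_real (expectation (\<lambda>\<omega>. indicator {0<..} (X' \<omega>) * Re (G' \<omega>))) +
    \<i> * of_real (expectation (\<lambda>\<omega>. indicator {0<..} (X' \<omega>) * Re (- \<i> * G' \<omega>)))"
    by (rule expectation_indicator_mult_complex) (auto simp: G')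
  show ?thesis unfolding e e' by (intro tendsto_intros 1 2)
qed

text \<open>The same exchange of exponentials for indicators, one coordinate at a time. Convergence
  of the unweighted one-dimensional transforms is a hypothesis of its own because each tilted law
  contains the plain law as well.\<close>

lemma levy_weight_finite:
  fixes X :: "nat \<Rightarrow> 'j \<Rightarrow> 'a \<Rightarrow> real" and X' :: "'j \<Rightarrow> 'a \<Rightarrow> real" and G :: "nat \<Rightarrow> 'a \<Rightarrow> complex"
  assumes "finite J"
    and "\<And>n j. j \<in> J \<Longrightarrow> X n j \<in> borel_measurable M" "\<And>j. j \<in> J \<Longrightarrow> X' j \<in> borel_measurable M"
      "\<And>n. G n \<in> borel_measurable M" "G' \<in> borel_measurable M"
    and "\<And>n \<omega>. norm (G n \<omega>) \<le> 1" and "\<And>\<omega>. norm (G' \<omega>) \<le> 1"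
    and "\<And>j. j \<in> J \<Longrightarrow> prob {\<omega> \<in> space M. X' j \<omega> = 0} = 0"
    and "\<And>j t. j \<in> J \<Longrightarrow> (\<lambda>n. expectation (\<lambda>\<omega>. iexp (t * X n j \<omega>)))
      \<longlonglongrightarrow> expectation (\<lambda>\<omega>. iexp (t * X' j \<omega>))"
    and "\<And>b. (\<lambda>n. expectation (\<lambda>\<omega>. iexp (\<Sum>j\<in>J. b j * X n j \<omega>) * G n \<omega>))
      \<longlonglongrightarrow> expectation (\<lambda>\<omega>. iexp (\<Sum>j\<in>J. b j * X' j \<omega>) * G' \<omega>)"
  shows "(\<lambda>n. expectation (\<lambda>\<omega>. (\<Prod>j\<in>J. indicator {0<..} (X n j \<omega>)) * G n \<omega>))
    \<longlonglongrightarrow> expectation (\<lambda>\<omega>. (\<Prod>j\<in>J. indicator {0<..} (X' j \<omega>)) * G' \<omega>)"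
  using assms
proof (induction J arbitrary: G G' rule: finite_induct)
  case empty
  from empty(9)[of "\<lambda>_. 0"] show ?case by simp
next
  case (insert k J)
  have [measurable]: "\<And>n. X n k \<in> borel_measurable M" "\<And>n j. j \<in> J \<Longrightarrow> X n j \<in> borel_measurable M"
    "X' k \<in> borel_measurable M" "\<And>j. j \<in> J \<Longrightarrow> X' j \<in> borel_measurable M"
    "\<And>n. G n \<in> borel_measurable M" "G' \<in> borel_measurable M"
    using insert.prems by auto
  have ex: "iexp (\<Sum>j\<in>insert k J. (b(k := t)) j * Y j \<omega>)
      = iexp (\<Sum>j\<in>J. b j * Y j \<omega>) * iexp (t * Y k \<omega>)" for b t \<omega> and Y :: "'j \<Rightarrow> 'a \<Rightarrow> real"
  proof -
    have "(\<Sum>j\<in>insert k J. (b(k := t)) j * Y j \<omega>) = t * Y k \<omega> + (\<Sum>j\<in>J. b j * Y j \<omega>)"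
      using insert.hyps by (auto intro!: sum.cong)
    then show ?thesis by (simp add: algebra_simps exp_add)
  qed
  have "(\<lambda>n. expectation (\<lambda>\<omega>. (\<Prod>j\<in>J. indicator {0<..} (X n j \<omega>)) * (iexp (t * X n k \<omega>) * G n \<omega>)))
    \<longlonglongrightarrow> expectation (\<lambda>\<omega>. (\<Prod>j\<in>J. indicator {0<..} (X' j \<omega>)) * (iexp (t * X' k \<omega>) * G' \<omega>))" for t
  proof (rule insert.IH)
    fix b
    show "(\<lambda>n. expectation (\<lambda>\<omega>. iexp (\<Sum>j\<in>J. b j * X n j \<omega>) * (iexp (t * X n k \<omega>) * G n \<omega>)))
      \<longlonglongrightarrow> expectation (\<lambda>\<omega>. iexp (\<Sum>j\<in>J. b j * X' j \<omega>) * (iexp (t * X' k \<omega>) * G' \<omega>))"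
      using insert.prems(9)[of "b(k := t)"] unfolding ex by (simp add: mult.assoc)
  qed (use insert.prems in \<open>auto simp: norm_mult\<close>)
  then have *: "(\<lambda>n. expectation (\<lambda>\<omega>. iexp (t * X n k \<omega>) * ((\<Prod>j\<in>J. indicator {0<..} (X n j \<omega>)) * G n \<omega>)))
    \<longlonglongrightarrow> expectation (\<lambda>\<omega>. iexp (t * X' k \<omega>) * ((\<Prod>j\<in>J. indicator {0<..} (X' j \<omega>)) * G' \<omega>))" for t
    by (simp add: mult_ac)
  have le: "norm ((\<Prod>j\<in>J. indicator {0::real<..} (Y j)) * z) \<le> 1" if "norm z \<le> 1" for Y and z :: complex
    using that by (auto simp: norm_mult prod_norm[symmetric] indicator_def intro!: mult_le_one prod_le_1)
  have "(\<lambda>n. expectation (\<lambda>\<omega>. indicator {0<..} (X n k \<omega>) * ((\<Prod>j\<in>J. indicator {0<..} (X n j \<omega>)) * G n \<omega>)))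
    \<longlonglongrightarrow> expectation (\<lambda>\<omega>. indicator {0<..} (X' k \<omega>) * ((\<Prod>j\<in>J. indicator {0<..} (X' j \<omega>)) * G' \<omega>))"
    by (rule levy_weight[OF _ _ _ _ _ _ _ _ *]) (use insert.prems le in auto)
  then show ?case using insert.hyps by (simp add: mult.assoc)
qed

end

section \<open>Freezing a random clock\<close>

lemma borel_measurable_vec_lambda [measurable (raw)]:
  fixes f :: "'m::finite \<Rightarrow> 'a \<Rightarrow> real"
  assumes "\<And>i. f i \<in> borel_measurable N"
  shows "(\<lambda>x. \<chi> i. f i x) \<in> borel_measurable N"
  using assms by (subst borel_measurable_euclidean_space) (auto simp: Basis_vec_def inner_axis)

lemma borel_measurable_vec_nth [measurable (raw)]:
  fixes f :: "'a \<Rightarrow> real ^ 'm"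
  assumes "f \<in> borel_measurable N"
  shows "(\<lambda>x. f x $ i) \<in> borel_measurable N"
proof -
  have "(\<lambda>x. f x \<bullet> axis i 1) \<in> borel_measurable N" using assms by measurable
  then show ?thesis by (simp add: inner_axis)
qed

lemma measurable_process_comp:
  assumes X: "measurable_process M X"
    and [measurable]: "f \<in> borel_measurable N" "g \<in> N \<rightarrow>\<^sub>M M" and f: "\<And>x. x \<in> space N \<Longrightarrow> 0 \<le> f x"
  shows "(\<lambda>x. X (f x) (g x)) \<in> borel_measurable N"
proof -
  have "(\<lambda>x. (f x, g x)) \<in> N \<rightarrow>\<^sub>M restrict_space borel {0..} \<Otimes>\<^sub>M M"
    by (intro measurable_Pair measurable_restrict_space2) (auto simp: f)
  from measurable_compose[OF this X[unfolded measurable_process_def]] show ?thesis by simp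
qed

lemma measurable_process_component:
  assumes "measurable_process M X" "0 \<le> t"
  shows "X t \<in> borel_measurable M"
  using measurable_process_comp[OF assms(1), of "\<lambda>_. t" M "\<lambda>\<omega>. \<omega>"] assms(2) by simp

text \<open>Uniform over the half line, so that one grid serves all times. The nonnegative integral
  avoids any integrability side condition.\<close>

definition L2_continuous :: "'w measure \<Rightarrow> (real \<Rightarrow> 'w \<Rightarrow> real) \<Rightarrow> bool" where
  "L2_continuous M Y \<longleftrightarrow> (\<forall>\<epsilon>>0. \<exists>\<delta>>0. \<forall>s\<ge>0. \<forall>t\<ge>0. \<bar>t - s\<bar> < \<delta> \<longrightarrow>
     (\<integral>\<^sup>+\<omega>. ennreal ((Y t \<omega> - Y s \<omega>)\<^sup>2) \<partial>M) \<le> ennreal \<epsilon>)"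

text \<open>The value at the grid point below \<open>\<bar>t\<bar>\<close>, along grids of mesh
  \<open>1 / n k\<close> that are chosen later and need not be dyadic. Where the values do not
  converge, \<open>lim\<close> returns some fixed value, which is harmless up to null sets; the
  modulus makes the function total in \<open>t\<close>.\<close>

definition dyadic_limit :: "(nat \<Rightarrow> nat) \<Rightarrow> 'm \<Rightarrow> real \<Rightarrow> ('m \<times> real \<Rightarrow> real) \<Rightarrow> real" where
  "dyadic_limit n i t \<xi> = lim (\<lambda>k. \<xi> (i, real (nat \<lfloor>real (n k) * \<bar>t\<bar>\<rfloor>) / real (n k)))"

text \<open>For fixed \<open>k\<close> the grid index takes countably many values, so evaluating
  \<open>\<xi>\<close> at a time-dependent grid point is a countable case distinction between
  coordinate projections.\<close>

lemma dyadic_limit_measurable: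
  fixes i :: 'm
  shows
  "(\<lambda>(t, \<xi>). dyadic_limit n i t \<xi>) \<in> borel_measurable (borel \<Otimes>\<^sub>M (\<Pi>\<^sub>M j\<in>UNIV \<times> {0..}. borel))"
proof -
  have 1: "(\<lambda>x::real \<times> ('m \<times> real \<Rightarrow> real). snd x (i, real j / real (n k)))
      \<in> borel_measurable (borel \<Otimes>\<^sub>M (\<Pi>\<^sub>M j\<in>UNIV \<times> {0..}. borel))" for j k
    by (rule measurable_compose[OF measurable_snd measurable_component_singleton]) auto
  have 2: "(\<lambda>x::real \<times> ('m \<times> real \<Rightarrow> real). nat \<lfloor>real (n k) * \<bar>fst x\<bar>\<rfloor>)
      \<in> borel \<Otimes>\<^sub>M (\<Pi>\<^sub>M j\<in>UNIV \<times> {0..}. borel) \<rightarrow>\<^sub>M count_space UNIV" for k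
    by measurable
  show ?thesis
    unfolding dyadic_limit_def split_beta'
    by (intro borel_measurable_lim_metric measurable_compose_countable[OF 1 2])
qed

text \<open>
  The coordinate \<open>\<sigma>\<close>-algebra does not see sojourn times, but a process that is continuous in
  \<open>L\<^sup>2\<close> coincides at almost every time with a function of countably many of its coordinates.
\<close>

lemma dyadic_version:
  fixes Y :: "'m::finite \<Rightarrow> real \<Rightarrow> 'w \<Rightarrow> real"
  assumes Ym: "\<And>i. measurable_process M (Y i)"
    and cont: "\<And>i. L2_continuous M (Y i)"
  obtains n where "\<And>k. 0 < n k"
    and "\<And>i t. 0 \<le> t \<Longrightarrow> AE \<omega> in M. dyadic_limit n i t (\<lambda>j\<in>UNIV \<times> {0..}. case_prod Y j \<omega>) = Y i t \<omega>"
proof -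
  \<comment> \<open>Geometric squared errors are requested so that they can be summed over
    \<open>k\<close>; a common mesh for all components exists because the index type is
    finite.\<close>
  have "\<exists>n>0. \<forall>i s t. 0 \<le> s \<longrightarrow> 0 \<le> t \<longrightarrow> \<bar>t - s\<bar> \<le> 1 / real n \<longrightarrow>
      (\<integral>\<^sup>+\<omega>. ennreal ((Y i t \<omega> - Y i s \<omega>)\<^sup>2) \<partial>M) \<le> ennreal ((1/2) ^ k)" for k :: nat
  proof -
    have "\<forall>i. \<exists>\<delta>>0. \<forall>s\<ge>0. \<forall>t\<ge>0. \<bar>t - s\<bar> < \<delta> \<longrightarrow>
        (\<integral>\<^sup>+\<omega>. ennreal ((Y i t \<omega> - Y i s \<omega>)\<^sup>2) \<partial>M) \<le> ennreal ((1/2) ^ k)"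
      using cont unfolding L2_continuous_def by simp
    then obtain \<delta> where \<delta>: "\<And>i. 0 < \<delta> i" and b: "\<And>i s t. 0 \<le> s \<Longrightarrow> 0 \<le> t \<Longrightarrow> \<bar>t - s\<bar> < \<delta> i \<Longrightarrow>
        (\<integral>\<^sup>+\<omega>. ennreal ((Y i t \<omega> - Y i s \<omega>)\<^sup>2) \<partial>M) \<le> ennreal ((1/2) ^ k)"
      by metis
    define d where "d = Min (range \<delta>)"
    have d: "0 < d" "\<And>i. d \<le> \<delta> i" using \<delta> by (auto simp: d_def)
    obtain m :: nat where m: "m > 0" "1 / real m < d"
      using d(1) by (metis reals_Archimedean inverse_eq_divide neq0_conv zero_less_Suc)
    show ?thesis
    proof (intro exI conjI allI impI b)
      show "\<bar>t - s\<bar> < \<delta> i" if "\<bar>t - s\<bar> \<le> 1 / real m" for i s t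
        using that m d(2)[of i] by linarith
    qed (use m in auto)
  qed
  then obtain n where n: "\<And>k. 0 < n k"
    and b: "\<And>k i s t. 0 \<le> s \<Longrightarrow> 0 \<le> t \<Longrightarrow> \<bar>t - s\<bar> \<le> 1 / real (n k) \<Longrightarrow>
      (\<integral>\<^sup>+\<omega>. ennreal ((Y i t \<omega> - Y i s \<omega>)\<^sup>2) \<partial>M) \<le> ennreal ((1/2) ^ k)"
    by metis
  show thesis
  proof (rule that[OF n])
    fix i :: 'm and t :: real assume t: "0 \<le> t"
    define g where "g k = real (nat \<lfloor>real (n k) * \<bar>t\<bar>\<rfloor>) / real (n k)" for k
    have g0: "0 \<le> g k" for k by (simp add: g_def)
    have g1: "\<bar>g k - t\<bar> \<le> 1 / real (n k)" for k
    proof -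
      have "\<bar>real_of_int \<lfloor>real (n k) * t\<rfloor> - real (n k) * t\<bar> \<le> 1" by linarith
      then have "\<bar>real_of_int \<lfloor>real (n k) * t\<rfloor> - real (n k) * t\<bar> / real (n k) \<le> 1 / real (n k)"
        by (rule divide_right_mono) simp
      moreover have "\<bar>real_of_int \<lfloor>real (n k) * t\<rfloor> - real (n k) * t\<bar> / real (n k) = \<bar>g k - t\<bar>"
        using n[of k] t by (simp add: g_def field_simps flip: abs_divide)
      ultimately show ?thesis by simp
    qed
    note [measurable] = measurable_process_component[OF Ym]
    have [measurable]: "Y i t \<in> borel_measurable M" "\<And>k. Y i (g k) \<in> borel_measurable M"
      using t g0 by auto
    have "(\<integral>\<^sup>+\<omega>. (\<Sum>k. ennreal ((Y i (g k) \<omega> - Y i t \<omega>)\<^sup>2)) \<partial>M)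
        = (\<Sum>k. \<integral>\<^sup>+\<omega>. ennreal ((Y i (g k) \<omega> - Y i t \<omega>)\<^sup>2) \<partial>M)"
      by (rule nn_integral_suminf) simp
    also have "\<dots> \<le> (\<Sum>k. ennreal ((1/2) ^ k))"
      by (intro suminf_le b t g0 g1) auto
    also have "\<dots> < \<infinity>"
      by (subst suminf_ennreal2) (auto simp: summable_geometric)
    \<comment> \<open>The sum of the squared errors has finite mean, so it is finite almost surely
      and its terms tend to 0: the grid values converge to \<open>Y i t\<close> pointwise and not
      only in mean square.\<close>
    finally have "AE \<omega> in M. (\<Sum>k. ennreal ((Y i (g k) \<omega> - Y i t \<omega>)\<^sup>2)) \<noteq> \<infinity>"
      by (intro nn_integral_PInf_AE) auto
    then show "AE \<omega> in M. dyadic_limit n i t (\<lambda>j\<in>UNIV \<times> {0..}. case_prod Y j \<omega>) = Y i t \<omega>"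
    proof eventually_elim
      fix \<omega> assume "(\<Sum>k. ennreal ((Y i (g k) \<omega> - Y i t \<omega>)\<^sup>2)) \<noteq> \<infinity>"
      then have "summable (\<lambda>k. (Y i (g k) \<omega> - Y i t \<omega>)\<^sup>2)"
        by (intro summable_suminf_not_top) auto
      then have "(\<lambda>k. sqrt ((Y i (g k) \<omega> - Y i t \<omega>)\<^sup>2)) \<longlonglongrightarrow> sqrt 0"
        by (intro tendsto_intros summable_LIMSEQ_zero)
      then have "(\<lambda>k. Y i (g k) \<omega>) \<longlonglongrightarrow> Y i t \<omega>"
        by (simp add: tendsto_rabs_zero_iff LIM_zero_iff)
      then have "lim (\<lambda>k. Y i (g k) \<omega>) = Y i t \<omega>" by (rule limI)
      then show "dyadic_limit n i t (\<lambda>j\<in>UNIV \<times> {0..}. case_prod Y j \<omega>) = Y i t \<omega>"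
        unfolding dyadic_limit_def g_def[symmetric] using g0 by simp
    qed
  qed
qed

text \<open>At time 0 every grid point is 0, so the equality holds surely. It is needed when a clock
  component vanishes: then all \<open>s\<close> are mapped to this single time, which an
  almost-every-time statement cannot control.\<close>

lemma dyadic_limit_0:
  "dyadic_limit n i 0 (\<lambda>j\<in>UNIV \<times> {0..}. case_prod Y j \<omega>) = Y i 0 \<omega>"
  unfolding dyadic_limit_def by (simp add: lim_const)

lemma sigma_rv_eq:
  assumes "Y \<in> M \<rightarrow>\<^sub>M N"
  shows "sigma_rv M N Y = {Y -` A \<inter> space M | A. A \<in> sets N}"
  unfolding sigma_rv_def using assms by (intro sets_vimage_algebra2) (auto dest: measurable_space)

lemma (in prob_space) distr_Pair_indep_set:
  assumes [measurable]: "P \<in> M \<rightarrow>\<^sub>M N" "Q \<in> M \<rightarrow>\<^sub>M S"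
    and ind: "indep_set (sigma_rv M N P) (sigma_rv M S Q)"
  shows "distr M N P \<Otimes>\<^sub>M distr M S Q = distr M (N \<Otimes>\<^sub>M S) (\<lambda>\<omega>. (P \<omega>, Q \<omega>))"
proof (rule pair_measure_eqI)
  show "sigma_finite_measure (distr M N P)" "sigma_finite_measure (distr M S Q)"
    by (auto intro!: prob_space_imp_sigma_finite prob_space_distr)
  fix A B assume "A \<in> sets (distr M N P)" "B \<in> sets (distr M S Q)"
  then have [measurable]: "A \<in> sets N" "B \<in> sets S" by auto
  have "prob ((P -` A \<inter> space M) \<inter> (Q -` B \<inter> space M))
      = prob (P -` A \<inter> space M) * prob (Q -` B \<inter> space M)"
    by (rule indep_setD[OF ind]) (auto simp: sigma_rv_eq)
  moreover have "(\<lambda>\<omega>. (P \<omega>, Q \<omega>)) -` (A \<times> B) \<inter> space M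
      = (P -` A \<inter> space M) \<inter> (Q -` B \<inter> space M)" by auto
  ultimately show "emeasure (distr M N P) A * emeasure (distr M S Q) B
      = emeasure (distr M (N \<Otimes>\<^sub>M S) (\<lambda>\<omega>. (P \<omega>, Q \<omega>))) (A \<times> B)"
    by (simp add: emeasure_distr emeasure_eq_measure ennreal_mult)
qed (simp cong: sets_pair_measure_cong)

text \<open>
  A clock that is independent of the coordinates may be frozen inside a time integral, although
  at individual times \<open>s\<close> the law of \<open>Y\<^sub>i (c\<^sub>i(P) s)\<close> is not determined by the joint law
  of \<open>P\<close> and the coordinates.
\<close>

lemma nn_integral_freeze:
  fixes Y :: "'m::finite \<Rightarrow> real \<Rightarrow> 'w \<Rightarrow> real" and F :: "'p \<Rightarrow> real \<Rightarrow> real ^ 'm \<Rightarrow> ennreal"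
    and H :: "'p \<Rightarrow> ennreal \<Rightarrow> ennreal"
  assumes M: "prob_space M" and Ym: "\<And>i. measurable_process M (Y i)"
    and cont: "\<And>i. L2_continuous M (Y i)"
    and P [measurable]: "P \<in> M \<rightarrow>\<^sub>M N"
    and ind: "prob_space.indep_set M (sigma_rv M N P) (sigma_process M (UNIV \<times> {0..}) (case_prod Y))"
    and F [measurable]: "(\<lambda>(p, s, x). F p s x) \<in> borel_measurable (N \<Otimes>\<^sub>M borel \<Otimes>\<^sub>M borel)"
    and c [measurable]: "\<And>i. c i \<in> borel_measurable N" and c0: "\<And>i p. 0 \<le> c i p"
    and H [measurable]: "(\<lambda>(p, q). H p q) \<in> borel_measurable (N \<Otimes>\<^sub>M borel)"
  shows "(\<integral>\<^sup>+\<omega>. H (P \<omega>) (\<integral>\<^sup>+s\<in>{0..}. F (P \<omega>) s (\<chi> i. Y i (c i (P \<omega>) * s) \<omega>) \<partial>lborel) \<partial>M) =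
    (\<integral>\<^sup>+p. \<integral>\<^sup>+\<omega>. H p (\<integral>\<^sup>+s\<in>{0..}. F p s (\<chi> i. Y i (c i p * s) \<omega>) \<partial>lborel) \<partial>M \<partial>distr M N P)"
proof -
  interpret prob_space M by fact
  let ?S = "\<Pi>\<^sub>M j\<in>UNIV \<times> {0..}. borel :: real measure"
  define path where "path \<omega> = (\<lambda>j\<in>UNIV \<times> {0..}. case_prod Y j \<omega>)" for \<omega>
  have path [measurable]: "path \<in> M \<rightarrow>\<^sub>M ?S"
    unfolding path_def
    by (intro measurable_restrict) (auto simp: measurable_process_component[OF Ym])
  have prod: "distr M N P \<Otimes>\<^sub>M distr M ?S path = distr M (N \<Otimes>\<^sub>M ?S) (\<lambda>\<omega>. (P \<omega>, path \<omega>))"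
    using ind unfolding sigma_process_def path_def[symmetric] by (intro distr_Pair_indep_set) auto
  obtain n where n: "\<And>k. 0 < n k"
    and ver: "\<And>i t. 0 \<le> t \<Longrightarrow> AE \<omega> in M. dyadic_limit n i t (path \<omega>) = Y i t \<omega>"
    unfolding path_def by (rule dyadic_version[of M Y, OF Ym cont]) blast
  have Ymeas[measurable]: "(\<lambda>x. Y i \<bar>f x\<bar> (g x)) \<in> borel_measurable K"
    if "f \<in> borel_measurable K" "g \<in> K \<rightarrow>\<^sub>M M" for i f g and K :: "'k measure"
    using that by (intro measurable_process_comp[OF Ym]) auto
  have Dm[measurable]: "(\<lambda>x. dyadic_limit n i (f x) (g x)) \<in> borel_measurable K"
    if "f \<in> borel_measurable K" "g \<in> K \<rightarrow>\<^sub>M ?S" for i f g and K :: "'k measure"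
    using measurable_compose[OF measurable_Pair[OF that] dyadic_limit_measurable[of n i]] by simp
  define J where "J p \<xi> = (\<integral>\<^sup>+s\<in>{0..}. F p s (\<chi> i. dyadic_limit n i (c i p * s) \<xi>) \<partial>lborel)" for p \<xi>
  have [measurable]: "(\<lambda>x. F (f x) (g x) (h x)) \<in> borel_measurable K"
    if "f \<in> K \<rightarrow>\<^sub>M N" "g \<in> borel_measurable K" "h \<in> borel_measurable K" for f g h and K :: "'k measure"
    using measurable_compose[OF measurable_Pair[OF that(1) measurable_Pair[OF that(2,3)]] F] by simp
  have [measurable]: "(\<lambda>x. H (f x) (g x)) \<in> borel_measurable K"
    if "f \<in> K \<rightarrow>\<^sub>M N" "g \<in> borel_measurable K" for f g and K :: "'k measure"
    using measurable_compose[OF measurable_Pair[OF that] H] by simp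
  have Jm: "(\<lambda>(p, \<xi>). J p \<xi>) \<in> borel_measurable (N \<Otimes>\<^sub>M ?S)"
    unfolding J_def split_beta' by measurable
  have [measurable]: "(\<lambda>x. J (f x) (g x)) \<in> borel_measurable K"
    if "f \<in> K \<rightarrow>\<^sub>M N" "g \<in> K \<rightarrow>\<^sub>M ?S" for f g and K :: "'k measure"
    using measurable_compose[OF measurable_Pair[OF that] Jm] by simp
  \<comment> \<open>Fubini turns "for each time, almost surely" into "almost surely, for almost
    every time".\<close>
  have ver': "AE \<omega> in M. AE t in lborel. dyadic_limit n i t (path \<omega>) = Y i \<bar>t\<bar> \<omega>" for i
  proof -
    interpret pair_sigma_finite M lborel by unfold_locales
    have "AE t in lborel. AE \<omega> in M. dyadic_limit n i t (path \<omega>) = Y i \<bar>t\<bar> \<omega>"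
    proof (rule AE_I2)
      fix t :: real
      have "dyadic_limit n i t \<xi> = dyadic_limit n i \<bar>t\<bar> \<xi>" for \<xi> :: "'m \<times> real \<Rightarrow> real"
        by (simp add: dyadic_limit_def)
      then show "AE \<omega> in M. dyadic_limit n i t (path \<omega>) = Y i \<bar>t\<bar> \<omega>"
        using ver[of "\<bar>t\<bar>" i] by simp
    qed
    moreover have "{x \<in> space (M \<Otimes>\<^sub>M lborel).
        dyadic_limit n i (snd x) (path (fst x)) = Y i \<bar>snd x\<bar> (fst x)} \<in> sets (M \<Otimes>\<^sub>M lborel)"
      by measurable
    ultimately show ?thesis by (subst AE_commute) auto
  qed
  have "AE \<omega> in M. \<forall>i. AE t in lborel. dyadic_limit n i t (path \<omega>) = Y i \<bar>t\<bar> \<omega>"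
    by (subst AE_all_countable) (use ver' in blast)
  \<comment> \<open>The exceptional set does not depend on \<open>p\<close>: scaling time by a
    positive factor preserves null sets, and the factor 0 is covered by the sure equality at time 0.
    This uniformity in \<open>p\<close> allows \<open>p\<close> to be replaced by the random
    \<open>P \<omega>\<close>.\<close>
  then have key: "AE \<omega> in M. \<forall>p. (\<integral>\<^sup>+s\<in>{0..}. F p s (\<chi> i. Y i (c i p * s) \<omega>) \<partial>lborel) = J p (path \<omega>)"
    using AE_space
  proof eventually_elim
    fix \<omega> assume \<omega>: "\<forall>i. AE t in lborel. dyadic_limit n i t (path \<omega>) = Y i \<bar>t\<bar> \<omega>" "\<omega> \<in> space M"
    show "\<forall>p. (\<integral>\<^sup>+s\<in>{0..}. F p s (\<chi> i. Y i (c i p * s) \<omega>) \<partial>lborel) = J p (path \<omega>)"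
    proof
      fix p
      have "AE s in lborel. dyadic_limit n i (c i p * s) (path \<omega>) = Y i \<bar>c i p * s\<bar> \<omega>" for i
      proof (cases "c i p = 0")
        case True
        then show ?thesis by (simp add: path_def dyadic_limit_0)
      next
        case False
        have "path \<omega> \<in> space ?S" using \<omega>(2) path by (rule measurable_space[rotated])
        then have [measurable]: "Measurable.pred borel (\<lambda>t. dyadic_limit n i t (path \<omega>) = Y i \<bar>t\<bar> \<omega>)"
          using \<omega>(2) by measurable
        then show ?thesis
          using AE_borel_affine[of "c i p" "\<lambda>t. dyadic_limit n i t (path \<omega>) = Y i \<bar>t\<bar> \<omega>" 0] \<omega> False
          by simp
      qed
      then have "AE s in lborel. \<forall>i. dyadic_limit n i (c i p * s) (path \<omega>) = Y i \<bar>c i p * s\<bar> \<omega>"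
        by (subst AE_all_countable) blast
      then show "(\<integral>\<^sup>+s\<in>{0..}. F p s (\<chi> i. Y i (c i p * s) \<omega>) \<partial>lborel) = J p (path \<omega>)"
        unfolding J_def
      proof (intro nn_integral_cong_AE, eventually_elim)
        fix s assume s: "\<forall>i. dyadic_limit n i (c i p * s) (path \<omega>) = Y i \<bar>c i p * s\<bar> \<omega>"
        show "F p s (\<chi> i. Y i (c i p * s) \<omega>) * indicator {0..} s =
            F p s (\<chi> i. dyadic_limit n i (c i p * s) (path \<omega>)) * indicator {0..} s"
          using s c0 by (auto simp: indicator_def abs_of_nonneg)
      qed
    qed
  qed
  interpret S: prob_space "distr M ?S path" by (rule prob_space_distr) simp
  have "(\<integral>\<^sup>+\<omega>. H (P \<omega>) (\<integral>\<^sup>+s\<in>{0..}. F (P \<omega>) s (\<chi> i. Y i (c i (P \<omega>) * s) \<omega>) \<partial>lborel) \<partial>M)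
      = (\<integral>\<^sup>+\<omega>. H (P \<omega>) (J (P \<omega>) (path \<omega>)) \<partial>M)"
    by (rule nn_integral_cong_AE) (use key in eventually_elim, simp)
  also have "\<dots> = (\<integral>\<^sup>+z. H (fst z) (J (fst z) (snd z)) \<partial>distr M (N \<Otimes>\<^sub>M ?S) (\<lambda>\<omega>. (P \<omega>, path \<omega>)))"
    by (subst nn_integral_distr) auto
  also have "\<dots> = (\<integral>\<^sup>+p. \<integral>\<^sup>+\<xi>. H p (J p \<xi>) \<partial>distr M ?S path \<partial>distr M N P)"
    unfolding prod[symmetric] by (subst S.nn_integral_fst[symmetric]) auto
  also have "\<dots> = (\<integral>\<^sup>+p. \<integral>\<^sup>+\<omega>. H p (J p (path \<omega>)) \<partial>M \<partial>distr M N P)"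
    by (intro nn_integral_cong nn_integral_distr) auto
  also have "\<dots> = (\<integral>\<^sup>+p. \<integral>\<^sup>+\<omega>. H p (\<integral>\<^sup>+s\<in>{0..}. F p s (\<chi> i. Y i (c i p * s) \<omega>) \<partial>lborel) \<partial>M \<partial>distr M N P)"
    by (rule nn_integral_cong, rule nn_integral_cong_AE) (use key in eventually_elim, simp)
  finally show ?thesis .
qed

lemma borel_measurable_process_integral:
  fixes Y :: "'m::finite \<Rightarrow> real \<Rightarrow> 'w \<Rightarrow> real" and F :: "'p \<Rightarrow> real \<Rightarrow> real ^ 'm \<Rightarrow> ennreal"
  assumes Ym: "\<And>i. measurable_process M (Y i)"
    and F [measurable]: "(\<lambda>(p, s, x). F p s x) \<in> borel_measurable (N \<Otimes>\<^sub>M borel \<Otimes>\<^sub>M borel)"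
    and c: "\<And>i. c i \<in> borel_measurable N" and c0: "\<And>i p. 0 \<le> c i p"
    and f [measurable]: "f \<in> K \<rightarrow>\<^sub>M N" and g [measurable]: "g \<in> K \<rightarrow>\<^sub>M M"
  shows "(\<lambda>x. \<integral>\<^sup>+s\<in>{0..}. F (f x) s (\<chi> i. Y i (c i (f x) * s) (g x)) \<partial>lborel) \<in> borel_measurable K"
proof -
  have [measurable]: "(\<lambda>x. c i (f x)) \<in> borel_measurable K" for i
    using f c by (rule measurable_compose)
  have [measurable]: "(\<lambda>z. Y i (c i (f (fst z)) * \<bar>snd z\<bar>) (g (fst z)))
      \<in> borel_measurable (K \<Otimes>\<^sub>M borel)" for i
    by (rule measurable_process_comp[OF Ym]) (auto simp: c0)
  have "(\<lambda>z. F (f (fst z)) (snd z) (\<chi> i. Y i (c i (f (fst z)) * \<bar>snd z\<bar>) (g (fst z))))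
      \<in> borel_measurable (K \<Otimes>\<^sub>M borel)"
    by (rule measurable_compose[where g="\<lambda>(p, s, x). F p s x", OF measurable_Pair[OF _ measurable_Pair], OF _ _ _ F, unfolded prod.case])
       measurable
  then have "(\<lambda>x. \<integral>\<^sup>+s\<in>{0..}. F (f x) s (\<chi> i. Y i (c i (f x) * \<bar>s\<bar>) (g x)) \<partial>lborel) \<in> borel_measurable K"
    by (intro lborel.borel_measurable_nn_integral) (simp add: split_beta')
  also have "(\<lambda>x. \<integral>\<^sup>+s\<in>{0..}. F (f x) s (\<chi> i. Y i (c i (f x) * \<bar>s\<bar>) (g x)) \<partial>lborel)
      = (\<lambda>x. \<integral>\<^sup>+s\<in>{0..}. F (f x) s (\<chi> i. Y i (c i (f x) * s) (g x)) \<partial>lborel)"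
    by (intro ext nn_integral_cong) (auto simp: indicator_def)
  finally show ?thesis .
qed

lemma expectation_freeze:
  fixes Y :: "'m::finite \<Rightarrow> real \<Rightarrow> 'w \<Rightarrow> real" and F :: "'p \<Rightarrow> real \<Rightarrow> real ^ 'm \<Rightarrow> ennreal"
    and H :: "'p \<Rightarrow> ennreal \<Rightarrow> real"
  assumes M: "prob_space M" and Ym: "\<And>i. measurable_process M (Y i)"
    and cont: "\<And>i. L2_continuous M (Y i)"
    and P [measurable]: "P \<in> M \<rightarrow>\<^sub>M N"
    and ind: "prob_space.indep_set M (sigma_rv M N P) (sigma_process M (UNIV \<times> {0..}) (case_prod Y))"
    and F [measurable]: "(\<lambda>(p, s, x). F p s x) \<in> borel_measurable (N \<Otimes>\<^sub>M borel \<Otimes>\<^sub>M borel)"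
    and c [measurable]: "\<And>i. c i \<in> borel_measurable N" and c0: "\<And>i p. 0 \<le> c i p"
    and H [measurable]: "(\<lambda>(p, q). H p q) \<in> borel_measurable (N \<Otimes>\<^sub>M borel)"
    and H_bound: "\<And>p q. 0 \<le> H p q" "\<And>p q. H p q \<le> b"
  shows "(LINT \<omega>|M. H (P \<omega>) (\<integral>\<^sup>+s\<in>{0..}. F (P \<omega>) s (\<chi> i. Y i (c i (P \<omega>) * s) \<omega>) \<partial>lborel)) =
    (LINT p|distr M N P. LINT \<omega>|M. H p (\<integral>\<^sup>+s\<in>{0..}. F p s (\<chi> i. Y i (c i p * s) \<omega>) \<partial>lborel))"
proof -
  interpret prob_space M by fact
  interpret N: prob_space "distr M N P" by (rule prob_space_distr) simp
  define J where "J p \<omega> = (\<integral>\<^sup>+s\<in>{0..}. F p s (\<chi> i. Y i (c i p * s) \<omega>) \<partial>lborel)" for p \<omega>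
  have J: "(\<lambda>x. J (f x) (g x)) \<in> borel_measurable K"
    if "f \<in> K \<rightarrow>\<^sub>M N" "g \<in> K \<rightarrow>\<^sub>M M" for f g and K :: "'k measure"
    unfolding J_def by (rule borel_measurable_process_integral[OF Ym F c c0 that])
  have HJ [measurable]: "(\<lambda>x. H (f x) (J (f x) (g x))) \<in> borel_measurable K"
    if "f \<in> K \<rightarrow>\<^sub>M N" "g \<in> K \<rightarrow>\<^sub>M M" for f g and K :: "'k measure"
    using measurable_compose[OF measurable_Pair[OF that(1) J[OF that]] H] by simp
  have e: "(LINT \<omega>|M. H p (J p \<omega>)) = enn2real (\<integral>\<^sup>+\<omega>. ennreal (H p (J p \<omega>)) \<partial>M)" if "p \<in> space N" for p
    using that by (intro integral_eq_nn_integral) (auto simp: H_bound)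
  have fin: "(\<integral>\<^sup>+\<omega>. ennreal (H p (J p \<omega>)) \<partial>M) < \<infinity>" for p
  proof -
    have "(\<integral>\<^sup>+\<omega>. ennreal (H p (J p \<omega>)) \<partial>M) \<le> (\<integral>\<^sup>+\<omega>. ennreal b \<partial>M)"
      by (intro nn_integral_mono ennreal_leI H_bound)
    then show ?thesis by (simp add: emeasure_space_1 order_le_less_trans)
  qed
  have "(LINT \<omega>|M. H (P \<omega>) (J (P \<omega>) \<omega>)) = enn2real (\<integral>\<^sup>+\<omega>. ennreal (H (P \<omega>) (J (P \<omega>) \<omega>)) \<partial>M)"
    by (intro integral_eq_nn_integral) (auto simp: H_bound)
  also have "(\<integral>\<^sup>+\<omega>. ennreal (H (P \<omega>) (J (P \<omega>) \<omega>)) \<partial>M)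
      = (\<integral>\<^sup>+p. \<integral>\<^sup>+\<omega>. ennreal (H p (J p \<omega>)) \<partial>M \<partial>distr M N P)"
    unfolding J_def by (rule nn_integral_freeze[OF M Ym cont P ind F c c0]) simp
  also have "\<dots> = (\<integral>\<^sup>+p. ennreal (LINT \<omega>|M. H p (J p \<omega>)) \<partial>distr M N P)"
    using fin by (intro nn_integral_cong) (simp add: e)
  also have "enn2real \<dots> = (LINT p|distr M N P. LINT \<omega>|M. H p (J p \<omega>))"
  proof (rule integral_eq_nn_integral[symmetric])
    have "(\<lambda>p. LINT \<omega>|M. H p (J p \<omega>)) \<in> borel_measurable N"
      by (rule borel_measurable_lebesgue_integral) (simp add: split_beta')
    then show "(\<lambda>p. LINT \<omega>|M. H p (J p \<omega>)) \<in> borel_measurable (distr M N P)"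
      by simp
  qed (auto simp: H_bound)
  finally show ?thesis unfolding J_def .
qed

section \<open>Polar decomposition of the normal law\<close>

definition std_normal_vec :: "(real ^ 'm) measure" where
  "std_normal_vec = density lborel (\<lambda>x. ennreal (\<Prod>i\<in>UNIV. std_normal_density (x $ i)))"

lemma sets_std_normal_vec [measurable_cong]: "sets std_normal_vec = sets borel"
  by (simp add: std_normal_vec_def)

lemma nn_integral_lborel_vec_prod:
  fixes f :: "'m::finite \<Rightarrow> real \<Rightarrow> ennreal"
  assumes [measurable]: "\<And>i. f i \<in> borel_measurable borel"
  shows "(\<integral>\<^sup>+(x::real^'m). (\<Prod>i\<in>UNIV. f i (x $ i)) \<partial>lborel) = (\<Prod>i\<in>UNIV. \<integral>\<^sup>+t. f i t \<partial>lborel)"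
proof -
  define b :: "'m \<Rightarrow> real ^ 'm" where "b i = axis i 1" for i
  have inj: "inj b" by (auto simp: b_def inj_def axis_eq_axis)
  have B: "(Basis :: (real^'m) set) = range b" by (auto simp: Basis_vec_def b_def)
  have 1: "(\<Prod>i\<in>UNIV. f i (x $ i)) = (\<Prod>e\<in>Basis. f (inv b e) (x \<bullet> e))" for x :: "real^'m"
    unfolding B by (subst prod.reindex[OF inj]) (simp add: inv_f_f[OF inj] inner_axis b_def[symmetric], simp add: b_def inner_axis)
  show ?thesis
    unfolding 1 by (subst nn_integral_lborel_prod)
      (simp_all add: B prod.reindex[OF inj] inv_f_f[OF inj])
qed

text \<open>Open boxes generate the Borel sets and are stable under intersection; on a box,
  independence gives the product of one-dimensional integrals.\<close>

lemma (in prob_space) distr_std_normal_vec: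
  fixes G :: "'m::finite \<Rightarrow> 'a \<Rightarrow> real"
  assumes ind: "indep_vars (\<lambda>_. borel) G UNIV"
    and G: "\<And>i. distr M borel (G i) = std_normal_distribution"
  shows "distr M borel (\<lambda>\<omega>. \<chi> i. G i \<omega>) = std_normal_vec"
proof -
  have [measurable]: "G i \<in> borel_measurable M" for i using ind by (auto simp: indep_vars_def)
  have [measurable]: "(\<lambda>\<omega>. \<chi> i. G i \<omega>) \<in> borel_measurable M"
    by (subst borel_measurable_euclidean_space) (auto simp: Basis_vec_def inner_axis)
  interpret D: prob_space "distr M borel (\<lambda>\<omega>. \<chi> i. G i \<omega>)" by (rule prob_space_distr) simp
  show ?thesis
  proof (rule measure_eqI_generator_eq)
    let ?E = "range (\<lambda>(a, b). box a b :: (real^'m) set)"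
    show "Int_stable ?E" by (auto simp: Int_stable_def box_Int_box)
    show "?E \<subseteq> Pow UNIV" "sets (distr M borel (\<lambda>\<omega>. \<chi> i. G i \<omega>)) = sigma_sets UNIV ?E"
      "sets std_normal_vec = sigma_sets UNIV ?E"
      by (simp_all add: borel_eq_box std_normal_vec_def)
    let ?A = "\<lambda>n::nat. box (- (real n *\<^sub>R One)) (real n *\<^sub>R One) :: (real^'m) set"
    show "range ?A \<subseteq> ?E" "(\<Union>i. ?A i) = UNIV"
      unfolding UN_box_eq_UNIV by auto
    show "emeasure (distr M borel (\<lambda>\<omega>. \<chi> i. G i \<omega>)) (?A n) \<noteq> \<infinity>" for n by simp
    fix X assume "X \<in> ?E"
    then obtain a b :: "real^'m" where X: "X = box a b" by auto
    have "emeasure (distr M borel (\<lambda>\<omega>. \<chi> i. G i \<omega>)) X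
        = emeasure M (\<Inter>i\<in>UNIV. G i -` {a $ i <..< b $ i} \<inter> space M)"
      unfolding X by (subst emeasure_distr) (auto intro!: arg_cong2[where f=emeasure] simp: mem_box_cart)
    also have "\<dots> = ennreal (\<Prod>i\<in>UNIV. prob (G i -` {a $ i <..< b $ i} \<inter> space M))"
      unfolding emeasure_eq_measure by (subst indep_varsD[OF ind]) auto
    also have "\<dots> = (\<Prod>i\<in>UNIV. emeasure (distr M borel (G i)) {a $ i <..< b $ i})"
      by (subst prod_ennreal[symmetric]) (auto simp: emeasure_distr emeasure_eq_measure)
    also have "\<dots> = (\<Prod>i\<in>UNIV. \<integral>\<^sup>+t. ennreal (std_normal_density t) * indicator {a $ i <..< b $ i} t \<partial>lborel)"
      unfolding G by (simp add: emeasure_density)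
    also have "\<dots> = (\<integral>\<^sup>+x. (\<Prod>i\<in>UNIV. ennreal (std_normal_density (x $ i)) * indicator {a $ i <..< b $ i} (x $ i)) \<partial>lborel)"
      by (rule nn_integral_lborel_vec_prod[symmetric]) simp
    also have "\<dots> = (\<integral>\<^sup>+x. ennreal (\<Prod>i\<in>UNIV. std_normal_density (x $ i)) * indicator X x \<partial>lborel)"
    proof (intro nn_integral_cong)
      fix x :: "real^'m"
      have "(\<Prod>i\<in>UNIV. indicator {a $ i <..< b $ i} (x $ i)) = (indicator X x :: ennreal)"
        by (auto simp: X mem_box_cart indicator_def split: if_splits) (meson UNIV_I finite prod_zero)?
      then show "(\<Prod>i\<in>UNIV. ennreal (std_normal_density (x $ i)) * indicator {a $ i <..< b $ i} (x $ i))
          = ennreal (\<Prod>i\<in>UNIV. std_normal_density (x $ i)) * indicator X x"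
        by (simp add: prod.distrib prod_ennreal)
    qed
    also have "\<dots> = emeasure std_normal_vec X"
      unfolding std_normal_vec_def by (subst emeasure_density) (auto simp: X)
    finally show "emeasure (distr M borel (\<lambda>\<omega>. \<chi> i. G i \<omega>)) X = emeasure std_normal_vec X" .
  qed
qed

text \<open>The density is a function of the norm alone, which is what makes direction and radius
  independent.\<close>

lemma std_normal_vec_density:
  fixes x :: "real ^ 'm::finite"
  shows "(\<Prod>i\<in>UNIV. std_normal_density (x $ i)) = (1 / sqrt (2 * pi)) ^ CARD('m) * exp (- (norm x)\<^sup>2 / 2)"
proof -
  have "(norm x)\<^sup>2 = (\<Sum>i\<in>UNIV. (x $ i)\<^sup>2)"
    by (simp add: norm_vec_def L2_set_def sum_nonneg)
  then have "exp (- (norm x)\<^sup>2 / 2) = (\<Prod>i\<in>UNIV. exp (- (x $ i)\<^sup>2 / 2))"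
    by (simp add: sum_divide_distrib sum_negf flip: exp_sum)
  then show ?thesis
    unfolding std_normal_density_def prod.distrib by simp
qed

lemma sphere_map_measurable [measurable]:
  "(\<lambda>x::real^'m::finite. x /\<^sub>R norm x) \<in> borel_measurable borel"
  by measurable

lemma emeasure_unit_ball:
  "emeasure lborel (ball (0::real^'m::finite) 1) \<noteq> 0" "emeasure lborel (ball (0::real^'m) 1) \<noteq> \<infinity>"
  using less_imp_neq[OF unit_ball_vol_pos[of "real CARD('m)"]] by (auto simp: emeasure_ball)

lemma emeasure_uniform_sphere:
  assumes [measurable]: "B \<in> sets borel"
  shows "emeasure uniform_sphere B * emeasure lborel (ball (0::real^'m::finite) 1) =
    emeasure lborel {x::real^'m. norm x < 1 \<and> x /\<^sub>R norm x \<in> B}"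
proof -
  let ?b = "emeasure lborel (ball (0::real^'m) 1)"
  have b: "?b \<noteq> 0" "?b \<noteq> \<infinity>"
    using emeasure_unit_ball[where 'm='m] by auto
  have "emeasure uniform_sphere B = emeasure (uniform_measure lborel (ball (0::real^'m) 1)) {x. x /\<^sub>R norm x \<in> B}"
    unfolding uniform_sphere_def by (subst emeasure_distr) (auto simp: vimage_def)
  also have "\<dots> = emeasure lborel (ball 0 1 \<inter> {x::real^'m. x /\<^sub>R norm x \<in> B}) / ?b"
    by (subst emeasure_uniform_measure) auto
  also have "ball 0 1 \<inter> {x::real^'m. x /\<^sub>R norm x \<in> B} = {x. norm x < 1 \<and> x /\<^sub>R norm x \<in> B}"
    by auto
  finally show ?thesis
    using b mult_divide_eq_ennreal[of ?b 1] by (simp add: ennreal_divide_times)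
qed

text \<open>Scaling by \<open>r\<close> does not change directions and multiplies Lebesgue measure
  by the power \<open>r ^ CARD('m)\<close>.\<close>

lemma emeasure_cone:
  assumes [measurable]: "B \<in> sets borel" and r: "0 \<le> r"
  shows "emeasure lborel {x::real^'m::finite. norm x < r \<and> x /\<^sub>R norm x \<in> B} =
    ennreal (r ^ CARD('m)) * emeasure lborel {x::real^'m. norm x < 1 \<and> x /\<^sub>R norm x \<in> B}"
proof (cases "r = 0")
  case False
  with r have r: "0 < r" by simp
  have "emeasure lborel {x::real^'m. norm x < r \<and> x /\<^sub>R norm x \<in> B} =
      emeasure (density (distr lborel borel (\<lambda>x. 0 + r *\<^sub>R x)) (\<lambda>_. ennreal (\<bar>r\<bar> ^ DIM(real^'m))))
        {x. norm x < r \<and> x /\<^sub>R norm x \<in> B}"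
    using r by (subst lborel_affine[of r 0]) (auto simp: ennreal_power)
  also have "\<dots> = ennreal (r ^ CARD('m)) * emeasure (distr lborel borel (\<lambda>x. 0 + r *\<^sub>R x)) {x::real^'m. norm x < r \<and> x /\<^sub>R norm x \<in> B}"
    using r by (subst emeasure_density_const) auto
  also have "emeasure (distr lborel borel (\<lambda>x. 0 + r *\<^sub>R x)) {x::real^'m. norm x < r \<and> x /\<^sub>R norm x \<in> B}
      = emeasure lborel {x::real^'m. norm x < 1 \<and> x /\<^sub>R norm x \<in> B}"
  proof -
    have "inverse r * inverse (norm x) * r = inverse (norm x)" for x :: "real^'m"
      using r by simp
    then have "(r *\<^sub>R x) /\<^sub>R norm (r *\<^sub>R x) = x /\<^sub>R norm x" for x :: "real^'m"
      using r by simp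
    then show ?thesis
      using r by (subst emeasure_distr)
        (auto intro!: arg_cong2[where f=emeasure] simp del: scaleR_scaleR norm_scaleR,
         auto simp: divide_less_eq mult_less_cancel_left1)
  qed
  finally show ?thesis .
qed simp

lemma prob_space_uniform_sphere: "prob_space (uniform_sphere :: (real^'m::finite) measure)"
  unfolding uniform_sphere_def
  by (intro prob_space.prob_space_distr prob_space_uniform_measure)
    (use emeasure_unit_ball[where 'm='m] in auto)

lemma sets_uniform_sphere [measurable_cong]: "sets uniform_sphere = sets borel"
  by (simp add: uniform_sphere_def)

text \<open>Normalized so that the ball of radius \<open>r\<close> gets mass \<open>r ^ m\<close>;
  the volume of the unit ball is multiplied in afterwards.\<close>

definition radial_measure :: "nat \<Rightarrow> real measure" where
  "radial_measure m = density lborel (\<lambda>\<rho>. ennreal (real m * \<rho> ^ (m - 1)) * indicator {0..} \<rho>)"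

lemma sets_radial_measure [simp, measurable_cong]: "sets (radial_measure m) = sets borel"
  by (simp add: radial_measure_def)

lemma emeasure_radial_measure:
  assumes m: "0 < m"
  shows "emeasure (radial_measure m) {..<r} = ennreal (max 0 r ^ m)"
proof (cases "0 \<le> r")
  case True
  have "emeasure (radial_measure m) {..<r} =
      (\<integral>\<^sup>+\<rho>. ennreal (real m * \<rho> ^ (m - 1)) * indicator {0..r} \<rho> \<partial>lborel)"
    unfolding radial_measure_def
  proof (subst emeasure_density)
    show "(\<integral>\<^sup>+\<rho>. ennreal (real m * \<rho> ^ (m - 1)) * indicator {0..} \<rho> * indicator {..<r} \<rho> \<partial>lborel)
        = (\<integral>\<^sup>+\<rho>. ennreal (real m * \<rho> ^ (m - 1)) * indicator {0..r} \<rho> \<partial>lborel)"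
    proof (rule nn_integral_cong_AE, use AE_lborel_singleton[of r] in eventually_elim)
      fix \<rho> :: real assume "\<rho> \<noteq> r"
      then have "indicator {0..} \<rho> * indicator {..<r} \<rho> = (indicator {0..r} \<rho> :: ennreal)"
        by (auto simp: indicator_def)
      then show "ennreal (real m * \<rho> ^ (m - 1)) * indicator {0..} \<rho> * indicator {..<r} \<rho>
          = ennreal (real m * \<rho> ^ (m - 1)) * indicator {0..r} \<rho>"
        by (simp only: mult.assoc)
    qed
  qed auto
  also have "\<dots> = ennreal (r ^ m - 0 ^ m)"
    using True m by (intro nn_integral_FTC_Icc) (auto intro!: DERIV_pow[THEN DERIV_subset])
  finally show ?thesis using True m by simp
next
  case False
  then have "emeasure (radial_measure m) {..<r} = 0"
    unfolding radial_measure_def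
    by (subst emeasure_density) (auto simp: nn_integral_0_iff_AE indicator_def)
  then show ?thesis using False m by simp
qed

text \<open>A product measure is determined by rectangles. For a fixed set \<open>B\<close> of
  directions both sides are measures of the radius alone, and these are compared on initial segments
  through the volume of cones.\<close>

lemma polar_product:
  "density (radial_measure CARD('m)) (\<lambda>_. emeasure lborel (ball (0::real^'m::finite) 1)) \<Otimes>\<^sub>M uniform_sphere
    = distr lborel (borel \<Otimes>\<^sub>M borel) (\<lambda>x::real^'m. (norm x, x /\<^sub>R norm x))"
proof (rule pair_measure_eqI)
  let ?b = "emeasure lborel (ball (0::real^'m) 1)"
  let ?R = "density (radial_measure CARD('m)) (\<lambda>_. ?b)"
  obtain b where b: "?b = ennreal b"
    using emeasure_lborel_ball_finite[of "0::real^'m" 1] by (cases ?b) auto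
  show "sigma_finite_measure (uniform_sphere :: (real^'m) measure)"
    using prob_space_uniform_sphere by (rule prob_space_imp_sigma_finite)
  have Rlt: "emeasure ?R {..<r} = ?b * ennreal (max 0 r ^ CARD('m))" for r
    by (subst emeasure_density_const) (auto simp: emeasure_radial_measure)
  show "sigma_finite_measure ?R"
  proof (rule sigma_finite_measure.intro, intro exI conjI)
    show "countable (range (\<lambda>n::nat. {..<real n}))" "range (\<lambda>n::nat. {..<real n}) \<subseteq> sets ?R"
      by (auto simp: radial_measure_def)
    show "\<Union> (range (\<lambda>n::nat. {..<real n})) = space ?R"
      by (auto simp: radial_measure_def reals_Archimedean2)
    show "\<forall>a\<in>range (\<lambda>n::nat. {..<real n}). emeasure ?R a \<noteq> \<infinity>"
      using Rlt b by (auto simp: ennreal_mult_eq_top_iff)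
  qed
  fix A B assume "A \<in> sets ?R" "B \<in> sets (uniform_sphere :: (real^'m) measure)"
  then have A [measurable]: "A \<in> sets borel" and B [measurable]: "B \<in> sets borel"
    by (auto simp: radial_measure_def uniform_sphere_def)
  define C where "C = {x::real^'m. x /\<^sub>R norm x \<in> B}"
  have C [measurable]: "C \<in> sets borel" by (simp add: C_def)
  \<comment> \<open>Radii are negated because the uniqueness criterion used here asks for agreement
    and finiteness on the half lines \<open>{q<..}\<close>, while the radial masses are finite on
    \<open>{..<r}\<close>.\<close>
  define K where "K = distr (density lborel (indicator C)) borel (\<lambda>x::real^'m. - norm x)"
  define L where "L = density (distr ?R borel uminus) (\<lambda>_. emeasure uniform_sphere B)"
  interpret S: prob_space "uniform_sphere :: (real^'m) measure" by (rule prob_space_uniform_sphere)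
  have Rs [measurable_cong]: "sets ?R = sets borel" by (simp add: radial_measure_def)
  have K: "emeasure K X = emeasure lborel {x. - norm x \<in> X \<and> x /\<^sub>R norm x \<in> B}" if [measurable]: "X \<in> sets borel" for X
  proof -
    have [measurable]: "(\<lambda>x::real^'m. - norm x) -` X \<in> sets borel"
      using measurable_sets[of "\<lambda>x::real^'m. - norm x" borel borel X] that by simp
    have "emeasure K X = emeasure (density lborel (indicator C)) ((\<lambda>x. - norm x) -` X)"
      unfolding K_def by (subst emeasure_distr) auto
    also have "\<dots> = (\<integral>\<^sup>+x. indicator C x * indicator ((\<lambda>x. - norm x) -` X) x \<partial>lborel)"
      by (subst emeasure_density) auto
    also have "\<dots> = (\<integral>\<^sup>+x. indicator {x. - norm x \<in> X \<and> x /\<^sub>R norm x \<in> B} x \<partial>lborel)"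
      by (intro nn_integral_cong) (auto simp: indicator_def C_def)
    also have "\<dots> = emeasure lborel {x. - norm x \<in> X \<and> x /\<^sub>R norm x \<in> B}"
      by (rule nn_integral_indicator) measurable
    finally show ?thesis .
  qed
  have L: "emeasure L X = emeasure uniform_sphere B * emeasure ?R {\<rho>. - \<rho> \<in> X}" if [measurable]: "X \<in> sets borel" for X
    unfolding L_def
    by (subst emeasure_density_const, simp, subst emeasure_distr)
      (auto simp: vimage_def radial_measure_def)
  have "K = L"
  proof (rule measure_eqI_lessThan)
    show "sets K = sets borel" "sets L = sets borel" by (simp_all add: K_def L_def)
    fix q :: real
    show eq: "emeasure K {q<..} = emeasure L {q<..}"
    proof -
      have "emeasure K {q<..} = emeasure lborel {x::real^'m. norm x < max 0 (- q) \<and> x /\<^sub>R norm x \<in> B}"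
      proof -
        have "- norm x \<in> {q<..} \<longleftrightarrow> norm x < max 0 (- q)" for x :: "real^'m"
          using norm_ge_zero[of x] by (simp add: less_max_iff_disj) linarith
        then show ?thesis by (subst K) auto
      qed
      also have "\<dots> = ennreal (max 0 (- q) ^ CARD('m)) * (emeasure uniform_sphere B * ?b)"
        by (subst emeasure_cone) (auto simp: emeasure_uniform_sphere)
      also have "\<dots> = emeasure uniform_sphere B * emeasure ?R {..<- q}"
        unfolding Rlt by (simp add: mult_ac)
      also have "{..<- q} = {\<rho>. - \<rho> \<in> {q<..}}" by auto
      finally show ?thesis by (simp add: L)
    qed
    have "{\<rho>. - \<rho> \<in> {q<..}} = {..<- q}" by auto
    moreover have "emeasure ?R {..<- q} < \<infinity>"
      unfolding Rlt by (simp add: b ennreal_mult_less_top)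
    ultimately show "emeasure K {q<..} < \<infinity>"
      unfolding eq L[OF borel_open[OF open_greaterThan]] S.emeasure_eq_measure
      by (simp only: ennreal_mult_less_top infinity_ennreal_def) simp
  qed
  then have "emeasure K {\<rho>. - \<rho> \<in> A} = emeasure L {\<rho>. - \<rho> \<in> A}" by simp
  moreover have "emeasure (distr lborel (borel \<Otimes>\<^sub>M borel) (\<lambda>x::real^'m. (norm x, x /\<^sub>R norm x))) (A \<times> B)
      = emeasure lborel {x::real^'m. norm x \<in> A \<and> x /\<^sub>R norm x \<in> B}"
    by (subst emeasure_distr) (auto intro!: arg_cong2[where f=emeasure])
  ultimately show "emeasure ?R A * emeasure uniform_sphere B =
      emeasure (distr lborel (borel \<Otimes>\<^sub>M borel) (\<lambda>x::real^'m. (norm x, x /\<^sub>R norm x))) (A \<times> B)"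
    by (simp add: K L mult.commute)
qed (simp add: radial_measure_def uniform_sphere_def cong: sets_pair_measure_cong)

lemma nn_integral_std_normal_vec_polar:
  fixes g :: "real ^ 'm::finite \<Rightarrow> ennreal"
  assumes g [measurable]: "g \<in> borel_measurable borel"
  shows "(\<integral>\<^sup>+x. g x \<partial>std_normal_vec) =
    (\<integral>\<^sup>+o'. (\<integral>\<^sup>+\<rho>. emeasure lborel (ball (0::real^'m) 1) *
      ennreal (real CARD('m) * \<rho> ^ (CARD('m) - 1) * ((1 / sqrt (2 * pi)) ^ CARD('m) * exp (- \<rho>\<^sup>2 / 2))) *
      indicator {0..} \<rho> * g (\<rho> *\<^sub>R o') \<partial>lborel) \<partial>uniform_sphere)"
proof -
  let ?b = "emeasure lborel (ball (0::real^'m) 1)" and ?m = "CARD('m)"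
  let ?R = "density (radial_measure ?m) (\<lambda>_. ?b)"
  let ?d = "\<lambda>\<rho>. (1 / sqrt (2 * pi)) ^ ?m * exp (- \<rho>\<^sup>2 / 2)"
  let ?f = "\<lambda>q::real \<times> (real^'m). ennreal (?d (fst q)) * g (fst q *\<^sub>R snd q)"
  interpret S: prob_space "uniform_sphere :: (real^'m) measure" by (rule prob_space_uniform_sphere)
  obtain b where b: "?b = ennreal b"
    using emeasure_unit_ball(2)[where 'm='m] by (cases ?b) auto
  have R: "?R = density lborel (\<lambda>\<rho>. ennreal (real ?m * \<rho> ^ (?m - 1)) * indicator {0..} \<rho> * ?b)"
    unfolding radial_measure_def by (subst density_density_eq) auto
  have fin: "AE \<rho> in lborel. ennreal (real ?m * \<rho> ^ (?m - 1)) * indicator {0..} \<rho> * ?b \<noteq> \<infinity>"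
    by (auto simp: b ennreal_mult_eq_top_iff indicator_def)
  interpret R: sigma_finite_measure ?R
    unfolding R using fin by (subst sigma_finite_measure.sigma_finite_iff_density_finite[OF lborel.sigma_finite_measure_axioms]) auto
  interpret pair_sigma_finite ?R "uniform_sphere :: (real^'m) measure" by unfold_locales
  have [measurable_cong]: "sets (?R \<Otimes>\<^sub>M (uniform_sphere :: (real^'m) measure)) = sets (borel \<Otimes>\<^sub>M borel)"
    by (intro sets_pair_measure_cong) (simp_all add: uniform_sphere_def)
  have "(\<integral>\<^sup>+x. g x \<partial>std_normal_vec) = (\<integral>\<^sup>+x. ennreal (?d (norm x)) * g x \<partial>lborel)"
    unfolding std_normal_vec_def std_normal_vec_density by (rule nn_integral_density) measurable
  also have "\<dots> = (\<integral>\<^sup>+x. ?f (norm x, x /\<^sub>R norm x) \<partial>lborel)"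
  proof (rule nn_integral_cong_AE, use AE_lborel_singleton[of "0::real^'m"] in eventually_elim)
    fix x :: "real^'m" assume "x \<noteq> 0"
    then have "norm x *\<^sub>R (x /\<^sub>R norm x) = x" by simp
    then show "ennreal (?d (norm x)) * g x = ?f (norm x, x /\<^sub>R norm x)" by (simp only: fst_conv snd_conv)
  qed
  also have "\<dots> = (\<integral>\<^sup>+q. ?f q \<partial>distr lborel (borel \<Otimes>\<^sub>M borel) (\<lambda>x::real^'m. (norm x, x /\<^sub>R norm x)))"
    by (subst nn_integral_distr) auto
  also have "\<dots> = (\<integral>\<^sup>+o'. \<integral>\<^sup>+\<rho>. ?f (\<rho>, o') \<partial>?R \<partial>uniform_sphere)"
    unfolding polar_product[symmetric]
    by (rule nn_integral_snd[symmetric]) measurable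
  also have "\<dots> = (\<integral>\<^sup>+o'. (\<integral>\<^sup>+\<rho>. ?b *
      ennreal (real ?m * \<rho> ^ (?m - 1) * ?d \<rho>) * indicator {0..} \<rho> * g (\<rho> *\<^sub>R o') \<partial>lborel) \<partial>uniform_sphere)"
    unfolding R
  proof (intro nn_integral_cong, subst nn_integral_density)
    fix o' :: "real^'m"
    show "(\<integral>\<^sup>+\<rho>. ennreal (real ?m * \<rho> ^ (?m - 1)) * indicator {0..} \<rho> * ?b * ?f (\<rho>, o') \<partial>lborel) =
      (\<integral>\<^sup>+\<rho>. ?b * ennreal (real ?m * \<rho> ^ (?m - 1) * ?d \<rho>) * indicator {0..} \<rho> * g (\<rho> *\<^sub>R o') \<partial>lborel)"
      by (intro nn_integral_cong) (auto simp: indicator_def ennreal_mult mult_ac)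
  qed auto
  finally show ?thesis .
qed

text \<open>The density of \<open>z\<close>, up to a factor depending only on \<open>v\<close> and
  \<open>m\<close>, when a radius \<open>sqrt v + z / sqrt v\<close> above \<open>sqrt v\<close> is
  drawn from the normal law: the power comes from the surface factor, the exponential from the
  Gaussian density.\<close>

definition excess_weight :: "nat \<Rightarrow> real \<Rightarrow> real \<Rightarrow> real" where
  "excess_weight m v z = indicator {0<..} z * (1 + z / v) ^ (m - 1) * exp (- z - z\<^sup>2 / (2 * v))"

lemma excess_weight_measurable [measurable]: "excess_weight m v \<in> borel_measurable borel"
  unfolding excess_weight_def by measurable

lemma excess_weight_nonneg: "0 < v \<Longrightarrow> 0 \<le> excess_weight m v z"
  by (auto simp: excess_weight_def indicator_def)

text \<open>
  The substitution \<open>\<rho> = \<surd>v + z / \<surd>v\<close> is affine and gives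
  \<open>\<rho>\<^sup>2 = v + 2 z + z\<^sup>2 / v\<close>, so that \<open>z\<close> is asymptotically exponential.
\<close>

lemma integral_std_normal_vec_tail:
  assumes v: "0 < v"
  shows "\<exists>\<kappa>>0. \<forall>g :: real ^ 'm::finite \<Rightarrow> real. g \<in> borel_measurable borel \<longrightarrow> (\<forall>x. 0 \<le> g x) \<longrightarrow>
      (LINT x|std_normal_vec. indicator {v<..} ((norm x)\<^sup>2) * g x) =
      \<kappa> * (LINT q|(uniform_sphere \<Otimes>\<^sub>M lborel). excess_weight CARD('m) v (snd q) *
        g ((sqrt v + snd q / sqrt v) *\<^sub>R fst q))"
proof -
  let ?b = "emeasure lborel (ball (0::real^'m) 1)" and ?m = "CARD('m)" and ?s = "sqrt v"
  interpret S: prob_space "uniform_sphere :: (real^'m) measure" by (rule prob_space_uniform_sphere)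
  interpret pair_sigma_finite "uniform_sphere :: (real^'m) measure" "lborel :: real measure" by unfold_locales
  have [measurable_cong]: "sets ((uniform_sphere :: (real^'m) measure) \<Otimes>\<^sub>M (lborel :: real measure)) = sets (borel \<Otimes>\<^sub>M borel)"
    by (intro sets_pair_measure_cong) (simp_all add: uniform_sphere_def)
  obtain b where b: "?b = ennreal b" "0 < b"
    using emeasure_unit_ball[where 'm='m] by (cases ?b) (auto simp: less_le)
  have s: "0 < ?s" "?s\<^sup>2 = v" using v by auto
  \<comment> \<open>Everything that does not involve \<open>z\<close>: volume of the unit ball,
    surface factor and Gaussian constant at radius \<open>?s\<close>, and the Jacobian
    \<open>1 / ?s\<close>. Its value is irrelevant later, since it cancels in quotients.\<close>
  define \<kappa> where "\<kappa> = b * (real ?m * (1 / sqrt (2 * pi)) ^ ?m * exp (- v / 2) * ?s ^ (?m - 1)) / ?s"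
  have \<kappa>: "0 < \<kappa>" unfolding \<kappa>_def using b s by (intro divide_pos_pos mult_pos_pos) auto
  show ?thesis
  proof (intro exI conjI allI impI, rule \<kappa>)
    fix g :: "real ^ 'm \<Rightarrow> real"
    assume g [measurable]: "g \<in> borel_measurable borel" and "\<forall>x. 0 \<le> g x"
    then have g0: "\<And>x. 0 \<le> g x" by simp
    let ?I = "\<integral>\<^sup>+q. ennreal (excess_weight ?m v (snd q) * g ((?s + snd q / ?s) *\<^sub>R fst q)) \<partial>(uniform_sphere \<Otimes>\<^sub>M lborel)"
    have "AE o' in (uniform_sphere :: (real^'m) measure). norm o' = 1"
    proof -
      have "AE x in uniform_measure lborel (ball (0::real^'m) 1). x \<noteq> 0"
        by (rule AE_uniform_measureI) (use AE_lborel_singleton[of "0::real^'m"] in auto)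
      then show ?thesis
        unfolding uniform_sphere_def by (subst AE_distr_iff) auto
    qed
    then have "(\<integral>\<^sup>+x. ennreal (indicator {v<..} ((norm x)\<^sup>2) * g x) \<partial>std_normal_vec) =
      (\<integral>\<^sup>+o'. ennreal \<kappa> * (\<integral>\<^sup>+z. ennreal (excess_weight ?m v z * g ((?s + z / ?s) *\<^sub>R o')) \<partial>lborel) \<partial>uniform_sphere)"
    proof (subst nn_integral_std_normal_vec_polar, simp, intro nn_integral_cong_AE, eventually_elim)
      fix o' :: "real^'m" assume o': "norm o' = 1"
      let ?h = "\<lambda>\<rho>. ?b * ennreal (real ?m * \<rho> ^ (?m - 1) * ((1 / sqrt (2 * pi)) ^ ?m * exp (- \<rho>\<^sup>2 / 2))) *
        indicator {0..} \<rho> * ennreal (indicator {v<..} ((norm (\<rho> *\<^sub>R o'))\<^sup>2) * g (\<rho> *\<^sub>R o'))"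
      have eq: "ennreal (1 / ?s) * ?h (?s + (1 / ?s) * z) = ennreal \<kappa> * ennreal (excess_weight ?m v z * g ((?s + z / ?s) *\<^sub>R o'))" for z
      proof -
        have sq: "(?s + z / ?s)\<^sup>2 = v + 2 * z + z\<^sup>2 / v"
          using s v by (simp add: power2_sum power_divide)
        \<comment> \<open>The restriction to nonnegative radii removes the second branch of
          \<open>v < \<rho>\<^sup>2\<close>, leaving exactly \<open>z > 0\<close>.\<close>
        have iff: "0 \<le> ?s + z / ?s \<and> v < (?s + z / ?s)\<^sup>2 \<longleftrightarrow> 0 < z"
        proof
          assume *: "0 \<le> ?s + z / ?s \<and> v < (?s + z / ?s)\<^sup>2"
          then have "?s < ?s + z / ?s" using s by (metis power2_less_imp_less)
          then show "0 < z" using s by (simp add: zero_less_divide_iff)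
        next
          assume "0 < z"
          then show "0 \<le> ?s + z / ?s \<and> v < (?s + z / ?s)\<^sup>2" using s v by (simp add: sq add_pos_pos)
        qed
        show ?thesis
        proof (cases "0 < z")
          case True
          have fac: "?s + z / ?s = ?s * (1 + z / v)" using s v by (simp add: field_simps power2_eq_square)
          have ex: "exp (- (?s + z / ?s)\<^sup>2 / 2) = exp (- v / 2) * exp (- z - z\<^sup>2 / (2 * v))"
            unfolding sq exp_add[symmetric] using v by (simp add: field_simps)
          have mult: "ennreal a * (ennreal b * ennreal p * 1 * ennreal c) = ennreal (a * (b * p * c))"
            if "0 \<le> a" "0 \<le> b" "0 \<le> p" "0 \<le> c" for a b p c :: real
            using that by (simp add: ennreal_mult mult.assoc)
          have "?h (?s + (1 / ?s) * z) = ennreal b *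
              ennreal (real ?m * (?s + z / ?s) ^ (?m - 1) * ((1 / sqrt (2 * pi)) ^ ?m * exp (- (?s + z / ?s)\<^sup>2 / 2))) *
              1 * ennreal (g ((?s + z / ?s) *\<^sub>R o'))"
            using True iff o' b by (simp add: indicator_def)
          then have "ennreal (1 / ?s) * ?h (?s + (1 / ?s) * z) =
            ennreal ((1 / ?s) * (b * (real ?m * (?s + z / ?s) ^ (?m - 1) * ((1 / sqrt (2 * pi)) ^ ?m * exp (- (?s + z / ?s)\<^sup>2 / 2))) *
              g ((?s + z / ?s) *\<^sub>R o')))"
            using True iff s b g0
            by (simp only:) (intro mult mult_nonneg_nonneg zero_le_power divide_nonneg_nonneg, auto)
          also have "\<dots> = ennreal (\<kappa> * (excess_weight ?m v z * g ((?s + z / ?s) *\<^sub>R o')))"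
            unfolding ex unfolding fac power_mult_distrib \<kappa>_def excess_weight_def
            using True by (simp add: mult_ac)
          also have "\<dots> = ennreal \<kappa> * ennreal (excess_weight ?m v z * g ((?s + z / ?s) *\<^sub>R o'))"
            using \<kappa> g0 v by (intro ennreal_mult mult_nonneg_nonneg excess_weight_nonneg) auto
          finally show ?thesis .
        next
          case False
          then have "\<not> (0 \<le> ?s + z / ?s \<and> v < (?s + z / ?s)\<^sup>2)" using iff by simp
          then show ?thesis using False o' by (auto simp: excess_weight_def)
        qed
      qed
      have "(\<integral>\<^sup>+\<rho>. ?h \<rho> \<partial>lborel) = ennreal \<bar>1 / ?s\<bar> * (\<integral>\<^sup>+z. ?h (?s + (1 / ?s) * z) \<partial>lborel)"
        using s by (intro nn_integral_real_affine) auto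
      also have "\<dots> = (\<integral>\<^sup>+z. ennreal (1 / ?s) * ?h (?s + (1 / ?s) * z) \<partial>lborel)"
        using s by (subst nn_integral_cmult) auto
      also have "\<dots> = ennreal \<kappa> * (\<integral>\<^sup>+z. ennreal (excess_weight ?m v z * g ((?s + z / ?s) *\<^sub>R o')) \<partial>lborel)"
        unfolding eq by (rule nn_integral_cmult) auto
      finally show "(\<integral>\<^sup>+\<rho>. ?h \<rho> \<partial>lborel) = ennreal \<kappa> * (\<integral>\<^sup>+z. ennreal (excess_weight ?m v z * g ((?s + z / ?s) *\<^sub>R o')) \<partial>lborel)" .
    qed
    also have "\<dots> = ennreal \<kappa> * (\<integral>\<^sup>+o'. \<integral>\<^sup>+z. ennreal (excess_weight ?m v z * g ((?s + z / ?s) *\<^sub>R o')) \<partial>lborel \<partial>uniform_sphere)"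
      by (rule nn_integral_cmult) measurable
    also have "(\<integral>\<^sup>+o'. \<integral>\<^sup>+z. ennreal (excess_weight ?m v z * g ((?s + z / ?s) *\<^sub>R o')) \<partial>lborel \<partial>uniform_sphere) = ?I"
      by (subst lborel.nn_integral_fst[symmetric]) auto
    finally have main: "(\<integral>\<^sup>+x. ennreal (indicator {v<..} ((norm x)\<^sup>2) * g x) \<partial>std_normal_vec) = ennreal \<kappa> * ?I" .
    have "(LINT x|std_normal_vec. indicator {v<..} ((norm x)\<^sup>2) * g x)
        = enn2real (\<integral>\<^sup>+x. ennreal (indicator {v<..} ((norm x)\<^sup>2) * g x) \<partial>std_normal_vec)"
      using g0 by (intro integral_eq_nn_integral) auto
    also have "\<dots> = \<kappa> * enn2real ?I"
      unfolding main using \<kappa> by (simp add: enn2real_mult)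
    also have "enn2real ?I = (LINT q|(uniform_sphere \<Otimes>\<^sub>M lborel). excess_weight ?m v (snd q) * g ((?s + snd q / ?s) *\<^sub>R fst q))"
      using g0 v by (intro integral_eq_nn_integral[symmetric]) (auto simp: excess_weight_nonneg)
    finally show "(LINT x|std_normal_vec. indicator {v<..} ((norm x)\<^sup>2) * g x) =
      \<kappa> * (LINT q|(uniform_sphere \<Otimes>\<^sub>M lborel). excess_weight ?m v (snd q) * g ((?s + snd q / ?s) *\<^sub>R fst q))" .
  qed
qed

lemma integrable_power_exp:
  "integrable lborel (\<lambda>z::real. indicator {0..} z * ((1 + z) ^ k * exp (- z)))"
proof -
  have m: "integrable lborel (\<lambda>z::real. indicator {0..} z * (z ^ j * exp (- z)))" for j :: nat
  proof (rule integrableI_bounded)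
    have "(\<integral>\<^sup>+(z::real). ennreal (norm (indicator {0..} z * (z ^ j * exp (- z)))) \<partial>lborel)
        = (\<integral>\<^sup>+z. ennreal (z ^ j * exp (- z)) * indicator {0..} z \<partial>lborel)"
      by (intro nn_integral_cong) (auto simp: indicator_def)
    also have "\<dots> < \<infinity>" unfolding nn_intergal_power_times_exp_Ici by simp
    finally show "(\<integral>\<^sup>+(z::real). ennreal (norm (indicator {0..} z * (z ^ j * exp (- z)))) \<partial>lborel) < \<infinity>" .
  qed measurable
  have "(\<lambda>z::real. indicator {0..} z * ((1 + z) ^ k * exp (- z)))
      = (\<lambda>z. \<Sum>j\<le>k. real (k choose j) * (indicator {0..} z * (z ^ j * exp (- z))))"
    by (subst add.commute, subst binomial_ring) (simp add: sum_distrib_left sum_distrib_right mult_ac)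
  then show ?thesis by (simp add: m)
qed

text \<open>In the quotient the constant of the polar tail formula cancels. For
  \<open>v \<ge> 1\<close> the weights are dominated by \<open>(1 + z) ^ (m - 1) * exp (- z)\<close>
  and converge to the exponential density, so numerator and denominator converge separately.\<close>

lemma std_normal_vec_tail_limit:
  fixes g :: "nat \<Rightarrow> real ^ 'm::finite \<Rightarrow> real" and G :: "(real ^ 'm) \<times> real \<Rightarrow> real"
  assumes v: "\<And>n. 1 \<le> v n" "filterlim v at_top sequentially"
    and g [measurable]: "\<And>n. g n \<in> borel_measurable borel"
    and G [measurable]: "G \<in> borel_measurable (borel \<Otimes>\<^sub>M borel)"
    and g01: "\<And>n x. 0 \<le> g n x" "\<And>n x. g n x \<le> 1"
    and lim: "AE q in (uniform_sphere \<Otimes>\<^sub>M lborel). 0 < snd q \<longrightarrow>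
      (\<lambda>n. g n ((sqrt (v n) + snd q / sqrt (v n)) *\<^sub>R fst q)) \<longlonglongrightarrow> G q"
  shows "(\<lambda>n. (LINT x|std_normal_vec. indicator {v n<..} ((norm x)\<^sup>2) * g n x) /
      (LINT x|(std_normal_vec :: (real ^ 'm) measure). indicator {v n<..} ((norm x)\<^sup>2)))
    \<longlonglongrightarrow> (LINT q|(uniform_sphere \<Otimes>\<^sub>M density lborel (exponential_density 1)). G q)"
proof -
  let ?U = "uniform_sphere :: (real^'m) measure" and ?m = "CARD('m)"
  let ?w = "\<lambda>n q. excess_weight ?m (v n) (snd q)"
  let ?x = "\<lambda>n q::(real^'m) \<times> real. (sqrt (v n) + snd q / sqrt (v n)) *\<^sub>R fst q"
  let ?e = "\<lambda>q::(real^'m) \<times> real. exponential_density 1 (snd q)"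
  interpret S: prob_space ?U by (rule prob_space_uniform_sphere)
  interpret pair_sigma_finite ?U "lborel :: real measure" by unfold_locales
  have [measurable_cong]: "sets (?U \<Otimes>\<^sub>M (lborel :: real measure)) = sets (borel \<Otimes>\<^sub>M borel)"
    by (intro sets_pair_measure_cong) (simp_all add: uniform_sphere_def)
  have v0: "0 < v n" for n using v(1)[of n] by linarith
  \<comment> \<open>At \<open>z = 0\<close> the weights are 0 while the exponential density is 1, so
    this null set has to be excluded.\<close>
  have nz: "AE q in (?U \<Otimes>\<^sub>M lborel). snd q \<noteq> (0::real)"
  proof (rule AE_pair_measure)
    show "{q \<in> space (?U \<Otimes>\<^sub>M lborel). snd q \<noteq> (0::real)} \<in> sets (?U \<Otimes>\<^sub>M lborel)"
      by measurable
  qed (simp add: AE_lborel_singleton)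
  have main: "(\<lambda>n. LINT q|(?U \<Otimes>\<^sub>M lborel). ?w n q * f n (?x n q)) \<longlonglongrightarrow> (LINT q|(?U \<Otimes>\<^sub>M lborel). ?e q * F q)"
    if [measurable]: "\<And>n. f n \<in> borel_measurable borel" "F \<in> borel_measurable (borel \<Otimes>\<^sub>M borel)"
      and f: "\<And>n x. 0 \<le> f n x" "\<And>n x. f n x \<le> 1"
      and l: "AE q in (?U \<Otimes>\<^sub>M lborel). 0 < snd q \<longrightarrow> (\<lambda>n. f n (?x n q)) \<longlonglongrightarrow> F q" for f F
  proof (rule integral_dominated_convergence)
    let ?b = "\<lambda>z::real. indicator {0..} z * ((1 + z) ^ (?m - 1) * exp (- z))"
    show "integrable (?U \<Otimes>\<^sub>M lborel) (\<lambda>q. ?b (snd q))"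
      using integrable_power_exp[of "?m - 1"]
      by (intro Fubini_integrable) auto
    show "AE q in (?U \<Otimes>\<^sub>M lborel). norm (?w n q * f n (?x n q)) \<le> ?b (snd q)" for n
    proof (rule AE_I2)
      fix q :: "(real^'m) \<times> real"
      have "excess_weight ?m (v n) z \<le> ?b z" for z
      proof (cases "0 < z")
        case True
        have "1 + z / v n \<le> 1 + z" using True v(1)[of n] v0[of n] by (simp add: field_simps)
        then have "(1 + z / v n) ^ (?m - 1) \<le> (1 + z) ^ (?m - 1)"
          using True v0[of n] by (intro power_mono) auto
        moreover have "exp (- z - z\<^sup>2 / (2 * v n)) \<le> exp (- z)" using v0[of n] by simp
        ultimately show ?thesis
          using True v0[of n] by (simp add: excess_weight_def mult_mono)
      qed (auto simp: excess_weight_def indicator_def)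
      then have "?w n q * f n (?x n q) \<le> ?b (snd q) * 1"
        using f v0[of n] by (intro mult_mono excess_weight_nonneg) (auto simp: indicator_def)
      then show "norm (?w n q * f n (?x n q)) \<le> ?b (snd q)"
        using f v0[of n] by (simp add: abs_mult excess_weight_nonneg)
    qed
    show "AE q in (?U \<Otimes>\<^sub>M lborel). (\<lambda>n. ?w n q * f n (?x n q)) \<longlonglongrightarrow> ?e q * F q"
      using l nz
    proof eventually_elim
      fix q :: "(real^'m) \<times> real"
      assume q: "0 < snd q \<longrightarrow> (\<lambda>n. f n (?x n q)) \<longlonglongrightarrow> F q" "snd q \<noteq> 0"
      show "(\<lambda>n. ?w n q * f n (?x n q)) \<longlonglongrightarrow> ?e q * F q"
      proof (cases "0 < snd q")
        case True
        have i: "(\<lambda>n. a / v n) \<longlonglongrightarrow> 0" for a :: real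
          by (rule real_tendsto_divide_at_top[OF tendsto_const v(2)])
        have "(\<lambda>n. (1 + snd q / v n) ^ (?m - 1) * exp (- snd q - ((snd q)\<^sup>2 / 2) / v n))
            \<longlonglongrightarrow> (1 + 0) ^ (?m - 1) * exp (- snd q - 0)"
          by (intro tendsto_intros i)
        then have "(\<lambda>n. ?w n q) \<longlonglongrightarrow> ?e q"
          using True by (simp add: excess_weight_def exponential_density_def)
        with q(1) True show ?thesis by (intro tendsto_mult) auto
      next
        case False
        with q(2) show ?thesis by (simp add: excess_weight_def exponential_density_def)
      qed
    qed
  qed measurable
  have Exp: "(LINT q|(?U \<Otimes>\<^sub>M density lborel (exponential_density 1)). F q) = (LINT q|(?U \<Otimes>\<^sub>M lborel). ?e q * F q)"
    if [measurable]: "F \<in> borel_measurable (borel \<Otimes>\<^sub>M borel)" for F :: "(real^'m) \<times> real \<Rightarrow> real"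
  proof -
    have "prob_space (density lborel (exponential_density 1))"
      by (rule prob_space_exponential_density) simp
    then have "?U \<Otimes>\<^sub>M density lborel (exponential_density 1) = density ?U (\<lambda>_. 1) \<Otimes>\<^sub>M density lborel (exponential_density 1)"
      by (simp add: density_1)
    also have "\<dots> = density (?U \<Otimes>\<^sub>M lborel) (\<lambda>(x, y). 1 * ennreal (exponential_density 1 y))"
      using \<open>prob_space (density lborel (exponential_density 1))\<close>
      by (intro pair_measure_density) (auto intro: prob_space_imp_sigma_finite lborel.sigma_finite_measure_axioms)
    finally have e: "?U \<Otimes>\<^sub>M density lborel (exponential_density 1) = density (?U \<Otimes>\<^sub>M lborel) (\<lambda>q. ennreal (?e q))"
      by (simp add: split_beta')
    show ?thesis
      unfolding e by (subst integral_density) (auto simp: exponential_density_nonneg)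
  qed
  have one: "(LINT q|(?U \<Otimes>\<^sub>M lborel). ?e q * 1) = 1"
  proof -
    interpret E: prob_space "density lborel (exponential_density 1)"
      by (rule prob_space_exponential_density) simp
    interpret P: pair_prob_space ?U "density lborel (exponential_density 1)" by unfold_locales
    show ?thesis using Exp[of "\<lambda>_. 1"] P.prob_space by simp
  qed
  have a: "(\<lambda>n. LINT q|(?U \<Otimes>\<^sub>M lborel). ?w n q * g n (?x n q)) \<longlonglongrightarrow> (LINT q|(?U \<Otimes>\<^sub>M lborel). ?e q * G q)"
    by (rule main[OF g G g01 lim])
  have b: "(\<lambda>n. LINT q|(?U \<Otimes>\<^sub>M lborel). ?w n q * 1) \<longlonglongrightarrow> 1"
  proof -
    have "(\<lambda>n. LINT q|(?U \<Otimes>\<^sub>M lborel). ?w n q * 1) \<longlonglongrightarrow> (LINT q|(?U \<Otimes>\<^sub>M lborel). ?e q * 1)"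
      by (rule main[of "\<lambda>_ _. 1" "\<lambda>_. 1"]) simp_all
    then show ?thesis unfolding one .
  qed
  have "(LINT x|std_normal_vec. indicator {v n<..} ((norm x)\<^sup>2) * g n x) /
      (LINT x|(std_normal_vec :: (real ^ 'm) measure). indicator {v n<..} ((norm x)\<^sup>2)) =
    (LINT q|(?U \<Otimes>\<^sub>M lborel). ?w n q * g n (?x n q)) / (LINT q|(?U \<Otimes>\<^sub>M lborel). ?w n q * 1)" for n
  proof -
    obtain \<kappa> where \<kappa>: "0 < \<kappa>"
      and e: "\<forall>g :: real ^ 'm \<Rightarrow> real. g \<in> borel_measurable borel \<longrightarrow> (\<forall>x. 0 \<le> g x) \<longrightarrow>
        (LINT x|std_normal_vec. indicator {v n<..} ((norm x)\<^sup>2) * g x) =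
        \<kappa> * (LINT q|(?U \<Otimes>\<^sub>M lborel). ?w n q * g (?x n q))"
      using integral_std_normal_vec_tail[where 'm='m, OF v0[of n]] by (elim exE conjE)
    show ?thesis
      using e[rule_format, of "g n", OF g g01(1)] e[rule_format, of "\<lambda>_. 1"] \<kappa> by simp
  qed
  then show ?thesis
    unfolding Exp[OF G] using tendsto_divide[OF a b] by simp
qed

section \<open>Convergence of occupation times\<close>

definition occupation :: "(real \<Rightarrow> 'a \<Rightarrow> real) \<Rightarrow> real \<Rightarrow> 'a \<Rightarrow> real" where
  "occupation D T \<omega> = (LINT w|lborel. indicator {0..T} w * indicator {0<..} (D w \<omega>))"

context prob_space begin

context
  fixes D :: "real \<Rightarrow> 'a \<Rightarrow> real" and T :: real
  assumes D [measurable]: "(\<lambda>(w, \<omega>). D w \<omega>) \<in> borel_measurable (borel \<Otimes>\<^sub>M M)"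
    and T: "0 \<le> T"
begin

lemma D_comp:
  "f \<in> borel_measurable K \<Longrightarrow> g \<in> K \<rightarrow>\<^sub>M M \<Longrightarrow> (\<lambda>x. D (f x) (g x)) \<in> borel_measurable K"
  using measurable_compose[OF measurable_Pair[of f K borel g M] D] by simp

lemma occupation_integrable:
  assumes "\<omega> \<in> space M"
  shows "integrable lborel (\<lambda>w. indicator {0..T} w * indicator {0<..} (D w \<omega>) :: real)"
proof (rule Bochner_Integration.integrable_bound)
  show "integrable lborel (indicator {0..T} :: real \<Rightarrow> real)" using T by (intro integrable_real_indicator) auto
  have [measurable]: "(\<lambda>w. D w \<omega>) \<in> borel_measurable lborel"
    by (rule D_comp) (use assms in auto)
  show "(\<lambda>w. indicator {0..T} w * indicator {0<..} (D w \<omega>) :: real) \<in> borel_measurable lborel"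
    by measurable
qed (auto simp: indicator_def)

lemma occupation_measurable: "occupation D T \<in> borel_measurable M"
proof -
  note [measurable] = D_comp
  show ?thesis unfolding occupation_def by measurable
qed

lemma occupation_bounds: "0 \<le> occupation D T \<omega>" "\<omega> \<in> space M \<Longrightarrow> occupation D T \<omega> \<le> T"
proof -
  show "0 \<le> occupation D T \<omega>" unfolding occupation_def by (auto simp: indicator_def)
  assume \<omega>: "\<omega> \<in> space M"
  have "occupation D T \<omega> \<le> (LINT w|lborel. indicator {0..T} w)"
    unfolding occupation_def
    by (intro integral_mono occupation_integrable \<omega> integrable_real_indicator)
      (auto simp: indicator_def T)
  then show "occupation D T \<omega> \<le> T" using T by simp
qed

text \<open>One factor of the power is written as a time integral and exchanged with the
  expectation; its indicator joins the product. Since indicators are idempotent,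
  \<open>insert w J\<close> is right even for \<open>w \<in> J\<close>. Iterating expresses moments
  through finite-dimensional probabilities without forming multiple product measures.\<close>

lemma occupation_moment_Suc:
  assumes J: "finite J"
  shows "expectation (\<lambda>\<omega>. occupation D T \<omega> ^ Suc k * (\<Prod>w\<in>J. indicator {0<..} (D w \<omega>))) =
    (LINT w|lborel. indicator {0..T} w *
      expectation (\<lambda>\<omega>. occupation D T \<omega> ^ k * (\<Prod>w\<in>insert w J. indicator {0<..} (D w \<omega>))))"
proof -
  interpret pair_sigma_finite M lborel by unfold_locales
  note [measurable] = D_comp occupation_measurable
  let ?f = "\<lambda>\<omega> w. indicator {0..T} w * (occupation D T \<omega> ^ k * (\<Prod>w\<in>insert w J. indicator {0<..} (D w \<omega>))) :: real"
  have ins: "(\<Prod>w\<in>insert w J. indicator {0<..} (D w \<omega>)) =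
      (indicator {0<..} (D w \<omega>) * (\<Prod>w\<in>J. indicator {0<..} (D w \<omega>)) :: real)" for w \<omega>
    using J by (cases "w \<in> J") (auto simp: insert_absorb indicator_def prod.remove)
  have m: "(\<lambda>(\<omega>, w). ?f \<omega> w) \<in> borel_measurable (M \<Otimes>\<^sub>M lborel)"
    unfolding ins by measurable
  have le: "\<bar>\<Prod>w\<in>J. indicator {0<..} (D w \<omega>)\<bar> \<le> (1::real)" for J \<omega>
    unfolding abs_prod by (intro prod_le_1) (auto simp: indicator_def)
  have int: "integrable (M \<Otimes>\<^sub>M lborel) (\<lambda>(\<omega>, w). ?f \<omega> w)"
  proof (rule Bochner_Integration.integrable_bound)
    show "integrable (M \<Otimes>\<^sub>M lborel) (\<lambda>q. indicator {0..T} (snd q) * T ^ k)"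
    proof (rule Fubini_integrable)
      show "(\<lambda>q. indicator {0..T} (snd q) * T ^ k) \<in> borel_measurable (M \<Otimes>\<^sub>M lborel)" by measurable
    qed (auto simp: T)
    show "(\<lambda>(\<omega>, w). ?f \<omega> w) \<in> borel_measurable (M \<Otimes>\<^sub>M lborel)" by (rule m)
    show "AE q in M \<Otimes>\<^sub>M lborel. norm (case q of (\<omega>, w) \<Rightarrow> ?f \<omega> w) \<le> norm (indicator {0..T} (snd q) * T ^ k)"
    proof (rule AE_I2)
      fix q :: "'a \<times> real" assume "q \<in> space (M \<Otimes>\<^sub>M lborel)"
      then have q: "fst q \<in> space M" by (auto simp: space_pair_measure)
      have "occupation D T (fst q) ^ k * \<bar>\<Prod>w\<in>insert (snd q) J. indicator {0<..} (D w (fst q))\<bar> \<le> T ^ k * 1"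
        using occupation_bounds q T by (intro mult_mono power_mono le) auto
      then show "norm (case q of (\<omega>, w) \<Rightarrow> ?f \<omega> w) \<le> norm (indicator {0..T} (snd q) * T ^ k)"
        using T occupation_bounds(1) by (simp add: split_beta' abs_mult indicator_def)
    qed
  qed
  have "expectation (\<lambda>\<omega>. occupation D T \<omega> ^ Suc k * (\<Prod>w\<in>J. indicator {0<..} (D w \<omega>)))
      = expectation (\<lambda>\<omega>. LINT w|lborel. ?f \<omega> w)"
  proof (rule Bochner_Integration.integral_cong[OF refl])
    fix \<omega> assume "\<omega> \<in> space M"
    have "(LINT w|lborel. ?f \<omega> w) = (LINT w|lborel. (occupation D T \<omega> ^ k * (\<Prod>w\<in>J. indicator {0<..} (D w \<omega>))) *
        (indicator {0..T} w * indicator {0<..} (D w \<omega>)))"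
      unfolding ins by (simp add: mult_ac)
    also have "\<dots> = (occupation D T \<omega> ^ k * (\<Prod>w\<in>J. indicator {0<..} (D w \<omega>))) * occupation D T \<omega>"
      unfolding occupation_def by (rule integral_mult_right_zero)
    finally show "occupation D T \<omega> ^ Suc k * (\<Prod>w\<in>J. indicator {0<..} (D w \<omega>)) = (LINT w|lborel. ?f \<omega> w)"
      by (simp add: mult_ac)
  qed
  also have "\<dots> = (LINT w|lborel. expectation (\<lambda>\<omega>. ?f \<omega> w))"
    using int by (rule Fubini_integral[symmetric])
  finally show ?thesis by simp
qed

end

text \<open>Dominated convergence in the newly split-off time \<open>w\<close>. The point
  \<open>w = 0\<close> is null, so only strictly positive times occur, where the limit process has
  no atom at 0.\<close>

lemma occupation_moments_limit:
  fixes D :: "nat \<Rightarrow> real \<Rightarrow> 'a \<Rightarrow> real" and D' :: "real \<Rightarrow> 'a \<Rightarrow> real"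
  assumes D: "\<And>n. (\<lambda>(w, \<omega>). D n w \<omega>) \<in> borel_measurable (borel \<Otimes>\<^sub>M M)"
    and D': "(\<lambda>(w, \<omega>). D' w \<omega>) \<in> borel_measurable (borel \<Otimes>\<^sub>M M)" and T: "0 \<le> T"
    and fdd: "\<And>J. finite J \<Longrightarrow> J \<subseteq> {0<..} \<Longrightarrow>
      (\<lambda>n. expectation (\<lambda>\<omega>. \<Prod>w\<in>J. indicator {0<..} (D n w \<omega>)) :: real)
        \<longlonglongrightarrow> expectation (\<lambda>\<omega>. \<Prod>w\<in>J. indicator {0<..} (D' w \<omega>))"
    and J: "finite J" "J \<subseteq> {0<..}"
  shows "(\<lambda>n. expectation (\<lambda>\<omega>. occupation (D n) T \<omega> ^ k * (\<Prod>w\<in>J. indicator {0<..} (D n w \<omega>))))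
    \<longlonglongrightarrow> expectation (\<lambda>\<omega>. occupation D' T \<omega> ^ k * (\<Prod>w\<in>J. indicator {0<..} (D' w \<omega>)))"
  using J
proof (induction k arbitrary: J)
  case 0
  then show ?case using fdd by simp
next
  case (Suc k)
  note [measurable] = D_comp[OF D T] D_comp[OF D' T] occupation_measurable[OF D T] occupation_measurable[OF D' T]
  have m: "(\<lambda>w. expectation (\<lambda>\<omega>. occupation C T \<omega> ^ k * (\<Prod>w\<in>insert w J. indicator {0<..} (C w \<omega>)))) \<in> borel_measurable borel"
    if C: "(\<lambda>(w, \<omega>). C w \<omega>) \<in> borel_measurable (borel \<Otimes>\<^sub>M M)" for C
  proof -
    note [measurable] = D_comp[OF C T] occupation_measurable[OF C T]
    have ins: "(\<Prod>w\<in>insert w J. indicator {0<..} (C w \<omega>)) =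
        (indicator {0<..} (C w \<omega>) * (\<Prod>w\<in>J. indicator {0<..} (C w \<omega>)) :: real)" for w \<omega>
      using Suc.prems by (cases "w \<in> J") (auto simp: insert_absorb indicator_def prod.remove)
    have "(\<lambda>(w, \<omega>). occupation C T \<omega> ^ k * (indicator {0<..} (C w \<omega>) * (\<Prod>w\<in>J. indicator {0<..} (C w \<omega>))) :: real)
        \<in> borel_measurable (borel \<Otimes>\<^sub>M M)"
      unfolding split_beta' by measurable
    then show ?thesis unfolding ins by (rule borel_measurable_lebesgue_integral)
  qed
  show ?case
    unfolding occupation_moment_Suc[OF D T Suc.prems(1)] occupation_moment_Suc[OF D' T Suc.prems(1)]
  proof (rule integral_dominated_convergence[where w="\<lambda>w. indicator {0..T} w * T ^ k"])
    show "AE w in lborel. (\<lambda>n. indicator {0..T} w * expectation (\<lambda>\<omega>. occupation (D n) T \<omega> ^ k * (\<Prod>w\<in>insert w J. indicator {0<..} (D n w \<omega>))))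
      \<longlonglongrightarrow> indicator {0..T} w * expectation (\<lambda>\<omega>. occupation D' T \<omega> ^ k * (\<Prod>w\<in>insert w J. indicator {0<..} (D' w \<omega>)))"
      using AE_lborel_singleton[of "0::real"]
    proof eventually_elim
      fix w :: real assume "w \<noteq> 0"
      then show "(\<lambda>n. indicator {0..T} w * expectation (\<lambda>\<omega>. occupation (D n) T \<omega> ^ k * (\<Prod>w\<in>insert w J. indicator {0<..} (D n w \<omega>))))
      \<longlonglongrightarrow> indicator {0..T} w * expectation (\<lambda>\<omega>. occupation D' T \<omega> ^ k * (\<Prod>w\<in>insert w J. indicator {0<..} (D' w \<omega>)))"
        using Suc.prems by (cases "0 < w") (auto intro!: tendsto_intros Suc.IH)
    qed
    show "AE w in lborel. norm (indicator {0..T} w * expectation (\<lambda>\<omega>. occupation (D n) T \<omega> ^ k * (\<Prod>w\<in>insert w J. indicator {0<..} (D n w \<omega>))))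
      \<le> indicator {0..T} w * T ^ k" for n
    proof (rule AE_I2)
      fix w :: real
      have "norm (expectation (\<lambda>\<omega>. occupation (D n) T \<omega> ^ k * (\<Prod>w\<in>insert w J. indicator {0<..} (D n w \<omega>))))
          \<le> expectation (\<lambda>\<omega>. T ^ k)"
      proof (rule order_trans[OF integral_norm_bound integral_mono])
        have le: "norm (occupation (D n) T \<omega> ^ k * (\<Prod>w\<in>insert w J. indicator {0<..} (D n w \<omega>))) \<le> T ^ k"
          if "\<omega> \<in> space M" for \<omega>
        proof -
          have "occupation (D n) T \<omega> ^ k * \<bar>\<Prod>w\<in>insert w J. indicator {0<..} (D n w \<omega>)\<bar> \<le> T ^ k * 1"
            using that occupation_bounds[OF D[of n] T, of \<omega>] T
            by (intro mult_mono power_mono) (auto simp: abs_prod intro!: prod_le_1 prod_nonneg)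
          then show ?thesis
            using occupation_bounds(1)[OF D[of n] T, of \<omega>] by (simp add: abs_mult)
        qed
        then show "norm (occupation (D n) T \<omega> ^ k * (\<Prod>w\<in>insert w J. indicator {0<..} (D n w \<omega>))) \<le> T ^ k"
          if "\<omega> \<in> space M" for \<omega>
          using that by simp
        show "integrable M (\<lambda>\<omega>. norm (occupation (D n) T \<omega> ^ k * (\<Prod>w\<in>insert w J. indicator {0<..} (D n w \<omega>))))"
        proof (rule integrable_norm, rule integrable_const_bound[where B="T ^ k"])
          show "AE \<omega> in M. norm (occupation (D n) T \<omega> ^ k * (\<Prod>w\<in>insert w J. indicator {0<..} (D n w \<omega>))) \<le> T ^ k"
            using le by (rule AE_I2)
        qed measurable
      qed simp
      then show "norm (indicator {0..T} w * expectation (\<lambda>\<omega>. occupation (D n) T \<omega> ^ k * (\<Prod>w\<in>insert w J. indicator {0<..} (D n w \<omega>))))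
          \<le> indicator {0..T} w * T ^ k"
        by (simp add: indicator_def prob_space)
    qed
  qed (use T m[OF D] m[OF D'] in \<open>auto simp: integrable_mult_left_iff\<close>)
qed

text \<open>Occupation times over a window of length \<open>T\<close> lie in the compact interval
  \<open>{0..T}\<close>, so convergence of moments extends to continuous functions by polynomial
  approximation. No tightness of paths is involved.\<close>

lemma occupation_limit:
  fixes D :: "nat \<Rightarrow> real \<Rightarrow> 'a \<Rightarrow> real" and D' :: "real \<Rightarrow> 'a \<Rightarrow> real"
  assumes D: "\<And>n. (\<lambda>(w, \<omega>). D n w \<omega>) \<in> borel_measurable (borel \<Otimes>\<^sub>M M)"
    and D': "(\<lambda>(w, \<omega>). D' w \<omega>) \<in> borel_measurable (borel \<Otimes>\<^sub>M M)" and T: "0 \<le> T"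
    and fdd: "\<And>J. finite J \<Longrightarrow> J \<subseteq> {0<..} \<Longrightarrow>
      (\<lambda>n. expectation (\<lambda>\<omega>. \<Prod>w\<in>J. indicator {0<..} (D n w \<omega>)) :: real)
        \<longlonglongrightarrow> expectation (\<lambda>\<omega>. \<Prod>w\<in>J. indicator {0<..} (D' w \<omega>))"
    and F: "continuous_on UNIV (F :: real \<Rightarrow> real)"
  shows "(\<lambda>n. expectation (\<lambda>\<omega>. F (occupation (D n) T \<omega>))) \<longlonglongrightarrow> expectation (\<lambda>\<omega>. F (occupation D' T \<omega>))"
proof (rule LIMSEQ_I)
  fix e :: real assume e: "0 < e"
  have [measurable]: "F \<in> borel_measurable borel" using F by (rule borel_measurable_continuous_onI)
  obtain g where g: "real_polynomial_function g" and fg: "\<And>x. x \<in> {0..T} \<Longrightarrow> \<bar>F x - g x\<bar> < e / 3"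
    using Stone_Weierstrass_real_polynomial_function[of "{0..T}" F "e/3"] F e
    by (auto intro: continuous_on_subset)
  obtain a N where g_eq: "g = (\<lambda>x. \<Sum>i\<le>N. a i * x ^ i)"
    using g by (auto simp: real_polynomial_function_iff_sum)
  obtain B where B: "\<And>x. x \<in> {0..T} \<Longrightarrow> norm (F x) \<le> B"
    using compact_imp_bounded[OF compact_continuous_image[OF continuous_on_subset[OF F] compact_Icc[of 0 T]]]
    unfolding bounded_iff by blast
  have pow: "integrable M (\<lambda>\<omega>. occupation C T \<omega> ^ i)" and Fint: "integrable M (\<lambda>\<omega>. F (occupation C T \<omega>))"
    and near: "\<bar>expectation (\<lambda>\<omega>. F (occupation C T \<omega>)) - expectation (\<lambda>\<omega>. g (occupation C T \<omega>))\<bar> \<le> e / 3"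
    if C: "(\<lambda>(w, \<omega>). C w \<omega>) \<in> borel_measurable (borel \<Otimes>\<^sub>M M)" for C i
  proof -
    note [measurable] = occupation_measurable[OF C T]
    have b: "occupation C T \<omega> \<in> {0..T}" if "\<omega> \<in> space M" for \<omega>
      using occupation_bounds[OF C T] that by auto
    show p: "integrable M (\<lambda>\<omega>. occupation C T \<omega> ^ i)" for i
    proof (rule integrable_const_bound[where B="T ^ i"])
      show "AE \<omega> in M. norm (occupation C T \<omega> ^ i) \<le> T ^ i"
        using b by (intro AE_I2) (simp add: power_abs power_mono)
    qed measurable
    show Fi: "integrable M (\<lambda>\<omega>. F (occupation C T \<omega>))"
      by (rule integrable_const_bound[where B=B]) (use b B in \<open>auto intro!: AE_I2\<close>)
    have gi: "integrable M (\<lambda>\<omega>. g (occupation C T \<omega>))" unfolding g_eq using p by simp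
    have "\<bar>expectation (\<lambda>\<omega>. F (occupation C T \<omega>) - g (occupation C T \<omega>))\<bar> \<le> expectation (\<lambda>\<omega>. e / 3)"
      using b fg Fi gi by (intro integral_abs_bound[THEN order_trans] integral_mono) (auto intro: less_imp_le)
    then show "\<bar>expectation (\<lambda>\<omega>. F (occupation C T \<omega>)) - expectation (\<lambda>\<omega>. g (occupation C T \<omega>))\<bar> \<le> e / 3"
      using Fi gi by (simp add: prob_space)
  qed
  have "(\<lambda>n. expectation (\<lambda>\<omega>. occupation (D n) T \<omega> ^ i)) \<longlonglongrightarrow> expectation (\<lambda>\<omega>. occupation D' T \<omega> ^ i)" for i
    using occupation_moments_limit[OF D D' T fdd, of "{}" i] by simp
  then have "(\<lambda>n. \<Sum>i\<le>N. a i * expectation (\<lambda>\<omega>. occupation (D n) T \<omega> ^ i)) \<longlonglongrightarrow>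
      (\<Sum>i\<le>N. a i * expectation (\<lambda>\<omega>. occupation D' T \<omega> ^ i))"
    by (intro tendsto_intros)
  then have "(\<lambda>n. expectation (\<lambda>\<omega>. g (occupation (D n) T \<omega>))) \<longlonglongrightarrow> expectation (\<lambda>\<omega>. g (occupation D' T \<omega>))"
    unfolding g_eq by (simp add: pow[OF D] pow[OF D'])
  then have "\<forall>\<^sub>F n in sequentially. \<bar>expectation (\<lambda>\<omega>. g (occupation (D n) T \<omega>)) - expectation (\<lambda>\<omega>. g (occupation D' T \<omega>))\<bar> < e / 3"
    using e by (auto dest!: tendstoD[where e="e/3"] simp: dist_real_def)
  then obtain N where N: "\<And>n. N \<le> n \<Longrightarrow> \<bar>expectation (\<lambda>\<omega>. g (occupation (D n) T \<omega>)) - expectation (\<lambda>\<omega>. g (occupation D' T \<omega>))\<bar> < e / 3"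
    by (auto simp: eventually_sequentially)
  show "\<exists>no. \<forall>n\<ge>no. norm (expectation (\<lambda>\<omega>. F (occupation (D n) T \<omega>)) - expectation (\<lambda>\<omega>. F (occupation D' T \<omega>))) < e"
  proof (intro exI allI impI)
    fix n assume "N \<le> n"
    from N[OF this] near[OF D, of n] near[OF D']
    show "norm (expectation (\<lambda>\<omega>. F (occupation (D n) T \<omega>)) - expectation (\<lambda>\<omega>. F (occupation D' T \<omega>))) < e"
      unfolding real_norm_def by linarith
  qed
qed

end

section \<open>Independence of path-valued variables\<close>

definition cylinders :: "'w measure \<Rightarrow> 'j set \<Rightarrow> ('j \<Rightarrow> 'w \<Rightarrow> real) \<Rightarrow> 'w set set" where
  "cylinders M I X = {{\<omega> \<in> space M. \<forall>j\<in>J. X j \<omega> \<in> A j} | J A. finite J \<and> J \<subseteq> I \<and> (\<forall>j. A j \<in> sets borel)}"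

lemma cylinders_measurable:
  assumes "j \<in> I"
  shows "X j \<in> borel_measurable (sigma (space M) (cylinders M I X))"
proof (rule measurableI)
  fix A :: "real set" assume A: "A \<in> sets borel"
  have sub: "cylinders M I X \<subseteq> Pow (space M)" by (auto simp: cylinders_def)
  have "X j -` A \<inter> space M \<in> cylinders M I X"
    unfolding cylinders_def using assms A by (intro CollectI exI[of _ "{j}"] exI[of _ "\<lambda>_. A"]) auto
  then show "X j -` A \<inter> space (sigma (space M) (cylinders M I X)) \<in> sets (sigma (space M) (cylinders M I X))"
    using sub by (simp add: space_measure_of_conv sets_measure_of sigma_sets.Basic)
qed auto

lemma cylinders_sets:
  assumes X: "\<And>j. j \<in> I \<Longrightarrow> X j \<in> borel_measurable M"
  shows "cylinders M I X \<subseteq> sets M"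
proof
  fix a assume "a \<in> cylinders M I X"
  then obtain J A where J: "finite J" "J \<subseteq> I" "\<And>j. A j \<in> sets borel" "a = {\<omega> \<in> space M. \<forall>j\<in>J. X j \<omega> \<in> A j}"
    unfolding cylinders_def by blast
  have "{\<omega> \<in> space M. X j \<omega> \<in> A j} \<in> sets M" if "j \<in> J" for j
    using measurable_sets[OF X J(3), of j j] J(2) that by (auto simp: vimage_def Int_def conj_commute)
  then show "a \<in> sets M" unfolding J(4) using J(1) by (intro sets.sets_Collect_finite_All) auto
qed

lemma Int_stable_cylinders: "Int_stable (cylinders M I X)"
proof (rule Int_stableI)
  fix a b assume "a \<in> cylinders M I X" "b \<in> cylinders M I X"
  then obtain J A L B where J: "finite J" "J \<subseteq> I" "\<And>j. A j \<in> sets borel" "a = {\<omega> \<in> space M. \<forall>j\<in>J. X j \<omega> \<in> A j}"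
    and L: "finite L" "L \<subseteq> I" "\<And>j. B j \<in> sets borel" "b = {\<omega> \<in> space M. \<forall>j\<in>L. X j \<omega> \<in> B j}"
    unfolding cylinders_def by blast
  let ?C = "\<lambda>j. (if j \<in> J then A j else UNIV) \<inter> (if j \<in> L then B j else UNIV)"
  have "a \<inter> b = {\<omega> \<in> space M. \<forall>j\<in>J \<union> L. X j \<omega> \<in> ?C j}" unfolding J(4) L(4) by auto
  moreover have "?C j \<in> sets borel" for j using J(3) L(3) by auto
  ultimately show "a \<inter> b \<in> cylinders M I X"
    unfolding cylinders_def using J(1,2) L(1,2)
    by (intro CollectI exI[of _ "J \<union> L"] exI[of _ ?C]) auto
qed

lemma sigma_rv_subset:
  assumes "P \<in> sigma (space M) E \<rightarrow>\<^sub>M N" "E \<subseteq> Pow (space M)"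
  shows "sigma_rv M N P \<subseteq> sigma_sets (space M) E"
proof -
  have "P \<in> space M \<rightarrow> space N" using measurable_space[OF assms(1)] assms(2) by (auto simp: space_measure_of_conv)
  then have "sigma_rv M N P = {P -` A \<inter> space M | A. A \<in> sets N}"
    unfolding sigma_rv_def by (rule sets_vimage_algebra2)
  then show ?thesis
    using measurable_sets[OF assms(1)] assms(2) by (auto simp: space_measure_of_conv sets_measure_of)
qed

context prob_space begin

lemma indep_set_subset:
  assumes "indep_set A B" "A' \<subseteq> A" "B' \<subseteq> B"
  shows "indep_set A' B'"
  using assms unfolding indep_set_def by (intro indep_sets_mono_sets[OF assms(1)[unfolded indep_set_def]]) (auto split: bool.split)

text \<open>Finite-dimensional events form an intersection-stable generator. On them the
  factorization is obtained in two rounds of weight uniqueness: the centered exponential of the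
  \<open>Y\<close> part is the weight that turns the \<open>X\<close> exponentials into indicators,
  then the centered product of \<open>X\<close> indicators is the weight for the \<open>Y\<close>
  part. Dividing by 2 keeps these weights bounded by 1.\<close>

lemma indep_set_cylinders:
  fixes X :: "'i \<Rightarrow> 'a \<Rightarrow> real" and Y :: "'j \<Rightarrow> 'a \<Rightarrow> real"
  assumes X [measurable]: "\<And>i. i \<in> I \<Longrightarrow> X i \<in> borel_measurable M"
    and Y [measurable]: "\<And>j. j \<in> K \<Longrightarrow> Y j \<in> borel_measurable M"
    and char: "\<And>J L a b. finite J \<Longrightarrow> J \<subseteq> I \<Longrightarrow> finite L \<Longrightarrow> L \<subseteq> K \<Longrightarrow>
      expectation (\<lambda>\<omega>. iexp ((\<Sum>i\<in>J. a i * X i \<omega>) + (\<Sum>j\<in>L. b j * Y j \<omega>))) =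
      expectation (\<lambda>\<omega>. iexp (\<Sum>i\<in>J. a i * X i \<omega>)) * expectation (\<lambda>\<omega>. iexp (\<Sum>j\<in>L. b j * Y j \<omega>))"
  shows "indep_set (sigma_sets (space M) (cylinders M I X)) (sigma_sets (space M) (cylinders M K Y))"
proof (rule indep_set_sigma_sets[OF _ Int_stable_cylinders Int_stable_cylinders], rule indep_setI)
  show "cylinders M I X \<subseteq> events" "cylinders M K Y \<subseteq> events"
    by (rule cylinders_sets; simp)+
  fix p q assume "p \<in> cylinders M I X" "q \<in> cylinders M K Y"
  then obtain J A L B where J: "finite J" "J \<subseteq> I" and A [measurable]: "\<And>j. A j \<in> sets borel"
      and p: "p = {\<omega> \<in> space M. \<forall>j\<in>J. X j \<omega> \<in> A j}"
    and L: "finite L" "L \<subseteq> K" and B [measurable]: "\<And>j. B j \<in> sets borel"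
      and q: "q = {\<omega> \<in> space M. \<forall>j\<in>L. Y j \<omega> \<in> B j}"
    unfolding cylinders_def by blast
  have [measurable]: "\<And>j. j \<in> J \<Longrightarrow> X j \<in> borel_measurable M" "\<And>j. j \<in> L \<Longrightarrow> Y j \<in> borel_measurable M"
    using J L by auto
  let ?g = "\<lambda>\<omega>. \<Prod>j\<in>J. indicator (A j) (X j \<omega>) :: complex" and ?h = "\<lambda>\<omega>. \<Prod>j\<in>L. indicator (B j) (Y j \<omega>) :: complex"
  have gh_le: "norm (?g \<omega>) \<le> 1" "norm (?h \<omega>) \<le> 1" for \<omega>
    by (auto simp: prod_norm[symmetric] indicator_def intro!: prod_le_1)
  have g_int: "integrable M ?g" by (rule integrable_const_bound[where B=1]) (use gh_le in auto)
  have h_int: "integrable M ?h" by (rule integrable_const_bound[where B=1]) (use gh_le in auto)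
  have e_int: "integrable M (\<lambda>\<omega>. iexp (f \<omega>) * k \<omega>)"
    if "f \<in> borel_measurable M" "k \<in> borel_measurable M" "\<And>\<omega>. norm (k \<omega>) \<le> 1" for f and k :: "'a \<Rightarrow> complex"
    using that by (rule integrable_iexp_mult)
  have e_le: "norm (expectation k) \<le> 1" if "\<And>\<omega>. norm (k \<omega>) \<le> 1" "k \<in> borel_measurable M" for k :: "'a \<Rightarrow> complex"
  proof -
    have "norm (expectation k) \<le> expectation (\<lambda>\<omega>. norm (k \<omega>))" by (rule integral_norm_bound)
    also have "\<dots> \<le> expectation (\<lambda>_. 1)"
      using that by (intro integral_mono integrable_norm integrable_const_bound[where B=1]) auto
    finally show ?thesis by (simp add: prob_space)
  qed
  have half: "norm ((x - y) / 2) \<le> 1" if "norm x \<le> 1" "norm y \<le> 1" for x y :: complex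
    using norm_triangle_ineq4[of x y] that by (simp add: norm_divide)
  have step1: "expectation (\<lambda>\<omega>. ?g \<omega> * iexp (\<Sum>j\<in>L. b j * Y j \<omega>)) = expectation ?g * expectation (\<lambda>\<omega>. iexp (\<Sum>j\<in>L. b j * Y j \<omega>))" for b
  proof -
    let ?e = "\<lambda>\<omega>. iexp (\<Sum>j\<in>L. b j * Y j \<omega>)"
    have m: "norm (expectation ?e) \<le> 1" by (rule e_le) auto
    have "expectation (\<lambda>\<omega>. (\<Prod>j\<in>J. indicator (A j) (X j \<omega>)) * ((?e \<omega> - expectation ?e) / 2)) = 0"
    proof (rule char_weight_unique_finite[OF J(1)])
      fix a
      have "expectation (\<lambda>\<omega>. iexp (\<Sum>j\<in>J. a j * X j \<omega>) * ((?e \<omega> - expectation ?e) / 2))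
        = expectation (\<lambda>\<omega>. (iexp (\<Sum>j\<in>J. a j * X j \<omega>) * ?e \<omega> - iexp (\<Sum>j\<in>J. a j * X j \<omega>) * expectation ?e) / 2)"
        by (simp add: algebra_simps)
      also have "\<dots> = (expectation (\<lambda>\<omega>. iexp (\<Sum>j\<in>J. a j * X j \<omega>) * ?e \<omega>)
          - expectation (\<lambda>\<omega>. iexp (\<Sum>j\<in>J. a j * X j \<omega>)) * expectation ?e) / 2"
        using e_int[of "\<lambda>\<omega>. \<Sum>j\<in>J. a j * X j \<omega>" ?e] e_int[of "\<lambda>\<omega>. \<Sum>j\<in>J. a j * X j \<omega>" "\<lambda>_. 1"]
        by (simp del: of_real_sum of_real_mult)
      also have "\<dots> = 0"
        using char[OF J L, of a b] by (simp add: distrib_left exp_add del: of_real_sum of_real_mult)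
      finally show "expectation (\<lambda>\<omega>. iexp (\<Sum>j\<in>J. a j * X j \<omega>) * ((?e \<omega> - expectation ?e) / 2)) = 0" .
    qed (use m half in auto)
    moreover have "expectation (\<lambda>\<omega>. ?g \<omega> * ((?e \<omega> - expectation ?e) / 2))
        = (expectation (\<lambda>\<omega>. ?g \<omega> * ?e \<omega>) - expectation ?g * expectation ?e) / 2"
    proof -
      have "integrable M (\<lambda>\<omega>. ?g \<omega> * ?e \<omega>)"
        using e_int[of "\<lambda>\<omega>. \<Sum>j\<in>L. b j * Y j \<omega>" ?g] gh_le by (simp add: mult.commute)
      then have "expectation (\<lambda>\<omega>. (?g \<omega> * ?e \<omega> - ?g \<omega> * expectation ?e) / 2)
        = (expectation (\<lambda>\<omega>. ?g \<omega> * ?e \<omega>) - expectation ?g * expectation ?e) / 2"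
        using g_int by (simp del: of_real_sum of_real_mult)
      then show ?thesis by (simp add: right_diff_distrib)
    qed
    ultimately show ?thesis by simp
  qed
  have "expectation (\<lambda>\<omega>. (\<Prod>j\<in>L. indicator (B j) (Y j \<omega>)) * ((?g \<omega> - expectation ?g) / 2)) = 0"
  proof (rule char_weight_unique_finite[OF L(1)])
    fix b
    let ?e = "\<lambda>\<omega>. iexp (\<Sum>j\<in>L. b j * Y j \<omega>)"
    have "expectation (\<lambda>\<omega>. ?e \<omega> * ((?g \<omega> - expectation ?g) / 2))
        = expectation (\<lambda>\<omega>. (?g \<omega> * ?e \<omega> - expectation ?g * ?e \<omega>) / 2)"
      by (simp add: algebra_simps)
    also have "\<dots> = (expectation (\<lambda>\<omega>. ?g \<omega> * ?e \<omega>) - expectation ?g * expectation ?e) / 2"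
      using e_int[of "\<lambda>\<omega>. \<Sum>j\<in>L. b j * Y j \<omega>" ?g] e_int[of "\<lambda>\<omega>. \<Sum>j\<in>L. b j * Y j \<omega>" "\<lambda>_. 1"] gh_le
      by (simp add: mult.commute del: of_real_sum of_real_mult)
    also have "\<dots> = 0" using step1 by simp
    finally show "expectation (\<lambda>\<omega>. ?e \<omega> * ((?g \<omega> - expectation ?g) / 2)) = 0" .
  qed (use half gh_le e_le[of ?g] in auto)
  moreover have "expectation (\<lambda>\<omega>. ?h \<omega> * ((?g \<omega> - expectation ?g) / 2))
      = (expectation (\<lambda>\<omega>. ?g \<omega> * ?h \<omega>) - expectation ?g * expectation ?h) / 2"
  proof -
    have "norm (?g \<omega> * ?h \<omega>) \<le> 1" for \<omega>
      unfolding norm_mult using gh_le by (intro mult_le_one) auto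
    then have "integrable M (\<lambda>\<omega>. ?g \<omega> * ?h \<omega>)"
      by (intro integrable_const_bound[where B=1]) auto
    then have "expectation (\<lambda>\<omega>. (?g \<omega> * ?h \<omega> - expectation ?g * ?h \<omega>) / 2)
        = (expectation (\<lambda>\<omega>. ?g \<omega> * ?h \<omega>) - expectation ?g * expectation ?h) / 2"
      using h_int by simp
    then show ?thesis by (simp add: right_diff_distrib mult.commute)
  qed
  ultimately have "expectation (\<lambda>\<omega>. ?g \<omega> * ?h \<omega>) = expectation ?g * expectation ?h" by simp
  moreover have ind: "(\<Prod>j\<in>F. indicator (C j) (V j \<omega>)) = (indicator {\<omega> \<in> space M. \<forall>j\<in>F. V j \<omega> \<in> C j} \<omega> :: complex)"
    if "finite F" "\<omega> \<in> space M" for F and C :: "'k \<Rightarrow> real set" and V \<omega>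
    using that by (auto simp: indicator_def prod_eq_1_iff)
  have ex: "expectation (indicator C :: 'a \<Rightarrow> complex) = of_real (prob C)" if "C \<in> events" for C
  proof -
    have "(indicator C :: 'a \<Rightarrow> complex) = (\<lambda>\<omega>. of_real (indicator C \<omega>))" by (auto simp: indicator_def)
    then show ?thesis using that by simp
  qed
  have pm: "p \<in> events" "q \<in> events"
    using \<open>p \<in> cylinders M I X\<close> \<open>q \<in> cylinders M K Y\<close> cylinders_sets[of I X M] cylinders_sets[of K Y M] X Y by auto
  have 1: "expectation ?g = of_real (prob p)"
    using pm by (subst Bochner_Integration.integral_cong[OF refl ind[OF J(1)]]) (simp_all flip: p add: ex)
  have 2: "expectation ?h = of_real (prob q)"
    using pm by (subst Bochner_Integration.integral_cong[OF refl ind[OF L(1)]]) (simp_all flip: q add: ex)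
  have 3: "expectation (\<lambda>\<omega>. ?g \<omega> * ?h \<omega>) = of_real (prob (p \<inter> q))"
  proof -
    have "expectation (\<lambda>\<omega>. ?g \<omega> * ?h \<omega>) = expectation (indicator (p \<inter> q))"
      by (intro Bochner_Integration.integral_cong refl) (simp add: ind J(1) L(1) indicator_inter_arith flip: p q)
    then show ?thesis using pm by (simp add: ex sets.Int)
  qed
  show "prob (p \<inter> q) = prob p * prob q"
    using \<open>expectation (\<lambda>\<omega>. ?g \<omega> * ?h \<omega>) = expectation ?g * expectation ?h\<close>
    unfolding 1 2 3 by (simp flip: of_real_mult)
qed

lemma indep_paths_char:
  fixes W :: "'m::finite \<Rightarrow> real \<Rightarrow> 'a \<Rightarrow> real"
  assumes W: "indep_vars (\<lambda>_. \<Pi>\<^sub>M t\<in>{0..}. borel) (\<lambda>i \<omega>. \<lambda>t\<in>{0..}. W i t \<omega>) UNIV"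
    and f: "\<And>i. f i \<in> borel_measurable (\<Pi>\<^sub>M t\<in>{0..}. borel)"
    and V: "\<And>i \<omega>. V i \<omega> = f i (\<lambda>t\<in>{0..}. W i t \<omega>)"
  shows "expectation (\<lambda>\<omega>. iexp (\<Sum>i\<in>UNIV. V i \<omega>)) = (\<Prod>i\<in>UNIV. expectation (\<lambda>\<omega>. iexp (V i \<omega>)))"
    and "indep_vars (\<lambda>_. borel) V UNIV"
proof -
  have "indep_vars (\<lambda>_. borel) (\<lambda>i \<omega>. f i (\<lambda>t\<in>{0..}. W i t \<omega>)) UNIV"
    by (rule indep_vars_compose2[OF W]) (rule f)
  then show ind: "indep_vars (\<lambda>_. borel) V UNIV" by (simp add: V[abs_def] fun_eq_iff)
  then have [measurable]: "V i \<in> borel_measurable M" for i by (auto simp: indep_vars_def)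
  from char_distr_sum[OF ind, of 1]
  show "expectation (\<lambda>\<omega>. iexp (\<Sum>i\<in>UNIV. V i \<omega>)) = (\<Prod>i\<in>UNIV. expectation (\<lambda>\<omega>. iexp (V i \<omega>)))"
    by (simp add: char_def integral_distr)
qed

end

lemma (in prob_space) gaussian_family_L2_continuous:
  assumes X: "gaussian_family M K X" and sym: "\<And>s t. K s t = K t s"
    and K: "\<And>\<epsilon>. 0 < \<epsilon> \<Longrightarrow> \<exists>\<delta>>0. \<forall>s\<ge>0. \<forall>t\<ge>0. \<bar>t - s\<bar> < \<delta> \<longrightarrow> K t t + K s s - 2 * K s t \<le> \<epsilon>"
  shows "L2_continuous M X"
proof -
  have e: "(\<integral>\<^sup>+\<omega>. ennreal ((X t \<omega> - X s \<omega>)\<^sup>2) \<partial>M) = ennreal (K t t + K s s - 2 * K s t)" if "0 \<le> s" "0 \<le> t" for s t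
  proof -
    interpret I: centered_normal M "\<lambda>\<omega>. X t \<omega> - X s \<omega>" "K t t + K s s - 2 * K s t"
      by (rule gaussian_family_increment[OF X that sym])
    show ?thesis using I.second_moment by (subst nn_integral_eq_integral) auto
  qed
  show ?thesis
    unfolding L2_continuous_def
  proof (intro allI impI)
    fix \<epsilon> :: real assume "0 < \<epsilon>"
    from K[OF this] show "\<exists>\<delta>>0. \<forall>s\<ge>0. \<forall>t\<ge>0. \<bar>t - s\<bar> < \<delta> \<longrightarrow>
        (\<integral>\<^sup>+\<omega>. ennreal ((X t \<omega> - X s \<omega>)\<^sup>2) \<partial>M) \<le> ennreal \<epsilon>"
      by (elim ex_forward) (simp add: e ennreal_leI)
  qed
qed

section \<open>The chi-square process after an exceedance\<close>

lemma norm_iexp_diff: "norm (iexp x - iexp y) \<le> \<bar>x - y\<bar>"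
proof -
  have "iexp x - iexp y = iexp y * (iexp (x - y) - 1)"
    by (simp add: algebra_simps flip: exp_add)
  also have "norm \<dots> \<le> \<bar>x - y\<bar>"
    using iexp_approx1[of "x - y" 0] by (simp add: norm_mult)
  finally show ?thesis .
qed

text \<open>The situation for one frozen clock and one exceedance time, taken as origin:
  \<open>W i\<close> is the original process run at the speed of the clock, \<open>\<rho> i\<close>
  its correlation, and \<open>Z i\<close> has the clock absorbed into its covariance. The
  coefficient \<open>c i\<close> may vanish because a clock component may.\<close>

locale local_chi_square = prob_space M for M :: "'w measure" +
  fixes W Z :: "'m::finite \<Rightarrow> real \<Rightarrow> 'w \<Rightarrow> real" and \<rho> :: "'m \<Rightarrow> real \<Rightarrow> real"
    and c :: "'m \<Rightarrow> real" and \<alpha> :: real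
  assumes alpha: "0 < \<alpha>"
    and W_process: "\<And>i. measurable_process M (W i)"
    and Z_process: "\<And>i. measurable_process M (Z i)"
    and W_gaussian: "\<And>i. gaussian_family M (\<lambda>s t. \<rho> i (t - s)) (W i)"
    and Z_gaussian: "\<And>i. gaussian_family M (\<lambda>s t. c i * (t powr \<alpha> + s powr \<alpha> - \<bar>t - s\<bar> powr \<alpha>)) (Z i)"
    and W_indep: "indep_vars (\<lambda>_. \<Pi>\<^sub>M t\<in>{0..}. borel) (\<lambda>i \<omega>. \<lambda>t\<in>{0..}. W i t \<omega>) UNIV"
    and Z_indep: "indep_vars (\<lambda>_. \<Pi>\<^sub>M t\<in>{0..}. borel) (\<lambda>i \<omega>. \<lambda>t\<in>{0..}. Z i t \<omega>) UNIV"
    and rho_measurable [measurable]: "\<And>i. \<rho> i \<in> borel_measurable borel"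
    and rho_0: "\<And>i. \<rho> i 0 = 1"
    and rho_minus: "\<And>i s. \<rho> i (- s) = \<rho> i s"
    and rho_cont: "\<And>i. isCont (\<rho> i) 0"
    and rho_lim: "\<And>i a. ((\<lambda>v. v * (1 - \<rho> i (a / v powr (1 / \<alpha>)))) \<longlongrightarrow> c i * \<bar>a\<bar> powr \<alpha>) at_top"
    and c_nonneg: "\<And>i. 0 \<le> c i"
begin

text \<open>The residuals are independent of \<open>W 0\<close>, so conditioning on \<open>W 0\<close> means fixing its value.\<close>

definition residual :: "'m \<Rightarrow> real \<Rightarrow> 'w \<Rightarrow> real" where
  "residual i s \<omega> = W i s \<omega> - \<rho> i s * W i 0 \<omega>"

abbreviation residual_cov :: "'m \<Rightarrow> real \<Rightarrow> real \<Rightarrow> real" where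
  "residual_cov i s t \<equiv> \<rho> i (t - s) - \<rho> i s * \<rho> i t"

lemma rho_swap: "\<rho> i (s - t) = \<rho> i (t - s)"
  using rho_minus[of i "t - s"] by simp

lemma residual_process: "measurable_process M (residual i)"
proof -
  have [measurable]: "W i 0 \<in> borel_measurable M" by (rule measurable_process_component[OF W_process]) simp
  have [measurable]: "(\<lambda>x. W i (fst x) (snd x)) \<in> borel_measurable (restrict_space borel {0..} \<Otimes>\<^sub>M M)"
    using W_process[of i] by (simp add: measurable_process_def split_beta')
  have "(\<lambda>x. \<rho> i (fst x)) \<in> borel_measurable (restrict_space borel {0..} \<Otimes>\<^sub>M M)"
    by (rule measurable_compose[OF measurable_compose[OF measurable_fst measurable_restrict_space1[OF measurable_ident]] rho_measurable, unfolded id_apply])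
  then show ?thesis
    unfolding measurable_process_def residual_def split_beta' by measurable
qed

text \<open>The combination is rewritten in values of \<open>W i\<close>, with coefficient
  \<open>a - B\<close> at the extra time 0, encoded by \<open>None\<close>. In the quadratic form
  the terms mixing \<open>a\<close> and \<open>b\<close> cancel, which for jointly Gaussian
  variables is independence of the initial value and the residuals.\<close>

lemma residual_char1:
  fixes J :: "'j set"
  assumes J: "finite J" and s: "\<And>j. j \<in> J \<Longrightarrow> 0 \<le> s j"
  shows "expectation (\<lambda>\<omega>. iexp (a * W i 0 \<omega> + (\<Sum>j\<in>J. b j * residual i (s j) \<omega>))) =
    of_real (exp (- (a\<^sup>2 + (\<Sum>j\<in>J. \<Sum>k\<in>J. b j * b k * residual_cov i (s j) (s k))) / 2))"
proof -
  define B where "B = (\<Sum>j\<in>J. b j * \<rho> i (s j))"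
  define I where "I = insert None (Some ` J)"
  define t where "t = (\<lambda>p. case p of None \<Rightarrow> 0 | Some j \<Rightarrow> s j)"
  define \<beta> where "\<beta> = (\<lambda>p. case p of None \<Rightarrow> a - B | Some j \<Rightarrow> b j)"
  have sumI: "(\<Sum>p\<in>I. f p) = f None + (\<Sum>j\<in>J. f (Some j))" for f :: "'j option \<Rightarrow> real"
    using J by (auto simp: I_def sum.reindex image_iff)
  have "(\<Sum>p\<in>I. \<beta> p * W i (t p) \<omega>) = a * W i 0 \<omega> + (\<Sum>j\<in>J. b j * residual i (s j) \<omega>)" for \<omega>
    by (simp add: sumI \<beta>_def t_def residual_def B_def algebra_simps sum_subtractf sum_distrib_left sum_distrib_right)
  moreover have "(\<Sum>p\<in>I. \<Sum>q\<in>I. \<beta> p * \<beta> q * \<rho> i (t q - t p)) =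
      a\<^sup>2 + (\<Sum>j\<in>J. \<Sum>k\<in>J. b j * b k * residual_cov i (s j) (s k))"
  proof -
    have "(\<Sum>p\<in>I. \<Sum>q\<in>I. \<beta> p * \<beta> q * \<rho> i (t q - t p)) =
        (a - B)\<^sup>2 + (a - B) * B + (\<Sum>j\<in>J. b j * (a - B) * \<rho> i (s j) + (\<Sum>k\<in>J. b j * b k * \<rho> i (s k - s j)))"
      unfolding sumI
      by (simp add: \<beta>_def t_def rho_0 rho_minus power2_eq_square B_def[symmetric] sum_distrib_left[symmetric] mult.assoc)
    also have "\<dots> = (a - B)\<^sup>2 + 2 * (a - B) * B + (\<Sum>j\<in>J. \<Sum>k\<in>J. b j * b k * \<rho> i (s k - s j))"
    proof -
      have "(\<Sum>j\<in>J. b j * (a - B) * \<rho> i (s j)) = (a - B) * B"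
        unfolding B_def sum_distrib_left by (intro sum.cong) (auto simp: mult_ac)
      then show ?thesis by (simp add: sum.distrib)
    qed
    also have "\<dots> = a\<^sup>2 + ((\<Sum>j\<in>J. \<Sum>k\<in>J. b j * b k * \<rho> i (s k - s j)) - B * B)"
      by (simp add: power2_eq_square algebra_simps)
    also have "B * B = (\<Sum>j\<in>J. \<Sum>k\<in>J. b j * b k * (\<rho> i (s j) * \<rho> i (s k)))"
      unfolding B_def sum_product by (intro sum.cong) (auto simp: mult_ac)
    also have "(\<Sum>j\<in>J. \<Sum>k\<in>J. b j * b k * \<rho> i (s k - s j)) - \<dots> = (\<Sum>j\<in>J. \<Sum>k\<in>J. b j * b k * residual_cov i (s j) (s k))"
      by (simp add: sum_subtractf right_diff_distrib)
    finally show ?thesis .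
  qed
  moreover have "expectation (\<lambda>\<omega>. iexp (\<Sum>p\<in>I. \<beta> p * W i (t p) \<omega>)) =
      of_real (exp (- (\<Sum>p\<in>I. \<Sum>q\<in>I. \<beta> p * \<beta> q * \<rho> i (t q - t p)) / 2))"
    by (rule gaussian_family_char[OF W_gaussian]) (use J s in \<open>auto simp: I_def t_def\<close>)
  ultimately show ?thesis by simp
qed

lemma residual_char:
  fixes J :: "'j set"
  assumes J: "finite J" and s: "\<And>j. j \<in> J \<Longrightarrow> 0 \<le> s j"
  shows "expectation (\<lambda>\<omega>. iexp (\<Sum>i\<in>UNIV. a i * W i 0 \<omega> + (\<Sum>j\<in>J. b i j * residual i (s j) \<omega>))) =
    (\<Prod>i\<in>UNIV. of_real (exp (- ((a i)\<^sup>2 + (\<Sum>j\<in>J. \<Sum>k\<in>J. b i j * b i k * residual_cov i (s j) (s k))) / 2)))"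
proof -
  have c: "(\<lambda>p. p t) \<in> borel_measurable (\<Pi>\<^sub>M t\<in>{0..}. borel)" if "0 \<le> t" for t :: real
    by (rule measurable_component_singleton) (use that in auto)
  have "expectation (\<lambda>\<omega>. iexp (\<Sum>i\<in>UNIV. a i * W i 0 \<omega> + (\<Sum>j\<in>J. b i j * residual i (s j) \<omega>))) =
    (\<Prod>i\<in>UNIV. expectation (\<lambda>\<omega>. iexp (a i * W i 0 \<omega> + (\<Sum>j\<in>J. b i j * residual i (s j) \<omega>))))"
  proof (rule indep_paths_char(1)[OF W_indep])
    fix i
    show "(\<lambda>p. a i * p 0 + (\<Sum>j\<in>J. b i j * (p (s j) - \<rho> i (s j) * p 0))) \<in> borel_measurable (\<Pi>\<^sub>M t\<in>{0..}. borel)"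
      using s c by (intro borel_measurable_add borel_measurable_sum borel_measurable_times borel_measurable_diff
          borel_measurable_const c) auto
    show "a i * W i 0 \<omega> + (\<Sum>j\<in>J. b i j * residual i (s j) \<omega>) =
        a i * (\<lambda>t\<in>{0..}. W i t \<omega>) 0 + (\<Sum>j\<in>J. b i j * ((\<lambda>t\<in>{0..}. W i t \<omega>) (s j) - \<rho> i (s j) * (\<lambda>t\<in>{0..}. W i t \<omega>) 0))" for \<omega>
      using s by (auto simp: residual_def intro!: sum.cong)
  qed
  also have "\<dots> = (\<Prod>i\<in>UNIV. of_real (exp (- ((a i)\<^sup>2 + (\<Sum>j\<in>J. \<Sum>k\<in>J. b i j * b i k * residual_cov i (s j) (s k))) / 2)))"
    by (simp only: residual_char1[OF J s])
  finally show ?thesis .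
qed

lemma residual_gaussian: "gaussian_family M (residual_cov i) (residual i)"
  unfolding gaussian_family_def
proof (intro conjI allI impI)
  show "residual i t \<in> borel_measurable M" if "0 \<le> t" for t
    using residual_process that by (rule measurable_process_component)
  fix J :: "real set" and b assume "finite J \<and> J \<subseteq> {0..}"
  then show "expectation (\<lambda>\<omega>. iexp (\<Sum>t\<in>J. b t * residual i t \<omega>)) =
      of_real (exp (- (\<Sum>s\<in>J. \<Sum>t\<in>J. b s * b t * residual_cov i s t) / 2))"
    using residual_char1[of J "\<lambda>t. t" 0 i b] by auto
qed

lemma residual_normal:
  assumes "0 \<le> s"
  shows "centered_normal M (residual i s) (1 - (\<rho> i s)\<^sup>2)"
proof
  show "residual i s \<in> borel_measurable M"
    using residual_process assms by (rule measurable_process_component)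
  show "(LINT \<omega>|M. iexp (a * residual i s \<omega>)) = of_real (exp (- (a\<^sup>2 * (1 - (\<rho> i s)\<^sup>2)) / 2))" for a
    using residual_char1[of "{()}" "\<lambda>_. s" 0 i "\<lambda>_. a"] assms by (simp add: rho_0 power2_eq_square)
qed

lemma residual_L2_continuous: "L2_continuous M (residual i)"
proof (rule gaussian_family_L2_continuous[OF residual_gaussian])
  show "residual_cov i s t = residual_cov i t s" for s t by (simp add: rho_swap[of i s t] mult.commute)
  fix \<epsilon> :: real assume "0 < \<epsilon>"
  then obtain \<delta> where \<delta>: "0 < \<delta>" "\<And>h. \<bar>h\<bar> < \<delta> \<Longrightarrow> \<bar>\<rho> i h - 1\<bar> < \<epsilon> / 2"
    using rho_cont[of i, unfolded continuous_at_eps_delta, rule_format, of "\<epsilon> / 2"] by (auto simp: rho_0 dist_real_def)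
  show "\<exists>\<delta>>0. \<forall>s\<ge>0. \<forall>t\<ge>0. \<bar>t - s\<bar> < \<delta> \<longrightarrow> residual_cov i t t + residual_cov i s s - 2 * residual_cov i s t \<le> \<epsilon>"
  proof (intro exI[of _ \<delta>] conjI allI impI \<delta>(1))
    fix s t :: real assume "\<bar>t - s\<bar> < \<delta>"
    then have h1: "1 - \<rho> i (t - s) \<le> \<epsilon> / 2" using \<delta>(2)[of "t - s"] by linarith
    \<comment> \<open>Removing the projection on \<open>W i 0\<close> subtracts a square, so the
      increments of the residual are no larger in mean square than those of
      \<open>W i\<close>.\<close>
    have h2: "residual_cov i t t + residual_cov i s s - 2 * residual_cov i s t = 2 * (1 - \<rho> i (t - s)) - (\<rho> i t - \<rho> i s)\<^sup>2"
      by (simp add: rho_0 power2_eq_square algebra_simps)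
    have "0 \<le> (\<rho> i t - \<rho> i s)\<^sup>2" by simp
    then show "residual_cov i t t + residual_cov i s s - 2 * residual_cov i s t \<le> \<epsilon>"
      unfolding h2 using h1 by argo
  qed
qed

text \<open>Independence is required from the whole family of residuals over all components and
  times, as this is what freezing the initial vector asks for. It follows from the factorized
  characteristic function through cylinder events.\<close>

lemma indep_initial_residual:
  "indep_set (sigma_rv M borel (\<lambda>\<omega>. \<chi> i. W i 0 \<omega>)) (sigma_process M (UNIV \<times> {0..}) (case_prod residual))"
proof (rule indep_set_subset)
  have W0: "W i 0 \<in> borel_measurable M" for i by (rule measurable_process_component[OF W_process]) simp
  have R: "residual i t \<in> borel_measurable M" if "0 \<le> t" for i t
    using residual_process that by (rule measurable_process_component)
  show "indep_set (sigma_sets (space M) (cylinders M UNIV (\<lambda>i. W i 0)))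
      (sigma_sets (space M) (cylinders M (UNIV \<times> {0..}) (case_prod residual)))"
  proof (rule indep_set_cylinders)
    fix J :: "'m set" and L :: "('m \<times> real) set" and a :: "'m \<Rightarrow> real" and b :: "'m \<times> real \<Rightarrow> real"
    assume J: "finite J" and L: "finite L" "L \<subseteq> UNIV \<times> {0..}"
    \<comment> \<open>The finite set \<open>L\<close> may pair different components with different
      times; padding with zero coefficients makes it a full rectangle of components and
      times.\<close>
    define T where "T = snd ` L"
    define a' where "a' i = (if i \<in> J then a i else 0)" for i
    define b' where "b' i t = (if (i, t) \<in> L then b (i, t) else 0)" for i t
    have T: "finite T" "\<And>t. t \<in> T \<Longrightarrow> 0 \<le> t" using L by (auto simp: T_def)
    have eJ: "(\<Sum>i\<in>J. a i * W i 0 \<omega>) = (\<Sum>i\<in>UNIV. a' i * W i 0 \<omega>)" for \<omega>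
      unfolding a'_def by (rule sum.mono_neutral_cong_left) auto
    have eL: "(\<Sum>j\<in>L. b j * case_prod residual j \<omega>) = (\<Sum>i\<in>UNIV. \<Sum>t\<in>T. b' i t * residual i t \<omega>)" for \<omega>
    proof -
      have "(\<Sum>j\<in>L. b j * case_prod residual j \<omega>) = (\<Sum>j\<in>UNIV \<times> T. b' (fst j) (snd j) * residual (fst j) (snd j) \<omega>)"
        unfolding b'_def using L(1) by (intro sum.mono_neutral_cong_left) (force simp: T_def split: if_splits)+
      also have "\<dots> = (\<Sum>i\<in>UNIV. \<Sum>t\<in>T. b' i t * residual i t \<omega>)"
        by (simp add: sum.cartesian_product split_beta')
      finally show ?thesis .
    qed
    show "expectation (\<lambda>\<omega>. iexp ((\<Sum>i\<in>J. a i * W i 0 \<omega>) + (\<Sum>j\<in>L. b j * case_prod residual j \<omega>))) =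
      expectation (\<lambda>\<omega>. iexp (\<Sum>i\<in>J. a i * W i 0 \<omega>)) * expectation (\<lambda>\<omega>. iexp (\<Sum>j\<in>L. b j * case_prod residual j \<omega>))"
    proof -
      have e0: "complex_of_real (exp (- (x + y) / 2)) = of_real (exp (- (x + 0) / 2)) * of_real (exp (- (0\<^sup>2 + y) / 2))" for x y :: real
        by (simp add: diff_divide_distrib flip: of_real_mult exp_add)
      define q where "q b i = (\<Sum>s\<in>T. \<Sum>t\<in>T. b i s * b i t * residual_cov i s t)" for b :: "'m \<Rightarrow> real \<Rightarrow> real" and i
      have ch: "expectation (\<lambda>\<omega>. iexp (\<Sum>i\<in>UNIV. a i * W i 0 \<omega> + (\<Sum>t\<in>T. b i t * residual i t \<omega>))) =
          (\<Prod>i\<in>UNIV. of_real (exp (- ((a i)\<^sup>2 + q b i) / 2)))" for a b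
        unfolding q_def using T by (rule residual_char)
      have q0: "q (\<lambda>_ _. 0) i = 0" for i by (simp add: q_def)
      have "expectation (\<lambda>\<omega>. iexp (\<Sum>i\<in>UNIV. a' i * W i 0 \<omega> + (\<Sum>t\<in>T. b' i t * residual i t \<omega>))) =
          expectation (\<lambda>\<omega>. iexp (\<Sum>i\<in>UNIV. a' i * W i 0 \<omega> + (\<Sum>t\<in>T. 0 * residual i t \<omega>))) *
          expectation (\<lambda>\<omega>. iexp (\<Sum>i\<in>UNIV. 0 * W i 0 \<omega> + (\<Sum>t\<in>T. b' i t * residual i t \<omega>)))"
        unfolding ch[of a' b'] ch[of a' "\<lambda>_ _. 0"] ch[of "\<lambda>_. 0" b'] q0 prod.distrib[symmetric]
        by (intro prod.cong refl e0)
      then show ?thesis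
        unfolding eJ eL by (simp only: sum.distrib mult_zero_left sum.neutral_const add_0_left add_0_right)
    qed
  qed (use W0 R in auto)
  have sub1: "cylinders M UNIV (\<lambda>i. W i 0) \<subseteq> Pow (space M)"
    and sub2: "cylinders M (UNIV \<times> {0..}) (case_prod residual) \<subseteq> Pow (space M)"
    by (auto simp: cylinders_def)
  show "sigma_rv M borel (\<lambda>\<omega>. \<chi> i. W i 0 \<omega>) \<subseteq> sigma_sets (space M) (cylinders M UNIV (\<lambda>i. W i 0))"
    by (intro sigma_rv_subset sub1 borel_measurable_vec_lambda cylinders_measurable) simp
  show "sigma_process M (UNIV \<times> {0..}) (case_prod residual) \<subseteq> sigma_sets (space M) (cylinders M (UNIV \<times> {0..}) (case_prod residual))"
    unfolding sigma_process_def by (intro sigma_rv_subset sub2 measurable_restrict cylinders_measurable)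
qed

end

section \<open>Convergence of the rescaled excess after an exceedance\<close>

context local_chi_square begin

text \<open>The radius of the polar substitution for the level \<open>v\<close> and the excess
  parameter \<open>z\<close>.\<close>

definition amp :: "real \<Rightarrow> real \<Rightarrow> real" where
  "amp v z = sqrt v + z / sqrt v"

definition rtime :: "real \<Rightarrow> real \<Rightarrow> real" where
  "rtime v w = \<bar>w\<bar> / v powr (1 / \<alpha>)"

text \<open>
  Given \<open>W 0 = x\<close>, this is \<open>|W(s)|\<^sup>2 - v\<close> at the rescaled time \<open>s\<close>; the modulus in \<open>rtime\<close> only
  makes the processes total in \<open>w\<close>.
\<close>

definition excess :: "real \<Rightarrow> real ^ 'm \<Rightarrow> real \<Rightarrow> 'w \<Rightarrow> real" where
  "excess v x w \<omega> = (\<Sum>i\<in>UNIV. (\<rho> i (rtime v w) * x $ i + residual i (rtime v w) \<omega>)\<^sup>2) - v"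

definition excess_limit :: "real ^ 'm \<Rightarrow> real \<Rightarrow> real \<Rightarrow> 'w \<Rightarrow> real" where
  "excess_limit e z w \<omega> =
     2 * ((\<Sum>i\<in>UNIV. Z i \<bar>w\<bar> \<omega> * e $ i) - (\<Sum>i\<in>UNIV. c i * (e $ i)\<^sup>2 * \<bar>w\<bar> powr \<alpha>) + z)"

lemma excess_measurable: "(\<lambda>(w, \<omega>). excess v x w \<omega>) \<in> borel_measurable (borel \<Otimes>\<^sub>M M)"
proof -
  have [measurable]: "(\<lambda>q. residual i (rtime v (fst q)) (snd q)) \<in> borel_measurable (borel \<Otimes>\<^sub>M M)" for i
    by (rule measurable_process_comp[OF residual_process]) (auto simp: rtime_def)
  have [measurable]: "rtime v \<in> borel_measurable borel" unfolding rtime_def by measurable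
  show ?thesis unfolding excess_def split_beta' by measurable
qed

lemma excess_limit_measurable: "(\<lambda>(w, \<omega>). excess_limit e z w \<omega>) \<in> borel_measurable (borel \<Otimes>\<^sub>M M)"
proof -
  have [measurable]: "(\<lambda>q. Z i \<bar>fst q\<bar> (snd q)) \<in> borel_measurable (borel \<Otimes>\<^sub>M M)" for i
    by (rule measurable_process_comp[OF Z_process]) auto
  show ?thesis unfolding excess_limit_def split_beta' by measurable
qed

lemma excess_rv: "excess v x w \<in> borel_measurable M" "excess_limit e z w \<in> borel_measurable M"
  using measurable_compose[OF measurable_Pair1' excess_measurable, of w v x]
    measurable_compose[OF measurable_Pair1' excess_limit_measurable, of w e z] by simp_all

lemma limit_char:
  assumes J: "finite J" "J \<subseteq> {0..}"
  shows "expectation (\<lambda>\<omega>. iexp (\<Sum>i\<in>UNIV. \<Sum>w\<in>J. \<beta> i w * Z i w \<omega>)) =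
    (\<Prod>i\<in>UNIV. of_real (exp (- (\<Sum>s\<in>J. \<Sum>t\<in>J. \<beta> i s * \<beta> i t * (c i * (t powr \<alpha> + s powr \<alpha> - \<bar>t - s\<bar> powr \<alpha>))) / 2)))"
proof -
  have m: "(\<lambda>p. p t) \<in> borel_measurable (\<Pi>\<^sub>M t\<in>{0..}. borel)" if "0 \<le> t" for t :: real
    by (rule measurable_component_singleton) (use that in auto)
  have "expectation (\<lambda>\<omega>. iexp (\<Sum>i\<in>UNIV. \<Sum>w\<in>J. \<beta> i w * Z i w \<omega>)) =
    (\<Prod>i\<in>UNIV. expectation (\<lambda>\<omega>. iexp (\<Sum>w\<in>J. \<beta> i w * Z i w \<omega>)))"
  proof (rule indep_paths_char(1)[OF Z_indep])
    show "(\<lambda>p. \<Sum>w\<in>J. \<beta> i w * p w) \<in> borel_measurable (\<Pi>\<^sub>M t\<in>{0..}. borel)" for i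
      using J m by (intro borel_measurable_sum borel_measurable_times borel_measurable_const m) auto
    show "(\<Sum>w\<in>J. \<beta> i w * Z i w \<omega>) = (\<Sum>w\<in>J. \<beta> i w * (\<lambda>t\<in>{0..}. Z i t \<omega>) w)" for i \<omega>
      using J by (intro sum.cong) auto
  qed
  also have "\<dots> = (\<Prod>i\<in>UNIV. of_real (exp (- (\<Sum>s\<in>J. \<Sum>t\<in>J. \<beta> i s * \<beta> i t * (c i * (t powr \<alpha> + s powr \<alpha> - \<bar>t - s\<bar> powr \<alpha>))) / 2)))"
    using J by (intro prod.cong refl gaussian_family_char[OF Z_gaussian]) auto
  finally show ?thesis .
qed

text \<open>The random part is a linear form in independent normals; one moving component suffices
  for positive variance because every coordinate of the direction is nonzero. This supplies the
  continuity point required by the continuity theorem.\<close>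

lemma limit_no_atom:
  assumes w: "0 < w" and e: "\<And>i. e $ i \<noteq> 0" and c: "\<exists>i. 0 < c i"
  shows "prob {\<omega> \<in> space M. excess_limit e z w \<omega> = 0} = 0"
proof -
  let ?V = "\<Sum>i\<in>UNIV. (e $ i)\<^sup>2 * (2 * c i * w powr \<alpha>)"
  have [measurable]: "Z i w \<in> borel_measurable M" for i
    using Z_process w by (intro measurable_process_component) auto
  have "0 < (e $ i)\<^sup>2 * (2 * c i * w powr \<alpha>)" if "0 < c i" for i using that e w by simp
  moreover have "0 \<le> (e $ i)\<^sup>2 * (2 * c i * w powr \<alpha>)" for i using c_nonneg by simp
  ultimately have V: "0 < ?V" using c by (metis (no_types, lifting) UNIV_I finite sum_pos2)
  interpret N: centered_normal M "\<lambda>\<omega>. \<Sum>i\<in>UNIV. Z i w \<omega> * e $ i" ?V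
  proof
    fix a :: real
    have "(LINT \<omega>|M. iexp (a * (\<Sum>i\<in>UNIV. Z i w \<omega> * e $ i)))
        = expectation (\<lambda>\<omega>. iexp (\<Sum>i\<in>UNIV. \<Sum>w\<in>{w}. a * e $ i * Z i w \<omega>))"
      by (simp add: sum_distrib_left mult_ac)
    also have "\<dots> = (\<Prod>i\<in>UNIV. of_real (exp (- (a\<^sup>2 * ((e $ i)\<^sup>2 * (2 * c i * w powr \<alpha>))) / 2)))"
      using w by (subst limit_char) (auto simp: power2_eq_square mult_ac)
    also have "\<dots> = of_real (exp (- (a\<^sup>2 * ?V) / 2))"
      by (simp add: sum_distrib_left sum_divide_distrib sum_negf flip: of_real_prod exp_sum)
    finally show "(LINT \<omega>|M. iexp (a * (\<Sum>i\<in>UNIV. Z i w \<omega> * e $ i))) = of_real (exp (- (a\<^sup>2 * ?V) / 2))" .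
  qed simp
  have "{\<omega> \<in> space M. excess_limit e z w \<omega> = 0} =
      {\<omega> \<in> space M. (\<Sum>i\<in>UNIV. Z i w \<omega> * e $ i) = (\<Sum>i\<in>UNIV. c i * (e $ i)\<^sup>2 * \<bar>w\<bar> powr \<alpha>) - z}"
    using w by (auto simp: excess_limit_def)
  then show ?thesis using N.no_atom[OF V] by simp
qed

context
  fixes v :: "nat \<Rightarrow> real" and e :: "real ^ 'm" and z :: real
  assumes v1: "\<And>n. 1 \<le> v n" and v_lim: "filterlim v at_top sequentially"
    and e_norm: "norm e = 1"
begin

lemma v_pos: "0 < v n" using v1[of n] by linarith

lemma e_sq: "(\<Sum>i\<in>UNIV. (e $ i)\<^sup>2) = 1"
  using e_norm by (simp add: norm_vec_def L2_set_def)

lemma inverse_v_lim: "(\<lambda>n. a / v n) \<longlonglongrightarrow> 0"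
  by (rule real_tendsto_divide_at_top[OF tendsto_const v_lim])

lemma amp_sq: "(amp (v n) z)\<^sup>2 = v n + 2 * z + z\<^sup>2 / v n"
  using v_pos[of n] by (simp add: amp_def power2_sum power_divide)

lemma amp_ratio_lim: "(\<lambda>n. (amp (v n) z)\<^sup>2 / v n) \<longlonglongrightarrow> 1"
proof -
  have "(\<lambda>n. 1 + (2 * z) / v n + (z\<^sup>2 / v n) / v n) \<longlonglongrightarrow> 1 + 0 + 0"
    by (intro tendsto_intros inverse_v_lim real_tendsto_divide_at_top[OF inverse_v_lim v_lim])
  moreover have "(amp (v n) z)\<^sup>2 / v n = 1 + (2 * z) / v n + (z\<^sup>2 / v n) / v n" for n
    using v_pos[of n] by (simp add: amp_sq add_divide_distrib)
  ultimately show ?thesis by simp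
qed

lemma scaled_time_lim: "(\<lambda>n. a / v n powr (1 / \<alpha>)) \<longlonglongrightarrow> 0"
proof (rule real_tendsto_divide_at_top[OF tendsto_const])
  show "filterlim (\<lambda>n. v n powr (1 / \<alpha>)) at_top sequentially"
  proof -
    have "filterlim (\<lambda>x::real. x powr (1 / \<alpha>)) at_top at_top" using alpha by real_asymp
    from filterlim_compose[OF this v_lim] show ?thesis .
  qed
qed

lemma rho_seq: "(\<lambda>n. v n * (1 - \<rho> i (a / v n powr (1 / \<alpha>)))) \<longlonglongrightarrow> c i * \<bar>a\<bar> powr \<alpha>"
  by (rule filterlim_compose[OF rho_lim v_lim])

lemma rho_seq_1: "(\<lambda>n. \<rho> i (a / v n powr (1 / \<alpha>))) \<longlonglongrightarrow> 1"
  using isCont_tendsto_compose[OF rho_cont scaled_time_lim] by (simp add: rho_0)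

text \<open>The identity \<open>k - a * b = (1 - a) + a * (1 - b) - (1 - k)\<close> splits the
  residual covariance into three deviations of a correlation from 1. The squared amplitude is
  asymptotic to \<open>v n\<close>, and each deviation times \<open>v n\<close> has a limit on the
  time scale \<open>v n powr (- 1 / \<alpha>)\<close>.\<close>

lemma cov_seq:
  assumes "0 \<le> s" "0 \<le> t"
  shows "(\<lambda>n. (amp (v n) z)\<^sup>2 * residual_cov i (rtime (v n) s) (rtime (v n) t)) \<longlonglongrightarrow>
    c i * (t powr \<alpha> + s powr \<alpha> - \<bar>t - s\<bar> powr \<alpha>)"
proof -
  let ?u = "\<lambda>n. v n powr (1 / \<alpha>)"
  have lim: "(\<lambda>n. (amp (v n) z)\<^sup>2 / v n * (v n * (1 - \<rho> i (s / ?u n)) + \<rho> i (s / ?u n) * (v n * (1 - \<rho> i (t / ?u n)))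
      - v n * (1 - \<rho> i ((t - s) / ?u n))))
      \<longlonglongrightarrow> 1 * (c i * \<bar>s\<bar> powr \<alpha> + 1 * (c i * \<bar>t\<bar> powr \<alpha>) - c i * \<bar>t - s\<bar> powr \<alpha>)"
    by (intro tendsto_intros amp_ratio_lim rho_seq rho_seq_1)
  have eq: "(amp (v n) z)\<^sup>2 / v n * (v n * (1 - \<rho> i (s / ?u n)) + \<rho> i (s / ?u n) * (v n * (1 - \<rho> i (t / ?u n)))
      - v n * (1 - \<rho> i ((t - s) / ?u n))) = (amp (v n) z)\<^sup>2 * residual_cov i (rtime (v n) s) (rtime (v n) t)" for n
  proof -
    have gen: "a / x * (x * p + r * (x * q) - x * k) = a * (p + r * q - k)" if "x \<noteq> 0" for a x p q r k :: real
      using that by (simp add: field_simps)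
    have nz: "v n \<noteq> 0" using v_pos[of n] by simp
    have alg: "1 - a + a * (1 - b) - (1 - k) = k - a * b" for a b k :: real
      by (simp add: algebra_simps)
    have r: "rtime (v n) s = s / ?u n" "rtime (v n) t = t / ?u n"
      and d: "(t - s) / ?u n = t / ?u n - s / ?u n"
      using assms by (simp_all add: rtime_def diff_divide_distrib)
    show ?thesis unfolding gen[OF nz] alg r d ..
  qed
  have "1 * (c i * \<bar>s\<bar> powr \<alpha> + 1 * (c i * \<bar>t\<bar> powr \<alpha>) - c i * \<bar>t - s\<bar> powr \<alpha>) =
      c i * (t powr \<alpha> + s powr \<alpha> - \<bar>t - s\<bar> powr \<alpha>)"
    using assms by (simp add: algebra_simps)
  then show ?thesis using lim unfolding eq by simp
qed

text \<open>For a unit direction the squared amplitude exceeds the level by \<open>2 * z\<close> in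
  the limit. The correlations lose the factor
  \<open>1 - \<rho>\<^sup>2 = (1 - \<rho>) * (1 + \<rho>)\<close>, whose second factor tends to 2;
  hence the common factor 2 of excess and drift.\<close>

lemma mean_seq:
  assumes "0 \<le> w"
  shows "(\<lambda>n. (\<Sum>i\<in>UNIV. (\<rho> i (rtime (v n) w) * (amp (v n) z * e $ i))\<^sup>2) - v n) \<longlonglongrightarrow>
    2 * (z - (\<Sum>i\<in>UNIV. c i * (e $ i)\<^sup>2 * w powr \<alpha>))"
proof -
  let ?u = "\<lambda>n. v n powr (1 / \<alpha>)"
  let ?r = "\<lambda>i n. \<rho> i (w / ?u n)"
  have "(\<lambda>n. (2 * z + z\<^sup>2 / v n) - (\<Sum>i\<in>UNIV. (amp (v n) z)\<^sup>2 / v n * (v n * (1 - ?r i n)) * (1 + ?r i n) * (e $ i)\<^sup>2))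
      \<longlonglongrightarrow> (2 * z + 0) - (\<Sum>i\<in>UNIV. 1 * (c i * \<bar>w\<bar> powr \<alpha>) * (1 + 1) * (e $ i)\<^sup>2)"
    by (intro tendsto_intros amp_ratio_lim rho_seq rho_seq_1 inverse_v_lim)
  moreover have "(\<Sum>i\<in>UNIV. (?r i n * (amp (v n) z * e $ i))\<^sup>2) - v n =
      (2 * z + z\<^sup>2 / v n) - (\<Sum>i\<in>UNIV. (amp (v n) z)\<^sup>2 / v n * (v n * (1 - ?r i n)) * (1 + ?r i n) * (e $ i)\<^sup>2)" for n
  proof -
    let ?A = "(amp (v n) z)\<^sup>2"
    have "(\<Sum>i\<in>UNIV. ?A / v n * (v n * (1 - ?r i n)) * (1 + ?r i n) * (e $ i)\<^sup>2)
        = (\<Sum>i\<in>UNIV. ?A * (e $ i)\<^sup>2 - (?r i n * (amp (v n) z * e $ i))\<^sup>2)"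
      using v_pos[of n] by (intro sum.cong refl) (simp add: power2_eq_square algebra_simps)
    also have "\<dots> = ?A - (\<Sum>i\<in>UNIV. (?r i n * (amp (v n) z * e $ i))\<^sup>2)"
      by (simp add: sum_subtractf e_sq flip: sum_distrib_left)
    finally show ?thesis by (simp add: amp_sq)
  qed
  ultimately have "(\<lambda>n. (\<Sum>i\<in>UNIV. (?r i n * (amp (v n) z * e $ i))\<^sup>2) - v n) \<longlonglongrightarrow>
      (2 * z + 0) - (\<Sum>i\<in>UNIV. 1 * (c i * \<bar>w\<bar> powr \<alpha>) * (1 + 1) * (e $ i)\<^sup>2)" by simp
  also have "(2 * z + 0) - (\<Sum>i\<in>UNIV. 1 * (c i * \<bar>w\<bar> powr \<alpha>) * (1 + 1) * (e $ i)\<^sup>2)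
      = 2 * (z - (\<Sum>i\<in>UNIV. c i * (e $ i)\<^sup>2 * w powr \<alpha>))"
    using assms by (simp add: right_diff_distrib sum_distrib_left mult_ac)
  finally show ?thesis using assms by (simp add: rtime_def)
qed

text \<open>Expanding the squares gives a deterministic part \<open>m\<close>, a part linear in the
  residuals, and the squared residuals \<open>Q\<close>. The last has mean tending to 0 and is
  dropped by the Lipschitz bound for \<open>iexp\<close>. What remains is exactly Gaussian, so its
  transform is explicit and only its mean and quadratic form have to converge.\<close>

lemma excess_char_limit:
  assumes J: "finite J" "J \<subseteq> {0..}"
  shows "(\<lambda>n. expectation (\<lambda>\<omega>. iexp (\<Sum>w\<in>J. b w * excess (v n) (amp (v n) z *\<^sub>R e) w \<omega>))) \<longlonglongrightarrow>
    expectation (\<lambda>\<omega>. iexp (\<Sum>w\<in>J. b w * excess_limit e z w \<omega>))"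
proof -
  define m where "m n w = (\<Sum>i\<in>UNIV. (\<rho> i (rtime (v n) w) * (amp (v n) z * e $ i))\<^sup>2) - v n" for n w
  define \<beta> where "\<beta> n i w = amp (v n) z * (2 * b w * e $ i * \<rho> i (rtime (v n) w))" for n i w
  define lin where "lin n \<omega> = (\<Sum>w\<in>J. b w * m n w) + (\<Sum>i\<in>UNIV. \<Sum>w\<in>J. \<beta> n i w * residual i (rtime (v n) w) \<omega>)" for n \<omega>
  define Q where "Q n w \<omega> = (\<Sum>i\<in>UNIV. (residual i (rtime (v n) w) \<omega>)\<^sup>2)" for n w \<omega>
  have rt: "0 \<le> rtime (v n) w" for n w by (simp add: rtime_def)
  have [measurable]: "residual i (rtime (v n) w) \<in> borel_measurable M" for i n w
    using residual_process rt by (rule measurable_process_component)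
  have [measurable]: "lin n \<in> borel_measurable M" "Q n w \<in> borel_measurable M" for n w
    unfolding lin_def Q_def by measurable
  note [measurable] = excess_rv
  have split: "(\<Sum>w\<in>J. b w * excess (v n) (amp (v n) z *\<^sub>R e) w \<omega>) = lin n \<omega> + (\<Sum>w\<in>J. b w * Q n w \<omega>)" for n \<omega>
  proof -
    have "b w * excess (v n) (amp (v n) z *\<^sub>R e) w \<omega> =
        b w * m n w + (\<Sum>i\<in>UNIV. \<beta> n i w * residual i (rtime (v n) w) \<omega>) + b w * Q n w \<omega>" for w
      by (simp add: excess_def m_def \<beta>_def Q_def power2_sum sum.distrib algebra_simps sum_distrib_left)
    then show ?thesis
      unfolding lin_def by (simp add: sum.distrib) (rule sum.swap)
  qed
  have Qint: "integrable M (Q n w)" and QE: "expectation (Q n w) = (\<Sum>i\<in>UNIV. 1 - (\<rho> i (rtime (v n) w))\<^sup>2)" for n w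
  proof -
    have i: "integrable M (\<lambda>\<omega>. (residual i (rtime (v n) w) \<omega>)\<^sup>2)"
      "expectation (\<lambda>\<omega>. (residual i (rtime (v n) w) \<omega>)\<^sup>2) = 1 - (\<rho> i (rtime (v n) w))\<^sup>2" for i
      using centered_normal.second_moment[OF residual_normal[OF rt]] by auto
    show "integrable M (Q n w)" unfolding Q_def using i by simp
    show "expectation (Q n w) = (\<Sum>i\<in>UNIV. 1 - (\<rho> i (rtime (v n) w))\<^sup>2)"
      unfolding Q_def using i by (subst Bochner_Integration.integral_sum) auto
  qed
  have diff: "(\<lambda>n. expectation (\<lambda>\<omega>. iexp (\<Sum>w\<in>J. b w * excess (v n) (amp (v n) z *\<^sub>R e) w \<omega>)) - expectation (\<lambda>\<omega>. iexp (lin n \<omega>))) \<longlonglongrightarrow> 0"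
  proof (rule tendsto_norm_zero_cancel, rule tendsto_sandwich[OF _ _ tendsto_const])
    have "norm (expectation (\<lambda>\<omega>. iexp (\<Sum>w\<in>J. b w * excess (v n) (amp (v n) z *\<^sub>R e) w \<omega>)) - expectation (\<lambda>\<omega>. iexp (lin n \<omega>)))
        \<le> (\<Sum>w\<in>J. \<bar>b w\<bar> * (\<Sum>i\<in>UNIV. 1 - (\<rho> i (rtime (v n) w))\<^sup>2))" for n
    proof -
      let ?A = "\<lambda>\<omega>. lin n \<omega> + (\<Sum>w\<in>J. b w * Q n w \<omega>)"
      have i: "integrable M (\<lambda>\<omega>. iexp (?A \<omega>))" "integrable M (\<lambda>\<omega>. iexp (lin n \<omega>))"
        by (rule integrable_iexp; simp)+
      have "norm (expectation (\<lambda>\<omega>. iexp (?A \<omega>)) - expectation (\<lambda>\<omega>. iexp (lin n \<omega>)))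
          = norm (expectation (\<lambda>\<omega>. iexp (?A \<omega>) - iexp (lin n \<omega>)))"
        by (subst Bochner_Integration.integral_diff[OF i]) (rule refl)
      also have "\<dots> \<le> expectation (\<lambda>\<omega>. norm (iexp (?A \<omega>) - iexp (lin n \<omega>)))"
        by (rule integral_norm_bound)
      also have "\<dots> \<le> expectation (\<lambda>\<omega>. \<Sum>w\<in>J. \<bar>b w\<bar> * Q n w \<omega>)"
      proof (rule integral_mono)
        show "integrable M (\<lambda>\<omega>. norm (iexp (?A \<omega>) - iexp (lin n \<omega>)))"
          by (intro integrable_norm Bochner_Integration.integrable_diff i)
        show "integrable M (\<lambda>\<omega>. \<Sum>w\<in>J. \<bar>b w\<bar> * Q n w \<omega>)" using Qint by simp
        show "norm (iexp (?A \<omega>) - iexp (lin n \<omega>)) \<le> (\<Sum>w\<in>J. \<bar>b w\<bar> * Q n w \<omega>)" for \<omega>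
        proof -
          have "norm (iexp (?A \<omega>) - iexp (lin n \<omega>)) \<le> \<bar>\<Sum>w\<in>J. b w * Q n w \<omega>\<bar>"
            using norm_iexp_diff[of "?A \<omega>" "lin n \<omega>"] by simp
          also have "\<dots> \<le> (\<Sum>w\<in>J. \<bar>b w * Q n w \<omega>\<bar>)" by (rule sum_abs)
          also have "\<dots> = (\<Sum>w\<in>J. \<bar>b w\<bar> * Q n w \<omega>)"
            by (simp add: abs_mult Q_def sum_nonneg)
          finally show ?thesis .
        qed
      qed
      also have "\<dots> = (\<Sum>w\<in>J. \<bar>b w\<bar> * (\<Sum>i\<in>UNIV. 1 - (\<rho> i (rtime (v n) w))\<^sup>2))"
        using Qint by (simp add: QE)
      finally show ?thesis unfolding split .
    qed
    then show "\<forall>\<^sub>F n in sequentially. norm (expectation (\<lambda>\<omega>. iexp (\<Sum>w\<in>J. b w * excess (v n) (amp (v n) z *\<^sub>R e) w \<omega>)) - expectation (\<lambda>\<omega>. iexp (lin n \<omega>)))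
        \<le> (\<Sum>w\<in>J. \<bar>b w\<bar> * (\<Sum>i\<in>UNIV. 1 - (\<rho> i (rtime (v n) w))\<^sup>2))" by simp
    have "(\<lambda>n. \<Sum>w\<in>J. \<bar>b w\<bar> * (\<Sum>i\<in>UNIV. 1 - (\<rho> i (rtime (v n) w))\<^sup>2)) \<longlonglongrightarrow> (\<Sum>w\<in>J. \<bar>b w\<bar> * (\<Sum>i\<in>(UNIV :: 'm set). 1 - 1\<^sup>2))"
      unfolding rtime_def by (intro tendsto_intros rho_seq_1)
    then show "(\<lambda>n. \<Sum>w\<in>J. \<bar>b w\<bar> * (\<Sum>i\<in>UNIV. 1 - (\<rho> i (rtime (v n) w))\<^sup>2)) \<longlonglongrightarrow> 0" by simp
  qed simp
  define q where "q n i = (\<Sum>s\<in>J. \<Sum>t\<in>J. \<beta> n i s * \<beta> n i t * residual_cov i (rtime (v n) s) (rtime (v n) t))" for n i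
  define q' where "q' i = (\<Sum>s\<in>J. \<Sum>t\<in>J. (2 * b s * e $ i) * (2 * b t * e $ i) * (c i * (t powr \<alpha> + s powr \<alpha> - \<bar>t - s\<bar> powr \<alpha>)))" for i
  have q_lim: "(\<lambda>n. q n i) \<longlonglongrightarrow> q' i" for i
  proof -
    have "(\<lambda>n. \<Sum>s\<in>J. \<Sum>t\<in>J. (2 * b s * e $ i * \<rho> i (rtime (v n) s)) * (2 * b t * e $ i * \<rho> i (rtime (v n) t)) *
        ((amp (v n) z)\<^sup>2 * residual_cov i (rtime (v n) s) (rtime (v n) t))) \<longlonglongrightarrow>
      (\<Sum>s\<in>J. \<Sum>t\<in>J. (2 * b s * e $ i * 1) * (2 * b t * e $ i * 1) * (c i * (t powr \<alpha> + s powr \<alpha> - \<bar>t - s\<bar> powr \<alpha>)))"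
    proof (intro tendsto_sum tendsto_mult[OF _ cov_seq])
      show "(\<lambda>n. (2 * b s * e $ i * \<rho> i (rtime (v n) s)) * (2 * b t * e $ i * \<rho> i (rtime (v n) t)))
          \<longlonglongrightarrow> (2 * b s * e $ i * 1) * (2 * b t * e $ i * 1)" for s t
        unfolding rtime_def by (intro tendsto_intros rho_seq_1)
    qed (use J in auto)
    then show ?thesis unfolding q_def q'_def \<beta>_def by (simp add: power2_eq_square mult_ac)
  qed
  have lin_char: "expectation (\<lambda>\<omega>. iexp (lin n \<omega>)) = iexp (\<Sum>w\<in>J. b w * m n w) * (\<Prod>i\<in>UNIV. of_real (exp (- q n i / 2)))" for n
  proof -
    have "expectation (\<lambda>\<omega>. iexp (lin n \<omega>)) = expectation (\<lambda>\<omega>. iexp (\<Sum>w\<in>J. b w * m n w) *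
        iexp (\<Sum>i\<in>UNIV. 0 * W i 0 \<omega> + (\<Sum>w\<in>J. \<beta> n i w * residual i (rtime (v n) w) \<omega>)))"
      unfolding lin_def by (simp add: distrib_left exp_add del: of_real_sum of_real_mult)
    also have "\<dots> = iexp (\<Sum>w\<in>J. b w * m n w) *
        expectation (\<lambda>\<omega>. iexp (\<Sum>i\<in>UNIV. 0 * W i 0 \<omega> + (\<Sum>w\<in>J. \<beta> n i w * residual i (rtime (v n) w) \<omega>)))"
      by (rule integral_mult_right_zero)
    also have "expectation (\<lambda>\<omega>. iexp (\<Sum>i\<in>UNIV. 0 * W i 0 \<omega> + (\<Sum>w\<in>J. \<beta> n i w * residual i (rtime (v n) w) \<omega>))) =
        (\<Prod>i\<in>UNIV. of_real (exp (- (0\<^sup>2 + q n i) / 2)))"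
      unfolding q_def by (rule residual_char[OF J(1) rt])
    finally show ?thesis by simp
  qed
  have m_lim: "(\<lambda>n. m n w) \<longlonglongrightarrow> 2 * (z - (\<Sum>i\<in>UNIV. c i * (e $ i)\<^sup>2 * w powr \<alpha>))" if "w \<in> J" for w
    unfolding m_def using that J by (intro mean_seq) auto
  let ?mu = "\<Sum>w\<in>J. b w * (2 * (z - (\<Sum>i\<in>UNIV. c i * (e $ i)\<^sup>2 * w powr \<alpha>)))"
  have "(\<lambda>n. expectation (\<lambda>\<omega>. iexp (lin n \<omega>))) \<longlonglongrightarrow> iexp ?mu * (\<Prod>i\<in>UNIV. of_real (exp (- q' i / 2)))"
    unfolding lin_char by (intro tendsto_intros q_lim m_lim) simp_all
  also have "iexp ?mu * (\<Prod>i\<in>UNIV. of_real (exp (- q' i / 2))) = expectation (\<lambda>\<omega>. iexp (\<Sum>w\<in>J. b w * excess_limit e z w \<omega>))"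
  proof -
    have "(\<Sum>w\<in>J. b w * excess_limit e z w \<omega>) = ?mu + (\<Sum>i\<in>UNIV. \<Sum>w\<in>J. 2 * b w * e $ i * Z i w \<omega>)" for \<omega>
    proof -
      have "b w * excess_limit e z w \<omega> = b w * (2 * (z - (\<Sum>i\<in>UNIV. c i * (e $ i)\<^sup>2 * w powr \<alpha>))) +
          (\<Sum>i\<in>UNIV. 2 * b w * e $ i * Z i w \<omega>)" if "w \<in> J" for w
        using that J by (auto simp: excess_limit_def algebra_simps sum_distrib_left)
      then have "(\<Sum>w\<in>J. b w * excess_limit e z w \<omega>) = ?mu + (\<Sum>w\<in>J. \<Sum>i\<in>UNIV. 2 * b w * e $ i * Z i w \<omega>)"
        by (simp add: sum.distrib)
      also have "(\<Sum>w\<in>J. \<Sum>i\<in>UNIV. 2 * b w * e $ i * Z i w \<omega>) = (\<Sum>i\<in>UNIV. \<Sum>w\<in>J. 2 * b w * e $ i * Z i w \<omega>)"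
        by (rule sum.swap)
      finally show ?thesis .
    qed
    then have "expectation (\<lambda>\<omega>. iexp (\<Sum>w\<in>J. b w * excess_limit e z w \<omega>)) =
        expectation (\<lambda>\<omega>. iexp ?mu * iexp (\<Sum>i\<in>UNIV. \<Sum>w\<in>J. 2 * b w * e $ i * Z i w \<omega>))"
      by (simp add: distrib_left exp_add del: of_real_sum of_real_mult)
    also have "\<dots> = iexp ?mu * expectation (\<lambda>\<omega>. iexp (\<Sum>i\<in>UNIV. \<Sum>w\<in>J. 2 * b w * e $ i * Z i w \<omega>))"
      by (rule integral_mult_right_zero)
    finally show ?thesis unfolding limit_char[OF J] q'_def by simp
  qed
  finally have "(\<lambda>n. expectation (\<lambda>\<omega>. iexp (lin n \<omega>))) \<longlonglongrightarrow> expectation (\<lambda>\<omega>. iexp (\<Sum>w\<in>J. b w * excess_limit e z w \<omega>))" .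
  from tendsto_add[OF diff this] show ?thesis by simp
qed

text \<open>Transforms are converted into probabilities of joint positivity by the exchange of
  exponentials for indicators, started with the constant weight 1; the occupation time then follows
  by moments.\<close>

lemma excess_occupation_limit:
  assumes e_nz: "\<And>i. e $ i \<noteq> 0" and c: "\<exists>i. 0 < c i" and T: "0 \<le> T" and F: "continuous_on UNIV (F :: real \<Rightarrow> real)"
  shows "(\<lambda>n. expectation (\<lambda>\<omega>. F (occupation (excess (v n) (amp (v n) z *\<^sub>R e)) T \<omega>))) \<longlonglongrightarrow>
    expectation (\<lambda>\<omega>. F (occupation (excess_limit e z) T \<omega>))"
proof (rule occupation_limit[OF excess_measurable excess_limit_measurable T _ F])
  fix J :: "real set" assume J: "finite J" "J \<subseteq> {0<..}"
  then have J0: "J \<subseteq> {0..}" by auto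
  let ?D = "\<lambda>n. excess (v n) (amp (v n) z *\<^sub>R e)" and ?D' = "excess_limit e z"
  have "(\<lambda>n. expectation (\<lambda>\<omega>. (\<Prod>w\<in>J. indicator {0<..} (?D n w \<omega>)) * (1::complex)))
    \<longlonglongrightarrow> expectation (\<lambda>\<omega>. (\<Prod>w\<in>J. indicator {0<..} (?D' w \<omega>)) * 1)"
  proof (rule levy_weight_finite[OF J(1)])
    show "prob {\<omega> \<in> space M. ?D' w \<omega> = 0} = 0" if "w \<in> J" for w
      using that J by (intro limit_no_atom e_nz c) auto
    show "(\<lambda>n. expectation (\<lambda>\<omega>. iexp (t * ?D n w \<omega>))) \<longlonglongrightarrow> expectation (\<lambda>\<omega>. iexp (t * ?D' w \<omega>))" if "w \<in> J" for w t
      using excess_char_limit[of "{w}" "\<lambda>_. t"] that J by auto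
    show "(\<lambda>n. expectation (\<lambda>\<omega>. iexp (\<Sum>w\<in>J. b w * ?D n w \<omega>) * 1)) \<longlonglongrightarrow> expectation (\<lambda>\<omega>. iexp (\<Sum>w\<in>J. b w * ?D' w \<omega>) * 1)" for b
      using excess_char_limit[OF J(1) J0, of b] by simp
  qed (auto simp: excess_rv)
  moreover have "expectation (\<lambda>\<omega>. (\<Prod>w\<in>J. indicator {0<..} (D w \<omega>)) * (1::complex)) =
      of_real (expectation (\<lambda>\<omega>. \<Prod>w\<in>J. indicator {0<..} (D w \<omega>)))" for D :: "real \<Rightarrow> 'w \<Rightarrow> real"
  proof -
    have "(\<Prod>w\<in>J. indicator {0<..} (D w \<omega>)) * (1::complex) = of_real (\<Prod>w\<in>J. indicator {0<..} (D w \<omega>))" for \<omega>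
      by (auto simp: indicator_def intro!: prod.cong)
    then show ?thesis by (simp only: integral_complex_of_real)
  qed
  ultimately show "(\<lambda>n. expectation (\<lambda>\<omega>. \<Prod>w\<in>J. indicator {0<..} (?D n w \<omega>)) :: real)
    \<longlonglongrightarrow> expectation (\<lambda>\<omega>. \<Prod>w\<in>J. indicator {0<..} (?D' w \<omega>))"
    by (simp only: tendsto_of_real_iff)
qed

end

end

section \<open>Sojourns over growing windows\<close>

definition ramp_real :: "real \<Rightarrow> real \<Rightarrow> real \<Rightarrow> real" where
  "ramp_real x \<eta> r = max 0 (min 1 ((r - x) / \<eta>))"

text \<open>Total sojourns may be infinite and \<open>enn2real\<close> sends \<open>\<top>\<close>
  to 0, so the argument is cut at \<open>x + \<eta>\<close>, where the ramp has already reached 1,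
  before the conversion.\<close>

definition ramp :: "real \<Rightarrow> real \<Rightarrow> ennreal \<Rightarrow> real" where
  "ramp x \<eta> q = ramp_real x \<eta> (enn2real (min q (ennreal (x + \<eta>))))"

lemma ramp_real_bounds: "0 \<le> ramp_real x \<eta> r" "ramp_real x \<eta> r \<le> 1"
  by (auto simp: ramp_real_def)

lemma ramp_bounds: "0 \<le> ramp x \<eta> r" "ramp x \<eta> r \<le> 1"
  by (auto simp: ramp_def ramp_real_bounds)

lemma ramp_real_lipschitz: "0 < \<eta> \<Longrightarrow> \<bar>ramp_real x \<eta> r - ramp_real x \<eta> s\<bar> \<le> \<bar>r - s\<bar> / \<eta>"
proof -
  assume \<eta>: "0 < \<eta>"
  have "\<bar>max 0 (min 1 a) - max 0 (min 1 b)\<bar> \<le> \<bar>a - b\<bar>" for a b :: real by linarith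
  from this[of "(r - x) / \<eta>" "(s - x) / \<eta>"] show ?thesis
    using \<eta> by (simp add: ramp_real_def diff_divide_distrib[symmetric] abs_divide)
qed

lemma ramp_real_continuous: "continuous_on UNIV (ramp_real x \<eta>)"
  unfolding ramp_real_def by (cases "\<eta> = 0") (auto intro!: continuous_intros)

lemma ramp_real_measurable [measurable]: "ramp_real x \<eta> \<in> borel_measurable borel"
  by (rule borel_measurable_continuous_onI[OF ramp_real_continuous])

lemma ramp_measurable [measurable]: "ramp x \<eta> \<in> borel_measurable borel"
  unfolding ramp_def by measurable

lemma ramp_ennreal:
  assumes "0 < \<eta>" "0 \<le> x" "0 \<le> r"
  shows "ramp x \<eta> (ennreal r) = ramp_real x \<eta> r"
proof -
  have "min (ennreal r) (ennreal (x + \<eta>)) = ennreal (min r (x + \<eta>))"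
    using assms by (simp add: min_def del: ennreal_plus)
  then have "ramp x \<eta> (ennreal r) = ramp_real x \<eta> (min r (x + \<eta>))"
    using assms by (simp add: ramp_def del: ennreal_plus)
  also have "\<dots> = ramp_real x \<eta> r"
    using assms by (auto simp: ramp_real_def min_def field_simps)
  finally show ?thesis .
qed

lemma ramp_indicator:
  assumes "0 < \<eta>" "0 \<le> x"
  shows "ramp x \<eta> q \<le> indicator {ennreal x<..} q" "indicator {ennreal (x + \<eta>)<..} q \<le> ramp x \<eta> q"
proof -
  show "ramp x \<eta> q \<le> indicator {ennreal x<..} q"
  proof (cases q)
    case (real r)
    then show ?thesis
      using assms by (auto simp: ramp_ennreal indicator_def ramp_real_def max_def min_def not_less divide_le_0_iff)
  qed (simp add: ramp_bounds)
  show "indicator {ennreal (x + \<eta>)<..} q \<le> ramp x \<eta> q"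
  proof (cases q)
    case (real r)
    then show ?thesis
      using assms by (auto simp: ramp_ennreal indicator_def ramp_real_def max_def min_def not_le field_simps ennreal_less_iff simp del: ennreal_plus)
  next
    case top
    then show ?thesis using assms by (simp add: ramp_def ramp_real_def del: ennreal_plus)
  qed
qed

lemma (in prob_space) nn_integral_occupation:
  assumes D: "(\<lambda>(w, \<omega>). D w \<omega>) \<in> borel_measurable (borel \<Otimes>\<^sub>M M)" and T: "0 \<le> T" and \<omega>: "\<omega> \<in> space M"
  shows "(\<integral>\<^sup>+w\<in>{0..T}. indicator {0<..} (D w \<omega>) \<partial>lborel) = ennreal (occupation D T \<omega>)"
proof -
  have "(\<integral>\<^sup>+w\<in>{0..T}. indicator {0<..} (D w \<omega>) \<partial>lborel)
      = (\<integral>\<^sup>+w. ennreal (indicator {0..T} w * indicator {0<..} (D w \<omega>)) \<partial>lborel)"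
    by (intro nn_integral_cong) (auto simp: indicator_def)
  also have "\<dots> = ennreal (occupation D T \<omega>)"
    unfolding occupation_def
    by (intro nn_integral_eq_integral occupation_integrable[OF D T \<omega>]) (auto simp: indicator_def)
  finally show ?thesis .
qed

text \<open>Monotone convergence over the windows \<open>{0..real j}\<close>. The cut inside the
  ramp keeps the values finite, so the argument also covers an infinite total sojourn.\<close>

lemma (in prob_space) ramp_occupation_tendsto:
  assumes D: "(\<lambda>(w, \<omega>). D w \<omega>) \<in> borel_measurable (borel \<Otimes>\<^sub>M M)" and \<eta>: "0 < \<eta>" "0 \<le> x"
  shows "(\<lambda>j. expectation (\<lambda>\<omega>. ramp_real x \<eta> (occupation D (real j) \<omega>))) \<longlonglongrightarrow>
    expectation (\<lambda>\<omega>. ramp x \<eta> (\<integral>\<^sup>+w\<in>{0..}. indicator {0<..} (D w \<omega>) \<partial>lborel))"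
proof (rule integral_dominated_convergence[where w="\<lambda>_. 1"])
  note [measurable] = D_comp[OF D order_refl] occupation_measurable[OF D of_nat_0_le_iff]
  show "(\<lambda>\<omega>. ramp x \<eta> (\<integral>\<^sup>+w\<in>{0..}. indicator {0<..} (D w \<omega>) \<partial>lborel)) \<in> borel_measurable M"
    by measurable
  show "(\<lambda>\<omega>. ramp_real x \<eta> (occupation D (real j) \<omega>)) \<in> borel_measurable M" for j by measurable
  show "AE \<omega> in M. (\<lambda>j. ramp_real x \<eta> (occupation D (real j) \<omega>)) \<longlonglongrightarrow>
      ramp x \<eta> (\<integral>\<^sup>+w\<in>{0..}. indicator {0<..} (D w \<omega>) \<partial>lborel)"
  proof (rule AE_I2)
    fix \<omega> assume \<omega>: "\<omega> \<in> space M"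
    have [measurable]: "(\<lambda>w. D w \<omega>) \<in> borel_measurable borel" by (rule D_comp[OF D order_refl]) (use \<omega> in auto)
    let ?I = "\<lambda>j. \<integral>\<^sup>+w\<in>{0..real j}. indicator {0<..} (D w \<omega>) \<partial>lborel"
    have "?I \<longlonglongrightarrow> (\<integral>\<^sup>+w\<in>{0..}. indicator {0<..} (D w \<omega>) \<partial>lborel)"
    proof (rule nn_integral_LIMSEQ)
      show "incseq (\<lambda>j w. indicator {0<..} (D w \<omega>) * indicator {0..real j} w :: ennreal)"
        by (auto simp: incseq_def le_fun_def indicator_def)
      show "(\<lambda>j. indicator {0<..} (D w \<omega>) * indicator {0..real j} w :: ennreal) \<longlonglongrightarrow> indicator {0<..} (D w \<omega>) * indicator {0..} w" for w
      proof (rule tendsto_eventually)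
        obtain N :: nat where "w \<le> real N" using real_arch_simple by blast
        then have "\<And>n. N \<le> n \<Longrightarrow> indicator {0..real n} w = (indicator {0..} w :: ennreal)"
          by (auto simp: indicator_def)
        then show "\<forall>\<^sub>F j in sequentially. indicator {0<..} (D w \<omega>) * indicator {0..real j} w = (indicator {0<..} (D w \<omega>) * indicator {0..} w :: ennreal)"
          unfolding eventually_sequentially by (intro exI[of _ N]) simp
      qed
    qed measurable
    moreover have "min (\<integral>\<^sup>+w\<in>{0..}. indicator {0<..} (D w \<omega>) \<partial>lborel) (ennreal (x + \<eta>)) \<noteq> \<top>"
      by (auto simp: min_def top_unique)
    ultimately have "(\<lambda>j. min (?I j) (ennreal (x + \<eta>))) \<longlonglongrightarrow> ennreal (enn2real (min (\<integral>\<^sup>+w\<in>{0..}. indicator {0<..} (D w \<omega>) \<partial>lborel) (ennreal (x + \<eta>))))"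
      by (simp add: less_top[symmetric] tendsto_min del: ennreal_plus)
    then have "(\<lambda>j. enn2real (min (?I j) (ennreal (x + \<eta>)))) \<longlonglongrightarrow>
        enn2real (min (\<integral>\<^sup>+w\<in>{0..}. indicator {0<..} (D w \<omega>) \<partial>lborel) (ennreal (x + \<eta>)))"
      by (rule tendsto_enn2real) simp
    then have "(\<lambda>j. ramp x \<eta> (?I j)) \<longlonglongrightarrow> ramp x \<eta> (\<integral>\<^sup>+w\<in>{0..}. indicator {0<..} (D w \<omega>) \<partial>lborel)"
      unfolding ramp_def using ramp_real_continuous[of x \<eta>]
      by (intro isCont_tendsto_compose[where g="ramp_real x \<eta>"]) (auto simp: continuous_on_eq_continuous_at)
    then show "(\<lambda>j. ramp_real x \<eta> (occupation D (real j) \<omega>)) \<longlonglongrightarrow>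
      ramp x \<eta> (\<integral>\<^sup>+w\<in>{0..}. indicator {0<..} (D w \<omega>) \<partial>lborel)"
      using nn_integral_occupation[OF D of_nat_0_le_iff \<omega>] ramp_ennreal[OF \<eta> occupation_bounds(1)[OF D of_nat_0_le_iff]]
      by simp
  qed
qed (auto simp: ramp_real_bounds)

lemma (in prob_space) expectation_occupation:
  assumes D: "(\<lambda>(w, \<omega>). D w \<omega>) \<in> borel_measurable (borel \<Otimes>\<^sub>M M)" and T: "0 \<le> T"
  shows "expectation (occupation D T) = (LINT w|lborel. indicator {0..T} w * prob {\<omega> \<in> space M. 0 < D w \<omega>})"
proof -
  have "expectation (\<lambda>\<omega>. indicator {0<..} (D w \<omega>)) = prob {\<omega> \<in> space M. 0 < D w \<omega>}" for w
  proof -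
    have "expectation (\<lambda>\<omega>. indicator {0<..} (D w \<omega>)) = expectation (indicator {\<omega> \<in> space M. 0 < D w \<omega>})"
      by (intro Bochner_Integration.integral_cong) (auto simp: indicator_def)
    also have "\<dots> = prob {\<omega> \<in> space M. 0 < D w \<omega>}" by (simp add: Int_def conj_commute conj_left_commute)
    finally show ?thesis .
  qed
  then show ?thesis using occupation_moment_Suc[OF D T, of "{}" 0] by simp
qed

section \<open>Negligibility of the sojourn outside a bounded window\<close>

context local_chi_square begin

lemma drift_normal:
  assumes s: "0 \<le> s"
  shows "centered_normal M (\<lambda>\<omega>. \<Sum>i\<in>UNIV. \<beta> i * residual i s \<omega>) (\<Sum>i\<in>UNIV. (\<beta> i)\<^sup>2 * (1 - (\<rho> i s)\<^sup>2))"
proof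
  have [measurable]: "residual i s \<in> borel_measurable M" for i
    using residual_process s by (rule measurable_process_component)
  show "(\<lambda>\<omega>. \<Sum>i\<in>UNIV. \<beta> i * residual i s \<omega>) \<in> borel_measurable M" by measurable
  fix a
  have "(LINT \<omega>|M. iexp (a * (\<Sum>i\<in>UNIV. \<beta> i * residual i s \<omega>))) =
      expectation (\<lambda>\<omega>. iexp (\<Sum>i\<in>UNIV. 0 * W i 0 \<omega> + (\<Sum>j\<in>{()}. a * \<beta> i * residual i s \<omega>)))"
    by (simp add: sum_distrib_left mult_ac)
  also have "\<dots> = (\<Prod>i\<in>UNIV. of_real (exp (- (0\<^sup>2 + (\<Sum>j\<in>{()}. \<Sum>k\<in>{()}. (a * \<beta> i) * (a * \<beta> i) * residual_cov i s s)) / 2)))"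
    by (rule residual_char) (auto simp: s)
  also have "\<dots> = of_real (exp (- (a\<^sup>2 * (\<Sum>i\<in>UNIV. (\<beta> i)\<^sup>2 * (1 - (\<rho> i s)\<^sup>2))) / 2))"
    by (simp add: rho_0 power2_eq_square sum_distrib_left sum_divide_distrib sum_negf mult_ac flip: of_real_prod exp_sum)
  finally show "(LINT \<omega>|M. iexp (a * (\<Sum>i\<in>UNIV. \<beta> i * residual i s \<omega>))) =
      of_real (exp (- (a\<^sup>2 * (\<Sum>i\<in>UNIV. (\<beta> i)\<^sup>2 * (1 - (\<rho> i s)\<^sup>2))) / 2))" .
qed

text \<open>
  The excess has a negative drift of order \<open>w powr \<alpha>\<close>.  Positivity forces either its linear part,
  whose variance is at most four times the drift, or one of the squared residuals to compensate it.
\<close>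

lemma excess_prob_bound:
  fixes k :: nat
  defines "\<kappa> \<equiv> fact (2 * k) / (2 ^ k * fact k)"
  assumes bounds: "\<And>i s. 0 \<le> s \<Longrightarrow> s \<le> \<tau> \<Longrightarrow> 0 \<le> \<rho> i s \<and> \<rho> i s \<le> 1 - c i / 2 * s powr \<alpha>"
    and v: "1 \<le> v" and w: "0 < w" "w \<le> v powr (1 / \<alpha>) * \<tau>"
    and e: "norm e = 1" "0 < \<delta>" "\<And>i. \<delta> \<le> (e $ i)\<^sup>2" and z: "0 \<le> z"
    and C: "0 < (\<Sum>i\<in>UNIV. c i)"
    and far: "4 * (2 * z + z\<^sup>2) \<le> \<delta> * (\<Sum>i\<in>UNIV. c i) / 2 * w powr \<alpha>"
  shows "prob {\<omega> \<in> space M. 0 < excess v (amp v z *\<^sub>R e) w \<omega>} \<le>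
    \<kappa> * (64 / (\<delta> * (\<Sum>i\<in>UNIV. c i) / 2 * w powr \<alpha>)) ^ k + real CARD('m) * (\<kappa> * (2 * real CARD('m) / (v * \<delta>)) ^ k)"
proof -
  define s where "s = rtime v w"
  have s: "0 \<le> s" "s \<le> \<tau>" "s powr \<alpha> = w powr \<alpha> / v"
  proof -
    have s': "s = w / v powr (1 / \<alpha>)" using w by (simp add: s_def rtime_def)
    show "0 \<le> s" by (simp add: s_def rtime_def)
    show "s \<le> \<tau>" unfolding s' using w v by (simp add: divide_le_eq mult.commute)
    show "s powr \<alpha> = w powr \<alpha> / v" unfolding s' using w v alpha by (simp add: powr_divide powr_powr)
  qed
  define A where "A = (amp v z)\<^sup>2"
  define \<sigma> where "\<sigma> i = 1 - (\<rho> i s)\<^sup>2" for i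
  define V where "V = (\<Sum>i\<in>UNIV. \<sigma> i)"
  \<comment> \<open>The drift: multiplying the coordinates of the starting vector by the
    correlations lowers its squared norm from \<open>A\<close> to \<open>A - q\<close>. The bound
    \<open>b\<close> below, of order \<open>w powr \<alpha>\<close>, is the part of it guaranteed by
    the bounds on the correlations.\<close>
  define q where "q = (\<Sum>i\<in>UNIV. A * \<sigma> i * (e $ i)\<^sup>2)"
  define L where "L \<omega> = (\<Sum>i\<in>UNIV. (2 * \<rho> i s * (amp v z * e $ i)) * residual i s \<omega>)" for \<omega>
  have amp: "A = v + 2 * z + z\<^sup>2 / v" using v by (simp add: A_def amp_def power2_sum power_divide)
  have \<sigma>1: "c i / 2 * s powr \<alpha> \<le> \<sigma> i" for i
  proof -
    have r: "0 \<le> \<rho> i s" "\<rho> i s \<le> 1 - c i / 2 * s powr \<alpha>" using bounds[OF s(1,2)] by auto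
    moreover have "0 \<le> c i / 2 * s powr \<alpha>" using c_nonneg[of i] by simp
    ultimately have "\<rho> i s * \<rho> i s \<le> \<rho> i s * 1" by (intro mult_left_mono) auto
    then show ?thesis using r by (simp add: \<sigma>_def power2_eq_square)
  qed
  have \<sigma>0: "0 \<le> \<sigma> i" for i
    using \<sigma>1[of i] c_nonneg[of i] by (meson divide_nonneg_pos mult_nonneg_nonneg order_trans powr_ge_zero zero_less_numeral)
  have Av: "v \<le> A" using z v by (simp add: amp)
  have V1: "(\<Sum>i\<in>UNIV. c i) / 2 * (w powr \<alpha> / v) \<le> V"
    using sum_mono[of UNIV "\<lambda>i. c i / 2 * s powr \<alpha>" \<sigma>, OF \<sigma>1]
    by (simp add: V_def s(3) sum_distrib_right sum_divide_distrib)
  have qV: "v * \<delta> * V \<le> q"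
  proof -
    have "v * \<delta> * V = (\<Sum>i\<in>UNIV. v * \<sigma> i * \<delta>)" by (simp add: V_def sum_distrib_left mult_ac)
    also have "\<dots> \<le> q"
      unfolding q_def using v e \<sigma>0 Av by (intro sum_mono mult_mono) auto
    finally show ?thesis .
  qed
  define b where "b = \<delta> * (\<Sum>i\<in>UNIV. c i) / 2 * w powr \<alpha>"
  have b: "0 < b" unfolding b_def using C e w by simp
  have bq: "b \<le> q"
  proof -
    have "b = v * \<delta> * ((\<Sum>i\<in>UNIV. c i) / 2 * (w powr \<alpha> / v))" using v by (simp add: b_def)
    also have "\<dots> \<le> v * \<delta> * V" using v e by (intro mult_left_mono V1) auto
    finally show ?thesis using qV by linarith
  qed
  have q0: "0 < q" using b bq by linarith
  interpret N: centered_normal M L "\<Sum>i\<in>UNIV. (2 * \<rho> i s * (amp v z * e $ i))\<^sup>2 * (1 - (\<rho> i s)\<^sup>2)"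
    unfolding L_def by (rule drift_normal[OF s(1)])
  let ?VL = "\<Sum>i\<in>UNIV. (2 * \<rho> i s * (amp v z * e $ i))\<^sup>2 * (1 - (\<rho> i s)\<^sup>2)"
  have VL: "?VL \<le> 4 * q"
  proof -
    have "(2 * \<rho> i s * (amp v z * e $ i))\<^sup>2 * (1 - (\<rho> i s)\<^sup>2) \<le> 4 * (A * \<sigma> i * (e $ i)\<^sup>2)" for i
    proof -
      have "(\<rho> i s)\<^sup>2 * (A * \<sigma> i * (e $ i)\<^sup>2) \<le> 1 * (A * \<sigma> i * (e $ i)\<^sup>2)"
        using \<sigma>0[of i] Av v by (intro mult_right_mono) (auto simp: \<sigma>_def)
      then show ?thesis by (simp add: \<sigma>_def A_def power_mult_distrib mult_ac)
    qed
    then show ?thesis unfolding q_def sum_distrib_left by (rule sum_mono)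
  qed
  have \<kappa>: "0 \<le> \<kappa>" by (simp add: \<kappa>_def)
  have PL: "prob {\<omega> \<in> space M. q / 4 \<le> \<bar>L \<omega>\<bar>} \<le> \<kappa> * (64 / b) ^ k"
  proof -
    \<comment> \<open>The linear part has variance at most \<open>4 * q\<close> and has to reach
      \<open>q / 4\<close>, hence \<open>4 * 16 = 64\<close>.\<close>
    have "?VL / (q / 4)\<^sup>2 \<le> 64 / b"
    proof -
      have "?VL / (q / 4)\<^sup>2 \<le> (4 * q) / (q / 4)\<^sup>2" using VL by (intro divide_right_mono) auto
      also have "\<dots> = 64 / q" using q0 by (simp add: power2_eq_square field_simps)
      also have "\<dots> \<le> 64 / b" using b bq by (intro divide_left_mono) auto
      finally show ?thesis .
    qed
    then have "(?VL / (q / 4)\<^sup>2) ^ k \<le> (64 / b) ^ k" using N.V_nonneg by (intro power_mono) auto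
    then have "\<kappa> * (?VL / (q / 4)\<^sup>2) ^ k \<le> \<kappa> * (64 / b) ^ k" using \<kappa> by (rule mult_left_mono)
    with N.tail_bound[of "q / 4" k] q0 show ?thesis by (simp add: \<kappa>_def)
  qed
  let ?m = "real CARD('m)"
  have [measurable]: "residual i s \<in> borel_measurable M" for i
    using residual_process s(1) by (rule measurable_process_component)
  have PY: "prob {\<omega> \<in> space M. sqrt (q / (2 * ?m)) \<le> \<bar>residual i s \<omega>\<bar>} \<le> \<kappa> * (2 * ?m / (v * \<delta>)) ^ k" for i
  proof -
    interpret Y: centered_normal M "residual i s" "1 - (\<rho> i s)\<^sup>2" by (rule residual_normal[OF s(1)])
    \<comment> \<open>A residual variance is at most \<open>q / (v * \<delta>)\<close>, so its ratio
      to \<open>q / (2 * ?m)\<close> does not depend on \<open>w\<close>: this term is small in the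
      level and not in the rescaled time.\<close>
    have "\<sigma> i \<le> V" unfolding V_def using \<sigma>0 by (intro member_le_sum) auto
    then have "v * \<delta> * \<sigma> i \<le> v * \<delta> * V" using v e by (intro mult_left_mono) auto
    then have "v * \<delta> * \<sigma> i \<le> q" using qV by linarith
    then have "\<sigma> i / (q / (2 * ?m)) \<le> 2 * ?m / (v * \<delta>)"
      using q0 v e by (simp add: field_simps)
    then have "(\<sigma> i / (q / (2 * ?m))) ^ k \<le> (2 * ?m / (v * \<delta>)) ^ k"
      using \<sigma>0[of i] q0 by (intro power_mono) auto
    then have "\<kappa> * (\<sigma> i / (q / (2 * ?m))) ^ k \<le> \<kappa> * (2 * ?m / (v * \<delta>)) ^ k" using \<kappa> by (rule mult_left_mono)
    with Y.tail_bound[of "sqrt (q / (2 * ?m))" k] q0 show ?thesis by (simp add: \<kappa>_def \<sigma>_def)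
  qed
  \<comment> \<open>The hypothesis \<open>far\<close> leaves at least \<open>3 * q / 4\<close> of
    the drift after the initial excess \<open>A - v\<close> is paid. If the linear part is below
    \<open>q / 4\<close> in modulus, the squared residuals must supply more than
    \<open>q / 2\<close>, and one of the \<open>?m\<close> of them at least its share.\<close>
  have sub: "{\<omega> \<in> space M. 0 < excess v (amp v z *\<^sub>R e) w \<omega>} \<subseteq>
      {\<omega> \<in> space M. q / 4 \<le> \<bar>L \<omega>\<bar>} \<union> (\<Union>i\<in>UNIV. {\<omega> \<in> space M. sqrt (q / (2 * ?m)) \<le> \<bar>residual i s \<omega>\<bar>})"
  proof
    fix \<omega> assume "\<omega> \<in> {\<omega> \<in> space M. 0 < excess v (amp v z *\<^sub>R e) w \<omega>}"
    then have \<omega>: "\<omega> \<in> space M" and D: "0 < excess v (amp v z *\<^sub>R e) w \<omega>" by auto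
    have es: "(\<Sum>i\<in>UNIV. (e $ i)\<^sup>2) = 1" using e(1) by (simp add: norm_vec_def L2_set_def)
    have "excess v (amp v z *\<^sub>R e) w \<omega> = (\<Sum>i\<in>UNIV. A * (e $ i)\<^sup>2) - v - q + L \<omega> + (\<Sum>i\<in>UNIV. (residual i s \<omega>)\<^sup>2)"
      unfolding excess_def s_def[symmetric] q_def L_def
      by (simp add: A_def \<sigma>_def power2_sum sum.distrib sum_subtractf algebra_simps power_mult_distrib)
    also have "(\<Sum>i\<in>UNIV. A * (e $ i)\<^sup>2) = A" by (simp add: es flip: sum_distrib_left)
    finally have D': "0 < A - v - q + L \<omega> + (\<Sum>i\<in>UNIV. (residual i s \<omega>)\<^sup>2)" using D by simp
    have "A - v \<le> q / 4"
    proof -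
      have "z\<^sup>2 / v \<le> z\<^sup>2" using v by (simp add: divide_le_eq mult_le_cancel_left1)
      then have "A - v \<le> 2 * z + z\<^sup>2" by (simp add: amp)
      also have "\<dots> \<le> b / 4" using far by (simp add: b_def)
      finally show ?thesis using bq by linarith
    qed
    show "\<omega> \<in> {\<omega> \<in> space M. q / 4 \<le> \<bar>L \<omega>\<bar>} \<union> (\<Union>i\<in>UNIV. {\<omega> \<in> space M. sqrt (q / (2 * ?m)) \<le> \<bar>residual i s \<omega>\<bar>})"
    proof (rule ccontr)
      assume n: "\<not> ?thesis"
      then have "\<bar>L \<omega>\<bar> < q / 4" using \<omega> by auto
      moreover have "(residual i s \<omega>)\<^sup>2 \<le> q / (2 * ?m)" for i
      proof -
        have "\<bar>residual i s \<omega>\<bar> \<le> sqrt (q / (2 * ?m))" using n \<omega> by (auto simp: not_le intro: less_imp_le)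
        then have "\<bar>residual i s \<omega>\<bar>\<^sup>2 \<le> (sqrt (q / (2 * ?m)))\<^sup>2" by (intro power_mono) auto
        then show ?thesis using q0 by simp
      qed
      then have "(\<Sum>i\<in>UNIV. (residual i s \<omega>)\<^sup>2) \<le> (\<Sum>i\<in>(UNIV::'m set). q / (2 * ?m))" by (rule sum_mono)
      then have "(\<Sum>i\<in>UNIV. (residual i s \<omega>)\<^sup>2) \<le> q / 2" by simp
      ultimately show False using D' \<open>A - v \<le> q / 4\<close> by linarith
    qed
  qed
  have "prob {\<omega> \<in> space M. 0 < excess v (amp v z *\<^sub>R e) w \<omega>} \<le>
      prob ({\<omega> \<in> space M. q / 4 \<le> \<bar>L \<omega>\<bar>} \<union> (\<Union>i\<in>UNIV. {\<omega> \<in> space M. sqrt (q / (2 * ?m)) \<le> \<bar>residual i s \<omega>\<bar>}))"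
    by (rule finite_measure_mono[OF sub]) measurable
  also have "\<dots> \<le> prob {\<omega> \<in> space M. q / 4 \<le> \<bar>L \<omega>\<bar>} +
      prob (\<Union>i\<in>UNIV. {\<omega> \<in> space M. sqrt (q / (2 * ?m)) \<le> \<bar>residual i s \<omega>\<bar>})"
    by (rule measure_Un_le) measurable
  also have "\<dots> \<le> \<kappa> * (64 / b) ^ k + (\<Sum>i\<in>(UNIV::'m set). \<kappa> * (2 * ?m / (v * \<delta>)) ^ k)"
  proof (rule add_mono[OF PL])
    have "prob (\<Union>i\<in>UNIV. {\<omega> \<in> space M. sqrt (q / (2 * ?m)) \<le> \<bar>residual i s \<omega>\<bar>})
        \<le> (\<Sum>i\<in>UNIV. prob {\<omega> \<in> space M. sqrt (q / (2 * ?m)) \<le> \<bar>residual i s \<omega>\<bar>})"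
      by (rule finite_measure_subadditive_finite) auto
    also have "\<dots> \<le> (\<Sum>i\<in>(UNIV::'m set). \<kappa> * (2 * ?m / (v * \<delta>)) ^ k)" by (rule sum_mono[OF PY])
    finally show "prob (\<Union>i\<in>UNIV. {\<omega> \<in> space M. sqrt (q / (2 * ?m)) \<le> \<bar>residual i s \<omega>\<bar>})
        \<le> (\<Sum>i\<in>(UNIV::'m set). \<kappa> * (2 * ?m / (v * \<delta>)) ^ k)" .
  qed
  finally show ?thesis by (simp add: b_def)
qed

text \<open>The pointwise bound is integrated over the times from \<open>T\<close> to the end of the
  window. The part decaying in \<open>w\<close> contributes at most \<open>A / T\<close>; the part
  decaying only in \<open>v\<close> is multiplied by the window length, which grows like
  \<open>v powr (1 / \<alpha>)\<close>.\<close>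

lemma excess_occupation_tail:
  assumes bounds: "\<And>i s. 0 \<le> s \<Longrightarrow> s \<le> \<tau> \<Longrightarrow> 0 \<le> \<rho> i s \<and> \<rho> i s \<le> 1 - c i / 2 * s powr \<alpha>"
    and \<tau>: "0 < \<tau>" and e: "norm e = 1" "\<And>i. e $ i \<noteq> 0" and z: "0 \<le> z" and c: "\<exists>i. 0 < c i"
  shows "\<exists>A B T0. 1 \<le> T0 \<and> (\<forall>v T. 1 \<le> v \<longrightarrow> T0 \<le> T \<longrightarrow> T \<le> v powr (1 / \<alpha>) * \<tau> \<longrightarrow>
    expectation (occupation (excess v (amp v z *\<^sub>R e)) (v powr (1 / \<alpha>) * \<tau>)) -
    expectation (occupation (excess v (amp v z *\<^sub>R e)) T) \<le> A / T + B * v powr (- 1 / 2))"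
proof -
  \<comment> \<open>The moment order serves twice: \<open>\<alpha> * k \<ge> 2\<close> makes the
    first bound at most a constant over \<open>w\<^sup>2\<close>, which is integrable, and
    \<open>1 / \<alpha> - k \<le> - 1 / 2\<close> lets the second bound beat the length of the
    window.\<close>
  define k where "k = nat \<lceil>2 / \<alpha>\<rceil>"
  have k: "2 \<le> \<alpha> * real k" "1 \<le> real k"
  proof -
    have "0 < 2 / \<alpha>" using alpha by simp
    then have "2 / \<alpha> \<le> real k" unfolding k_def by linarith
    then show "2 \<le> \<alpha> * real k" using alpha by (simp add: divide_le_eq mult.commute)
    have "0 < k" using \<open>0 < 2 / \<alpha>\<close> unfolding k_def by linarith
    then show "1 \<le> real k" by simp
  qed
  define \<kappa> :: real where "\<kappa> = fact (2 * k) / (2 ^ k * fact k)"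
  \<comment> \<open>Positive because the direction avoids all coordinate hyperplanes; it ensures
    that the drift is seen whichever components of the clock are moving.\<close>
  define \<delta> where "\<delta> = Min (range (\<lambda>i. (e $ i)\<^sup>2))"
  have \<delta>: "0 < \<delta>" "\<And>i. \<delta> \<le> (e $ i)\<^sup>2" using e(2) by (auto simp: \<delta>_def)
  have C: "0 < (\<Sum>i\<in>UNIV. c i)" using c c_nonneg by (metis UNIV_I finite sum_pos2)
  define b where "b = \<delta> * (\<Sum>i\<in>UNIV. c i) / 2"
  have b: "0 < b" using \<delta> C by (simp add: b_def)
  define y where "y = 4 * (2 * z + z\<^sup>2)"
  have y: "0 \<le> y" using z by (simp add: y_def)
  \<comment> \<open>From this time on the drift dominates the initial excess, which is the
    hypothesis \<open>far\<close> of the pointwise bound.\<close>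
  define T0 where "T0 = max 1 ((y / b) powr (1 / \<alpha>))"
  define A where "A = \<kappa> * (64 / b) ^ k"
  define m where "m = real CARD('m)"
  define B where "B = m * (\<kappa> * (2 * m / \<delta>) ^ k)"
  have A0: "0 \<le> A" "0 \<le> B" using b \<delta> by (simp_all add: A_def B_def \<kappa>_def m_def)
  have P: "prob {\<omega> \<in> space M. 0 < excess v (amp v z *\<^sub>R e) w \<omega>} \<le> A / w\<^sup>2 + B * v powr (- real k)"
    if v: "1 \<le> v" and w: "T0 \<le> w" "w \<le> v powr (1 / \<alpha>) * \<tau>" for v w
  proof -
    have w1: "1 \<le> w" using w by (simp add: T0_def)
    have "(y / b) powr (1 / \<alpha>) \<le> w" using w by (simp add: T0_def)
    then have "((y / b) powr (1 / \<alpha>)) powr \<alpha> \<le> w powr \<alpha>" using alpha by (intro powr_mono2) auto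
    then have "y / b \<le> w powr \<alpha>" using alpha y b by (simp add: powr_powr)
    then have "y \<le> b * w powr \<alpha>" using b by (simp add: divide_le_eq mult.commute)
    then have far: "4 * (2 * z + z\<^sup>2) \<le> \<delta> * (\<Sum>i\<in>UNIV. c i) / 2 * w powr \<alpha>"
      unfolding y_def b_def .
    have "(64 / (b * w powr \<alpha>)) ^ k \<le> (64 / b) ^ k / w\<^sup>2"
    proof -
      have "w\<^sup>2 = w powr 2" using w1 by (simp add: powr_numeral)
      also have "\<dots> \<le> w powr (\<alpha> * real k)" using w1 k by (intro powr_mono) auto
      also have "\<dots> = (w powr \<alpha>) ^ k" using w1 by (simp add: powr_powr flip: powr_realpow)
      finally have "(64 / b) ^ k / (w powr \<alpha>) ^ k \<le> (64 / b) ^ k / w\<^sup>2"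
        using b w1 by (intro divide_left_mono) auto
      moreover have "(64 / (b * w powr \<alpha>)) ^ k = (64 / b) ^ k / (w powr \<alpha>) ^ k"
        by (simp add: power_divide power_mult_distrib)
      ultimately show ?thesis by simp
    qed
    then have "\<kappa> * (64 / (b * w powr \<alpha>)) ^ k \<le> A / w\<^sup>2"
      unfolding A_def by (metis mult_left_mono times_divide_eq_right \<kappa>_def divide_nonneg_nonneg fact_ge_zero mult_nonneg_nonneg zero_le_numeral zero_le_power)
    moreover have "m * (\<kappa> * (2 * m / (v * \<delta>)) ^ k) = B * v powr (- real k)"
      using v by (simp add: B_def power_divide power_mult_distrib powr_minus powr_realpow divide_inverse power_inverse)
    moreover have "prob {\<omega> \<in> space M. 0 < excess v (amp v z *\<^sub>R e) w \<omega>} \<le>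
        \<kappa> * (64 / (b * w powr \<alpha>)) ^ k + m * (\<kappa> * (2 * m / (v * \<delta>)) ^ k)"
      unfolding b_def \<kappa>_def m_def using w1
      by (intro excess_prob_bound[OF bounds v _ w(2) e(1) \<delta> z C far]) auto
    ultimately show ?thesis by linarith
  qed
  have "expectation (occupation (excess v (amp v z *\<^sub>R e)) S) - expectation (occupation (excess v (amp v z *\<^sub>R e)) T)
      \<le> A / T + (B * \<tau>) * v powr (- 1 / 2)"
    if v: "1 \<le> v" and T: "T0 \<le> T" "T \<le> S" and S: "S = v powr (1 / \<alpha>) * \<tau>" for v T S
  proof -
    let ?D = "excess v (amp v z *\<^sub>R e)"
    let ?p = "\<lambda>w. prob {\<omega> \<in> space M. 0 < ?D w \<omega>}"
    let ?h = "\<lambda>w. (A / w\<^sup>2 + B * v powr (- real k)) * indicator {T..S} w"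
    have T1: "1 \<le> T" using T by (simp add: T0_def)
    note [measurable] = D_comp[OF excess_measurable order_refl]
    have pm [measurable]: "?p \<in> borel_measurable borel"
    proof -
      have "(\<lambda>w. expectation (\<lambda>\<omega>. indicator {0<..} (?D w \<omega>) :: real)) \<in> borel_measurable borel"
        by (rule borel_measurable_lebesgue_integral) (simp add: split_beta')
      moreover have "expectation (\<lambda>\<omega>. indicator {0<..} (?D w \<omega>)) = ?p w" for w
      proof -
        have "expectation (\<lambda>\<omega>. indicator {0<..} (?D w \<omega>)) = expectation (indicator {\<omega> \<in> space M. 0 < ?D w \<omega>})"
          by (intro Bochner_Integration.integral_cong) (auto simp: indicator_def)
        also have "\<dots> = ?p w" by (simp add: Int_def conj_commute conj_left_commute)
        finally show ?thesis .
      qed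
      ultimately show ?thesis by simp
    qed
    have pi: "integrable lborel (\<lambda>w. indicator {0..R} w * ?p w)" if "0 \<le> R" for R
    proof (rule Bochner_Integration.integrable_bound)
      show "integrable lborel (indicator {0..R} :: real \<Rightarrow> real)" using that by (intro integrable_real_indicator) auto
    qed (auto simp: indicator_def)
    have h: "has_bochner_integral lborel ?h ((- A / S + B * v powr (- real k) * S) - (- A / T + B * v powr (- real k) * T))"
    proof (rule has_bochner_integral_FTC_Icc_nonneg)
      fix w assume w: "w \<in> {T..S}"
      then have "w \<noteq> 0" using T1 by auto
      then show "((\<lambda>w. - A / w + B * v powr (- real k) * w) has_real_derivative A / w\<^sup>2 + B * v powr (- real k)) (at w)"
        by (auto intro!: derivative_eq_intros simp: power2_eq_square field_simps)
      show "0 \<le> A / w\<^sup>2 + B * v powr (- real k)" using A0 by simp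
    qed (use T in auto)
    have "expectation (occupation ?D S) - expectation (occupation ?D T)
        = (LINT w|lborel. indicator {0..S} w * ?p w - indicator {0..T} w * ?p w)"
      using T1 T pi[of S] pi[of T]
      by (subst (1 2) expectation_occupation[OF excess_measurable]) auto
    also have "\<dots> \<le> (LINT w|lborel. ?h w)"
    proof (rule integral_mono)
      show "integrable lborel (\<lambda>w. indicator {0..S} w * ?p w - indicator {0..T} w * ?p w)"
        using T1 T pi[of S] pi[of T] by auto
      show "integrable lborel ?h" using h by (rule integrable.intros)
      fix w
      show "indicator {0..S} w * ?p w - indicator {0..T} w * ?p w \<le> ?h w"
      proof (cases "w \<in> {T..S}")
        case True
        then have "?p w \<le> A / w\<^sup>2 + B * v powr (- real k)" using T S by (intro P v) auto
        moreover have "0 \<le> A / w\<^sup>2 + B * v powr (- real k)" using A0 by simp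
        ultimately show ?thesis using True T1 by (auto simp: indicator_def)
      next
        case False
        then show ?thesis using T T1 by (auto simp: indicator_def)
      qed
    qed
    also have "\<dots> = (- A / S + B * v powr (- real k) * S) - (- A / T + B * v powr (- real k) * T)"
      using h by (rule has_bochner_integral_integral_eq)
    also have "\<dots> \<le> A / T + B * (v powr (- real k) * S)"
    proof -
      have "0 \<le> A / S" "0 \<le> B * v powr (- real k) * T" using A0 T T1 by auto
      then show ?thesis by simp
    qed
    also have "\<dots> \<le> A / T + B * (v powr (- 1 / 2) * \<tau>)"
    proof (intro add_left_mono mult_left_mono A0)
      have "1 / \<alpha> \<le> real k / 2" using k alpha by (simp add: divide_le_eq mult.commute)
      then have "1 / \<alpha> - real k \<le> - 1 / 2" using k by simp
      then have "v powr (1 / \<alpha> - real k) \<le> v powr (- 1 / 2)" using v by (intro powr_mono) auto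
      moreover have "v powr (- real k) * S = v powr (1 / \<alpha> - real k) * \<tau>"
        using v by (simp add: S powr_diff powr_minus divide_inverse mult_ac)
      ultimately show "v powr (- real k) * S \<le> v powr (- 1 / 2) * \<tau>" using \<tau> by simp
    qed
    finally show ?thesis by (simp add: mult_ac)
  qed
  moreover have "1 \<le> T0" by (simp add: T0_def)
  ultimately show ?thesis by blast
qed

text \<open>The ramp has Lipschitz constant \<open>1 / \<eta>\<close>, so the mean sojourn beyond a
  fixed \<open>T\<close> controls the error of truncation. First \<open>T\<close> is fixed, large
  enough for the limit and for \<open>A / T\<close>; then \<open>n\<close> grows, for the bounded
  window and for the error decaying in \<open>v n\<close>. These four errors get
  \<open>\<epsilon> / 4\<close> each.\<close>

lemma ramp_limit:
  assumes bounds: "\<And>i s. 0 \<le> s \<Longrightarrow> s \<le> \<tau> \<Longrightarrow> 0 \<le> \<rho> i s \<and> \<rho> i s \<le> 1 - c i / 2 * s powr \<alpha>"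
    and \<tau>: "0 < \<tau>" and e: "norm e = 1" "\<And>i. e $ i \<noteq> 0" and z: "0 \<le> z" and c: "\<exists>i. 0 < c i"
    and v: "\<And>n. 1 \<le> v n" "filterlim v at_top sequentially" and \<eta>: "0 < \<eta>" "0 \<le> x"
  shows "(\<lambda>n. expectation (\<lambda>\<omega>. ramp_real x \<eta> (occupation (excess (v n) (amp (v n) z *\<^sub>R e)) (v n powr (1 / \<alpha>) * \<tau>) \<omega>)))
    \<longlonglongrightarrow> expectation (\<lambda>\<omega>. ramp x \<eta> (\<integral>\<^sup>+w\<in>{0..}. indicator {0<..} (excess_limit e z w \<omega>) \<partial>lborel))"
proof (rule LIMSEQ_I)
  let ?D = "\<lambda>n. excess (v n) (amp (v n) z *\<^sub>R e)" and ?S = "\<lambda>n. v n powr (1 / \<alpha>) * \<tau>"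
  let ?L = "expectation (\<lambda>\<omega>. ramp x \<eta> (\<integral>\<^sup>+w\<in>{0..}. indicator {0<..} (excess_limit e z w \<omega>) \<partial>lborel))"
  let ?E = "\<lambda>n T. expectation (\<lambda>\<omega>. ramp_real x \<eta> (occupation (?D n) T \<omega>))"
  let ?E' = "\<lambda>T. expectation (\<lambda>\<omega>. ramp_real x \<eta> (occupation (excess_limit e z) T \<omega>))"
  fix \<epsilon> :: real assume \<epsilon>: "0 < \<epsilon>"
  obtain A B T0 where T0: "1 \<le> T0" and tail: "\<And>v T. 1 \<le> v \<Longrightarrow> T0 \<le> T \<Longrightarrow> T \<le> v powr (1 / \<alpha>) * \<tau> \<Longrightarrow>
      expectation (occupation (excess v (amp v z *\<^sub>R e)) (v powr (1 / \<alpha>) * \<tau>)) -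
      expectation (occupation (excess v (amp v z *\<^sub>R e)) T) \<le> A / T + B * v powr (- 1 / 2)"
    using excess_occupation_tail[OF bounds \<tau> e z c] by blast
  have "(\<lambda>j. A / real j / \<eta>) \<longlonglongrightarrow> 0 / \<eta>"
    using \<eta> by (intro tendsto_divide lim_const_over_n tendsto_const) auto
  then have "\<forall>\<^sub>F j in sequentially. A / real j / \<eta> < \<epsilon> / 4"
    using \<epsilon> by (intro order_tendstoD) auto
  moreover have "\<forall>\<^sub>F j in sequentially. \<bar>?E' (real j) - ?L\<bar> < \<epsilon> / 4"
    using ramp_occupation_tendsto[OF excess_limit_measurable \<eta>, of e z] \<epsilon>
    by (auto dest!: tendstoD[where e="\<epsilon> / 4"] simp: dist_real_def)
  moreover have "\<forall>\<^sub>F j in sequentially. T0 \<le> real j"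
    using eventually_ge_at_top[of "nat \<lceil>T0\<rceil>"] by eventually_elim linarith
  ultimately have "\<forall>\<^sub>F j in sequentially. A / real j / \<eta> < \<epsilon> / 4 \<and> \<bar>?E' (real j) - ?L\<bar> < \<epsilon> / 4 \<and> T0 \<le> real j"
    by eventually_elim auto
  then obtain j where j: "A / real j / \<eta> < \<epsilon> / 4" "\<bar>?E' (real j) - ?L\<bar> < \<epsilon> / 4" "T0 \<le> real j"
    by (auto simp: eventually_sequentially)
  define T where "T = real j"
  have T: "0 \<le> T" by (simp add: T_def)
  have "\<forall>\<^sub>F n in sequentially. \<bar>?E n T - ?E' T\<bar> < \<epsilon> / 4"
  proof -
    have "(\<lambda>n. ?E n T) \<longlonglongrightarrow> ?E' T"
      by (rule excess_occupation_limit[OF v e(1) e(2) c T ramp_real_continuous])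
    then show ?thesis using \<epsilon> by (auto dest!: tendstoD[where e="\<epsilon> / 4"] simp: dist_real_def)
  qed
  moreover have "\<forall>\<^sub>F n in sequentially. B * v n powr (- 1 / 2) / \<eta> < \<epsilon> / 4"
  proof -
    have "((\<lambda>x::real. x powr (- 1 / 2)) \<longlongrightarrow> 0) at_top" by real_asymp
    then have "(\<lambda>n. B * v n powr (- 1 / 2) / \<eta>) \<longlonglongrightarrow> B * 0 / \<eta>"
      using \<eta> by (intro tendsto_intros filterlim_compose[OF _ v(2)]) auto
    then show ?thesis using \<epsilon> by (intro order_tendstoD) auto
  qed
  moreover have "\<forall>\<^sub>F n in sequentially. T \<le> ?S n"
  proof -
    have "filterlim (\<lambda>x::real. x powr (1 / \<alpha>) * \<tau>) at_top at_top" using alpha \<tau> by real_asymp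
    from filterlim_compose[OF this v(2)] show ?thesis by (auto simp: filterlim_at_top)
  qed
  ultimately have "\<forall>\<^sub>F n in sequentially. norm (?E n (?S n) - ?L) < \<epsilon>"
  proof eventually_elim
    fix n assume n: "\<bar>?E n T - ?E' T\<bar> < \<epsilon> / 4" "B * v n powr (- 1 / 2) / \<eta> < \<epsilon> / 4" "T \<le> ?S n"
    have S0: "0 \<le> ?S n" using \<tau> by simp
    note [measurable] = occupation_measurable[OF excess_measurable]
    have [measurable]: "occupation (?D n) T \<in> borel_measurable M" "occupation (?D n) (?S n) \<in> borel_measurable M"
      using T S0 by auto
    have oi: "integrable M (occupation (?D n) R)" if "0 \<le> R" for R
      by (rule integrable_const_bound[where B=R])
        (use occupation_bounds[OF excess_measurable that] occupation_measurable[OF excess_measurable that] in \<open>auto intro!: AE_I2\<close>)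
    have ci: "integrable M (\<lambda>\<omega>. ramp_real x \<eta> (occupation (?D n) R \<omega>))" if "0 \<le> R" for R
    proof -
      have [measurable]: "occupation (?D n) R \<in> borel_measurable M" by (rule occupation_measurable[OF excess_measurable that])
      show ?thesis by (rule integrable_const_bound[where B=1]) (auto simp: ramp_real_bounds)
    qed
    have mono: "occupation (?D n) T \<omega> \<le> occupation (?D n) (?S n) \<omega>" if "\<omega> \<in> space M" for \<omega>
      unfolding occupation_def using n(3)
      by (intro integral_mono occupation_integrable[OF excess_measurable T that] occupation_integrable[OF excess_measurable S0 that])
        (auto simp: indicator_def)
    have "\<bar>?E n (?S n) - ?E n T\<bar> = \<bar>expectation (\<lambda>\<omega>. ramp_real x \<eta> (occupation (?D n) (?S n) \<omega>) - ramp_real x \<eta> (occupation (?D n) T \<omega>))\<bar>"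
      using ci[OF T] ci[OF S0] by simp
    also have "\<dots> \<le> expectation (\<lambda>\<omega>. (occupation (?D n) (?S n) \<omega> - occupation (?D n) T \<omega>) / \<eta>)"
    proof (rule order_trans[OF integral_abs_bound integral_mono])
      fix \<omega> assume "\<omega> \<in> space M"
      then show "\<bar>ramp_real x \<eta> (occupation (?D n) (?S n) \<omega>) - ramp_real x \<eta> (occupation (?D n) T \<omega>)\<bar>
          \<le> (occupation (?D n) (?S n) \<omega> - occupation (?D n) T \<omega>) / \<eta>"
        using ramp_real_lipschitz[OF \<eta>(1), of x "occupation (?D n) (?S n) \<omega>" "occupation (?D n) T \<omega>"] mono by auto
    qed (use ci[OF T] ci[OF S0] oi[OF T] oi[OF S0] in auto)
    also have "\<dots> = (expectation (occupation (?D n) (?S n)) - expectation (occupation (?D n) T)) / \<eta>"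
      using oi[OF T] oi[OF S0] by simp
    also have "\<dots> \<le> (A / T + B * v n powr (- 1 / 2)) / \<eta>"
      using \<eta> j(3) n(3) v(1) by (intro divide_right_mono tail) (auto simp: T_def)
    also have "\<dots> < \<epsilon> / 4 + \<epsilon> / 4" using n(2) j(1) unfolding add_divide_distrib T_def by linarith
    finally show "norm (?E n (?S n) - ?L) < \<epsilon>"
      using n(1) j(2) unfolding real_norm_def T_def by linarith
  qed
  then show "\<exists>no. \<forall>n\<ge>no. norm (?E n (?S n) - ?L) < \<epsilon>" by (simp add: eventually_sequentially)
qed

end

section \<open>The limit given an exceedance at the initial time\<close>

lemma AE_lborel_vec_nth_neq_0: "AE x in (lborel :: (real ^ 'm::finite) measure). x $ i \<noteq> 0"
proof -
  let ?f = "\<lambda>j. if j = i then indicator {0} else (\<lambda>_. 1) :: real \<Rightarrow> ennreal"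
  have "emeasure lborel {x::real^'m. x $ i = 0} = (\<integral>\<^sup>+(x::real^'m). (\<Prod>j\<in>UNIV. ?f j (x $ j)) \<partial>lborel)"
  proof -
    have "(\<Prod>j\<in>UNIV. ?f j (x $ j)) = indicator {x. x $ i = 0} x" for x :: "real^'m"
      by (subst prod.remove[of UNIV i]) (auto simp: indicator_def intro!: prod.neutral)
    moreover have "{x::real^'m. x $ i = 0} \<in> sets borel" by measurable
    ultimately show ?thesis by simp
  qed
  also have "\<dots> = (\<Prod>j\<in>UNIV. \<integral>\<^sup>+t. ?f j t \<partial>lborel)"
    by (rule nn_integral_lborel_vec_prod) auto
  also have "\<dots> = 0"
    by (rule prod_zero) (auto intro!: exI[of _ i])
  finally show ?thesis
    by (intro AE_I[of _ _ "{x. x $ i = 0}"]) (auto simp: space_borel)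
qed

text \<open>Coordinate hyperplanes are cones of volume zero, so a uniform direction avoids them
  almost surely; on the remaining directions the drift bound is available.\<close>

lemma AE_uniform_sphere:
  "AE e in (uniform_sphere :: (real ^ 'm::finite) measure). norm e = 1 \<and> (\<forall>i. e $ i \<noteq> 0)"
proof -
  have "AE x in (lborel :: (real^'m) measure). \<forall>i. x $ i \<noteq> 0"
    by (subst AE_all_countable) (simp add: AE_lborel_vec_nth_neq_0)
  then have "AE x in uniform_measure lborel (ball (0::real^'m) 1). x \<noteq> 0 \<and> (\<forall>i. x $ i \<noteq> 0)"
    using AE_lborel_singleton[of "0::real^'m"] by (intro AE_uniform_measureI) (auto elim: eventually_elim2)
  then have "AE x in uniform_measure lborel (ball (0::real^'m) 1).
      norm (x /\<^sub>R norm x) = 1 \<and> (\<forall>i. (x /\<^sub>R norm x) $ i \<noteq> 0)"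
    by eventually_elim auto
  then show ?thesis
    unfolding uniform_sphere_def by (subst AE_distr_iff) auto
qed

context local_chi_square begin

definition limit_sojourn :: "real ^ 'm \<Rightarrow> real \<Rightarrow> 'w \<Rightarrow> ennreal" where
  "limit_sojourn e z \<omega> = (\<integral>\<^sup>+w\<in>{0..}. indicator {0<..} (excess_limit e z w \<omega>) \<partial>lborel)"

lemma limit_sojourn_measurable:
  assumes "f \<in> borel_measurable K" "g \<in> borel_measurable K" "h \<in> K \<rightarrow>\<^sub>M M"
  shows "(\<lambda>x. limit_sojourn (f x) (g x) (h x)) \<in> borel_measurable K"
proof -
  let ?F = "\<lambda>(e, z) (w::real) y. indicator {0<..} (2 * ((\<Sum>i\<in>UNIV. y $ i * e $ i) - (\<Sum>i\<in>UNIV. c i * (e $ i)\<^sup>2 * \<bar>w\<bar> powr \<alpha>) + z)) :: ennreal"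
  have m: "(\<lambda>(p, w, y). ?F p w y) \<in> borel_measurable ((borel \<Otimes>\<^sub>M borel) \<Otimes>\<^sub>M borel \<Otimes>\<^sub>M borel)"
    unfolding split_beta' by measurable
  have "(\<lambda>x. \<integral>\<^sup>+s\<in>{0..}. ?F (f x, g x) s (\<chi> i. Z i (1 * s) (h x)) \<partial>lborel) \<in> borel_measurable K"
    by (rule borel_measurable_process_integral[OF Z_process m, where c="\<lambda>_ _. 1" and f="\<lambda>x. (f x, g x)"])
      (use assms in auto)
  also have "(\<lambda>x. \<integral>\<^sup>+s\<in>{0..}. ?F (f x, g x) s (\<chi> i. Z i (1 * s) (h x)) \<partial>lborel) = (\<lambda>x. limit_sojourn (f x) (g x) (h x))"
    unfolding limit_sojourn_def by (intro ext nn_integral_cong) (auto simp: excess_limit_def indicator_def)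
  finally show ?thesis .
qed

lemma initial_std_normal: "distr M borel (\<lambda>\<omega>. \<chi> i. W i 0 \<omega>) = std_normal_vec"
proof (rule distr_std_normal_vec)
  show "indep_vars (\<lambda>_. borel) (\<lambda>i. W i 0) UNIV"
    by (rule indep_paths_char(2)[OF W_indep, where f="\<lambda>i p. p 0"]) (auto intro: measurable_component_singleton)
  fix i
  interpret N: centered_normal M "W i 0" 1
  proof
    show "W i 0 \<in> borel_measurable M" by (rule measurable_process_component[OF W_process]) simp
    show "(LINT \<omega>|M. iexp (a * W i 0 \<omega>)) = of_real (exp (- (a\<^sup>2 * 1) / 2))" for a
      using residual_char1[of "{}" "\<lambda>_. 0" a i] by simp
  qed
  have "distr M borel (W i 0) = distr std_normal_distribution borel (\<lambda>z. z)" using N.distr_eq by simp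
  also have "\<dots> = distr std_normal_distribution std_normal_distribution (\<lambda>z. z)"
    by (rule distr_cong) auto
  also have "\<dots> = std_normal_distribution" by (rule distr_id)
  finally show "distr M borel (W i 0) = std_normal_distribution" .
qed

lemma scaled_sojourn:
  assumes v: "0 < v" and \<omega>: "\<omega> \<in> space M" and \<tau>: "0 \<le> \<tau>"
  shows "ennreal (v powr (1 / \<alpha>)) * (\<integral>\<^sup>+s\<in>{0..}. indicator {0..\<tau>} s *
      indicator {v<..} (\<Sum>i\<in>UNIV. (\<rho> i s * x $ i + residual i s \<omega>)\<^sup>2) \<partial>lborel) =
    ennreal (occupation (excess v x) (v powr (1 / \<alpha>) * \<tau>) \<omega>)"
proof -
  let ?u = "v powr (1 / \<alpha>)"
  have u: "0 < ?u" using v by simp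
  have [measurable]: "(\<lambda>w. excess v x w \<omega>) \<in> borel_measurable borel"
    by (rule D_comp[OF excess_measurable order_refl]) (use \<omega> in auto)
  have "ennreal (occupation (excess v x) (?u * \<tau>) \<omega>) = (\<integral>\<^sup>+w\<in>{0..?u * \<tau>}. indicator {0<..} (excess v x w \<omega>) \<partial>lborel)"
    using u \<tau> by (intro nn_integral_occupation[symmetric] excess_measurable \<omega>) auto
  also have "\<dots> = ennreal \<bar>?u\<bar> * (\<integral>\<^sup>+s. indicator {0<..} (excess v x (0 + ?u * s) \<omega>) * indicator {0..?u * \<tau>} (0 + ?u * s) \<partial>lborel)"
    using u by (intro nn_integral_real_affine) auto
  also have "(\<integral>\<^sup>+s. indicator {0<..} (excess v x (0 + ?u * s) \<omega>) * indicator {0..?u * \<tau>} (0 + ?u * s) \<partial>lborel) =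
      (\<integral>\<^sup>+s\<in>{0..}. indicator {0..\<tau>} s * indicator {v<..} (\<Sum>i\<in>UNIV. (\<rho> i s * x $ i + residual i s \<omega>)\<^sup>2) \<partial>lborel)"
  proof (intro nn_integral_cong)
    fix s :: real
    show "indicator {0<..} (excess v x (0 + ?u * s) \<omega>) * indicator {0..?u * \<tau>} (0 + ?u * s) =
      (indicator {0..\<tau>} s * indicator {v<..} (\<Sum>i\<in>UNIV. (\<rho> i s * x $ i + residual i s \<omega>)\<^sup>2) * indicator {0..} s :: ennreal)"
    proof (cases "0 \<le> s")
      case True
      then have "rtime v (?u * s) = s" using u by (simp add: rtime_def abs_mult)
      then show ?thesis using True u by (auto simp: excess_def indicator_def)
    next
      case False
      then show ?thesis using u by (auto simp: indicator_def zero_le_mult_iff)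
    qed
  qed
  finally show ?thesis using u by simp
qed

lemma conditional_limit:
  assumes bounds: "\<And>i s. 0 \<le> s \<Longrightarrow> s \<le> \<tau> \<Longrightarrow> 0 \<le> \<rho> i s \<and> \<rho> i s \<le> 1 - c i / 2 * s powr \<alpha>"
    and \<tau>: "0 < \<tau>" and c: "\<exists>i. 0 < c i"
    and v: "\<And>n. 1 \<le> v n" "filterlim v at_top sequentially" and \<eta>: "0 < \<eta>" "0 \<le> x"
  shows "(\<lambda>n. expectation (\<lambda>\<omega>. indicator {v n<..} (\<Sum>i\<in>UNIV. (W i 0 \<omega>)\<^sup>2) * ramp x \<eta> (ennreal (v n powr (1 / \<alpha>)) *
        (\<integral>\<^sup>+s\<in>{0..}. indicator {0..\<tau>} s * indicator {v n<..} (\<Sum>i\<in>UNIV. (W i s \<omega>)\<^sup>2) \<partial>lborel))) /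
      (LINT x|(std_normal_vec :: (real ^ 'm) measure). indicator {v n<..} ((norm x)\<^sup>2)))
    \<longlonglongrightarrow> (LINT q|(uniform_sphere \<Otimes>\<^sub>M density lborel (exponential_density 1)).
      expectation (\<lambda>\<omega>. ramp x \<eta> (limit_sojourn (fst q) (snd q) \<omega>)))"
proof -
  let ?u = "\<lambda>n. v n powr (1 / \<alpha>)"
  define F where "F n p s y = (indicator {0..\<tau>} s * indicator {v n<..} (\<Sum>i\<in>UNIV. (\<rho> i s * p $ i + y $ i)\<^sup>2) :: ennreal)"
    for n and p y :: "real^'m" and s
  define H where "H n p q = indicator {v n<..} ((norm p)\<^sup>2) * ramp x \<eta> (ennreal (?u n) * q)" for n and p :: "real^'m" and q
  define g where "g n p = expectation (\<lambda>\<omega>. ramp_real x \<eta> (occupation (excess (v n) p) (?u n * \<tau>) \<omega>))" for n p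
  have v0: "0 < v n" for n using v(1)[of n] by linarith
  have W0 [measurable]: "W i 0 \<in> borel_measurable M" for i by (rule measurable_process_component[OF W_process]) simp
  have Fm: "(\<lambda>(p, s, y). F n p s y) \<in> borel_measurable (borel \<Otimes>\<^sub>M borel \<Otimes>\<^sub>M borel)" for n
    unfolding F_def split_beta' by measurable
  have Hm: "(\<lambda>(p, q). H n p q) \<in> borel_measurable (borel \<Otimes>\<^sub>M borel)" for n
    unfolding H_def split_beta' by measurable
  have occ: "ramp x \<eta> (ennreal (?u n) * (\<integral>\<^sup>+s\<in>{0..}. F n p s (\<chi> i. residual i (1 * s) \<omega>) \<partial>lborel)) =
      ramp_real x \<eta> (occupation (excess (v n) p) (?u n * \<tau>) \<omega>)" if "\<omega> \<in> space M" for n p \<omega>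
  proof -
    have "0 \<le> ?u n * \<tau>" using \<tau> by simp
    then show ?thesis
      using scaled_sojourn[OF v0 that, of \<tau> n p] \<tau> \<eta> occupation_bounds(1)[OF excess_measurable, of "?u n * \<tau>" "v n" p \<omega>]
      by (simp add: F_def ramp_ennreal)
  qed
  have Wrec: "H n (\<chi> i. W i 0 \<omega>) (\<integral>\<^sup>+s\<in>{0..}. F n (\<chi> i. W i 0 \<omega>) s (\<chi> i. residual i (1 * s) \<omega>) \<partial>lborel) =
      indicator {v n<..} (\<Sum>i\<in>UNIV. (W i 0 \<omega>)\<^sup>2) * ramp x \<eta> (ennreal (?u n) *
        (\<integral>\<^sup>+s\<in>{0..}. indicator {0..\<tau>} s * indicator {v n<..} (\<Sum>i\<in>UNIV. (W i s \<omega>)\<^sup>2) \<partial>lborel))" for n \<omega>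
    by (simp add: H_def F_def residual_def norm_vec_def L2_set_def sum_nonneg)
  have "expectation (\<lambda>\<omega>. indicator {v n<..} (\<Sum>i\<in>UNIV. (W i 0 \<omega>)\<^sup>2) * ramp x \<eta> (ennreal (?u n) *
        (\<integral>\<^sup>+s\<in>{0..}. indicator {0..\<tau>} s * indicator {v n<..} (\<Sum>i\<in>UNIV. (W i s \<omega>)\<^sup>2) \<partial>lborel)))
      = (LINT p|std_normal_vec. indicator {v n<..} ((norm p)\<^sup>2) * g n p)" for n
  proof -
    have "expectation (\<lambda>\<omega>. H n (\<chi> i. W i 0 \<omega>) (\<integral>\<^sup>+s\<in>{0..}. F n (\<chi> i. W i 0 \<omega>) s (\<chi> i. residual i (1 * s) \<omega>) \<partial>lborel)) =
      (LINT p|distr M borel (\<lambda>\<omega>. \<chi> i. W i 0 \<omega>). expectation (\<lambda>\<omega>. H n p (\<integral>\<^sup>+s\<in>{0..}. F n p s (\<chi> i. residual i (1 * s) \<omega>) \<partial>lborel)))"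
      by (rule expectation_freeze[OF prob_space_axioms residual_process residual_L2_continuous _ indep_initial_residual Fm,
            where c="\<lambda>_ _. 1" and b=1])
        (use Hm in \<open>auto simp: H_def ramp_bounds indicator_def\<close>)
    also have "\<dots> = (LINT p|std_normal_vec. indicator {v n<..} ((norm p)\<^sup>2) * g n p)"
      unfolding initial_std_normal g_def
      by (intro Bochner_Integration.integral_cong refl)
         (simp add: H_def occ[simplified] cong: Bochner_Integration.integral_cong)
    finally show ?thesis unfolding Wrec .
  qed
  note num = this
  have gm: "g n \<in> borel_measurable borel" for n
  proof -
    have J: "(\<lambda>y. \<integral>\<^sup>+s\<in>{0..}. F n (fst y) s (\<chi> i. residual i (1 * s) (snd y)) \<partial>lborel) \<in> borel_measurable (borel \<Otimes>\<^sub>M M)"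
      by (rule borel_measurable_process_integral[OF residual_process Fm, where c="\<lambda>_ _. 1" and f=fst and g=snd]) auto
    have "(\<lambda>p. expectation (\<lambda>\<omega>. ramp x \<eta> (ennreal (?u n) * (\<integral>\<^sup>+s\<in>{0..}. F n p s (\<chi> i. residual i (1 * s) \<omega>) \<partial>lborel)))) \<in> borel_measurable borel"
    proof (rule borel_measurable_lebesgue_integral)
      show "(\<lambda>(p, \<omega>). ramp x \<eta> (ennreal (?u n) * (\<integral>\<^sup>+s\<in>{0..}. F n p s (\<chi> i. residual i (1 * s) \<omega>) \<partial>lborel))) \<in> borel_measurable (borel \<Otimes>\<^sub>M M)"
        unfolding split_beta' using J by measurable
    qed
    then show ?thesis unfolding g_def by (simp add: occ[simplified] cong: Bochner_Integration.integral_cong)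
  qed
  have g01: "0 \<le> g n p" "g n p \<le> 1" for n p
  proof -
    show "0 \<le> g n p" unfolding g_def by (simp add: ramp_real_bounds)
    have "0 \<le> ?u n * \<tau>" using \<tau> by simp
    note [measurable] = occupation_measurable[OF excess_measurable this]
    have "g n p \<le> expectation (\<lambda>_. 1)"
      unfolding g_def by (intro integral_mono integrable_const_bound[where B=1]) (auto simp: ramp_real_bounds)
    then show "g n p \<le> 1" by (simp add: prob_space)
  qed
  let ?G = "\<lambda>q. expectation (\<lambda>\<omega>. ramp x \<eta> (limit_sojourn (fst q) (snd q) \<omega>))"
  have Gm: "?G \<in> borel_measurable (borel \<Otimes>\<^sub>M borel)"
  proof (rule borel_measurable_lebesgue_integral)
    have "(\<lambda>y. limit_sojourn (fst (fst y)) (snd (fst y)) (snd y)) \<in> borel_measurable ((borel \<Otimes>\<^sub>M borel) \<Otimes>\<^sub>M M)"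
      by (rule limit_sojourn_measurable) measurable
    then show "(\<lambda>(q, \<omega>). ramp x \<eta> (limit_sojourn (fst q) (snd q) \<omega>)) \<in> borel_measurable ((borel \<Otimes>\<^sub>M borel) \<Otimes>\<^sub>M M)"
      unfolding split_beta' by measurable
  qed
  have "AE q in (uniform_sphere \<Otimes>\<^sub>M lborel). 0 < snd q \<longrightarrow>
      (\<lambda>n. g n ((sqrt (v n) + snd q / sqrt (v n)) *\<^sub>R fst q)) \<longlonglongrightarrow> ?G q"
  proof -
    interpret S: prob_space "uniform_sphere :: (real^'m) measure" by (rule prob_space_uniform_sphere)
    interpret pair_sigma_finite "uniform_sphere :: (real^'m) measure" "lborel :: real measure" by unfold_locales
    have "AE q in ((uniform_sphere :: (real^'m) measure) \<Otimes>\<^sub>M (lborel :: real measure)). norm (fst q) = 1 \<and> (\<forall>i. fst q $ i \<noteq> 0)"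
    proof (rule AE_pair_measure)
      show "{q \<in> space ((uniform_sphere :: (real^'m) measure) \<Otimes>\<^sub>M (lborel :: real measure)). norm (fst q) = 1 \<and> (\<forall>i. fst q $ i \<noteq> 0)}
          \<in> sets (uniform_sphere \<Otimes>\<^sub>M lborel)" by measurable
    qed (use AE_uniform_sphere in auto)
    then show ?thesis
    proof eventually_elim
      fix q :: "(real^'m) \<times> real" assume q: "norm (fst q) = 1 \<and> (\<forall>i. fst q $ i \<noteq> 0)"
      show "0 < snd q \<longrightarrow> (\<lambda>n. g n ((sqrt (v n) + snd q / sqrt (v n)) *\<^sub>R fst q)) \<longlonglongrightarrow> ?G q"
      proof
        assume "0 < snd q"
        then show "(\<lambda>n. g n ((sqrt (v n) + snd q / sqrt (v n)) *\<^sub>R fst q)) \<longlonglongrightarrow> ?G q"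
          unfolding g_def limit_sojourn_def amp_def[symmetric]
          using q by (intro ramp_limit[OF bounds \<tau> _ _ _ c v \<eta>]) auto
      qed
    qed
  qed
  from std_normal_vec_tail_limit[OF v gm Gm g01 this]
  show ?thesis unfolding num .
qed

end

lemma (in prob_space) L2_continuous_stationary:
  assumes X: "gaussian_family M (\<lambda>s t. r (t - s)) X" and even: "\<And>h. r (- h) = r h" and cont: "isCont r 0"
  shows "L2_continuous M X"
proof (rule gaussian_family_L2_continuous[OF X])
  show "r (t - s) = r (s - t)" for s t using even[of "t - s"] by simp
  fix \<epsilon> :: real assume "0 < \<epsilon>"
  then obtain \<delta> where \<delta>: "0 < \<delta>" "\<And>h. \<bar>h\<bar> < \<delta> \<Longrightarrow> \<bar>r h - r 0\<bar> < \<epsilon> / 2"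
    using cont[unfolded continuous_at_eps_delta, rule_format, of "\<epsilon> / 2"] by (auto simp: dist_real_def)
  show "\<exists>\<delta>>0. \<forall>s\<ge>0. \<forall>t\<ge>0. \<bar>t - s\<bar> < \<delta> \<longrightarrow> r (t - t) + r (s - s) - 2 * r (t - s) \<le> \<epsilon>"
  proof (intro exI[of _ \<delta>] conjI allI impI \<delta>(1))
    fix s t :: real assume "\<bar>t - s\<bar> < \<delta>"
    from \<delta>(2)[OF this] have "2 * r 0 - 2 * r (t - s) \<le> \<epsilon>" by argo
    then show "r (t - t) + r (s - s) - 2 * r (t - s) \<le> \<epsilon>" by simp
  qed
qed

lemma (in prob_space) L2_continuous_fbm:
  assumes Z: "gaussian_family M (\<lambda>s t. t powr \<alpha> + s powr \<alpha> - \<bar>t - s\<bar> powr \<alpha>) Z" and \<alpha>: "0 < \<alpha>"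
  shows "L2_continuous M Z"
proof (rule gaussian_family_L2_continuous[OF Z])
  fix \<epsilon> :: real assume \<epsilon>: "0 < \<epsilon>"
  show "\<exists>\<delta>>0. \<forall>s\<ge>0. \<forall>t\<ge>0. \<bar>t - s\<bar> < \<delta> \<longrightarrow>
      (t powr \<alpha> + t powr \<alpha> - \<bar>t - t\<bar> powr \<alpha>) + (s powr \<alpha> + s powr \<alpha> - \<bar>s - s\<bar> powr \<alpha>)
      - 2 * (t powr \<alpha> + s powr \<alpha> - \<bar>t - s\<bar> powr \<alpha>) \<le> \<epsilon>"
  \<comment> \<open>Increments of the process have variance
    \<open>2 * \<bar>t - s\<bar> powr \<alpha>\<close>, which is solved for the time lag.\<close>
  proof (intro exI[of _ "(\<epsilon> / 2) powr (1 / \<alpha>)"] conjI allI impI)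
    show "0 < (\<epsilon> / 2) powr (1 / \<alpha>)" using \<epsilon> by simp
    fix s t :: real assume "\<bar>t - s\<bar> < (\<epsilon> / 2) powr (1 / \<alpha>)"
    then have "\<bar>t - s\<bar> powr \<alpha> \<le> ((\<epsilon> / 2) powr (1 / \<alpha>)) powr \<alpha>" using \<alpha> by (intro powr_mono2) auto
    also have "\<dots> = \<epsilon> / 2" using \<alpha> \<epsilon> by (simp add: powr_powr)
    finally show "(t powr \<alpha> + t powr \<alpha> - \<bar>t - t\<bar> powr \<alpha>) + (s powr \<alpha> + s powr \<alpha> - \<bar>s - s\<bar> powr \<alpha>)
      - 2 * (t powr \<alpha> + s powr \<alpha> - \<bar>t - s\<bar> powr \<alpha>) \<le> \<epsilon>"
      using \<alpha> by simp
  qed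
qed (simp add: abs_minus_commute add.commute)

section \<open>The time-changed process\<close>

locale sojourn_setting = prob_space M for M :: "'w measure" +
  fixes X Z :: "'m::finite \<Rightarrow> real \<Rightarrow> 'w \<Rightarrow> real" and r :: "'m \<Rightarrow> real \<Rightarrow> real" and C :: "'m \<Rightarrow> real" and \<alpha> :: real
  assumes alpha: "0 < \<alpha>" and C_pos: "\<And>i. 0 < C i"
    and X_stat: "\<And>i. stationary_gaussian_process M (r i) (X i)"
    and X_indep: "indep_vars (\<lambda>_. \<Pi>\<^sub>M t\<in>{0..}. borel) (\<lambda>i \<omega>. \<lambda>t\<in>{0..}. X i t \<omega>) UNIV"
    and expansion: "\<And>i. local_expansion \<alpha> (C i) (r i)"
    and Z_fbm: "\<And>i. fractional_brownian_motion M \<alpha> (Z i)"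
    and Z_indep: "indep_vars (\<lambda>_. \<Pi>\<^sub>M t\<in>{0..}. borel) (\<lambda>i \<omega>. \<lambda>t\<in>{0..}. Z i t \<omega>) UNIV"
begin

lemma X_process: "measurable_process M (X i)"
  using X_stat[of i] by (simp add: stationary_gaussian_process_def)

lemma Z_process: "measurable_process M (Z i)"
  using Z_fbm[of i] by (simp add: fractional_brownian_motion_def)

lemma X_gaussian: "gaussian_family M (\<lambda>s t. r i (t - s)) (X i)"
  using X_stat[of i] by (intro gaussian_process_family prob_space_axioms) (auto simp: stationary_gaussian_process_def)

lemma Z_gaussian: "gaussian_family M (\<lambda>s t. t powr \<alpha> + s powr \<alpha> - \<bar>t - s\<bar> powr \<alpha>) (Z i)"
  using Z_fbm[of i] by (intro gaussian_process_family prob_space_axioms) (auto simp: fractional_brownian_motion_def)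

lemma r_cov: "0 \<le> s \<Longrightarrow> 0 \<le> t \<Longrightarrow> r i (t - s) = expectation (\<lambda>\<omega>. X i s \<omega> * X i t \<omega>)"
  using X_stat[of i] by (auto simp: stationary_gaussian_process_def covariance_def centered_process_def)

lemma r_minus: "r i (- h) = r i h"
proof -
  have "r i (- h) = r i h" if "0 \<le> h" for h
    using r_cov[of h 0 i] r_cov[of 0 h i] that by (simp add: mult.commute)
  from this[of h] this[of "- h"] show ?thesis by (cases "0 \<le> h") auto
qed

text \<open>No regularity of \<open>r i\<close> away from 0 is assumed; measurability is inherited
  from the joint measurability of the process by writing the covariance as an expectation depending
  on the lag.\<close>

lemma r_measurable: "r i \<in> borel_measurable borel"
proof -
  have [measurable]: "X i 0 \<in> borel_measurable M" by (rule measurable_process_component[OF X_process]) simp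
  have [measurable]: "(\<lambda>q. X i \<bar>fst q\<bar> (snd q)) \<in> borel_measurable (borel \<Otimes>\<^sub>M M)"
    by (rule measurable_process_comp[OF X_process]) auto
  have "(\<lambda>h. expectation (\<lambda>\<omega>. X i 0 \<omega> * X i \<bar>h\<bar> \<omega>)) \<in> borel_measurable borel"
    by (rule borel_measurable_lebesgue_integral) (simp add: split_beta')
  also have "(\<lambda>h. expectation (\<lambda>\<omega>. X i 0 \<omega> * X i \<bar>h\<bar> \<omega>)) = r i"
  proof
    fix h show "expectation (\<lambda>\<omega>. X i 0 \<omega> * X i \<bar>h\<bar> \<omega>) = r i h"
      using r_cov[of 0 "\<bar>h\<bar>" i] r_minus[of i h] by (cases "0 \<le> h") auto
  qed
  finally show ?thesis .
qed

lemma r_expansion: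
  assumes "0 < \<epsilon>"
  shows "\<exists>\<delta>>0. \<forall>i t. \<bar>t\<bar> < \<delta> \<longrightarrow> \<bar>r i t - (1 - C i * \<bar>t\<bar> powr \<alpha>)\<bar> \<le> \<epsilon> * \<bar>t\<bar> powr \<alpha>"
proof -
  have "\<forall>i. \<forall>\<^sub>F t in nhds 0. norm (r i t - (1 - C i * \<bar>t\<bar> powr \<alpha>)) \<le> \<epsilon> * norm (\<bar>t\<bar> powr \<alpha>)"
    using landau_o.smallD[OF expansion[unfolded local_expansion_def] assms] by simp
  then have "\<forall>\<^sub>F t in nhds 0. \<forall>i. norm (r i t - (1 - C i * \<bar>t\<bar> powr \<alpha>)) \<le> \<epsilon> * norm (\<bar>t\<bar> powr \<alpha>)"
    by (simp add: eventually_all_finite)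
  then show ?thesis by (auto simp: eventually_nhds_metric dist_real_def)
qed

lemma r_0: "r i 0 = 1"
proof -
  obtain \<delta> where "0 < \<delta>" "\<And>i t. \<bar>t\<bar> < \<delta> \<Longrightarrow> \<bar>r i t - (1 - C i * \<bar>t\<bar> powr \<alpha>)\<bar> \<le> 1 * \<bar>t\<bar> powr \<alpha>"
    using r_expansion[of 1] by auto
  from this(2)[of 0 i] this(1) alpha show ?thesis by simp
qed

lemma r_cont: "isCont (r i) 0"
proof -
  obtain \<delta> where \<delta>: "0 < \<delta>" "\<And>i t. \<bar>t\<bar> < \<delta> \<Longrightarrow> \<bar>r i t - (1 - C i * \<bar>t\<bar> powr \<alpha>)\<bar> \<le> 1 * \<bar>t\<bar> powr \<alpha>"
    using r_expansion[of 1] by auto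
  have p: "((\<lambda>t::real. \<bar>t\<bar> powr \<alpha>) \<longlongrightarrow> \<bar>0\<bar> powr \<alpha>) (at 0)"
    by (rule tendsto_powr'[OF tendsto_rabs[OF tendsto_ident_at] tendsto_const]) (use alpha in auto)
  have "((\<lambda>t. r i t - (1 - C i * \<bar>t\<bar> powr \<alpha>)) \<longlongrightarrow> 0) (at 0)"
  proof (rule tendsto_0_le[of "\<lambda>t::real. \<bar>t\<bar> powr \<alpha>" _ _ 1])
    show "((\<lambda>t::real. \<bar>t\<bar> powr \<alpha>) \<longlongrightarrow> 0) (at 0)" using p by simp
    show "\<forall>\<^sub>F t in at 0. norm (r i t - (1 - C i * \<bar>t\<bar> powr \<alpha>)) \<le> norm (\<bar>t\<bar> powr \<alpha>) * 1"
      unfolding eventually_at using \<delta> by (intro exI[of _ \<delta>]) (auto simp: dist_real_def)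
  qed
  from tendsto_add[OF this tendsto_diff[OF tendsto_const[of 1] tendsto_mult[OF tendsto_const[of "C i"] p]]]
  show ?thesis by (simp add: isCont_def r_0)
qed

lemma r_limit: "((\<lambda>v. v * (1 - r i (a / v powr (1 / \<alpha>)))) \<longlongrightarrow> C i * \<bar>a\<bar> powr \<alpha>) at_top"
proof (rule tendstoI)
  fix \<epsilon> :: real assume \<epsilon>: "0 < \<epsilon>"
  define \<epsilon>' where "\<epsilon>' = \<epsilon> / (2 * (\<bar>a\<bar> powr \<alpha> + 1))"
  have \<epsilon>': "0 < \<epsilon>'" unfolding \<epsilon>'_def using \<epsilon> by (intro divide_pos_pos) (auto intro: add_nonneg_pos)
  obtain \<delta> where \<delta>: "0 < \<delta>" "\<And>i t. \<bar>t\<bar> < \<delta> \<Longrightarrow> \<bar>r i t - (1 - C i * \<bar>t\<bar> powr \<alpha>)\<bar> \<le> \<epsilon>' * \<bar>t\<bar> powr \<alpha>"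
    using r_expansion[OF \<epsilon>'] by auto
  have "((\<lambda>v::real. \<bar>a\<bar> / v powr (1 / \<alpha>)) \<longlongrightarrow> 0) at_top" using alpha by real_asymp
  then have "\<forall>\<^sub>F v in at_top. \<bar>a\<bar> / v powr (1 / \<alpha>) < \<delta>" using \<delta>(1) by (rule order_tendstoD)
  then show "\<forall>\<^sub>F v in at_top. dist (v * (1 - r i (a / v powr (1 / \<alpha>)))) (C i * \<bar>a\<bar> powr \<alpha>) < \<epsilon>"
    using eventually_gt_at_top[of 0]
  proof eventually_elim
    fix v :: real assume v: "\<bar>a\<bar> / v powr (1 / \<alpha>) < \<delta>" "0 < v"
    let ?t = "a / v powr (1 / \<alpha>)"
    have t: "\<bar>?t\<bar> powr \<alpha> = \<bar>a\<bar> powr \<alpha> / v" using v(2) alpha by (simp add: powr_divide powr_powr)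
    have "v * (1 - r i ?t) - C i * \<bar>a\<bar> powr \<alpha> = - v * (r i ?t - (1 - C i * \<bar>?t\<bar> powr \<alpha>))"
      unfolding t using v(2) by (simp add: field_simps)
    then have "\<bar>v * (1 - r i ?t) - C i * \<bar>a\<bar> powr \<alpha>\<bar> = v * \<bar>r i ?t - (1 - C i * \<bar>?t\<bar> powr \<alpha>)\<bar>"
      using v(2) by (simp add: abs_mult)
    also have "\<dots> \<le> v * (\<epsilon>' * \<bar>?t\<bar> powr \<alpha>)" using v by (intro mult_left_mono \<delta>(2)) auto
    also have "\<dots> = \<epsilon>' * \<bar>a\<bar> powr \<alpha>" unfolding t using v(2) by simp
    also have "\<dots> \<le> \<epsilon>' * (\<bar>a\<bar> powr \<alpha> + 1)" using \<epsilon>' by simp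
    also have "\<dots> = \<epsilon> / 2"
    proof -
      have "\<bar>a\<bar> powr \<alpha> + 1 \<noteq> 0" using powr_ge_zero[of "\<bar>a\<bar>" \<alpha>] by linarith
      then show ?thesis unfolding \<epsilon>'_def by (simp add: field_simps)
    qed
    finally show "dist (v * (1 - r i ?t)) (C i * \<bar>a\<bar> powr \<alpha>) < \<epsilon>" using \<epsilon> by (simp add: dist_real_def)
  qed
qed

text \<open>The radius found here, divided by a bound on the clock, is what limits \<open>t\<close>
  in the end. The error of the expansion is taken relative to the smallest \<open>C i\<close>, so
  that it costs at most half of each leading term.\<close>

lemma r_bounds: "\<exists>\<delta>>0. \<forall>i t. \<bar>t\<bar> < \<delta> \<longrightarrow> 0 \<le> r i t \<and> r i t \<le> 1 - C i / 2 * \<bar>t\<bar> powr \<alpha>"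
proof -
  define m where "m = Min (range C)"
  define D where "D = Max (range C)"
  have m: "0 < m" "\<And>i. m \<le> C i" using C_pos by (auto simp: m_def)
  have D: "\<And>i. C i \<le> D" by (auto simp: D_def)
  have D0: "0 < D" using C_pos D by (meson less_le_trans)
  obtain \<delta> where \<delta>: "0 < \<delta>" "\<And>i t. \<bar>t\<bar> < \<delta> \<Longrightarrow> \<bar>r i t - (1 - C i * \<bar>t\<bar> powr \<alpha>)\<bar> \<le> m / 2 * \<bar>t\<bar> powr \<alpha>"
    using r_expansion[of "m / 2"] m by auto
  \<comment> \<open>The second bound gives
    \<open>C i * \<bar>t\<bar> powr \<alpha> \<le> 1 / 2\<close>; even with the error added, at most
    \<open>3 / 4\<close> is lost, which yields nonnegativity.\<close>
  define \<gamma> where "\<gamma> = min \<delta> ((1 / (2 * D)) powr (1 / \<alpha>))"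
  have \<gamma>: "0 < \<gamma>" using \<delta> D0 by (simp add: \<gamma>_def)
  show ?thesis
  proof (intro exI[of _ \<gamma>] conjI allI impI \<gamma>)
    fix i and t :: real assume t: "\<bar>t\<bar> < \<gamma>"
    have "\<bar>r i t - (1 - C i * \<bar>t\<bar> powr \<alpha>)\<bar> \<le> m / 2 * \<bar>t\<bar> powr \<alpha>" using t by (intro \<delta>(2)) (simp add: \<gamma>_def)
    also have "\<dots> \<le> C i / 2 * \<bar>t\<bar> powr \<alpha>" using m(2)[of i] by (intro mult_right_mono) auto
    finally have b: "\<bar>r i t - (1 - C i * \<bar>t\<bar> powr \<alpha>)\<bar> \<le> C i / 2 * \<bar>t\<bar> powr \<alpha>" .
    have eq: "C i * \<bar>t\<bar> powr \<alpha> = C i / 2 * \<bar>t\<bar> powr \<alpha> + C i / 2 * \<bar>t\<bar> powr \<alpha>" by simp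
    show "r i t \<le> 1 - C i / 2 * \<bar>t\<bar> powr \<alpha>" using b eq by linarith
    have "\<bar>t\<bar> powr \<alpha> \<le> ((1 / (2 * D)) powr (1 / \<alpha>)) powr \<alpha>" using t alpha by (intro powr_mono2) (auto simp: \<gamma>_def)
    also have "\<dots> = 1 / (2 * D)" using alpha D0 by (simp add: powr_powr)
    finally have "C i * \<bar>t\<bar> powr \<alpha> \<le> D * (1 / (2 * D))" using D D0 by (intro mult_mono) auto
    also have "\<dots> = 1 / 2" using D0 by simp
    finally have "C i * \<bar>t\<bar> powr \<alpha> \<le> 1 / 2" .
    then show "0 \<le> r i t" using b eq by linarith
  qed
qed

definition zlim :: "real ^ 'm \<Rightarrow> (real ^ 'm) \<times> real \<Rightarrow> real \<Rightarrow> 'w \<Rightarrow> real" where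
  "zlim \<theta> q w \<omega> = (\<Sum>i\<in>UNIV. Z i (C i powr (1 / \<alpha>) * \<bar>\<theta> $ i\<bar> * w) \<omega> * fst q $ i)
    - (\<Sum>i\<in>UNIV. C i * (fst q $ i)\<^sup>2 * \<bar>\<theta> $ i\<bar> powr \<alpha> * w powr \<alpha>) + snd q"

definition zsojourn :: "real ^ 'm \<Rightarrow> (real ^ 'm) \<times> real \<Rightarrow> 'w \<Rightarrow> ennreal" where
  "zsojourn \<theta> q \<omega> = (\<integral>\<^sup>+w\<in>{0..}. indicator {0<..} (zlim \<theta> q w \<omega>) \<partial>lborel)"

definition chi :: "real ^ 'm \<Rightarrow> real \<Rightarrow> 'w \<Rightarrow> real" where
  "chi \<theta> s \<omega> = (\<Sum>i\<in>UNIV. (X i (\<bar>\<theta> $ i\<bar> * s) \<omega>)\<^sup>2)"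

text \<open>Covariances of \<open>X i\<close> depend on time differences only, so the starting time
  \<open>s\<close> disappears from the correlations. On the side of the limit, scaling time by
  \<open>C i powr (1 / \<alpha>) * \<bar>\<theta> $ i\<bar>\<close> multiplies the fractional
  covariance by \<open>C i * \<bar>\<theta> $ i\<bar> powr \<alpha>\<close>, the coefficient in the
  expansion of the slowed correlation.\<close>

lemma local_chi_square_frozen:
  assumes s: "0 \<le> s"
  shows "local_chi_square M (\<lambda>i w. X i (\<bar>\<theta> $ i\<bar> * (s + w))) (\<lambda>i w. Z i (C i powr (1 / \<alpha>) * \<bar>\<theta> $ i\<bar> * w))
    (\<lambda>i w. r i (\<bar>\<theta> $ i\<bar> * w)) (\<lambda>i. C i * \<bar>\<theta> $ i\<bar> powr \<alpha>) \<alpha>"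
proof
  let ?a = "\<lambda>i. \<bar>\<theta> $ i\<bar>" and ?k = "\<lambda>i. C i powr (1 / \<alpha>) * \<bar>\<theta> $ i\<bar>"
  have k: "?k i powr \<alpha> = C i * ?a i powr \<alpha>" "0 \<le> ?k i" for i
    using alpha C_pos[of i] by (auto simp: powr_mult powr_powr)
  show "0 < \<alpha>" by (rule alpha)
  fix i
  have fstm: "fst \<in> borel_measurable (restrict_space borel {0::real..} \<Otimes>\<^sub>M M)"
    by (rule measurable_compose[OF measurable_fst measurable_restrict_space1[OF measurable_ident], unfolded id_apply])
  have sp: "0 \<le> fst q" if "q \<in> space (restrict_space borel {0::real..} \<Otimes>\<^sub>M M)" for q
    using that by (auto simp: space_pair_measure space_restrict_space)
  show "measurable_process M (\<lambda>w. X i (?a i * (s + w)))"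
    unfolding measurable_process_def split_beta'
    using fstm s sp by (intro measurable_process_comp[OF X_process]) auto
  show "measurable_process M (\<lambda>w. Z i (?k i * w))"
    unfolding measurable_process_def split_beta'
    using fstm sp C_pos[of i] by (intro measurable_process_comp[OF Z_process]) auto
  have "gaussian_family M (\<lambda>u t. r i (?a i * (s + t) - ?a i * (s + u))) (\<lambda>w. X i (?a i * (s + w)))"
    by (rule gaussian_family_time_change[OF X_gaussian]) (use s in auto)
  moreover have "(\<lambda>u t. r i (?a i * (s + t) - ?a i * (s + u))) = (\<lambda>u t. r i (?a i * (t - u)))"
    by (intro ext arg_cong[where f="r i"]) (simp add: algebra_simps)
  ultimately show "gaussian_family M (\<lambda>u t. r i (?a i * (t - u))) (\<lambda>w. X i (?a i * (s + w)))" by simp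
  have G: "gaussian_family M (\<lambda>u t. (?k i * t) powr \<alpha> + (?k i * u) powr \<alpha> - \<bar>?k i * t - ?k i * u\<bar> powr \<alpha>) (\<lambda>w. Z i (?k i * w))"
    by (rule gaussian_family_time_change[OF Z_gaussian]) (use k in auto)
  show "gaussian_family M (\<lambda>u t. C i * ?a i powr \<alpha> * (t powr \<alpha> + u powr \<alpha> - \<bar>t - u\<bar> powr \<alpha>)) (\<lambda>w. Z i (?k i * w))"
    unfolding gaussian_family_def
  proof (intro conjI allI impI)
    show "Z i (?k i * t) \<in> borel_measurable M" if "0 \<le> t" for t
      using G that by (rule gaussian_familyD_measurable)
    fix J :: "real set" and c :: "real \<Rightarrow> real" assume J: "finite J \<and> J \<subseteq> {0..}"
    then have e: "expectation (\<lambda>\<omega>. iexp (\<Sum>t\<in>J. c t * Z i (?k i * t) \<omega>)) =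
        of_real (exp (- (\<Sum>s\<in>J. \<Sum>t\<in>J. c s * c t * ((?k i * t) powr \<alpha> + (?k i * s) powr \<alpha> - \<bar>?k i * t - ?k i * s\<bar> powr \<alpha>)) / 2))"
      using G unfolding gaussian_family_def by blast
    have "(?k i * t) powr \<alpha> + (?k i * u) powr \<alpha> - \<bar>?k i * t - ?k i * u\<bar> powr \<alpha> =
        C i * ?a i powr \<alpha> * (t powr \<alpha> + u powr \<alpha> - \<bar>t - u\<bar> powr \<alpha>)" if "t \<in> J" "u \<in> J" for t u
    proof -
      have "0 \<le> t" "0 \<le> u" using that J by auto
      moreover have "\<bar>?k i * t - ?k i * u\<bar> = ?k i * \<bar>t - u\<bar>"
        using k(2)[of i] by (simp add: abs_mult flip: right_diff_distrib)
      ultimately show ?thesis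
        unfolding k(1)[symmetric] using k(2)[of i] by (simp add: powr_mult algebra_simps)
    qed
    then have "(\<Sum>s\<in>J. \<Sum>t\<in>J. c s * c t * ((?k i * t) powr \<alpha> + (?k i * s) powr \<alpha> - \<bar>?k i * t - ?k i * s\<bar> powr \<alpha>)) =
        (\<Sum>s\<in>J. \<Sum>t\<in>J. c s * c t * (C i * ?a i powr \<alpha> * (t powr \<alpha> + s powr \<alpha> - \<bar>t - s\<bar> powr \<alpha>)))"
      by (intro sum.cong refl) simp
    with e show "expectation (\<lambda>\<omega>. iexp (\<Sum>t\<in>J. c t * Z i (?k i * t) \<omega>)) =
        of_real (exp (- (\<Sum>s\<in>J. \<Sum>t\<in>J. c s * c t * (C i * ?a i powr \<alpha> * (t powr \<alpha> + s powr \<alpha> - \<bar>t - s\<bar> powr \<alpha>))) / 2))"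
      by simp
  qed
  show "(\<lambda>w. r i (?a i * w)) \<in> borel_measurable borel"
    by (rule measurable_compose[OF _ r_measurable]) simp
  show "r i (?a i * 0) = 1" by (simp add: r_0)
  show "r i (?a i * - u) = r i (?a i * u)" for u using r_minus[of i "?a i * u"] by simp
  show "isCont (\<lambda>w. r i (?a i * w)) 0"
    by (rule isCont_o2[of _ "\<lambda>w. ?a i * w" "r i"]) (auto simp: r_cont)
  show "((\<lambda>v. v * (1 - r i (?a i * (a / v powr (1 / \<alpha>))))) \<longlongrightarrow> C i * ?a i powr \<alpha> * \<bar>a\<bar> powr \<alpha>) at_top" for a
    using r_limit[of i "?a i * a"] by (simp add: abs_mult powr_mult mult.assoc)
  show "0 \<le> C i * ?a i powr \<alpha>" using C_pos[of i] by simp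
next
  let ?a = "\<lambda>i. \<bar>\<theta> $ i\<bar>" and ?k = "\<lambda>i. C i powr (1 / \<alpha>) * \<bar>\<theta> $ i\<bar>"
  have m: "(\<lambda>p. \<lambda>t\<in>{0..}. p (h t)) \<in> (\<Pi>\<^sub>M t\<in>{0..}. borel) \<rightarrow>\<^sub>M (\<Pi>\<^sub>M t\<in>{0..}. borel)"
    if "\<And>t. 0 \<le> t \<Longrightarrow> 0 \<le> h t" for h :: "real \<Rightarrow> real"
    using that by (intro measurable_restrict measurable_component_singleton) auto
  have "indep_vars (\<lambda>_. \<Pi>\<^sub>M t\<in>{0..}. borel) (\<lambda>i \<omega>. \<lambda>t\<in>{0..}. (\<lambda>t\<in>{0..}. X i t \<omega>) (?a i * (s + t))) UNIV"
    using s by (intro indep_vars_compose2[OF X_indep] m) auto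
  also have "(\<lambda>i \<omega>. \<lambda>t\<in>{0..}. (\<lambda>t\<in>{0..}. X i t \<omega>) (?a i * (s + t))) = (\<lambda>i \<omega>. \<lambda>t\<in>{0..}. X i (?a i * (s + t)) \<omega>)"
    using s by (intro ext) (auto simp: restrict_def)
  finally show "indep_vars (\<lambda>_. \<Pi>\<^sub>M t\<in>{0..}. borel) (\<lambda>i \<omega>. \<lambda>t\<in>{0..}. X i (?a i * (s + t)) \<omega>) UNIV" .
  have "indep_vars (\<lambda>_. \<Pi>\<^sub>M t\<in>{0..}. borel) (\<lambda>i \<omega>. \<lambda>t\<in>{0..}. (\<lambda>t\<in>{0..}. Z i t \<omega>) (?k i * t)) UNIV"
    using C_pos by (intro indep_vars_compose2[OF Z_indep] m) auto
  also have "(\<lambda>i \<omega>. \<lambda>t\<in>{0..}. (\<lambda>t\<in>{0..}. Z i t \<omega>) (?k i * t)) = (\<lambda>i \<omega>. \<lambda>t\<in>{0..}. Z i (?k i * t) \<omega>)"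
    using C_pos by (intro ext) (auto simp: restrict_def)
  finally show "indep_vars (\<lambda>_. \<Pi>\<^sub>M t\<in>{0..}. borel) (\<lambda>i \<omega>. \<lambda>t\<in>{0..}. Z i (?k i * t) \<omega>) UNIV" .
qed

end

text \<open>
  Differentiating \<open>(\<integral>\<^bsub>s\<^esub>\<^bsup>t\<^esup> a - x)\<^sup>+\<close> in \<open>s\<close>, with the threshold crossed at the first
  \<open>s\<close> where the remaining integral equals \<open>x\<close>.
\<close>

lemma excess_of_integral:
  fixes a :: "real \<Rightarrow> real"
  assumes [measurable]: "a \<in> borel_measurable borel" and a: "\<And>s. 0 \<le> a s" "\<And>s. a s \<le> 1"
    and t: "0 \<le> t" and x: "0 \<le> x"
  shows "max 0 ((LINT r|lborel. indicator {0..t} r * a r) - x) =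
    (LINT s|lborel. indicator {0..t} s * (a s * indicator {x<..} (LINT r|lborel. indicator {s..t} r * a r)))"
proof -
  define g where "g s = (LINT r|lborel. indicator {s..t} r * a r)" for s
  have int: "integrable lborel (\<lambda>r. indicator I r * a r)" if "I \<in> sets borel" "emeasure lborel I < \<infinity>" for I :: "real set"
  proof (rule Bochner_Integration.integrable_bound)
    show "integrable lborel (indicator I :: real \<Rightarrow> real)" using that by (intro integrable_real_indicator) auto
    show "(\<lambda>r. indicator I r * a r) \<in> borel_measurable lborel" using that by simp
  qed (use a in \<open>auto simp: indicator_def\<close>)
  have int': "integrable lborel (\<lambda>r. indicator {u..t} r * a r)" for u
    by (rule int) (cases "u \<le> t"; simp)+
  have lip: "g u - g w \<le> w - u" "g w \<le> g u" if "u \<le> w" "w \<le> t" for u w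
  proof -
    show "g w \<le> g u"
      unfolding g_def using that a by (intro integral_mono int') (auto simp: indicator_def)
    have "g u - g w = (LINT r|lborel. indicator {u..t} r * a r - indicator {w..t} r * a r)"
      unfolding g_def by (simp add: int')
    also have "\<dots> \<le> (LINT r|lborel. indicator {u..w} r)"
      using that a int'[of u] int'[of w]
      by (intro integral_mono Bochner_Integration.integrable_diff int' integrable_real_indicator)
        (auto simp: indicator_def)
    also have "\<dots> = w - u" using that by simp
    finally show "g u - g w \<le> w - u" .
  qed
  have cont: "continuous_on {0..t} g"
    unfolding continuous_on_iff dist_real_def
  proof (intro ballI allI impI)
    fix u e :: real assume u: "u \<in> {0..t}" and e: "0 < e"
    show "\<exists>d>0. \<forall>w\<in>{0..t}. \<bar>w - u\<bar> < d \<longrightarrow> \<bar>g w - g u\<bar> < e"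
    proof (intro exI[of _ e] conjI ballI impI e)
      fix w assume w: "w \<in> {0..t}" "\<bar>w - u\<bar> < e"
      show "\<bar>g w - g u\<bar> < e"
        using lip[of u w] lip[of w u] u w by (cases "u \<le> w") auto
    qed
  qed
  have gt: "g t = 0"
  proof -
    have "AE r in lborel. indicator {t..t} r * a r = 0"
      using AE_lborel_singleton[of t] by eventually_elim auto
    then show ?thesis unfolding g_def by (rule integral_eq_zero_AE)
  qed
  show ?thesis
  proof (cases "g 0 \<le> x")
    case True
    have z: "indicator {0..t} s * (a s * indicator {x<..} (g s)) = 0" for s
      using lip(2)[of 0 s] True by (cases "s \<in> {0..t}") auto
    have "(LINT s|lborel. indicator {0..t} s * (a s * indicator {x<..} (g s))) = 0"
      unfolding z by simp
    then show ?thesis using True unfolding g_def by simp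
  next
    case False
    let ?S = "{0..t} \<inter> g -` {..x}"
    have "compact ?S"
      unfolding compact_eq_bounded_closed
    proof
      show "bounded ?S" by (rule bounded_subset[of "{0..t}"]) auto
      show "closed ?S" by (rule continuous_closed_preimage[OF cont]) auto
    qed
    moreover have "?S \<noteq> {}" using gt t x by auto
    ultimately have "\<exists>s\<in>?S. \<forall>u\<in>?S. s \<le> u" by (rule compact_attains_inf)
    then obtain s where s: "s \<in> ?S" and first: "\<forall>u\<in>?S. s \<le> u" by (rule bexE)
    have min: "s \<le> u" if "u \<in> ?S" for u using first that by (rule bspec)
    \<comment> \<open>The intermediate value theorem gives a point not after \<open>s\<close> where
      the value is exactly \<open>x\<close>, and minimality makes it \<open>s\<close>
      itself.\<close>
    have gs: "g s = x"
    proof -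
      have "\<exists>u\<ge>0. u \<le> s \<and> g u = x"
        using s False by (intro IVT2' continuous_on_subset[OF cont]) auto
      then obtain u where u: "0 \<le> u" "u \<le> s" "g u = x" by auto
      then have "s \<le> u" using s by (intro min) auto
      with u show ?thesis by simp
    qed
    \<comment> \<open>By monotonicity the indicator cuts the integral off at \<open>s\<close>, up to
      one point, so that it equals \<open>g 0 - g s\<close>.\<close>
    have eq: "indicator {0..t} u * (a u * indicator {x<..} (g u)) = indicator {0..<s} u * a u" for u
    proof (cases "u \<in> {0..t}")
      case True
      show ?thesis
      proof (cases "u < s")
        case True
        then have "x < g u" using min[of u] \<open>u \<in> {0..t}\<close> by (auto simp: not_le[symmetric])
        then show ?thesis using True \<open>u \<in> {0..t}\<close> by auto
      next
        case False
        then have "g u \<le> x" using lip(2)[of s u] gs True by auto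
        then show ?thesis using False by auto
      qed
    qed (use s in auto)
    have "g 0 = (LINT r|lborel. indicator {0..<s} r * a r + indicator {s..t} r * a r)"
      unfolding g_def using s by (intro Bochner_Integration.integral_cong) (auto simp: indicator_def)
    also have "\<dots> = (LINT r|lborel. indicator {0..<s} r * a r) + g s"
      using s int'[of s] int[of "{0..<s}"] by (simp add: g_def)
    finally have "g 0 - x = (LINT r|lborel. indicator {0..<s} r * a r)" using gs by simp
    then show ?thesis
      using False unfolding g_def[symmetric] eq by simp
  qed
qed

lemma emeasure_lborel_atLeast: "emeasure lborel {0::real..} = \<top>"
proof -
  have "of_nat n \<le> emeasure lborel {0::real..}" for n
    using emeasure_mono[of "{0..real n}" "{0..}" lborel] by (simp add: ennreal_of_nat_eq_real_of_nat)
  note le = this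
  show ?thesis
  proof (cases "emeasure lborel {0::real..}")
    case (real y)
    obtain n :: nat where "y < real n" using reals_Archimedean2 by blast
    with le[of n] real show ?thesis by (simp add: ennreal_of_nat_eq_real_of_nat)
  qed
qed

text \<open>The tail of the chi-square law whose degrees of freedom are the dimension; the type
  argument only carries that dimension.\<close>

definition chi_tail :: "'m::finite itself \<Rightarrow> real \<Rightarrow> real" where
  "chi_tail _ v = (LINT x|(std_normal_vec :: (real ^ 'm) measure). indicator {v<..} ((norm x)\<^sup>2))"

text \<open>Taking \<open>g\<close> constantly 1 in the polar tail limit shows that the tail divided
  by itself tends to 1. As division by 0 yields 0, the tail cannot vanish along the sequence
  eventually.\<close>

lemma chi_tail_nonzero:
  assumes v: "\<And>n. 1 \<le> v n" "filterlim v at_top sequentially"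
  shows "\<forall>\<^sub>F n in sequentially. chi_tail TYPE('m::finite) (v n) \<noteq> 0"
proof -
  let ?E = "density lborel (exponential_density 1)"
  interpret S: prob_space "uniform_sphere :: (real^'m) measure" by (rule prob_space_uniform_sphere)
  interpret E: prob_space ?E by (rule prob_space_exponential_density) simp
  interpret P: pair_prob_space "uniform_sphere :: (real^'m) measure" ?E by unfold_locales
  have "(\<lambda>n. (LINT x|(std_normal_vec :: (real ^ 'm) measure). indicator {v n<..} ((norm x)\<^sup>2) * 1) / chi_tail TYPE('m) (v n))
    \<longlonglongrightarrow> (LINT q|((uniform_sphere :: (real^'m) measure) \<Otimes>\<^sub>M ?E). 1)"
    unfolding chi_tail_def
    by (rule std_normal_vec_tail_limit[OF v, where g="\<lambda>_ _. 1" and G="\<lambda>_. 1"]) auto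
  then have "(\<lambda>n. chi_tail TYPE('m) (v n) / chi_tail TYPE('m) (v n)) \<longlonglongrightarrow> 1"
    using P.prob_space by (simp add: chi_tail_def)
  then have "\<forall>\<^sub>F n in sequentially. 0 < chi_tail TYPE('m) (v n) / chi_tail TYPE('m) (v n)"
    by (rule order_tendstoD) simp
  then show ?thesis by eventually_elim auto
qed

section \<open>The limit at a given exceedance time for a frozen clock\<close>

context sojourn_setting begin

text \<open>At a single time the components are independent standard normals whatever the clock,
  zero speed included. This common value is the normalization that turns expectations into
  conditional ones.\<close>

lemma chi_prob:
  assumes "0 \<le> s"
  shows "expectation (\<lambda>\<omega>. indicator {v<..} (chi \<theta> s \<omega>)) = chi_tail TYPE('m) v"
proof -
  interpret L: local_chi_square M "\<lambda>i w. X i (\<bar>\<theta> $ i\<bar> * (s + w))" "\<lambda>i w. Z i (C i powr (1 / \<alpha>) * \<bar>\<theta> $ i\<bar> * w)"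
    "\<lambda>i w. r i (\<bar>\<theta> $ i\<bar> * w)" "\<lambda>i. C i * \<bar>\<theta> $ i\<bar> powr \<alpha>" \<alpha>
    by (rule local_chi_square_frozen[OF assms])
  have [measurable]: "X i (\<bar>\<theta> $ i\<bar> * s) \<in> borel_measurable M" for i
    using assms by (intro measurable_process_component[OF X_process]) auto
  have "chi_tail TYPE('m) v = (LINT x|distr M borel (\<lambda>\<omega>. \<chi> i. X i (\<bar>\<theta> $ i\<bar> * (s + 0)) \<omega>). indicator {v<..} ((norm x)\<^sup>2))"
    unfolding chi_tail_def L.initial_std_normal ..
  also have "\<dots> = expectation (\<lambda>\<omega>. indicator {v<..} (chi \<theta> s \<omega>))"
    by (subst integral_distr) (auto simp: chi_def norm_vec_def L2_set_def sum_nonneg)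
  finally show ?thesis ..
qed

definition limit_ramp :: "real \<Rightarrow> real \<Rightarrow> real ^ 'm \<Rightarrow> real" where
  "limit_ramp x \<eta> \<theta> = (LINT q|(uniform_sphere \<Otimes>\<^sub>M density lborel (exponential_density 1)).
     expectation (\<lambda>\<omega>. ramp x \<eta> (zsojourn \<theta> q \<omega>)))"

text \<open>If some clock component is nonzero, this is the conditional limit with window
  \<open>\<tau>\<close>. The zero clock is separate because the linear part of the limit
  degenerates: the chi-square process stays constant, the limiting total sojourn is infinite, and
  both sides give ramp value 1.\<close>

lemma frozen_limit:
  assumes s: "0 \<le> s" and \<tau>: "0 < \<tau>"
    and small: "\<And>i u. \<bar>u\<bar> \<le> \<bar>\<theta> $ i\<bar> * \<tau> \<Longrightarrow> 0 \<le> r i u \<and> r i u \<le> 1 - C i / 2 * \<bar>u\<bar> powr \<alpha>"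
    and v: "\<And>n. 1 \<le> v n" "filterlim v at_top sequentially" and \<eta>: "0 < \<eta>" "0 \<le> x"
  shows "(\<lambda>n. expectation (\<lambda>\<omega>. indicator {v n<..} (chi \<theta> s \<omega>) * ramp x \<eta> (ennreal (v n powr (1 / \<alpha>)) *
      (\<integral>\<^sup>+w\<in>{0..}. indicator {0..\<tau>} w * indicator {v n<..} (chi \<theta> (s + w) \<omega>) \<partial>lborel))) / chi_tail TYPE('m) (v n))
    \<longlonglongrightarrow> limit_ramp x \<eta> \<theta>"
proof -
  let ?W = "\<lambda>i w. X i (\<bar>\<theta> $ i\<bar> * (s + w))" and ?Z = "\<lambda>i w. Z i (C i powr (1 / \<alpha>) * \<bar>\<theta> $ i\<bar> * w)"
  interpret L: local_chi_square M ?W ?Z "\<lambda>i w. r i (\<bar>\<theta> $ i\<bar> * w)" "\<lambda>i. C i * \<bar>\<theta> $ i\<bar> powr \<alpha>" \<alpha>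
    by (rule local_chi_square_frozen[OF s])
  have ls: "L.limit_sojourn e z \<omega> = zsojourn \<theta> (e, z) \<omega>" for e z \<omega>
    unfolding L.limit_sojourn_def zsojourn_def L.excess_limit_def zlim_def
    by (intro nn_integral_cong) (auto simp: indicator_def mult_ac)
  show ?thesis
  proof (cases "\<exists>i. \<theta> $ i \<noteq> 0")
    case True
    have c: "\<exists>i. 0 < C i * \<bar>\<theta> $ i\<bar> powr \<alpha>"
    proof -
      obtain i where "\<theta> $ i \<noteq> 0" using True by blast
      then have "0 < C i * \<bar>\<theta> $ i\<bar> powr \<alpha>" by (intro mult_pos_pos C_pos) simp
      then show ?thesis by blast
    qed
    have b: "0 \<le> r i (\<bar>\<theta> $ i\<bar> * u) \<and> r i (\<bar>\<theta> $ i\<bar> * u) \<le> 1 - C i * \<bar>\<theta> $ i\<bar> powr \<alpha> / 2 * u powr \<alpha>"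
      if "0 \<le> u" "u \<le> \<tau>" for i u
    proof -
      have "\<bar>\<bar>\<theta> $ i\<bar> * u\<bar> \<le> \<bar>\<theta> $ i\<bar> * \<tau>" using that by (simp add: abs_mult mult_left_mono)
      from small[OF this] that show ?thesis by (simp add: abs_mult powr_mult mult_ac)
    qed
    show ?thesis
      using L.conditional_limit[OF b \<tau> c v \<eta>]
      unfolding limit_ramp_def chi_tail_def ls prod.collapse chi_def by simp
  next
    case False
    then have \<theta>: "\<theta> $ i = 0" for i by auto
    have chi0: "chi \<theta> (s + w) \<omega> = chi \<theta> s \<omega>" for w \<omega> by (simp add: chi_def \<theta>)
    \<comment> \<open>The fractional covariance vanishes at time 0, so \<open>Z i 0\<close> is 0
      only almost surely; under the zero clock the limit process then equals its exponential part
      for all times.\<close>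
    have Z0: "AE \<omega> in M. \<forall>i. Z i 0 \<omega> = 0"
    proof (subst AE_all_countable, intro allI)
      fix i
      interpret N: centered_normal M "Z i 0" 0
      proof
        show "Z i 0 \<in> borel_measurable M" by (rule measurable_process_component[OF Z_process]) simp
        show "(LINT \<omega>|M. iexp (a * Z i 0 \<omega>)) = of_real (exp (- (a\<^sup>2 * 0) / 2))" for a
          using gaussian_family_char[OF Z_gaussian[of i], of "{()}" "\<lambda>_. 0" "\<lambda>_. a"] by simp
      qed
      have "AE \<omega> in M. (Z i 0 \<omega>)\<^sup>2 = 0"
        using N.second_moment by (subst integral_nonneg_eq_0_iff_AE[symmetric]) auto
      then show "AE \<omega> in M. Z i 0 \<omega> = 0" by simp
    qed
    have ramp_top: "ramp x \<eta> \<top> = 1" using \<eta> by (simp add: ramp_def ramp_real_def del: ennreal_plus)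
    have G: "expectation (\<lambda>\<omega>. ramp x \<eta> (zsojourn \<theta> q \<omega>)) = 1" if q: "0 < snd q" for q
    proof -
      have "AE \<omega> in M. ramp x \<eta> (zsojourn \<theta> q \<omega>) = 1"
        using Z0
      proof eventually_elim
        fix \<omega> assume "\<forall>i. Z i 0 \<omega> = 0"
        then have "zlim \<theta> q w \<omega> = snd q" for w by (simp add: zlim_def \<theta>)
        then have "zsojourn \<theta> q \<omega> = \<top>"
          using q by (simp add: zsojourn_def emeasure_lborel_atLeast)
        then show "ramp x \<eta> (zsojourn \<theta> q \<omega>) = 1" by (simp add: ramp_top)
      qed
      moreover have "(\<lambda>\<omega>. ramp x \<eta> (zsojourn \<theta> q \<omega>)) \<in> borel_measurable M"
        using L.limit_sojourn_measurable[of "\<lambda>_. fst q" M "\<lambda>_. snd q" "\<lambda>\<omega>. \<omega>"] by (simp add: ls)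
      ultimately show ?thesis
        using integral_cong_AE[of "\<lambda>\<omega>. ramp x \<eta> (zsojourn \<theta> q \<omega>)" M "\<lambda>_. 1"] by (simp add: prob_space)
    qed
    let ?E = "density lborel (exponential_density 1)"
    interpret S: prob_space "uniform_sphere :: (real^'m) measure" by (rule prob_space_uniform_sphere)
    interpret E: prob_space ?E by (rule prob_space_exponential_density) simp
    interpret P: pair_prob_space "uniform_sphere :: (real^'m) measure" ?E by unfold_locales
    have "AE z in ?E. 0 < z"
      using AE_lborel_singleton[of "0::real"]
      by (subst AE_density) (auto elim!: eventually_mono simp: exponential_density_def)
    have [measurable_cong]: "sets ((uniform_sphere :: (real^'m) measure) \<Otimes>\<^sub>M ?E) = sets (borel \<Otimes>\<^sub>M borel)"
      by (intro sets_pair_measure_cong) (simp_all add: uniform_sphere_def)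
    have "AE q in ((uniform_sphere :: (real^'m) measure) \<Otimes>\<^sub>M ?E). 0 < snd q"
    proof (rule P.AE_pair_measure)
      show "{q \<in> space ((uniform_sphere :: (real^'m) measure) \<Otimes>\<^sub>M ?E). 0 < snd q} \<in> sets (uniform_sphere \<Otimes>\<^sub>M ?E)"
        by measurable
    qed (use \<open>AE z in ?E. 0 < z\<close> in simp)
    then have "AE q in ((uniform_sphere :: (real^'m) measure) \<Otimes>\<^sub>M ?E). expectation (\<lambda>\<omega>. ramp x \<eta> (zsojourn \<theta> q \<omega>)) = 1"
      by eventually_elim (rule G)
    moreover have "(\<lambda>q. expectation (\<lambda>\<omega>. ramp x \<eta> (zsojourn \<theta> q \<omega>))) \<in> borel_measurable ((uniform_sphere :: (real^'m) measure) \<Otimes>\<^sub>M ?E)"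
    proof (rule borel_measurable_lebesgue_integral)
      have "(\<lambda>y. L.limit_sojourn (fst (fst y)) (snd (fst y)) (snd y)) \<in> borel_measurable (((uniform_sphere :: (real^'m) measure) \<Otimes>\<^sub>M ?E) \<Otimes>\<^sub>M M)"
        by (rule L.limit_sojourn_measurable) measurable
      then show "(\<lambda>(q, \<omega>). ramp x \<eta> (zsojourn \<theta> q \<omega>)) \<in> borel_measurable (((uniform_sphere :: (real^'m) measure) \<Otimes>\<^sub>M ?E) \<Otimes>\<^sub>M M)"
        unfolding ls split_beta' by (simp cong: measurable_cong_sets)
    qed
    ultimately have "limit_ramp x \<eta> \<theta> = P.expectation (\<lambda>_. 1)"
      unfolding limit_ramp_def by (intro integral_cong_AE) auto
    then have lim1: "limit_ramp x \<eta> \<theta> = 1" by (simp add: P.prob_space)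
    \<comment> \<open>Under the zero clock an exceedance lasts for the whole window. Once its
      rescaled length passes \<open>x + \<eta>\<close> the ramp is 1, and the quotient is a tail
      probability divided by itself.\<close>
    have "filterlim (\<lambda>y::real. y powr (1 / \<alpha>) * \<tau>) at_top at_top" using alpha \<tau> by real_asymp
    then have "filterlim (\<lambda>n. v n powr (1 / \<alpha>) * \<tau>) at_top sequentially" using v(2) by (rule filterlim_compose)
    then have "\<forall>\<^sub>F n in sequentially. x + \<eta> < v n powr (1 / \<alpha>) * \<tau>" by (simp add: filterlim_at_top_dense)
    with chi_tail_nonzero[where 'm='m, OF v]
    have "\<forall>\<^sub>F n in sequentially. 1 = expectation (\<lambda>\<omega>. indicator {v n<..} (chi \<theta> s \<omega>) * ramp x \<eta> (ennreal (v n powr (1 / \<alpha>)) *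
      (\<integral>\<^sup>+w\<in>{0..}. indicator {0..\<tau>} w * indicator {v n<..} (chi \<theta> (s + w) \<omega>) \<partial>lborel))) / chi_tail TYPE('m) (v n)"
    proof eventually_elim
      fix n assume n: "chi_tail TYPE('m) (v n) \<noteq> 0" "x + \<eta> < v n powr (1 / \<alpha>) * \<tau>"
      have e: "indicator {v n<..} (chi \<theta> s \<omega>) * ramp x \<eta> (ennreal (v n powr (1 / \<alpha>)) *
        (\<integral>\<^sup>+w\<in>{0..}. indicator {0..\<tau>} w * indicator {v n<..} (chi \<theta> (s + w) \<omega>) \<partial>lborel)) = (indicator {v n<..} (chi \<theta> s \<omega>) :: real)" for \<omega>
      proof (cases "v n < chi \<theta> s \<omega>")
        case True
        have "(\<integral>\<^sup>+w\<in>{0..}. indicator {0..\<tau>} w * indicator {v n<..} (chi \<theta> (s + w) \<omega>) \<partial>lborel) = (\<integral>\<^sup>+w. indicator {0..\<tau>} w \<partial>lborel)"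
          using True by (intro nn_integral_cong) (auto simp: chi0 indicator_def)
        also have "\<dots> = ennreal \<tau>" using \<tau> by simp
        finally have "ennreal (v n powr (1 / \<alpha>)) * (\<integral>\<^sup>+w\<in>{0..}. indicator {0..\<tau>} w * indicator {v n<..} (chi \<theta> (s + w) \<omega>) \<partial>lborel) =
            ennreal (v n powr (1 / \<alpha>) * \<tau>)" using \<tau> by (simp add: ennreal_mult)
        moreover have "ramp x \<eta> (ennreal (v n powr (1 / \<alpha>) * \<tau>)) = 1"
          using n \<eta> \<tau> by (subst ramp_ennreal) (auto simp: ramp_real_def field_simps)
        ultimately show ?thesis using True by simp
      qed simp
      show "1 = expectation (\<lambda>\<omega>. indicator {v n<..} (chi \<theta> s \<omega>) * ramp x \<eta> (ennreal (v n powr (1 / \<alpha>)) *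
        (\<integral>\<^sup>+w\<in>{0..}. indicator {0..\<tau>} w * indicator {v n<..} (chi \<theta> (s + w) \<omega>) \<partial>lborel))) / chi_tail TYPE('m) (v n)"
        unfolding e chi_prob[OF s] using n(1) by simp
    qed
    then show ?thesis unfolding lim1 by (rule tendsto_eventually[OF eventually_mono]) simp
  qed
qed

end

section \<open>Joint law of the ingredients of the limit process\<close>

lemma measurable_sigma_of_sigma_rv:
  assumes Y: "Y \<in> M \<rightarrow>\<^sub>M N" and sub: "sigma_rv M N Y \<subseteq> \<A>" and \<A>: "\<A> \<subseteq> Pow (space M)"
  shows "Y \<in> sigma (space M) \<A> \<rightarrow>\<^sub>M N"
proof (rule measurableI)
  show "Y x \<in> space N" if "x \<in> space (sigma (space M) \<A>)" for x
    using measurable_space[OF Y] that \<A> by (simp add: space_measure_of_conv)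
  fix A assume "A \<in> sets N"
  then have "Y -` A \<inter> space M \<in> \<A>" using sub unfolding sigma_rv_eq[OF Y] by auto
  then show "Y -` A \<inter> space (sigma (space M) \<A>) \<in> sets (sigma (space M) \<A>)"
    using \<A> by (simp add: space_measure_of_conv sets_measure_of sigma_sets.Basic)
qed

locale sojourn_problem = prob_space M for M :: "'w measure" +
  fixes X Z :: "'m::finite \<Rightarrow> real \<Rightarrow> 'w \<Rightarrow> real" and r :: "'m \<Rightarrow> real \<Rightarrow> real" and C :: "'m \<Rightarrow> real" and \<alpha> :: real
    and \<theta> U :: "'w \<Rightarrow> real ^ 'm" and E :: "'w \<Rightarrow> real"
  assumes alpha: "0 < \<alpha>" and C_pos: "\<And>i. 0 < C i"
    and X_stat: "\<And>i. stationary_gaussian_process M (r i) (X i)"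
    and X_indep: "indep_vars (\<lambda>_. \<Pi>\<^sub>M t\<in>{0..}. borel) (\<lambda>i \<omega>. \<lambda>t\<in>{0..}. X i t \<omega>) UNIV"
    and expansion: "\<And>i. local_expansion \<alpha> (C i) (r i)"
    and Z_fbm: "\<And>i. fractional_brownian_motion M \<alpha> (Z i)"
    and theta_measurable [measurable]: "\<theta> \<in> borel_measurable M"
    and theta_nonneg: "\<And>i \<omega>. \<omega> \<in> space M \<Longrightarrow> 0 \<le> \<theta> \<omega> $ i"
    and theta_indep: "indep_set (sigma_rv M borel \<theta>) (sigma_process M (UNIV \<times> {0..}) (case_prod X))"
    and U_measurable [measurable]: "U \<in> borel_measurable M" and U_distr: "distr M borel U = uniform_sphere"
    and E_distributed: "distributed M lborel E (exponential_density 1)"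
    and ingredients_indep: "indep_sets (sigma_ingredient M Z U \<theta> E) UNIV"
begin

lemma E_measurable [measurable]: "E \<in> borel_measurable M"
  using E_distributed by (simp add: distributed_def)

lemma E_distr: "distr M borel E = density lborel (exponential_density 1)"
proof -
  have "distr M borel E = distr M lborel E" by (rule distr_cong) auto
  then show ?thesis using E_distributed by (simp add: distributed_def)
qed

lemma Z_component: "0 \<le> t \<Longrightarrow> Z i t \<in> borel_measurable M"
  using Z_fbm[of i] by (auto simp: fractional_brownian_motion_def intro: measurable_process_component)

lemma Z_path: "(\<lambda>\<omega>. \<lambda>t\<in>{0..}. Z i t \<omega>) \<in> M \<rightarrow>\<^sub>M (\<Pi>\<^sub>M t\<in>{0..}. borel)"
  by (intro measurable_restrict Z_component) auto

lemma Z_indep: "indep_vars (\<lambda>_. \<Pi>\<^sub>M t\<in>{0..}. borel) (\<lambda>i \<omega>. \<lambda>t\<in>{0..}. Z i t \<omega>) UNIV"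
  unfolding indep_vars_def2
proof (intro conjI ballI Z_path)
  have "indep_sets (sigma_ingredient M Z U \<theta> E \<circ> Fbm) UNIV"
  proof (rule indep_setsI)
    show "(sigma_ingredient M Z U \<theta> E \<circ> Fbm) i \<subseteq> events" for i
      using ingredients_indep unfolding indep_sets_def comp_def by blast
    fix A and J :: "'m set" assume J: "J \<noteq> {}" "J \<subseteq> UNIV" "finite J" and A: "\<forall>j\<in>J. A j \<in> (sigma_ingredient M Z U \<theta> E \<circ> Fbm) j"
    have inj: "inj_on Fbm J" by (auto simp: inj_on_def)
    have "prob (\<Inter>k\<in>Fbm ` J. A (inv Fbm k)) = (\<Prod>k\<in>Fbm ` J. prob (A (inv Fbm k)))"
      using J A by (intro indep_setsD[OF ingredients_indep]) (auto simp: inv_f_f inj_def)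
    then show "prob (\<Inter>j\<in>J. A j) = (\<Prod>j\<in>J. prob (A j))"
      using inj by (simp add: prod.reindex inv_f_f inj_def)
  qed
  then show "indep_sets (\<lambda>i. {(\<lambda>\<omega>. \<lambda>t\<in>{0..}. Z i t \<omega>) -` A \<inter> space M |A. A \<in> sets (\<Pi>\<^sub>M t\<in>{0..}. borel)}) UNIV"
    by (simp add: comp_def sigma_process_def sigma_rv_eq[OF Z_path])
qed

lemma ingredients_Pow: "(\<Union>k\<in>A. sigma_ingredient M Z U \<theta> E k) \<subseteq> Pow (space M)"
proof (rule UN_least)
  fix k
  have "sigma_ingredient M Z U \<theta> E k \<subseteq> events" using ingredients_indep by (simp add: indep_sets_def)
  then show "sigma_ingredient M Z U \<theta> E k \<subseteq> Pow (space M)" using sets.space_closed by (rule order_trans)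
qed

text \<open>Disjoint groups of independent intersection-stable families generate independent
  sigma-algebras. The hypotheses ask for measurability with respect to a group, so tuples and path
  families built from several ingredients are covered.\<close>

lemma ingredient_groups:
  assumes disj: "I \<inter> J = {}"
    and P: "P \<in> sigma (space M) (\<Union>k\<in>I. sigma_ingredient M Z U \<theta> E k) \<rightarrow>\<^sub>M N1"
    and Q: "Q \<in> sigma (space M) (\<Union>k\<in>J. sigma_ingredient M Z U \<theta> E k) \<rightarrow>\<^sub>M N2"
  shows "indep_set (sigma_rv M N1 P) (sigma_rv M N2 Q)"
proof -
  note sub = ingredients_Pow
  have rv: "Int_stable (sigma_rv M N Y)" for N and Y :: "'w \<Rightarrow> 'y"
    unfolding sigma_rv_def by (rule sets.Int_stable)
  have "Int_stable (sigma_ingredient M Z U \<theta> E k)" for k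
    by (cases k) (auto simp: sigma_process_def intro!: rv)
  moreover have "indep_sets (sigma_ingredient M Z U \<theta> E) (\<Union>b\<in>UNIV. case_bool I J b)"
    by (rule indep_sets_mono_index[OF _ ingredients_indep]) simp
  moreover have "disjoint_family (case_bool I J)"
    using disj by (auto simp: disjoint_family_on_def split: bool.split)
  ultimately have "indep_sets (\<lambda>b. sigma_sets (space M) (\<Union>k\<in>case_bool I J b. sigma_ingredient M Z U \<theta> E k)) UNIV"
    by (intro indep_sets_collect_sigma) auto
  also have "(\<lambda>b. sigma_sets (space M) (\<Union>k\<in>case_bool I J b. sigma_ingredient M Z U \<theta> E k)) =
      case_bool (sigma_sets (space M) (\<Union>k\<in>I. sigma_ingredient M Z U \<theta> E k)) (sigma_sets (space M) (\<Union>k\<in>J. sigma_ingredient M Z U \<theta> E k))"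
    by (rule ext) (simp split: bool.split)
  finally have "indep_set (sigma_sets (space M) (\<Union>k\<in>I. sigma_ingredient M Z U \<theta> E k)) (sigma_sets (space M) (\<Union>k\<in>J. sigma_ingredient M Z U \<theta> E k))"
    by (simp add: indep_set_def)
  then show ?thesis
    by (rule indep_set_subset) (intro sigma_rv_subset P Q sub)+
qed

lemma ingredient_measurable:
  "Clock \<in> I \<Longrightarrow> \<theta> \<in> sigma (space M) (\<Union>k\<in>I. sigma_ingredient M Z U \<theta> E k) \<rightarrow>\<^sub>M borel"
  "Direction \<in> I \<Longrightarrow> U \<in> sigma (space M) (\<Union>k\<in>I. sigma_ingredient M Z U \<theta> E k) \<rightarrow>\<^sub>M borel"
  "Exponential \<in> I \<Longrightarrow> E \<in> sigma (space M) (\<Union>k\<in>I. sigma_ingredient M Z U \<theta> E k) \<rightarrow>\<^sub>M borel"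
  "Fbm i \<in> I \<Longrightarrow> 0 \<le> t \<Longrightarrow> Z i t \<in> sigma (space M) (\<Union>k\<in>I. sigma_ingredient M Z U \<theta> E k) \<rightarrow>\<^sub>M borel"
proof -
  note sub = ingredients_Pow
  show "\<theta> \<in> sigma (space M) (\<Union>k\<in>I. sigma_ingredient M Z U \<theta> E k) \<rightarrow>\<^sub>M borel" if "Clock \<in> I"
    by (rule measurable_sigma_of_sigma_rv[OF theta_measurable _ sub]) (use that in force)
  show "U \<in> sigma (space M) (\<Union>k\<in>I. sigma_ingredient M Z U \<theta> E k) \<rightarrow>\<^sub>M borel" if "Direction \<in> I"
    by (rule measurable_sigma_of_sigma_rv[OF U_measurable _ sub]) (use that in force)
  show "E \<in> sigma (space M) (\<Union>k\<in>I. sigma_ingredient M Z U \<theta> E k) \<rightarrow>\<^sub>M borel" if "Exponential \<in> I"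
    by (rule measurable_sigma_of_sigma_rv[OF E_measurable _ sub]) (use that in force)
  show "Z i t \<in> sigma (space M) (\<Union>k\<in>I. sigma_ingredient M Z U \<theta> E k) \<rightarrow>\<^sub>M borel" if "Fbm i \<in> I" "0 \<le> t"
  proof -
    have "(\<lambda>\<omega>. \<lambda>t\<in>{0..}. Z i t \<omega>) \<in> sigma (space M) (\<Union>k\<in>I. sigma_ingredient M Z U \<theta> E k) \<rightarrow>\<^sub>M (\<Pi>\<^sub>M t\<in>{0..}. borel)"
      by (rule measurable_sigma_of_sigma_rv[OF Z_path _ sub]) (use that(1) in \<open>force simp: sigma_process_def\<close>)
    from measurable_compose[OF this measurable_component_singleton[of t]] that(2) show ?thesis by simp
  qed
qed

sublocale sojourn_setting M X Z r C \<alpha>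
  by unfold_locales (fact alpha C_pos X_stat X_indep expansion Z_fbm Z_indep)+

definition total_sojourn :: "'w \<Rightarrow> ennreal" where
  "total_sojourn \<omega> = (\<integral>\<^sup>+ s\<in>{0..}. indicator {0<..} (limit_process \<alpha> C Z U \<theta> E s \<omega>) \<partial>lborel)"

text \<open>Grouping is used three times: direction against exponential variable, clock against that
  pair, and the resulting triple against all fractional motions. The triple is then frozen in the
  sojourn integral, and its law is integrated with the clock outermost.\<close>

lemma total_sojourn_mean:
  assumes \<eta>: "0 < \<eta>" "0 \<le> x"
  shows "expectation (\<lambda>\<omega>. ramp x \<eta> (total_sojourn \<omega>)) = (LINT p|distr M borel \<theta>. limit_ramp x \<eta> p)"
    and "total_sojourn \<in> borel_measurable M" and "limit_ramp x \<eta> \<in> borel_measurable borel"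
proof -
  let ?N = "borel \<Otimes>\<^sub>M (borel \<Otimes>\<^sub>M borel) :: ((real^'m) \<times> (real^'m) \<times> real) measure"
  define P where "P \<omega> = (\<theta> \<omega>, (U \<omega>, E \<omega>))" for \<omega>
  define F where "F p s y = (indicator {0<..} ((\<Sum>i\<in>UNIV. y $ i * fst (snd p) $ i)
    - (\<Sum>i\<in>UNIV. C i * (fst (snd p) $ i)\<^sup>2 * \<bar>fst p $ i\<bar> powr \<alpha> * s powr \<alpha>) + snd (snd p)) :: ennreal)"
    for p :: "(real^'m) \<times> (real^'m) \<times> real" and s :: real and y :: "real^'m"
  define k where "k i p = C i powr (1 / \<alpha>) * \<bar>fst p $ i\<bar>" for i and p :: "(real^'m) \<times> (real^'m) \<times> real"
  let ?E = "density lborel (exponential_density 1)"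
  let ?Q = "(uniform_sphere :: (real^'m) measure) \<Otimes>\<^sub>M ?E"
  interpret S: prob_space "uniform_sphere :: (real^'m) measure" by (rule prob_space_uniform_sphere)
  interpret Ex: prob_space ?E by (rule prob_space_exponential_density) simp
  interpret Q: pair_prob_space "uniform_sphere :: (real^'m) measure" ?E by unfold_locales
  interpret T: prob_space "distr M borel \<theta>" by (rule prob_space_distr) simp
  interpret TQ: pair_prob_space "distr M borel \<theta>" ?Q by unfold_locales
  have Qs [measurable_cong]: "sets ?Q = sets (borel \<Otimes>\<^sub>M borel)"
    by (intro sets_pair_measure_cong) (simp_all add: uniform_sphere_def)
  have Pm [measurable]: "P \<in> M \<rightarrow>\<^sub>M ?N" unfolding P_def by measurable
  have Fm: "(\<lambda>(p, s, y). F p s y) \<in> borel_measurable (?N \<Otimes>\<^sub>M borel \<Otimes>\<^sub>M borel)"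
    unfolding F_def split_beta' by measurable
  have km: "k i \<in> borel_measurable ?N" for i unfolding k_def by measurable
  have k0: "0 \<le> k i p" for i p by (simp add: k_def)
  have zs: "(\<integral>\<^sup>+s\<in>{0..}. F p s (\<chi> i. Z i (k i p * s) \<omega>) \<partial>lborel) = zsojourn (fst p) (snd p) \<omega>" for p \<omega>
    unfolding zsojourn_def zlim_def F_def k_def by simp
  have ts: "(\<integral>\<^sup>+s\<in>{0..}. F (P \<omega>) s (\<chi> i. Z i (k i (P \<omega>) * s) \<omega>) \<partial>lborel) = total_sojourn \<omega>" if "\<omega> \<in> space M" for \<omega>
    unfolding total_sojourn_def limit_process_def F_def k_def P_def using theta_nonneg[OF that] by simp
  have zm: "(\<lambda>y. zsojourn (fst (f y)) (snd (f y)) (g y)) \<in> borel_measurable L" if "f \<in> L \<rightarrow>\<^sub>M ?N" "g \<in> L \<rightarrow>\<^sub>M M" for f g and L :: "'l measure"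
    unfolding zs[symmetric] by (rule borel_measurable_process_integral[OF Z_process Fm km k0 that])
  have "(\<lambda>\<omega>. zsojourn (fst (P \<omega>)) (snd (P \<omega>)) \<omega>) \<in> borel_measurable M" by (rule zm) auto
  then show "total_sojourn \<in> borel_measurable M"
    using ts unfolding zs by (simp cong: measurable_cong)
  define g where "g p = expectation (\<lambda>\<omega>. ramp x \<eta> (zsojourn (fst p) (snd p) \<omega>))" for p
  have gm: "g \<in> borel_measurable ?N"
    unfolding g_def
  proof (rule borel_measurable_lebesgue_integral)
    have "(\<lambda>y. zsojourn (fst (fst y)) (snd (fst y)) (snd y)) \<in> borel_measurable (?N \<Otimes>\<^sub>M M)" by (rule zm) auto
    then show "(\<lambda>(p, \<omega>). ramp x \<eta> (zsojourn (fst p) (snd p) \<omega>)) \<in> borel_measurable (?N \<Otimes>\<^sub>M M)"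
      unfolding split_beta' by measurable
  qed
  have g01: "norm (g p) \<le> 1" if "p \<in> space ?N" for p
  proof -
    have [measurable]: "(\<lambda>\<omega>. zsojourn (fst p) (snd p) \<omega>) \<in> borel_measurable M"
      by (rule zm) (use that in auto)
    have "g p \<le> expectation (\<lambda>_. 1)"
      unfolding g_def by (intro integral_mono integrable_const_bound[where B=1]) (auto simp: ramp_bounds)
    moreover have "0 \<le> g p" unfolding g_def by (simp add: ramp_bounds)
    ultimately show ?thesis by (simp add: prob_space)
  qed
  have NQ: "sets (distr M borel \<theta> \<Otimes>\<^sub>M ?Q) = sets ?N"
    by (intro sets_pair_measure_cong) (simp_all add: uniform_sphere_def)
  have gm' [measurable]: "g \<in> borel_measurable (distr M borel \<theta> \<Otimes>\<^sub>M ?Q)"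
    using gm by (simp add: measurable_cong_sets[OF NQ refl])
  have lr: "limit_ramp x \<eta> p = (LINT q|?Q. g (p, q))" for p
    by (simp add: limit_ramp_def g_def)
  have "(\<lambda>p. LINT q|?Q. g (p, q)) \<in> borel_measurable (distr M borel \<theta>)"
    by (rule Q.borel_measurable_lebesgue_integral) simp
  then show "limit_ramp x \<eta> \<in> borel_measurable borel"
    by (simp add: lr[abs_def] fun_eq_iff cong: measurable_cong)
  have dUE: "distr M (borel \<Otimes>\<^sub>M borel) (\<lambda>\<omega>. (U \<omega>, E \<omega>)) = ?Q"
  proof -
    have "indep_set (sigma_rv M borel U) (sigma_rv M borel E)"
      by (rule ingredient_groups[of "{Direction}" "{Exponential}"]; (intro ingredient_measurable)?; simp)
    from distr_Pair_indep_set[OF U_measurable E_measurable this] show ?thesis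
      unfolding U_distr E_distr by simp
  qed
  have dP: "distr M ?N P = distr M borel \<theta> \<Otimes>\<^sub>M ?Q"
  proof -
    have "indep_set (sigma_rv M borel \<theta>) (sigma_rv M (borel \<Otimes>\<^sub>M borel) (\<lambda>\<omega>. (U \<omega>, E \<omega>)))"
      by (rule ingredient_groups[of "{Clock}" "{Direction, Exponential}"];
          (intro measurable_Pair ingredient_measurable)?; simp)
    from distr_Pair_indep_set[OF theta_measurable _ this] show ?thesis
      unfolding dUE P_def by simp
  qed
  have ind: "indep_set (sigma_rv M ?N P) (sigma_process M (UNIV \<times> {0..}) (case_prod Z))"
    unfolding sigma_process_def
  proof (rule ingredient_groups[of "{Clock, Direction, Exponential}" "range Fbm"])
    show "P \<in> sigma (space M) (\<Union>k\<in>{Clock, Direction, Exponential}. sigma_ingredient M Z U \<theta> E k) \<rightarrow>\<^sub>M ?N"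
      unfolding P_def by (intro measurable_Pair ingredient_measurable) simp_all
    show "(\<lambda>\<omega>. \<lambda>j\<in>UNIV \<times> {0..}. case_prod Z j \<omega>) \<in> sigma (space M) (\<Union>k\<in>range Fbm. sigma_ingredient M Z U \<theta> E k) \<rightarrow>\<^sub>M (\<Pi>\<^sub>M j\<in>UNIV \<times> {0..}. borel)"
    proof (rule measurable_restrict)
      fix j :: "'m \<times> real" assume "j \<in> UNIV \<times> {0..}"
      then show "case_prod Z j \<in> sigma (space M) (\<Union>k\<in>range Fbm. sigma_ingredient M Z U \<theta> E k) \<rightarrow>\<^sub>M borel"
        using ingredient_measurable(4)[of "fst j" "range Fbm" "snd j"] by (auto simp del: UN_simps)
    qed
  qed auto
  have "expectation (\<lambda>\<omega>. ramp x \<eta> (\<integral>\<^sup>+s\<in>{0..}. F (P \<omega>) s (\<chi> i. Z i (k i (P \<omega>) * s) \<omega>) \<partial>lborel)) =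
      (LINT p|distr M ?N P. expectation (\<lambda>\<omega>. ramp x \<eta> (\<integral>\<^sup>+s\<in>{0..}. F p s (\<chi> i. Z i (k i p * s) \<omega>) \<partial>lborel)))"
    by (rule expectation_freeze[OF prob_space_axioms Z_process L2_continuous_fbm[OF Z_gaussian alpha] Pm ind Fm km k0,
        where H="\<lambda>_ q. ramp x \<eta> q" and b=1]) (auto simp: ramp_bounds)
  also have "\<dots> = (LINT p|(distr M borel \<theta> \<Otimes>\<^sub>M ?Q). g p)" unfolding dP zs g_def ..
  also have "\<dots> = (LINT p|distr M borel \<theta>. LINT q|?Q. g (p, q))"
  proof (rule TQ.integral_fst'[symmetric])
    show "integrable (distr M borel \<theta> \<Otimes>\<^sub>M ?Q) g"
      by (rule TQ.integrable_const_bound[where B=1])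
        (use g01 in \<open>auto simp: sets_eq_imp_space_eq[OF NQ] intro!: AE_I2\<close>)
  qed
  also have "\<dots> = (LINT p|distr M borel \<theta>. limit_ramp x \<eta> p)" by (simp add: lr)
  also have "expectation (\<lambda>\<omega>. ramp x \<eta> (\<integral>\<^sup>+s\<in>{0..}. F (P \<omega>) s (\<chi> i. Z i (k i (P \<omega>) * s) \<omega>) \<partial>lborel)) =
      expectation (\<lambda>\<omega>. ramp x \<eta> (total_sojourn \<omega>))"
    by (intro Bochner_Integration.integral_cong refl) (simp only: ts)
  finally show "expectation (\<lambda>\<omega>. ramp x \<eta> (total_sojourn \<omega>)) = (LINT p|distr M borel \<theta>. limit_ramp x \<eta> p)" .
qed

end

section \<open>The sojourn ratio as an average over clock and exceedance time\<close>

lemma norm_indicator_mult: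
  fixes y :: real
  assumes "0 \<le> y" "y \<le> 1"
  shows "norm (indicator A s * y) \<le> norm (indicator A s :: real)" "norm (indicator A s * y) \<le> indicator A s"
  using assms by (auto simp: indicator_def)

context sojourn_problem begin

definition remaining :: "real \<Rightarrow> real \<Rightarrow> real ^ 'm \<Rightarrow> real \<Rightarrow> 'w \<Rightarrow> real" where
  "remaining v t p s \<omega> = (LINT r|lborel. indicator {s..t} r * indicator {v<..} (chi p \<bar>r\<bar> \<omega>))"

lemma chi_measurable:
  assumes [measurable]: "f \<in> borel_measurable K" "g \<in> borel_measurable K" "h \<in> K \<rightarrow>\<^sub>M M"
  shows "(\<lambda>x. chi (f x) \<bar>g x\<bar> (h x)) \<in> borel_measurable K"
proof -
  have [measurable]: "(\<lambda>x. X i (\<bar>f x $ i\<bar> * \<bar>g x\<bar>) (h x)) \<in> borel_measurable K" for i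
    by (rule measurable_process_comp[OF X_process]) auto
  show ?thesis unfolding chi_def by measurable
qed

lemma remaining_measurable:
  assumes [measurable]: "f \<in> borel_measurable K" "g \<in> borel_measurable K" "h \<in> K \<rightarrow>\<^sub>M M"
  shows "(\<lambda>x. remaining v t (f x) (g x) (h x)) \<in> borel_measurable K"
proof -
  have [measurable]: "(\<lambda>z. chi (f (fst z)) \<bar>snd z\<bar> (h (fst z))) \<in> borel_measurable (K \<Otimes>\<^sub>M lborel)"
    by (rule chi_measurable) auto
  have eq: "indicator {s..t} r = (indicator {0..} (r - s) * indicator {..t} r :: real)" for s r :: real
    by (auto simp: indicator_def)
  show ?thesis unfolding remaining_def eq
    by (rule lborel.borel_measurable_lebesgue_integral) (simp add: split_beta')
qed

lemma remaining_integrable: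
  assumes "\<omega> \<in> space M"
  shows "integrable lborel (\<lambda>r. indicator {s..t} r * indicator {v<..} (chi p \<bar>r\<bar> \<omega>) :: real)"
proof (rule Bochner_Integration.integrable_bound)
  have [measurable]: "(\<lambda>r. chi p \<bar>r\<bar> \<omega>) \<in> borel_measurable lborel"
    by (rule chi_measurable) (use assms in auto)
  show "(\<lambda>r. indicator {s..t} r * indicator {v<..} (chi p \<bar>r\<bar> \<omega>) :: real) \<in> borel_measurable lborel" by measurable
  show "integrable lborel (indicator {s..t} :: real \<Rightarrow> real)"
    by (rule integrable_real_indicator) (auto simp: emeasure_lborel_Icc_eq)
qed (auto simp: indicator_def)

lemma remaining_bounds:
  assumes "\<omega> \<in> space M" "0 \<le> t" "0 \<le> s"
  shows "0 \<le> remaining v t p s \<omega>" "remaining v t p s \<omega> \<le> t"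
proof -
  show "0 \<le> remaining v t p s \<omega>" unfolding remaining_def by (auto simp: indicator_def)
  have "remaining v t p s \<omega> \<le> (LINT r|lborel. indicator {0..t} r)"
    unfolding remaining_def using assms
    by (intro integral_mono remaining_integrable integrable_real_indicator) (auto simp: indicator_def)
  then show "remaining v t p s \<omega> \<le> t" using assms by simp
qed

lemma remaining_nn:
  assumes "\<omega> \<in> space M"
  shows "(\<integral>\<^sup>+r. indicator {s..t} r * indicator {v<..} (chi p \<bar>r\<bar> \<omega>) \<partial>lborel) = ennreal (remaining v t p s \<omega>)"
proof -
  have "(\<integral>\<^sup>+r. indicator {s..t} r * indicator {v<..} (chi p \<bar>r\<bar> \<omega>) \<partial>lborel) =
      (\<integral>\<^sup>+r. ennreal (indicator {s..t} r * indicator {v<..} (chi p \<bar>r\<bar> \<omega>)) \<partial>lborel)"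
    by (intro nn_integral_cong) (auto simp: indicator_def)
  also have "\<dots> = ennreal (remaining v t p s \<omega>)"
    unfolding remaining_def by (intro nn_integral_eq_integral remaining_integrable assms) (auto simp: indicator_def)
  finally show ?thesis .
qed

lemma remaining_shift:
  assumes "\<omega> \<in> space M" "0 \<le> s"
  shows "(\<integral>\<^sup>+w\<in>{0..}. indicator {0..t - s} w * indicator {v<..} (chi p (s + w) \<omega>) \<partial>lborel) =
    ennreal (remaining v t p s \<omega>)"
proof -
  have [measurable]: "(\<lambda>r. chi p \<bar>r\<bar> \<omega>) \<in> borel_measurable borel"
    by (rule chi_measurable) (use assms in auto)
  have "ennreal (remaining v t p s \<omega>) = ennreal \<bar>1\<bar> * (\<integral>\<^sup>+w. indicator {s..t} (s + 1 * w) * indicator {v<..} (chi p \<bar>s + 1 * w\<bar> \<omega>) \<partial>lborel)"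
    unfolding remaining_nn[OF assms(1), symmetric] by (rule nn_integral_real_affine) auto
  also have "\<dots> = (\<integral>\<^sup>+w\<in>{0..}. indicator {0..t - s} w * indicator {v<..} (chi p (s + w) \<omega>) \<partial>lborel)"
    using assms(2) by (simp, intro nn_integral_cong) (auto simp: indicator_def)
  finally show ?thesis ..
qed

lemma sojourn_remaining:
  assumes "\<omega> \<in> space M"
  shows "sojourn_time (time_changed_chi_square X \<theta>) t v \<omega> = remaining v t (\<theta> \<omega>) 0 \<omega>"
  unfolding sojourn_time_def remaining_def set_lebesgue_integral_def
  by (intro Bochner_Integration.integral_cong refl)
    (use theta_nonneg[OF assms] in \<open>auto simp: chi_def time_changed_chi_square_def indicator_def\<close>)

text \<open>Here \<open>g\<close> is bounded on \<open>{0..t}\<close> only, while freezing needs a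
  bounded functional. Clipping \<open>g\<close> to \<open>{0..b}\<close> repairs this without any
  change, because sojourns in \<open>{0..t}\<close> take values there.\<close>

lemma mean_freeze:
  fixes g :: "real \<Rightarrow> real"
  assumes t: "0 \<le> t" and g [measurable]: "g \<in> borel_measurable borel"
    and g_bound: "\<And>y. 0 \<le> y \<Longrightarrow> y \<le> t \<Longrightarrow> 0 \<le> g y \<and> g y \<le> b"
  shows "expectation (\<lambda>\<omega>. g (sojourn_time (time_changed_chi_square X \<theta>) t v \<omega>)) =
    (LINT p|distr M borel \<theta>. expectation (\<lambda>\<omega>. g (remaining v t p 0 \<omega>)))"
proof -
  define F where "F s y = (indicator {0..t} s * indicator {v<..} (\<Sum>i\<in>UNIV. (y $ i)\<^sup>2) :: ennreal)" for s and y :: "real^'m"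
  define H where "H q = max 0 (min b (g (enn2real q)))" for q
  have b: "0 \<le> b" using g_bound[of 0] t order_trans[of 0 "g 0" b] by auto
  have J: "(\<integral>\<^sup>+s\<in>{0..}. F s (\<chi> i. X i (\<bar>p $ i\<bar> * s) \<omega>) \<partial>lborel) = ennreal (remaining v t p 0 \<omega>)" if "\<omega> \<in> space M" for p \<omega>
  proof -
    have "(\<integral>\<^sup>+s\<in>{0..}. F s (\<chi> i. X i (\<bar>p $ i\<bar> * s) \<omega>) \<partial>lborel) =
        (\<integral>\<^sup>+r. indicator {0..t} r * indicator {v<..} (chi p \<bar>r\<bar> \<omega>) \<partial>lborel)"
      by (intro nn_integral_cong) (auto simp: F_def chi_def indicator_def)
    then show ?thesis using remaining_nn[OF that] by simp
  qed
  have HJ: "H (ennreal (remaining v t p 0 \<omega>)) = g (remaining v t p 0 \<omega>)" if "\<omega> \<in> space M" for p \<omega>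
    using remaining_bounds[OF that t order_refl, of v p] g_bound[of "remaining v t p 0 \<omega>"] by (simp add: H_def)
  have "expectation (\<lambda>\<omega>. H (\<integral>\<^sup>+s\<in>{0..}. F s (\<chi> i. X i (\<bar>\<theta> \<omega> $ i\<bar> * s) \<omega>) \<partial>lborel)) =
    (LINT p|distr M borel \<theta>. expectation (\<lambda>\<omega>. H (\<integral>\<^sup>+s\<in>{0..}. F s (\<chi> i. X i (\<bar>p $ i\<bar> * s) \<omega>) \<partial>lborel)))"
  proof (rule expectation_freeze[OF prob_space_axioms X_process L2_continuous_stationary[OF X_gaussian r_minus r_cont]
        theta_measurable theta_indep, where F="\<lambda>_. F" and H="\<lambda>_. H" and c="\<lambda>i p. \<bar>p $ i\<bar>" and b=b])
    show "(\<lambda>(p, s, x). F s x) \<in> borel_measurable ((borel :: (real^'m) measure) \<Otimes>\<^sub>M borel \<Otimes>\<^sub>M borel)"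
      unfolding F_def split_beta' by measurable
    show "(\<lambda>(p, q). H q) \<in> borel_measurable ((borel :: (real^'m) measure) \<Otimes>\<^sub>M borel)"
      unfolding H_def split_beta' by measurable
  qed (use b in \<open>auto simp: H_def\<close>)
  then show ?thesis
    by (simp add: J HJ sojourn_remaining cong: Bochner_Integration.integral_cong)
qed

lemma indicator_chi_expectation:
  "expectation (\<lambda>\<omega>. indicator {v<..} (chi p \<bar>s\<bar> \<omega>)) = chi_tail TYPE('m) v"
  by (rule chi_prob) simp

text \<open>For each frozen clock Fubini gives an integral over time of one and the same tail
  probability, so no asymptotics enter the denominator of the ratio.\<close>

lemma sojourn_mean:
  assumes t: "0 \<le> t"
  shows "expectation (sojourn_time (time_changed_chi_square X \<theta>) t v) = t * chi_tail TYPE('m) v"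
proof -
  interpret pair_sigma_finite M lborel by unfold_locales
  interpret T: prob_space "distr M borel \<theta>" by (rule prob_space_distr) simp
  have "expectation (remaining v t p 0) = t * chi_tail TYPE('m) v" for p
  proof -
    have cm [measurable]: "(\<lambda>q. chi p \<bar>snd q\<bar> (fst q)) \<in> borel_measurable (M \<Otimes>\<^sub>M lborel)"
      by (rule chi_measurable) auto
    have int: "integrable (M \<Otimes>\<^sub>M lborel) (\<lambda>(\<omega>, r). indicator {0..t} r * indicator {v<..} (chi p \<bar>r\<bar> \<omega>) :: real)"
    proof (rule Bochner_Integration.integrable_bound)
      show "integrable (M \<Otimes>\<^sub>M lborel) (\<lambda>q. indicator {0..t} (snd q) :: real)"
      proof (rule Fubini_integrable)
        show "(\<lambda>q. indicator {0..t} (snd q) :: real) \<in> borel_measurable (M \<Otimes>\<^sub>M lborel)" by measurable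
      qed (use t in auto)
    qed (auto simp: split_beta' indicator_def)
    have "expectation (remaining v t p 0) = (LINT r|lborel. expectation (\<lambda>\<omega>. indicator {0..t} r * indicator {v<..} (chi p \<bar>r\<bar> \<omega>)))"
      unfolding remaining_def by (rule Fubini_integral[OF int, symmetric])
    also have "\<dots> = (LINT r|lborel. indicator {0..t} r * chi_tail TYPE('m) v)"
      by (simp add: indicator_chi_expectation)
    finally show ?thesis using t by simp
  qed
  then show ?thesis
    using mean_freeze[OF t, of "\<lambda>y. y" t v] T.prob_space by simp
qed

text \<open>After dividing the threshold by \<open>u\<close>, the pathwise identity is applied to
  the exceedance indicator of a frozen path. Freezing comes first, so that the remaining sojourn is
  that of a path with fixed clock.\<close>

lemma excess_mean:
  assumes t: "0 \<le> t" and x: "0 \<le> x" and u: "0 < u"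
  shows "expectation (\<lambda>\<omega>. max 0 (u * sojourn_time (time_changed_chi_square X \<theta>) t v \<omega> - x)) =
    u * (LINT p|distr M borel \<theta>. LINT s|lborel. indicator {0..t} s *
      expectation (\<lambda>\<omega>. indicator {v<..} (chi p \<bar>s\<bar> \<omega>) * indicator {x / u<..} (remaining v t p s \<omega>)))"
proof -
  interpret pair_sigma_finite M lborel by unfold_locales
  have "expectation (\<lambda>\<omega>. max 0 (u * remaining v t p 0 \<omega> - x)) = u * (LINT s|lborel. indicator {0..t} s *
      expectation (\<lambda>\<omega>. indicator {v<..} (chi p \<bar>s\<bar> \<omega>) * indicator {x / u<..} (remaining v t p s \<omega>)))" for p
  proof -
    let ?k = "\<lambda>\<omega> s. indicator {v<..} (chi p \<bar>s\<bar> \<omega>) * indicator {x / u<..} (remaining v t p s \<omega>) :: real"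
    have cm [measurable]: "(\<lambda>q. chi p \<bar>snd q\<bar> (fst q)) \<in> borel_measurable (M \<Otimes>\<^sub>M lborel)"
      "(\<lambda>q. remaining v t p (snd q) (fst q)) \<in> borel_measurable (M \<Otimes>\<^sub>M lborel)"
      by (rule chi_measurable remaining_measurable; simp)+
    have int: "integrable (M \<Otimes>\<^sub>M lborel) (\<lambda>(\<omega>, s). indicator {0..t} s * ?k \<omega> s)"
    proof (rule Bochner_Integration.integrable_bound)
      show "integrable (M \<Otimes>\<^sub>M lborel) (\<lambda>q. indicator {0..t} (snd q) :: real)"
      proof (rule Fubini_integrable)
        show "(\<lambda>q. indicator {0..t} (snd q) :: real) \<in> borel_measurable (M \<Otimes>\<^sub>M lborel)" by measurable
      qed (use t in auto)
    qed (auto simp: split_beta' indicator_def)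
    have "expectation (\<lambda>\<omega>. max 0 (u * remaining v t p 0 \<omega> - x)) = expectation (\<lambda>\<omega>. u * (LINT s|lborel. indicator {0..t} s * ?k \<omega> s))"
    proof (intro Bochner_Integration.integral_cong refl)
      fix \<omega> assume \<omega>: "\<omega> \<in> space M"
      have [measurable]: "(\<lambda>r. chi p \<bar>r\<bar> \<omega>) \<in> borel_measurable borel"
        by (rule chi_measurable) (use \<omega> in auto)
      have "max 0 (u * remaining v t p 0 \<omega> - x) = u * max 0 (remaining v t p 0 \<omega> - x / u)"
        using u by (simp add: max_def field_simps)
      also have "max 0 (remaining v t p 0 \<omega> - x / u) = (LINT s|lborel. indicator {0..t} s * ?k \<omega> s)"
        unfolding remaining_def using t x u by (intro excess_of_integral) (auto simp: indicator_def)
      finally show "max 0 (u * remaining v t p 0 \<omega> - x) = u * (LINT s|lborel. indicator {0..t} s * ?k \<omega> s)" .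
    qed
    also have "\<dots> = u * expectation (\<lambda>\<omega>. LINT s|lborel. indicator {0..t} s * ?k \<omega> s)"
      by (rule integral_mult_right_zero)
    also have "expectation (\<lambda>\<omega>. LINT s|lborel. indicator {0..t} s * ?k \<omega> s) =
        (LINT s|lborel. expectation (\<lambda>\<omega>. indicator {0..t} s * ?k \<omega> s))"
      by (rule Fubini_integral[OF int, symmetric])
    finally show ?thesis by simp
  qed
  moreover have "expectation (\<lambda>\<omega>. max 0 (u * sojourn_time (time_changed_chi_square X \<theta>) t v \<omega> - x)) =
    (LINT p|distr M borel \<theta>. expectation (\<lambda>\<omega>. max 0 (u * remaining v t p 0 \<omega> - x)))"
  proof (rule mean_freeze[OF t, where b="u * t"])
    fix y assume "0 \<le> y" "y \<le> t"
    then have "u * y \<le> u * t" using u by simp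
    then show "0 \<le> max 0 (u * y - x) \<and> max 0 (u * y - x) \<le> u * t" using x u t by (auto intro: order_trans[of _ "u * y"])
  qed measurable
  ultimately show ?thesis by simp
qed

text \<open>The layer-cake formula: integrating the indicator of \<open>y < u * L\<close> over
  \<open>y \<ge> x\<close> gives the positive part of \<open>u * L - x\<close>.\<close>

lemma tail_integral:
  assumes t: "0 \<le> t" and u: "0 < u"
  shows "(LINT y:{x..}|lborel. prob {\<omega> \<in> space M. u * sojourn_time (time_changed_chi_square X \<theta>) t v \<omega> > y} / c) =
    expectation (\<lambda>\<omega>. max 0 (u * sojourn_time (time_changed_chi_square X \<theta>) t v \<omega> - x)) / c"
proof -
  interpret pair_sigma_finite M lborel by unfold_locales
  let ?L = "sojourn_time (time_changed_chi_square X \<theta>) t v"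
  have Lm [measurable]: "?L \<in> borel_measurable M"
    using remaining_measurable[of \<theta> M "\<lambda>_. 0" "\<lambda>\<omega>. \<omega>" v t] by (simp add: sojourn_remaining cong: measurable_cong)
  have L: "0 \<le> ?L \<omega>" "?L \<omega> \<le> t" if "\<omega> \<in> space M" for \<omega>
    using remaining_bounds[OF that t order_refl] by (simp_all add: sojourn_remaining that)
  let ?k = "\<lambda>\<omega> y. indicator {x..} y * indicator {..<u * ?L \<omega>} y :: real"
  have ind: "indicator {..<u * ?L \<omega>} y = (indicator {0<..} (u * ?L \<omega> - y) :: real)" for \<omega> y by (auto simp: indicator_def)
  have int: "integrable (M \<Otimes>\<^sub>M lborel) (\<lambda>(\<omega>, y). ?k \<omega> y)"
  proof (rule Bochner_Integration.integrable_bound)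
    show "integrable (M \<Otimes>\<^sub>M lborel) (\<lambda>q. indicator {x..max x (u * t)} (snd q) :: real)"
    proof (rule Fubini_integrable)
      show "(\<lambda>q. indicator {x..max x (u * t)} (snd q) :: real) \<in> borel_measurable (M \<Otimes>\<^sub>M lborel)" by measurable
    qed (auto simp: emeasure_lborel_Icc_eq)
    show "(\<lambda>(\<omega>, y). ?k \<omega> y) \<in> borel_measurable (M \<Otimes>\<^sub>M lborel)" unfolding ind split_beta' by measurable
    show "AE q in (M \<Otimes>\<^sub>M (lborel :: real measure)). norm ((\<lambda>(\<omega>, y). ?k \<omega> y) q) \<le> norm (indicator {x..max x (u * t)} (snd q) :: real)"
    proof (rule AE_I2)
      fix q assume "q \<in> space (M \<Otimes>\<^sub>M (lborel :: real measure))"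
      then have "?L (fst q) \<le> t" using L by (auto simp: space_pair_measure)
      then have "u * ?L (fst q) \<le> u * t" using u by simp
      then show "norm ((\<lambda>(\<omega>, y). ?k \<omega> y) q) \<le> norm (indicator {x..max x (u * t)} (snd q) :: real)"
        by (auto simp: split_beta' indicator_def)
    qed
  qed
  have "(LINT y:{x..}|lborel. prob {\<omega> \<in> space M. u * ?L \<omega> > y} / c) =
      (LINT y|lborel. expectation (\<lambda>\<omega>. ?k \<omega> y) / c)"
    unfolding set_lebesgue_integral_def
  proof (intro Bochner_Integration.integral_cong refl)
    fix y :: real
    have "expectation (\<lambda>\<omega>. indicator {..<u * ?L \<omega>} y) = expectation (indicator {\<omega> \<in> space M. u * ?L \<omega> > y})"
      by (intro Bochner_Integration.integral_cong refl) (auto simp: indicator_def)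
    also have "\<dots> = prob {\<omega> \<in> space M. u * ?L \<omega> > y}" by (simp add: Int_def conj_commute conj_left_commute)
    finally show "indicator {x..} y *\<^sub>R (prob {\<omega> \<in> space M. u * ?L \<omega> > y} / c) = expectation (\<lambda>\<omega>. ?k \<omega> y) / c"
      by simp
  qed
  also have "\<dots> = (LINT y|lborel. expectation (\<lambda>\<omega>. ?k \<omega> y)) / c" by simp
  also have "(LINT y|lborel. expectation (\<lambda>\<omega>. ?k \<omega> y)) = expectation (\<lambda>\<omega>. LINT y|lborel. ?k \<omega> y)"
    by (rule Fubini_integral[OF int])
  also have "\<dots> = expectation (\<lambda>\<omega>. max 0 (u * ?L \<omega> - x))"
  proof (intro Bochner_Integration.integral_cong refl)
    fix \<omega>
    have "(\<lambda>y. ?k \<omega> y) = indicator {x..<u * ?L \<omega>}" by (auto simp: indicator_def fun_eq_iff)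
    then show "(LINT y|lborel. ?k \<omega> y) = max 0 (u * ?L \<omega> - x)"
      by (simp add: measure_def max_def)
  qed
  finally show ?thesis .
qed

text \<open>The mean of \<open>G\<close> of the remaining sojourn given an exceedance at
  \<open>s\<close>, averaged over the clock and over \<open>s\<close> uniform in
  \<open>{0..t}\<close>. A vanishing tail makes the quotient 0 by convention, so the bounds on it
  need no case distinction.\<close>

definition joint_mean :: "real \<Rightarrow> real \<Rightarrow> (real \<Rightarrow> real) \<Rightarrow> real" where
  "joint_mean t v G = (LINT p|distr M borel \<theta>. LINT s|lborel. indicator {0..t} s *
     (expectation (\<lambda>\<omega>. indicator {v<..} (chi p \<bar>s\<bar> \<omega>) * G (remaining v t p s \<omega>)) / chi_tail TYPE('m) v)) / t"

definition ramp_mean :: "real \<Rightarrow> real \<Rightarrow> real \<Rightarrow> real \<Rightarrow> real" where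
  "ramp_mean t x \<eta> v = joint_mean t v (\<lambda>y. ramp x \<eta> (ennreal (v powr (1 / \<alpha>) * y)))"

lemma chi_tail_nonneg: "0 \<le> chi_tail TYPE('m) v"
proof -
  have "0 \<le> expectation (\<lambda>\<omega>. indicator {v<..} (chi 0 0 \<omega>) :: real)" by simp
  then show ?thesis using chi_prob[of 0 v 0] by simp
qed

lemma joint_measurable:
  fixes G :: "real \<Rightarrow> real"
  assumes [measurable]: "G \<in> borel_measurable borel"
  shows "(\<lambda>q. expectation (\<lambda>\<omega>. indicator {v<..} (chi (fst q) \<bar>snd q\<bar> \<omega>) * G (remaining v t (fst q) (snd q) \<omega>)))
    \<in> borel_measurable (borel \<Otimes>\<^sub>M borel)"
proof (rule borel_measurable_lebesgue_integral)
  have [measurable]: "(\<lambda>z. chi (fst (fst z)) \<bar>snd (fst z)\<bar> (snd z)) \<in> borel_measurable ((borel \<Otimes>\<^sub>M borel) \<Otimes>\<^sub>M M)"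
    "(\<lambda>z. remaining v t (fst (fst z)) (snd (fst z)) (snd z)) \<in> borel_measurable ((borel \<Otimes>\<^sub>M borel) \<Otimes>\<^sub>M M)"
    by (rule chi_measurable remaining_measurable; measurable)+
  show "(\<lambda>(q, \<omega>). indicator {v<..} (chi (fst q) \<bar>snd q\<bar> \<omega>) * G (remaining v t (fst q) (snd q) \<omega>)) \<in> borel_measurable ((borel \<Otimes>\<^sub>M borel) \<Otimes>\<^sub>M M)"
    unfolding split_beta' by measurable
qed

lemma joint_bounds:
  fixes G :: "real \<Rightarrow> real"
  assumes [measurable]: "G \<in> borel_measurable borel" and G: "\<And>y. 0 \<le> G y" "\<And>y. G y \<le> 1"
  shows "0 \<le> expectation (\<lambda>\<omega>. indicator {v<..} (chi p \<bar>s\<bar> \<omega>) * G (remaining v t p s \<omega>))"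
    and "expectation (\<lambda>\<omega>. indicator {v<..} (chi p \<bar>s\<bar> \<omega>) * G (remaining v t p s \<omega>)) \<le> chi_tail TYPE('m) v"
    and "integrable M (\<lambda>\<omega>. indicator {v<..} (chi p \<bar>s\<bar> \<omega>) * G (remaining v t p s \<omega>))"
proof -
  have [measurable]: "(\<lambda>\<omega>. chi p \<bar>s\<bar> \<omega>) \<in> borel_measurable M" "(\<lambda>\<omega>. remaining v t p s \<omega>) \<in> borel_measurable M"
    by (rule chi_measurable remaining_measurable; simp)+
  show i: "integrable M (\<lambda>\<omega>. indicator {v<..} (chi p \<bar>s\<bar> \<omega>) * G (remaining v t p s \<omega>))"
    by (rule integrable_const_bound[where B=1]) (auto simp: indicator_def G)
  show "0 \<le> expectation (\<lambda>\<omega>. indicator {v<..} (chi p \<bar>s\<bar> \<omega>) * G (remaining v t p s \<omega>))"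
    by (intro integral_nonneg_AE AE_I2) (auto simp: G)
  have "expectation (\<lambda>\<omega>. indicator {v<..} (chi p \<bar>s\<bar> \<omega>) * G (remaining v t p s \<omega>)) \<le> expectation (\<lambda>\<omega>. indicator {v<..} (chi p \<bar>s\<bar> \<omega>))"
    by (intro integral_mono i integrable_const_bound[where B=1]) (auto simp: indicator_def G)
  then show "expectation (\<lambda>\<omega>. indicator {v<..} (chi p \<bar>s\<bar> \<omega>) * G (remaining v t p s \<omega>)) \<le> chi_tail TYPE('m) v"
    by (simp add: indicator_chi_expectation)
qed

lemma joint_quotient:
  fixes G :: "real \<Rightarrow> real" and v :: real
  assumes Gm: "G \<in> borel_measurable borel" and G: "\<And>y. 0 \<le> G y" "\<And>y. G y \<le> 1" and t: "0 < t"
  defines "e \<equiv> \<lambda>p s. expectation (\<lambda>\<omega>. indicator {v<..} (chi p \<bar>s\<bar> \<omega>) * G (remaining v t p s \<omega>)) / chi_tail TYPE('m) v"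
  shows "0 \<le> e p s" "e p s \<le> 1" "integrable lborel (\<lambda>s. indicator {0..t} s * e p s)"
    "norm (LINT s|lborel. indicator {0..t} s * e p s) \<le> t"
    "(\<lambda>p. LINT s|lborel. indicator {0..t} s * e p s) \<in> borel_measurable borel"
proof -
  have e01: "0 \<le> e p s" "e p s \<le> 1" for p s
    using joint_bounds[OF Gm G, where v=v and p=p and s=s and t=t] chi_tail_nonneg[of v]
    unfolding e_def by (auto simp: divide_le_eq_1)
  then show "0 \<le> e p s" "e p s \<le> 1" .
  have em: "(\<lambda>q. e (fst q) (snd q)) \<in> borel_measurable (borel \<Otimes>\<^sub>M borel)"
    using joint_measurable[OF Gm] unfolding e_def by (intro borel_measurable_divide borel_measurable_const)
  have em1: "e p \<in> borel_measurable borel" for p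
    using measurable_compose[OF measurable_Pair1' em, of p] by simp
  have ind_int: "integrable lborel (indicator {0..t} :: real \<Rightarrow> real)"
    using t by (intro integrable_real_indicator) auto
  show i: "integrable lborel (\<lambda>s. indicator {0..t} s * e p s)" for p
  proof (rule Bochner_Integration.integrable_bound[OF ind_int])
    show "(\<lambda>s. indicator {0..t} s * e p s) \<in> borel_measurable lborel"
      using borel_measurable_times[OF _ em1[of p], of "indicator {0..t}"] by simp
  qed (intro AE_I2 norm_indicator_mult e01)
  have "(LINT s|lborel. indicator {0..t} s * e p s) \<le> (LINT s|lborel. indicator {0..t} s)"
    by (intro integral_mono i ind_int mult_left_le e01) simp
  moreover have "0 \<le> (LINT s|lborel. indicator {0..t} s * e p s)"
    by (intro integral_nonneg_AE AE_I2 mult_nonneg_nonneg e01) simp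
  ultimately show "norm (LINT s|lborel. indicator {0..t} s * e p s) \<le> t" using t by simp
  have "(\<lambda>q. indicator {0..t} (snd q) * e (fst q) (snd q)) \<in> borel_measurable (borel \<Otimes>\<^sub>M borel)"
    by (intro borel_measurable_times em) measurable
  then have "(\<lambda>(p, s). indicator {0..t} s * e p s) \<in> borel_measurable (borel \<Otimes>\<^sub>M lborel)"
    by (simp add: split_beta' cong: measurable_cong_sets sets_pair_measure_cong)
  then show "(\<lambda>p. LINT s|lborel. indicator {0..t} s * e p s) \<in> borel_measurable borel"
    by (rule lborel.borel_measurable_lebesgue_integral)
qed

lemma ramp_mean_limit:
  assumes t: "0 < t" and K: "AE \<omega> in M. \<forall>i. \<theta> \<omega> $ i \<le> K"
    and small: "\<And>i u. \<bar>u\<bar> \<le> K * t \<Longrightarrow> 0 \<le> r i u \<and> r i u \<le> 1 - C i / 2 * \<bar>u\<bar> powr \<alpha>"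
    and v: "\<And>n. 1 \<le> v n" "filterlim v at_top sequentially" and \<eta>: "0 < \<eta>" "0 \<le> x"
  shows "(\<lambda>n. ramp_mean t x \<eta> (v n)) \<longlonglongrightarrow> expectation (\<lambda>\<omega>. ramp x \<eta> (total_sojourn \<omega>))"
proof -
  let ?G = "\<lambda>n y. ramp x \<eta> (ennreal (v n powr (1 / \<alpha>) * y))"
  let ?e = "\<lambda>n p s. expectation (\<lambda>\<omega>. indicator {v n<..} (chi p \<bar>s\<bar> \<omega>) * ?G n (remaining (v n) t p s \<omega>)) / chi_tail TYPE('m) (v n)"
  interpret T: prob_space "distr M borel \<theta>" by (rule prob_space_distr) simp
  have Gm: "?G n \<in> borel_measurable borel" for n by measurable
  note quot = joint_quotient[OF Gm ramp_bounds t, where v="v n" for n]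
  have ind_int: "integrable lborel (indicator {0..t} :: real \<Rightarrow> real)"
    using t by (intro integrable_real_indicator) auto
  have inner: "(\<lambda>n. LINT s|lborel. indicator {0..t} s * ?e n p s) \<longlonglongrightarrow> (LINT s|lborel. indicator {0..t} s * limit_ramp x \<eta> p)"
    if p: "\<And>i. \<bar>p $ i\<bar> \<le> K" for p
  proof (rule integral_dominated_convergence[where w="indicator {0..t}"])
    show "AE s in lborel. (\<lambda>n. indicator {0..t} s * ?e n p s) \<longlonglongrightarrow> indicator {0..t} s * limit_ramp x \<eta> p"
      using AE_lborel_singleton[of t]
    proof eventually_elim
      fix s :: real assume "s \<noteq> t"
      show "(\<lambda>n. indicator {0..t} s * ?e n p s) \<longlonglongrightarrow> indicator {0..t} s * limit_ramp x \<eta> p"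
      proof (cases "0 \<le> s \<and> s < t")
        case True
        \<comment> \<open>Only lags up to the clock speed times \<open>t - s\<close> occur after the
          exceedance, so the bounds on the range \<open>K * t\<close> suffice.\<close>
        have sm: "0 \<le> r i u \<and> r i u \<le> 1 - C i / 2 * \<bar>u\<bar> powr \<alpha>" if "\<bar>u\<bar> \<le> \<bar>p $ i\<bar> * (t - s)" for i u
        proof (rule small)
          have "\<bar>p $ i\<bar> * (t - s) \<le> K * t" using p[of i] True t by (intro mult_mono) auto
          then show "\<bar>u\<bar> \<le> K * t" using that by linarith
        qed
        have eq: "ennreal (v n powr (1 / \<alpha>)) * (\<integral>\<^sup>+w\<in>{0..}. indicator {0..t - s} w * indicator {v n<..} (chi p (s + w) \<omega>) \<partial>lborel)
            = ennreal (v n powr (1 / \<alpha>) * remaining (v n) t p s \<omega>)" if "\<omega> \<in> space M" for n \<omega>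
          using remaining_shift[OF that, of s t "v n" p] remaining_bounds(1)[OF that, of t s] True t by (simp add: ennreal_mult)
        have "(\<lambda>n. expectation (\<lambda>\<omega>. indicator {v n<..} (chi p s \<omega>) * ramp x \<eta> (ennreal (v n powr (1 / \<alpha>)) *
          (\<integral>\<^sup>+w\<in>{0..}. indicator {0..t - s} w * indicator {v n<..} (chi p (s + w) \<omega>) \<partial>lborel))) / chi_tail TYPE('m) (v n))
          \<longlonglongrightarrow> limit_ramp x \<eta> p"
          using True by (intro frozen_limit sm v \<eta>) auto
        then have "(\<lambda>n. ?e n p s) \<longlonglongrightarrow> limit_ramp x \<eta> p"
          using True by (simp add: eq cong: Bochner_Integration.integral_cong)
        then show ?thesis by (intro tendsto_intros)
      next
        case False
        with \<open>s \<noteq> t\<close> show ?thesis by (auto simp: indicator_def)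
      qed
    qed
    show "AE s in lborel. norm (indicator {0..t} s * ?e n p s) \<le> indicator {0..t} s" for n
      by (intro AE_I2 norm_indicator_mult quot(1,2))
    show "(\<lambda>s. indicator {0..t} s * ?e n p s) \<in> borel_measurable lborel" for n
      by (rule borel_measurable_integrable[OF quot(3)])
  qed (use ind_int in auto)
  have "(\<lambda>n. LINT p|distr M borel \<theta>. LINT s|lborel. indicator {0..t} s * ?e n p s) \<longlonglongrightarrow>
      (LINT p|distr M borel \<theta>. LINT s|lborel. indicator {0..t} s * limit_ramp x \<eta> p)"
  proof (rule integral_dominated_convergence[where w="\<lambda>_. t"])
    have "AE \<omega> in M. \<forall>i. \<bar>\<theta> \<omega> $ i\<bar> \<le> K"
      using K AE_space by eventually_elim (use theta_nonneg in auto)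
    then have "AE p in distr M borel \<theta>. \<forall>i. \<bar>p $ i\<bar> \<le> K" by (subst AE_distr_iff) auto
    then show "AE p in distr M borel \<theta>. (\<lambda>n. LINT s|lborel. indicator {0..t} s * ?e n p s) \<longlonglongrightarrow> (LINT s|lborel. indicator {0..t} s * limit_ramp x \<eta> p)"
      by eventually_elim (rule inner, blast)
    show "AE p in distr M borel \<theta>. norm (LINT s|lborel. indicator {0..t} s * ?e n p s) \<le> t" for n
      by (intro AE_I2 quot(4))
    show "(\<lambda>p. LINT s|lborel. indicator {0..t} s * ?e n p s) \<in> borel_measurable (distr M borel \<theta>)" for n
      using quot(5) by simp
    show "(\<lambda>p. LINT s|lborel. indicator {0..t} s * limit_ramp x \<eta> p) \<in> borel_measurable (distr M borel \<theta>)"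
      using total_sojourn_mean(3)[OF \<eta>] by simp
  qed auto
  then have "(\<lambda>n. (LINT p|distr M borel \<theta>. LINT s|lborel. indicator {0..t} s * ?e n p s) / t) \<longlonglongrightarrow>
      (LINT p|distr M borel \<theta>. LINT s|lborel. indicator {0..t} s * limit_ramp x \<eta> p) / t"
    using t by (intro tendsto_intros) auto
  also have "(LINT p|distr M borel \<theta>. LINT s|lborel. indicator {0..t} s * limit_ramp x \<eta> p) / t = expectation (\<lambda>\<omega>. ramp x \<eta> (total_sojourn \<omega>))"
    using t by (simp add: total_sojourn_mean(1)[OF \<eta>])
  finally show ?thesis unfolding ramp_mean_def joint_mean_def .
qed

lemma joint_mean_mono:
  fixes G H :: "real \<Rightarrow> real"
  assumes Gm: "G \<in> borel_measurable borel" and Hm: "H \<in> borel_measurable borel"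
    and G: "\<And>y. 0 \<le> G y" and GH: "\<And>y. G y \<le> H y" and H: "\<And>y. H y \<le> 1" and t: "0 < t"
  shows "joint_mean t v G \<le> joint_mean t v H"
proof -
  interpret T: prob_space "distr M borel \<theta>" by (rule prob_space_distr) simp
  let ?e = "\<lambda>G p s. expectation (\<lambda>\<omega>. indicator {v<..} (chi p \<bar>s\<bar> \<omega>) * G (remaining v t p s \<omega>)) / chi_tail TYPE('m) v"
  have intp: "integrable (distr M borel \<theta>) (\<lambda>p. LINT s|lborel. indicator {0..t} s * ?e G p s)"
    if G: "G \<in> borel_measurable borel" "\<And>y. 0 \<le> G y" "\<And>y. G y \<le> 1" for G :: "real \<Rightarrow> real"
    by (rule T.integrable_const_bound[where B=t, OF AE_I2]) (use joint_quotient[OF G t] in auto)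
  have G1: "G y \<le> 1" and H0: "0 \<le> H y" for y using G GH H order_trans by blast+
  have "?e G p s \<le> ?e H p s" for p s
    by (intro divide_right_mono integral_mono joint_bounds Gm Hm G H G1 H0 mult_left_mono GH chi_tail_nonneg) simp
  then have "(LINT s|lborel. indicator {0..t} s * ?e G p s) \<le> (LINT s|lborel. indicator {0..t} s * ?e H p s)" for p
    by (intro integral_mono joint_quotient(3) t Gm Hm G H G1 H0 mult_left_mono) simp_all
  then show ?thesis unfolding joint_mean_def
    by (intro divide_right_mono[OF integral_mono] intp Gm Hm G H G1 H0) (use t in auto)
qed

lemma ratio_eq_joint_mean:
  assumes t: "0 < t" and x: "0 \<le> x" and v: "0 < v"
  shows "(LINT y:{x..}|lborel. prob {\<omega> \<in> space M. v powr (1 / \<alpha>) * sojourn_time (time_changed_chi_square X \<theta>) t v \<omega> > y} /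
      (v powr (1 / \<alpha>) * expectation (sojourn_time (time_changed_chi_square X \<theta>) t v))) =
    joint_mean t v (indicator {x / v powr (1 / \<alpha>)<..})"
proof -
  have u: "0 < v powr (1 / \<alpha>)" using v by simp
  show ?thesis
    unfolding tail_integral[OF less_imp_le[OF t] u] excess_mean[OF less_imp_le[OF t] x u] sojourn_mean[OF less_imp_le[OF t]] joint_mean_def
    using u t by (simp add: field_simps)
qed

text \<open>Monotonicity in \<open>G\<close> for the two ramps enclosing the indicator of the half
  line; \<open>\<eta> < x\<close> keeps the start of the upper ramp positive.\<close>

lemma ratio_bounds:
  assumes t: "0 < t" and \<eta>: "0 < \<eta>" "\<eta> < x" and v: "0 < v"
  shows "ramp_mean t x \<eta> v \<le> joint_mean t v (indicator {x / v powr (1 / \<alpha>)<..})"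
    and "joint_mean t v (indicator {x / v powr (1 / \<alpha>)<..}) \<le> ramp_mean t (x - \<eta>) \<eta> v"
proof -
  have u: "0 < v powr (1 / \<alpha>)" using v by simp
  have x: "0 < x" using \<eta> by linarith
  have i: "indicator {x / v powr (1 / \<alpha>)<..} y = (indicator {ennreal x<..} (ennreal (v powr (1 / \<alpha>) * y)) :: real)" for y
    using u x by (auto simp: indicator_def field_simps ennreal_less_iff)
  show "ramp_mean t x \<eta> v \<le> joint_mean t v (indicator {x / v powr (1 / \<alpha>)<..})"
    unfolding ramp_mean_def
    by (intro joint_mean_mono) (use t \<eta> x ramp_indicator(1)[of \<eta> x] in \<open>auto simp: i ramp_bounds indicator_def[of "{x / v powr (1 / \<alpha>)<..}"]\<close>)
  show "joint_mean t v (indicator {x / v powr (1 / \<alpha>)<..}) \<le> ramp_mean t (x - \<eta>) \<eta> v"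
    unfolding ramp_mean_def
    by (intro joint_mean_mono) (use t \<eta> x ramp_indicator(2)[of \<eta> "x - \<eta>"] in \<open>auto simp: i ramp_bounds\<close>)
qed

section \<open>From ramps back to tail probabilities\<close>

lemma sojourn_tail_ramp:
  assumes \<eta>: "0 < \<eta>" "0 \<le> x"
  shows "sojourn_tail M (limit_process \<alpha> C Z U \<theta> E) (x + \<eta>) \<le> expectation (\<lambda>\<omega>. ramp x \<eta> (total_sojourn \<omega>))"
    and "expectation (\<lambda>\<omega>. ramp x \<eta> (total_sojourn \<omega>)) \<le> sojourn_tail M (limit_process \<alpha> C Z U \<theta> E) x"
proof -
  note [measurable] = total_sojourn_mean(2)[OF \<eta>]
  have B: "sojourn_tail M (limit_process \<alpha> C Z U \<theta> E) y = expectation (\<lambda>\<omega>. indicator {ennreal y<..} (total_sojourn \<omega>))" for y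
  proof -
    have "sojourn_tail M (limit_process \<alpha> C Z U \<theta> E) y = prob {\<omega> \<in> space M. ennreal y < total_sojourn \<omega>}"
      by (simp add: sojourn_tail_def total_sojourn_def)
    also have "\<dots> = expectation (indicator {\<omega> \<in> space M. ennreal y < total_sojourn \<omega>})" by (simp add: Int_def conj_commute conj_left_commute)
    also have "\<dots> = expectation (\<lambda>\<omega>. indicator {ennreal y<..} (total_sojourn \<omega>))"
      by (intro Bochner_Integration.integral_cong refl) (auto simp: indicator_def)
    finally show ?thesis .
  qed
  have i: "integrable M (\<lambda>\<omega>. indicator {ennreal y<..} (total_sojourn \<omega>) :: real)" "integrable M (\<lambda>\<omega>. ramp x \<eta> (total_sojourn \<omega>))" for y
    by (rule integrable_const_bound[where B=1]; simp add: ramp_bounds indicator_def)+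
  show "sojourn_tail M (limit_process \<alpha> C Z U \<theta> E) (x + \<eta>) \<le> expectation (\<lambda>\<omega>. ramp x \<eta> (total_sojourn \<omega>))"
    unfolding B by (intro integral_mono i ramp_indicator \<eta>)
  show "expectation (\<lambda>\<omega>. ramp x \<eta> (total_sojourn \<omega>)) \<le> sojourn_tail M (limit_process \<alpha> C Z U \<theta> E) x"
    unfolding B by (intro integral_mono i ramp_indicator \<eta>)
qed

text \<open>The ratio lies between two ramp means, whose limits lie between
  \<open>B (x + \<eta>)\<close> and \<open>B (x - \<eta>)\<close>. Continuity of \<open>B\<close> at
  \<open>x\<close> closes the gap, with the limit in the level taken before \<open>\<eta>\<close>
  could shrink.\<close>

lemma sojourn_limit:
  assumes t: "0 < t" and K: "AE \<omega> in M. \<forall>i. \<theta> \<omega> $ i \<le> K"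
    and small: "\<And>i u. \<bar>u\<bar> \<le> K * t \<Longrightarrow> 0 \<le> r i u \<and> r i u \<le> 1 - C i / 2 * \<bar>u\<bar> powr \<alpha>"
    and x: "0 < x" and cont: "isCont (sojourn_tail M (limit_process \<alpha> C Z U \<theta> E)) x"
  shows "((\<lambda>v. LINT y:{x..}|lborel.
      prob {\<omega> \<in> space M. v powr (1 / \<alpha>) * sojourn_time (time_changed_chi_square X \<theta>) t v \<omega> > y} /
      (v powr (1 / \<alpha>) * expectation (sojourn_time (time_changed_chi_square X \<theta>) t v)))
    \<longlongrightarrow> sojourn_tail M (limit_process \<alpha> C Z U \<theta> E) x) at_top" (is "(?f \<longlongrightarrow> ?B x) at_top")
proof (rule tendsto_at_topI_sequentially)
  fix V :: "nat \<Rightarrow> real" assume V: "filterlim V at_top sequentially"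
  \<comment> \<open>The sequential limits ask for levels at least 1 for every index; only finitely
    many terms are changed.\<close>
  define v where "v n = max 1 (V n)" for n
  have eq: "\<forall>\<^sub>F n in sequentially. v n = V n"
    using V[unfolded filterlim_at_top, rule_format, of 1] by eventually_elim (simp add: v_def)
  have "filterlim v at_top sequentially"
    using V filterlim_cong[OF refl refl eq, of at_top] by blast
  then have v: "1 \<le> v n" "filterlim v at_top sequentially" for n by (auto simp: v_def)
  have f: "?f (v n) = joint_mean t (v n) (indicator {x / v n powr (1 / \<alpha>)<..})" for n
    using v(1)[of n] x by (intro ratio_eq_joint_mean t) auto
  \<comment> \<open>A single \<open>\<eta>\<close> is taken for both sides, at most half of
    \<open>x\<close>, so that \<open>x - \<eta>\<close> stays positive.\<close>
  have near: "\<exists>\<eta>. 0 < \<eta> \<and> \<eta> < x \<and> P (?B (x + \<eta>)) \<and> P (?B (x - \<eta>))" if "\<forall>\<^sub>F y in nhds (?B x). P y" for P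
  proof -
    have "\<forall>\<^sub>F y in nhds x. P (?B y)"
      using eventually_compose_filterlim[OF that cont[unfolded continuous_within tendsto_at_iff_tendsto_nhds]] .
    then obtain d where d: "0 < d" "\<And>y. dist y x < d \<Longrightarrow> P (?B y)" by (auto simp: eventually_nhds_metric)
    show ?thesis
      using d x by (intro exI[of _ "min d x / 2"]) (auto simp: dist_real_def min_def)
  qed
  have "(\<lambda>n. ?f (v n)) \<longlonglongrightarrow> ?B x"
    unfolding f
  proof (rule order_tendstoI)
    fix a assume "a < ?B x"
    then obtain \<eta> where \<eta>: "0 < \<eta>" "\<eta> < x" "a < ?B (x + \<eta>)"
      using near[of "\<lambda>y. a < y"] eventually_nhds_in_open[of "{a<..}" "?B x"] by auto
    have "a < expectation (\<lambda>\<omega>. ramp x \<eta> (total_sojourn \<omega>))"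
      using sojourn_tail_ramp(1)[of \<eta> x] \<eta> x by linarith
    then have "\<forall>\<^sub>F n in sequentially. a < ramp_mean t x \<eta> (v n)"
      using \<eta> x by (intro order_tendstoD(1)[OF ramp_mean_limit[OF t K small v]]) auto
    then show "\<forall>\<^sub>F n in sequentially. a < joint_mean t (v n) (indicator {x / v n powr (1 / \<alpha>)<..})"
    proof eventually_elim
      fix n assume "a < ramp_mean t x \<eta> (v n)"
      then show "a < joint_mean t (v n) (indicator {x / v n powr (1 / \<alpha>)<..})"
        using ratio_bounds(1)[OF t \<eta>(1,2), of "v n"] v(1)[of n] by linarith
    qed
  next
    fix a assume "?B x < a"
    then obtain \<eta> where \<eta>: "0 < \<eta>" "\<eta> < x" "?B (x - \<eta>) < a"
      using near[of "\<lambda>y. y < a"] eventually_nhds_in_open[of "{..<a}" "?B x"] by auto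
    have "expectation (\<lambda>\<omega>. ramp (x - \<eta>) \<eta> (total_sojourn \<omega>)) < a"
      using sojourn_tail_ramp(2)[of \<eta> "x - \<eta>"] \<eta> x by linarith
    then have "\<forall>\<^sub>F n in sequentially. ramp_mean t (x - \<eta>) \<eta> (v n) < a"
      using \<eta> x by (intro order_tendstoD(2)[OF ramp_mean_limit[OF t K small v]]) auto
    then show "\<forall>\<^sub>F n in sequentially. joint_mean t (v n) (indicator {x / v n powr (1 / \<alpha>)<..}) < a"
    proof eventually_elim
      fix n assume "ramp_mean t (x - \<eta>) \<eta> (v n) < a"
      then show "joint_mean t (v n) (indicator {x / v n powr (1 / \<alpha>)<..}) < a"
        using ratio_bounds(2)[OF t \<eta>(1,2), of "v n"] v(1)[of n] by linarith
    qed
  qed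
  then show "(\<lambda>n. ?f (V n)) \<longlonglongrightarrow> ?B x"
    by (rule Lim_transform_eventually) (use eq in eventually_elim, simp)
qed

lemma small_times:
  assumes "AE \<omega> in M. \<forall>i. \<theta> \<omega> $ i \<le> K"
  shows "\<forall>\<^sub>F t in at_right 0. \<forall>x>0. isCont (sojourn_tail M (limit_process \<alpha> C Z U \<theta> E)) x \<longrightarrow>
    ((\<lambda>v. LINT y:{x..}|lborel.
      prob {\<omega> \<in> space M. v powr (1 / \<alpha>) * sojourn_time (time_changed_chi_square X \<theta>) t v \<omega> > y} /
      (v powr (1 / \<alpha>) * expectation (sojourn_time (time_changed_chi_square X \<theta>) t v)))
    \<longlongrightarrow> sojourn_tail M (limit_process \<alpha> C Z U \<theta> E) x) at_top"
proof -
  \<comment> \<open>A positive bound for the clock, so that \<open>\<delta> / K'\<close> is a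
    positive threshold for \<open>t\<close>; it does not depend on \<open>x\<close>.\<close>
  define K' where "K' = max 1 K"
  have K': "AE \<omega> in M. \<forall>i. \<theta> \<omega> $ i \<le> K'"
    using assms by eventually_elim (auto simp: K'_def intro: order_trans)
  obtain \<delta> where \<delta>: "0 < \<delta>" "\<And>i t. \<bar>t\<bar> < \<delta> \<Longrightarrow> 0 \<le> r i t \<and> r i t \<le> 1 - C i / 2 * \<bar>t\<bar> powr \<alpha>"
    using r_bounds by auto
  have K0: "0 < K'" by (simp add: K'_def)
  have "\<forall>\<^sub>F t in at_right 0. t \<in> {0<..<\<delta> / K'}"
    using K0 \<delta>(1) by (intro eventually_at_right_real) simp
  then show ?thesis
  proof eventually_elim
    fix t assume t: "t \<in> {0<..<\<delta> / K'}"
    then have "K' * t < \<delta>" using K0 by (simp add: field_simps)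
    with \<delta>(2) have small: "0 \<le> r i u \<and> r i u \<le> 1 - C i / 2 * \<bar>u\<bar> powr \<alpha>" if "\<bar>u\<bar> \<le> K' * t" for i u
      using that by auto
    show "\<forall>x>0. isCont (sojourn_tail M (limit_process \<alpha> C Z U \<theta> E)) x \<longrightarrow>
      ((\<lambda>v. LINT y:{x..}|lborel.
        prob {\<omega> \<in> space M. v powr (1 / \<alpha>) * sojourn_time (time_changed_chi_square X \<theta>) t v \<omega> > y} /
        (v powr (1 / \<alpha>) * expectation (sojourn_time (time_changed_chi_square X \<theta>) t v)))
      \<longlongrightarrow> sojourn_tail M (limit_process \<alpha> C Z U \<theta> E) x) at_top"
      using t by (intro allI impI sojourn_limit[OF _ K' small]) auto
  qed
qed

end

theorem proposition4p1:
  fixes M :: "'w measure"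
    and X Z :: "'m::finite \<Rightarrow> real \<Rightarrow> 'w \<Rightarrow> real"
    and r :: "'m \<Rightarrow> real \<Rightarrow> real"
    and C :: "'m \<Rightarrow> real"
    and \<alpha> :: real
    and \<theta> U :: "'w \<Rightarrow> real ^ 'm"
    and E :: "'w \<Rightarrow> real"
    and \<zeta> :: "real \<Rightarrow> 'w \<Rightarrow> real"
    and L :: "real \<Rightarrow> real \<Rightarrow> 'w \<Rightarrow> real"
    and B :: "real \<Rightarrow> real"
  defines "\<zeta> \<equiv> time_changed_chi_square X \<theta>"
    and "L \<equiv> sojourn_time \<zeta>"
    and "B \<equiv> sojourn_tail M (limit_process \<alpha> C Z U \<theta> E)"
  assumes "prob_space M"
    and "CARD('m) \<ge> 2"
    and "0 < \<alpha>" and "\<alpha> \<le> 2"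
    and "\<And>i. 0 < C i"
    (* the processes X_i *)
    and "\<And>i. stationary_gaussian_process M (r i) (X i)"
    and "prob_space.indep_vars M (\<lambda>_. \<Pi>\<^sub>M t\<in>{0..}. borel) (\<lambda>i \<omega>. \<lambda>t\<in>{0..}. X i t \<omega>) UNIV"
    and "\<And>i. local_expansion \<alpha> (C i) (r i)"
    and "\<And>i t. 0 < t \<Longrightarrow> r i t < 1"
    (* the random time scales *)
    and "\<theta> \<in> borel_measurable M"
    and "\<And>i \<omega>. \<omega> \<in> space M \<Longrightarrow> 0 \<le> \<theta> \<omega> $ i"
    and "\<exists>K. AE \<omega> in M. \<forall>i. \<theta> \<omega> $ i \<le> K"
    and "prob_space.indep_set M (sigma_rv M borel \<theta>)
           (sigma_process M (UNIV \<times> {0..}) (\<lambda>(i, t). X i t))"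
    (* the ingredients of the limit *)
    and "\<And>i. fractional_brownian_motion M \<alpha> (Z i)"
    and "U \<in> borel_measurable M" and "distr M borel U = uniform_sphere"
    and "distributed M lborel E (exponential_density 1)"
    and "prob_space.indep_sets M (sigma_ingredient M Z U \<theta> E) UNIV"
  shows "\<forall>\<^sub>F t in at_right 0. \<forall>x>0. isCont B x \<longrightarrow>
    ((\<lambda>v. LINT y:{x..}|lborel.
            prob_space.prob M {\<omega> \<in> space M. v powr (1 / \<alpha>) * L t v \<omega> > y} /
            (v powr (1 / \<alpha>) * prob_space.expectation M (L t v)))
      \<longlongrightarrow> B x) at_top"
proof -
  interpret sojourn_problem M X Z r C \<alpha> \<theta> U E
    unfolding sojourn_problem_def sojourn_problem_axioms_def using assms by blast
  obtain K where "AE \<omega> in M. \<forall>i. \<theta> \<omega> $ i \<le> K" using assms by blast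
  then show ?thesis unfolding B_def L_def \<zeta>_def by (rule small_times)
qed

end
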